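(* Let $X=\mathbb D^2$ be the closed two-dimensional disk. Any $h\in\mathscr M(X)$ is weakly PSC min-concordant to the standard metric on the unit disk in Euclidean $\mathbb R^2$.
   Context: $I=[0,1]$. $\mathscr M(X)$ is the set of smooth Riemannian metrics $h$ on $X$ for which $\lambda_1>0$, where $\lambda_1$ is the principal eigenvalue of $-\Delta_hu+\frac12R_hu=\lambda u$ on $X$, $\partial_\eta u+H_hu=0$ on $\partial X$ ($\eta$ the outward unit normal of $\partial X$, $H_h$ the mean curvature of $\partial X$ with respect to $\eta$, here the geodesic curvature, positive for the Euclidean unit disk; $R_h$ the scalar curvature, twice the Gauss curvature), i.e. $$\lambda_1=\inf_{u\ne0}\frac{\int_X\big(|\nabla_X u|^2+\frac12R_hu^2\big)\,\mathrm{dvol}_h+\int_{\partial X}H_hu^2\,\mathrm{dvol}^\partial_h}{\int_Xu^2\,\mathrm{dvol}_h}.$$ Here $\mathrm{dvol}_h$ is the area element of $h$ and $\mathrm{dvol}_h^\partial$ the induced length element on $\partial X$. Two metrics $h_0,h_1$ on $X$ are weakly PSC min-concordant if there is a Riemannian metric $g$ of positive scalar curvature on $X\times I$ such that: (i) the mean curvature of the cylindrical boundary $\partial X\times I$ in metric $g$ is identically zero; (ii) $g$ restricts to $h_0$ on the tangent spaces to $X\times\{0\}$ and to $h_1$ on the tangent spaces to $X\times\{1\}$; (iii) both $X\times\{0\}$ and $X\times\{1\}$ are free boundary minimal surfaces with respect to $g$, i.e. they have zero mean curvature and meet $\partial X\times I$ orthogonally. *)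

theory Defs
  imports "HOL-Analysis.Analysis"
begin

primrec Ck_on :: "nat \<Rightarrow> 'a set \<Rightarrow> ('a::euclidean_space \<Rightarrow> real) \<Rightarrow> bool" where
  "Ck_on 0 U f = continuous_on U f"
| "Ck_on (Suc k) U f =
     (f differentiable_on U \<and> (\<forall>b\<in>Basis. Ck_on k U (\<lambda>x. frechet_derivative f (at x) b)))"

definition smooth_on :: "'a set \<Rightarrow> ('a::euclidean_space \<Rightarrow> real) \<Rightarrow> bool" where
  "smooth_on U f \<longleftrightarrow> open U \<and> (\<forall>k. Ck_on k U f)"


section \<open>Riemannian metrics in global coordinates\<close>

text \<open>
  A metric is a field of bilinear forms on a coordinate space. On a closed set \<open>M\<close>
  (a manifold with boundary or corners, here always the closure of its interior) smoothness
  means smooth extendability to an open neighbourhood. The extension is part of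
  the function, so that ordinary derivatives can be used at boundary points; by continuity
  every derivative at a point of \<open>M\<close> is determined by the values on \<open>M\<close>.
\<close>

type_synonym 'a metric = "'a \<Rightarrow> 'a \<Rightarrow> 'a \<Rightarrow> real"

definition riemannian_metric_on :: "'a::euclidean_space set \<Rightarrow> 'a metric \<Rightarrow> bool" where
  "riemannian_metric_on M g \<longleftrightarrow>
     (\<exists>U. M \<subseteq> U \<and> (\<forall>v w. smooth_on U (\<lambda>x. g x v w)) \<and>
       (\<forall>x\<in>U. bilinear (g x) \<and> (\<forall>v w. g x v w = g x w v) \<and> (\<forall>v. v \<noteq> 0 \<longrightarrow> 0 < g x v v)))"

definition gradient :: "'a::euclidean_space metric \<Rightarrow> ('a \<Rightarrow> real) \<Rightarrow> 'a \<Rightarrow> 'a" where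
  "gradient g f x = (THE w. \<forall>z. g x w z = frechet_derivative f (at x) z)"

definition orthonormal_basis :: "'a::euclidean_space metric \<Rightarrow> 'a \<Rightarrow> 'a set \<Rightarrow> 'a set \<Rightarrow> bool" where
  "orthonormal_basis g x T E \<longleftrightarrow>
     span E = T \<and> (\<forall>e\<in>E. \<forall>f\<in>E. g x e f = (if e = f then 1 else 0))"

text \<open>The trace of the bilinear form \<open>B\<close> on the subspace \<open>T\<close> with respect to \<open>g x\<close>; it does not
  depend on the chosen orthonormal basis.\<close>

definition metric_trace ::
    "'a::euclidean_space metric \<Rightarrow> 'a \<Rightarrow> 'a set \<Rightarrow> ('a \<Rightarrow> 'a \<Rightarrow> real) \<Rightarrow> real" where
  "metric_trace g x T B = (\<Sum>e\<in>(SOME E. orthonormal_basis g x T E). B e e)"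

text \<open>The Levi-Civita derivative of the constant field \<open>v\<close> in direction \<open>u\<close> (Koszul formula).\<close>

definition christoffel :: "'a::euclidean_space metric \<Rightarrow> 'a \<Rightarrow> 'a \<Rightarrow> 'a \<Rightarrow> 'a" where
  "christoffel g x u v = (THE w. \<forall>z. g x w z =
     (frechet_derivative (\<lambda>y. g y v z) (at x) u
      + frechet_derivative (\<lambda>y. g y u z) (at x) v
      - frechet_derivative (\<lambda>y. g y u v) (at x) z) / 2)"

definition cov_deriv :: "'a::euclidean_space metric \<Rightarrow> ('a \<Rightarrow> 'a) \<Rightarrow> 'a \<Rightarrow> 'a \<Rightarrow> 'a" where
  "cov_deriv g V x u = frechet_derivative V (at x) u + christoffel g x u (V x)"

text \<open>\<open>R(u,v)w = \<nabla>\<^sub>u\<nabla>\<^sub>v w - \<nabla>\<^sub>v\<nabla>\<^sub>u w\<close> for constant, hence commuting, fields \<open>u\<close>, \<open>v\<close>, \<open>w\<close>.\<close>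

definition riemann :: "'a::euclidean_space metric \<Rightarrow> 'a \<Rightarrow> 'a \<Rightarrow> 'a \<Rightarrow> 'a \<Rightarrow> 'a" where
  "riemann g x u v w =
     cov_deriv g (\<lambda>y. christoffel g y v w) x u - cov_deriv g (\<lambda>y. christoffel g y u w) x v"

definition ricci :: "'a::euclidean_space metric \<Rightarrow> 'a \<Rightarrow> 'a \<Rightarrow> 'a \<Rightarrow> real" where
  "ricci g x v w = (\<Sum>b\<in>Basis. riemann g x b v w \<bullet> b)"

definition scalar_curvature :: "'a::euclidean_space metric \<Rightarrow> 'a \<Rightarrow> real" where
  "scalar_curvature g x = metric_trace g x UNIV (ricci g x)"


section \<open>Mean curvature\<close>

text \<open>
  A hypersurface is presented by a field \<open>n\<close> of Euclidean conormals of a foliation having the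
  hypersurface as a leaf, so its tangent space at \<open>p\<close> is \<open>{v. v \<bullet> n p = 0}\<close>. The unit normal
  with respect to \<open>g\<close> is the one on the side of \<open>n\<close>. Only its derivatives along the
  hypersurface enter the mean curvature, so the choice of foliation is immaterial.
\<close>

definition tangent_space :: "('a::euclidean_space \<Rightarrow> 'a) \<Rightarrow> 'a \<Rightarrow> 'a set" where
  "tangent_space n p = {v. v \<bullet> n p = 0}"

definition unit_normal :: "'a::euclidean_space metric \<Rightarrow> ('a \<Rightarrow> 'a) \<Rightarrow> 'a \<Rightarrow> 'a" where
  "unit_normal g n p =
     (THE \<eta>. (\<forall>v\<in>tangent_space n p. g p \<eta> v = 0) \<and> g p \<eta> \<eta> = 1 \<and> 0 < \<eta> \<bullet> n p)"

definition mean_curvature :: "'a::euclidean_space metric \<Rightarrow> ('a \<Rightarrow> 'a) \<Rightarrow> 'a \<Rightarrow> real" where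
  "mean_curvature g n p =
     metric_trace g p (tangent_space n p) (\<lambda>v w. g p (cov_deriv g (unit_normal g n) p v) w)"


section \<open>The disk and the principal eigenvalue\<close>

abbreviation disk :: "(real^2) set" where
  "disk \<equiv> cball 0 1"

text \<open>The radial field \<open>\<lambda>x. x\<close> is a Euclidean outward conormal of the boundary circle.\<close>

definition boundary_curvature :: "(real^2) metric \<Rightarrow> real^2 \<Rightarrow> real" where
  "boundary_curvature h = mean_curvature h (\<lambda>x. x)"

definition area_integral :: "(real^2) metric \<Rightarrow> (real^2 \<Rightarrow> real) \<Rightarrow> real" where
  "area_integral h f =
     (LINT x:disk|lborel. f x * sqrt (det (\<chi> i j. h x (axis i 1) (axis j 1))))"

definition boundary_integral :: "(real^2) metric \<Rightarrow> (real^2 \<Rightarrow> real) \<Rightarrow> real" where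
  "boundary_integral h f =
     (LINT t:{0..2*pi}|lborel.
        (let c = vector [cos t, sin t]; c' = vector [- sin t, cos t] in f c * sqrt (h c c' c')))"

definition rayleigh_quotient :: "(real^2) metric \<Rightarrow> (real^2 \<Rightarrow> real) \<Rightarrow> real" where
  "rayleigh_quotient h u =
     (area_integral h (\<lambda>x. h x (gradient h u x) (gradient h u x)
          + scalar_curvature h x * (u x)\<^sup>2 / 2)
      + boundary_integral h (\<lambda>x. boundary_curvature h x * (u x)\<^sup>2))
     / area_integral h (\<lambda>x. (u x)\<^sup>2)"

text \<open>Test functions are smooth up to the boundary; they are dense in the Sobolev space \<open>H\<^sup>1\<close>, so the
  infimum is the principal eigenvalue. It is taken in the extended reals so that it is meaningful
  without a prior proof that the quotient is bounded below.\<close>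

definition test_functions :: "(real^2 \<Rightarrow> real) set" where
  "test_functions = {u. (\<exists>U. disk \<subseteq> U \<and> smooth_on U u) \<and> (\<exists>x\<in>disk. u x \<noteq> 0)}"

definition principal_eigenvalue :: "(real^2) metric \<Rightarrow> ereal" where
  "principal_eigenvalue h = (INF u\<in>test_functions. ereal (rayleigh_quotient h u))"

definition positive_metrics :: "(real^2) metric set" where
  "positive_metrics = {h. riemannian_metric_on disk h \<and> 0 < principal_eigenvalue h}"

definition standard_metric :: "'a::euclidean_space metric" where
  "standard_metric x v w = v \<bullet> w"


section \<open>Concordance\<close>

definition wall_conormal :: "(real^2) \<times> real \<Rightarrow> (real^2) \<times> real" where
  "wall_conormal p = (fst p, 0)"

definition slice_conormal :: "(real^2) \<times> real \<Rightarrow> (real^2) \<times> real" where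
  "slice_conormal p = (0, 1)"

text \<open>The slice at height \<open>s\<close> is a free boundary minimal surface; two hypersurfaces meet
  orthogonally when their normals are orthogonal.\<close>

definition free_boundary_minimal_slice :: "((real^2) \<times> real) metric \<Rightarrow> real \<Rightarrow> bool" where
  "free_boundary_minimal_slice g s \<longleftrightarrow>
     (\<forall>x\<in>disk. mean_curvature g slice_conormal (x, s) = 0) \<and>
     (\<forall>x\<in>sphere 0 1.
        g (x, s) (unit_normal g slice_conormal (x, s)) (unit_normal g wall_conormal (x, s)) = 0)"

definition weakly_PSC_min_concordant :: "(real^2) metric \<Rightarrow> (real^2) metric \<Rightarrow> bool" where
  "weakly_PSC_min_concordant h\<^sub>0 h\<^sub>1 \<longleftrightarrow>
     (\<exists>g. riemannian_metric_on (disk \<times> {0..1}) g \<and>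
        (\<forall>p\<in>disk \<times> {0..1}. 0 < scalar_curvature g p) \<and>
        (\<forall>p\<in>sphere 0 1 \<times> {0..1}. mean_curvature g wall_conormal p = 0) \<and>
        (\<forall>x\<in>disk. \<forall>v w. g (x, 0) (v, 0) (w, 0) = h\<^sub>0 x v w) \<and>
        (\<forall>x\<in>disk. \<forall>v w. g (x, 1) (v, 0) (w, 0) = h\<^sub>1 x v w) \<and>
        free_boundary_minimal_slice g 0 \<and>
        free_boundary_minimal_slice g 1)"

end

theory Submission
  imports Defs
begin

text \<open>
  The concordance is a lens inside a static space. For a metric \<open>H\<close> on the plane and a positive
  function \<open>N(x,t)\<close>, the metric \<open>H + N\<^sup>2 dt\<^sup>2\<close> has totally geodesic slices and scalar curvature
  \<open>R - 2 \<Delta>N / N\<close>, no matter how \<open>N\<close> depends on \<open>t\<close>. Extend \<open>h\<close> to a metric \<open>H\<close> that is flat far away, and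
  suppose that \<open>u > 0\<close> satisfies \<open>\<Delta>u < R u / 2\<close> on the unit disk; a concave paraboloid does so on a flat
  unit disk around a distant point \<open>P\<close>. Consider a disk that shrinks from the unit disk around the origin
  to a tiny one, moves to \<open>P\<close>, and grows back. If \<open>N\<close> is a factor depending on \<open>t\<close> times a function
  interpolating between \<open>u\<close> and the paraboloid, and that factor is large when the disk is small, then the
  region swept out has a strictly mean convex wall. Changing \<open>N\<close> in a thin layer makes the wall
  minimal and keeps the scalar curvature positive. No boundary condition on \<open>u\<close> is needed.

  To find \<open>u\<close>, only the Rayleigh quotients of functions vanishing on the circle are used. In divergence
  form the operator \<open>L = R / 2 - \<Delta>\<close> has a coefficient matrix whose inverse \<open>b\<close> has determinant one, and for
  \<open>k(x,y) = f(b(x - y, x - y) / \<epsilon>\<^sup>2)\<close>, with \<open>b\<close> taken at the midpoint and \<open>f\<close> a bump function, the kernel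
  \<open>L\<^sub>x k - L\<^sub>y k\<close> is of size \<open>\<epsilon>\<close>. If no combination of functions \<open>k(x,\<cdot>)\<close> with nonnegative coefficients works,
  an approachability argument yields averages \<open>w\<close> of functions \<open>k(\<cdot>,y)\<close> such that \<open>L w\<close> is at most a
  small multiple of a sum of translates of \<open>w\<close>, up to a small error. Then the energy of \<open>w\<close> is too small.
\<close>

section \<open>Smooth functions\<close>

text \<open>Shrinking with a concave radius profile helps the wall, but half the squared radius S
  has to level off at a tiny value \<sigma>, and there its second derivative can be of size
  1/\<sigma>. The term that pays for this is quadratic in the time factor of N. That factor is a
  power S^(-a), with exp(m S) for lower order errors, and its square beats 1/\<sigma> for small
  \<sigma> because a > 1/2. The admissible \<open>a\<close> is limited by the Laplacian of |x|^2/2;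
  since the trace of the inverse metric strictly exceeds its value in a single direction, there is
  room above 1/2. Once the disk is tiny, inequalities on the path of its centre suffice, by
  continuity, so the two supersolutions and a steep paraboloid are interpolated without any
  comparison between them. The supersolution is sought among finite sums of smooth kernels, so it is
  smooth by construction, and a duality argument takes the place of solving an equation. Multiplying
  by the area density gives determinant one because the dimension is two; constancy of the
  determinant is what cancels the terms of L_x k - L_y k that would spoil the order
  \<epsilon>.\<close>

abbreviation smooth :: "('a::euclidean_space \<Rightarrow> real) \<Rightarrow> bool" where "smooth \<equiv> smooth_on UNIV"

lemma Ck_on_cong:
  assumes "open U" "\<And>x. x \<in> U \<Longrightarrow> f x = g x"
  shows "Ck_on k U f = Ck_on k U g"
  using assms
proof (induction k arbitrary: f g)
  case 0
  then show ?case by (simp cong: continuous_on_cong)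
next
  case (Suc k)
  have eq: "(f has_derivative D) (at x) \<longleftrightarrow> (g has_derivative D) (at x)" if "x \<in> U" for x D
    using has_derivative_transform_within_open[of f D x UNIV U g]
      has_derivative_transform_within_open[of g D x UNIV U f] that Suc.prems by auto
  have "frechet_derivative f (at x) = frechet_derivative g (at x)" if "x \<in> U" for x
    unfolding frechet_derivative_def using eq[OF that] by simp
  moreover have "f differentiable_on U \<longleftrightarrow> g differentiable_on U"
    unfolding differentiable_on_def using eq Suc.prems(1) at_within_open[of _ U]
    by (simp add: differentiable_def)
  ultimately show ?case
    using Suc.IH[OF Suc.prems(1)] by (metis (mono_tags, lifting) Ck_on.simps(2))
qed

lemma Ck_on_SucI:
  assumes "open U" "\<And>x. x \<in> U \<Longrightarrow> (f has_derivative f' x) (at x)"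
    and "\<And>b. b \<in> Basis \<Longrightarrow> Ck_on k U (\<lambda>x. f' x b)"
  shows "Ck_on (Suc k) U f"
proof -
  have "frechet_derivative f (at x) = f' x" if "x \<in> U" for x
    using frechet_derivative_at[OF assms(2)[OF that]] by simp
  then have "Ck_on k U (\<lambda>x. frechet_derivative f (at x) b) = Ck_on k U (\<lambda>x. f' x b)" for b
    by (intro Ck_on_cong) (use assms in auto)
  moreover have "f differentiable_on U"
    unfolding differentiable_on_def differentiable_def
    using assms(2) has_derivative_at_withinI by blast
  ultimately show ?thesis using assms(3) by simp
qed

lemma Ck_on_SucD:
  assumes "open U" "Ck_on (Suc k) U f" "x \<in> U"
  shows "(f has_derivative frechet_derivative f (at x)) (at x)"
  using assms by (metis (no_types, lifting) Ck_on.simps(2) differentiable_on_eq_differentiable_at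
      frechet_derivative_works)

lemma Ck_on_mono:
  assumes "open U" "Ck_on (Suc k) U f"
  shows "Ck_on k U f"
  using assms(2)
proof (induction k arbitrary: f)
  case 0
  then show ?case by (simp add: differentiable_imp_continuous_on)
next
  case (Suc k)
  then show ?case by (metis Ck_on.simps(2))
qed

lemma Ck_on_const: "open U \<Longrightarrow> Ck_on k U (\<lambda>x. c)"
proof (induction k arbitrary: c)
  case (Suc k)
  then show ?case
    by (intro Ck_on_SucI[where f'="\<lambda>x v. 0"]) (auto intro!: derivative_eq_intros)
qed (auto intro!: continuous_intros)

lemma Ck_on_add:
  assumes "open U"
  shows "Ck_on k U f \<Longrightarrow> Ck_on k U g \<Longrightarrow> Ck_on k U (\<lambda>x. f x + g x)"
proof (induction k arbitrary: f g)
  case (Suc k)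
  show ?case
  proof (rule Ck_on_SucI[OF assms])
    fix x assume "x \<in> U"
    then show "((\<lambda>x. f x + g x) has_derivative
        (\<lambda>v. frechet_derivative f (at x) v + frechet_derivative g (at x) v)) (at x)"
      using has_derivative_add[OF Ck_on_SucD[OF assms Suc.prems(1)] Ck_on_SucD[OF assms Suc.prems(2)]]
      by blast
  qed (intro Suc.IH; use Suc.prems in simp)
qed (auto intro!: continuous_intros)

lemma Ck_on_mult:
  assumes "open U"
  shows "Ck_on k U f \<Longrightarrow> Ck_on k U g \<Longrightarrow> Ck_on k U (\<lambda>x. f x * g x)"
proof (induction k arbitrary: f g)
  case (Suc k)
  show ?case
  proof (rule Ck_on_SucI[OF assms])
    fix x assume "x \<in> U"
    then show "((\<lambda>x. f x * g x) has_derivative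
        (\<lambda>v. f x * frechet_derivative g (at x) v + frechet_derivative f (at x) v * g x)) (at x)"
      using has_derivative_mult[OF Ck_on_SucD[OF assms Suc.prems(1)] Ck_on_SucD[OF assms Suc.prems(2)]]
      by blast
  qed (intro Ck_on_add[OF assms] Suc.IH; use Suc.prems Ck_on_mono[OF assms] in simp)
qed (auto intro!: continuous_intros)

lemma Ck_on_sum:
  assumes "open U" "\<And>i. i \<in> I \<Longrightarrow> Ck_on k U (f i)"
  shows "Ck_on k U (\<lambda>x. \<Sum>i\<in>I. f i x)"
  using assms(2)
proof (induction I rule: infinite_finite_induct)
  case (insert i I)
  then show ?case using Ck_on_add[OF assms(1), of k "f i"] by simp
qed (auto intro: Ck_on_const assms(1))

lemma Ck_on_linear:
  assumes "open U" "bounded_linear f"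
  shows "Ck_on k U f"
proof (cases k)
  case 0
  then show ?thesis using assms(2) by (simp add: linear_continuous_on)
next
  case (Suc n)
  show ?thesis unfolding Suc
    by (intro Ck_on_SucI[where f'="\<lambda>x. f"] bounded_linear_imp_has_derivative Ck_on_const assms)
qed

text \<open>The chain rule writes a partial derivative of the composite as a sum of products, each
  containing a partial derivative of \<open>f\<close> composed with the same map. The induction
  therefore runs over all \<open>f\<close>, and the components of the map are reused one class
  lower.\<close>

lemma Ck_on_compose:
  fixes f :: "'b::euclidean_space \<Rightarrow> real" and \<phi> :: "'a::euclidean_space \<Rightarrow> 'b"
  assumes "open U" "open V" "\<And>x. x \<in> U \<Longrightarrow> \<phi> x \<in> V"
  shows "Ck_on k V f \<Longrightarrow> (\<And>b. b \<in> Basis \<Longrightarrow> Ck_on k U (\<lambda>x. \<phi> x \<bullet> b)) \<Longrightarrow> Ck_on k U (\<lambda>x. f (\<phi> x))"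
proof (induction k arbitrary: f)
  case 0
  have "continuous_on U \<phi>"
    using continuous_on_componentwise[of U \<phi>] 0 by auto
  with 0 have "continuous_on U (f \<circ> \<phi>)"
    by (intro continuous_on_compose) (auto intro: continuous_on_subset[of V] assms(3))
  then show ?case by (simp add: o_def)
next
  case (Suc k)
  define D where "D b x = frechet_derivative (\<lambda>x. \<phi> x \<bullet> b) (at x)" for b x
  have phi: "(\<phi> has_derivative (\<lambda>v. \<Sum>b\<in>Basis. D b x v *\<^sub>R b)) (at x)" if "x \<in> U" for x
  proof -
    have "((\<lambda>x. \<phi> x \<bullet> b) has_derivative D b x) (at x)" if "b \<in> Basis" for b
      unfolding D_def by (rule Ck_on_SucD[of U k]) (use Suc.prems assms \<open>x \<in> U\<close> that in auto)
    then have "((\<lambda>x. \<Sum>b\<in>Basis. (\<phi> x \<bullet> b) *\<^sub>R b) has_derivative (\<lambda>v. \<Sum>b\<in>Basis. D b x v *\<^sub>R b)) (at x)"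
      by (intro has_derivative_sum has_derivative_scaleR_left) auto
    then show ?thesis by (simp add: euclidean_representation)
  qed
  have der: "((\<lambda>x. f (\<phi> x)) has_derivative
      (\<lambda>v. \<Sum>b\<in>Basis. D b x v * frechet_derivative f (at (\<phi> x)) b)) (at x)" if "x \<in> U" for x
  proof -
    have f: "(f has_derivative frechet_derivative f (at (\<phi> x))) (at (\<phi> x))"
      by (rule Ck_on_SucD[of V k]) (use Suc.prems assms that in auto)
    have "frechet_derivative f (at (\<phi> x)) (\<Sum>b\<in>Basis. c b *\<^sub>R b) =
      (\<Sum>b\<in>Basis. c b * frechet_derivative f (at (\<phi> x)) b)" for c
      using has_derivative_linear[OF f] by (simp add: linear_sum linear_scale)
    with has_derivative_compose[OF phi[OF that] f] show ?thesis by simp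
  qed
  show ?case
  proof (rule Ck_on_SucI[OF assms(1) der], assumption)
    fix b' :: 'a assume b': "b' \<in> Basis"
    show "Ck_on k U (\<lambda>x. \<Sum>b\<in>Basis. D b x b' * frechet_derivative f (at (\<phi> x)) b)"
    proof (intro Ck_on_sum Ck_on_mult assms(1))
      fix b :: 'b assume b: "b \<in> Basis"
      show "Ck_on k U (\<lambda>x. D b x b')" unfolding D_def
        using Suc.prems(2)[OF b] b' by simp
      show "Ck_on k U (\<lambda>x. frechet_derivative f (at (\<phi> x)) b)"
        by (rule Suc.IH) (use Suc.prems b Ck_on_mono[OF assms(1)] in auto)
    qed
  qed
qed

lemma Ck_on_real_SucI:
  fixes f :: "real \<Rightarrow> real"
  assumes "open U" "\<And>x. x \<in> U \<Longrightarrow> (f has_real_derivative f' x) (at x)" "Ck_on k U f'"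
  shows "Ck_on (Suc k) U f"
  by (rule Ck_on_SucI[where f'="\<lambda>x v. f' x * v"])
    (use assms in \<open>auto simp: has_field_derivative_def\<close>)

definition dd :: "('a::euclidean_space \<Rightarrow> real) \<Rightarrow> 'a \<Rightarrow> 'a \<Rightarrow> real" where
  "dd f v x = frechet_derivative f (at x) v"

lemma dd_eqI: "(f has_derivative D) (at x) \<Longrightarrow> dd f v x = D v"
  unfolding dd_def using frechet_derivative_at by metis

lemma smooth_on_open: "smooth_on U f \<Longrightarrow> open U"
  by (simp add: smooth_on_def)

lemma smooth_on_deriv:
  assumes "smooth_on U f" "x \<in> U"
  shows "(f has_derivative (\<lambda>v. dd f v x)) (at x)"
  unfolding dd_def using Ck_on_SucD[of U 0 f x] assms unfolding smooth_on_def by auto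

lemma smooth_on_cong: "(\<And>x. x \<in> U \<Longrightarrow> f x = g x) \<Longrightarrow> smooth_on U f = smooth_on U g"
  unfolding smooth_on_def using Ck_on_cong by blast

lemma smooth_on_cont: "smooth_on U f \<Longrightarrow> continuous_on U f"
  unfolding smooth_on_def using Ck_on.simps(1) by blast

lemma smooth_on_const [simp]: "open U \<Longrightarrow> smooth_on U (\<lambda>x. c)"
  by (simp add: smooth_on_def Ck_on_const)

lemma smooth_on_add: "smooth_on U f \<Longrightarrow> smooth_on U g \<Longrightarrow> smooth_on U (\<lambda>x. f x + g x)"
  by (simp add: smooth_on_def Ck_on_add)

lemma smooth_on_mult: "smooth_on U f \<Longrightarrow> smooth_on U g \<Longrightarrow> smooth_on U (\<lambda>x. f x * g x)"
  by (simp add: smooth_on_def Ck_on_mult)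

lemma smooth_on_sum: "open U \<Longrightarrow> (\<And>i. i \<in> I \<Longrightarrow> smooth_on U (f i)) \<Longrightarrow> smooth_on U (\<lambda>x. \<Sum>i\<in>I. f i x)"
  by (simp add: smooth_on_def Ck_on_sum)

lemma smooth_on_linear: "open U \<Longrightarrow> bounded_linear f \<Longrightarrow> smooth_on U f"
  by (simp add: smooth_on_def Ck_on_linear)

lemma smooth_on_dd:
  assumes "smooth_on U f"
  shows "smooth_on U (dd f v)"
proof -
  have "smooth_on U (dd f b)" if "b \<in> Basis" for b
    using assms that unfolding smooth_on_def dd_def by (metis Ck_on.simps(2))
  then have "smooth_on U (\<lambda>x. \<Sum>b\<in>Basis. (v \<bullet> b) * dd f b x)"
    using assms smooth_on_open by (intro smooth_on_sum smooth_on_mult) auto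
  moreover have "dd f v x = (\<Sum>b\<in>Basis. (v \<bullet> b) * dd f b x)" if "x \<in> U" for x
  proof -
    have "linear (\<lambda>v. dd f v x)" using has_derivative_linear[OF smooth_on_deriv[OF assms that]] .
    then have "dd f (\<Sum>b\<in>Basis. c b *\<^sub>R b) x = (\<Sum>b\<in>Basis. c b * dd f b x)" for c
      by (simp add: linear_sum[of "\<lambda>v. dd f v x"] linear_scale[of "\<lambda>v. dd f v x"])
    from this[of "\<lambda>b. v \<bullet> b"] show ?thesis by (simp add: euclidean_representation)
  qed
  ultimately show ?thesis using smooth_on_cong[of U "dd f v"] by simp
qed

lemma smooth_on_compose:
  fixes f :: "'b::euclidean_space \<Rightarrow> real" and \<phi> :: "'a::euclidean_space \<Rightarrow> 'b"
  assumes "smooth_on V f" "open U" "\<And>b. b \<in> Basis \<Longrightarrow> smooth_on U (\<lambda>x. \<phi> x \<bullet> b)" "\<And>x. x \<in> U \<Longrightarrow> \<phi> x \<in> V"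
  shows "smooth_on U (\<lambda>x. f (\<phi> x))"
  unfolding smooth_on_def
proof (intro conjI allI)
  fix k show "Ck_on k U (\<lambda>x. f (\<phi> x))"
    by (rule Ck_on_compose[of U V]) (use assms in \<open>auto simp: smooth_on_def\<close>)
qed (rule assms)

lemma smooth_on_compose_real:
  fixes f :: "real \<Rightarrow> real"
  assumes "smooth_on V f" "smooth_on U \<phi>" "\<And>x. x \<in> U \<Longrightarrow> \<phi> x \<in> V"
  shows "smooth_on U (\<lambda>x. f (\<phi> x))"
  by (rule smooth_on_compose[OF assms(1)]) (use assms smooth_on_open in auto)

lemma smooth_on_subset: "smooth_on U f \<Longrightarrow> open V \<Longrightarrow> V \<subseteq> U \<Longrightarrow> smooth_on V f"
  by (rule smooth_on_compose[of U f V "\<lambda>x. x"])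
    (auto intro!: smooth_on_linear bounded_linear_inner_left)

text \<open>Serves functions given by different formulas on overlapping open sets, such as a metric
  glued by a cutoff.\<close>

lemma smooth_on_local:
  assumes "open U" "\<And>x. x \<in> U \<Longrightarrow> \<exists>V. x \<in> V \<and> smooth_on V f"
  shows "smooth_on U f"
proof -
  have "Ck_on k U f" if "\<And>x. x \<in> U \<Longrightarrow> \<exists>V. x \<in> V \<and> open V \<and> Ck_on k V f" for k
    using that
  proof (induction k arbitrary: f)
    case 0
    then show ?case
      by (metis Ck_on.simps(1) assms(1) continuous_on_eq_continuous_at)
  next
    case (Suc k)
    have "f differentiable_on U"
      unfolding differentiable_on_def
      using Suc.prems by (metis Ck_on.simps(2) differentiable_at_withinI differentiable_on_eq_differentiable_at)
    moreover have "Ck_on k U (\<lambda>x. frechet_derivative f (at x) b)" if "b \<in> Basis" for b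
      by (rule Suc.IH) (use Suc.prems that in \<open>metis Ck_on.simps(2)\<close>)
    ultimately show ?case by simp
  qed
  then show ?thesis
    using assms unfolding smooth_on_def by metis
qed

lemma smooth_on_exp_real: "smooth (exp :: real \<Rightarrow> real)"
proof -
  have "Ck_on k UNIV (exp :: real \<Rightarrow> real)" for k
  proof (induction k)
    case (Suc k)
    show ?case by (rule Ck_on_real_SucI[OF _ _ Suc]) (auto intro!: derivative_eq_intros)
  qed (auto intro!: continuous_intros)
  then show ?thesis by (simp add: smooth_on_def)
qed

lemma smooth_on_inverse_real: "smooth_on (- {0}) (inverse :: real \<Rightarrow> real)"
proof -
  have "Ck_on k (- {0}) (inverse :: real \<Rightarrow> real)" for k
  proof (induction k)
    case (Suc k)
    have "Ck_on k (- {0}) (\<lambda>x::real. (- 1) * (inverse x * inverse x))"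
      by (intro Ck_on_mult Suc Ck_on_const open_Compl) auto
    then show ?case
      by (rule Ck_on_real_SucI[rotated 2])
        (auto intro!: derivative_eq_intros open_Compl simp: power2_eq_square)
  qed (auto intro!: continuous_intros)
  then show ?thesis by (simp add: smooth_on_def open_Compl)
qed

lemma smooth_on_ln_real: "smooth_on {0<..} (ln :: real \<Rightarrow> real)"
proof -
  have inv: "smooth_on {0<..} (inverse :: real \<Rightarrow> real)"
    by (rule smooth_on_subset[OF smooth_on_inverse_real]) auto
  have "Ck_on k {0<..} (ln :: real \<Rightarrow> real)" for k
  proof (cases k)
    case (Suc n)
    show ?thesis unfolding Suc
      by (rule Ck_on_real_SucI[where f'=inverse])
        (use inv in \<open>auto intro!: derivative_eq_intros simp: smooth_on_def inverse_eq_divide\<close>)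
  qed (auto intro!: continuous_intros)
  then show ?thesis by (simp add: smooth_on_def)
qed

lemma smooth_on_uminus: "smooth_on U f \<Longrightarrow> smooth_on U (\<lambda>x. - f x)"
  using smooth_on_mult[of U "\<lambda>x. -1" f] by (simp add: smooth_on_open)

lemma smooth_on_diff: "smooth_on U f \<Longrightarrow> smooth_on U g \<Longrightarrow> smooth_on U (\<lambda>x. f x - g x)"
  using smooth_on_add[of U f "\<lambda>x. - g x"] smooth_on_uminus[of U g] by simp

lemma smooth_on_power: "smooth_on U f \<Longrightarrow> smooth_on U (\<lambda>x. f x ^ n)"
  using smooth_on_open[of U f] by (induction n) (auto intro: smooth_on_mult)

lemma smooth_on_exp: "smooth_on U f \<Longrightarrow> smooth_on U (\<lambda>x. exp (f x))"
  by (rule smooth_on_compose_real[OF smooth_on_exp_real]) auto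

lemma smooth_on_inverse: "smooth_on U f \<Longrightarrow> (\<And>x. x \<in> U \<Longrightarrow> f x \<noteq> 0) \<Longrightarrow> smooth_on U (\<lambda>x. inverse (f x))"
  by (rule smooth_on_compose_real[OF smooth_on_inverse_real]) auto

lemma smooth_on_divide:
  "smooth_on U f \<Longrightarrow> smooth_on U g \<Longrightarrow> (\<And>x. x \<in> U \<Longrightarrow> g x \<noteq> 0) \<Longrightarrow> smooth_on U (\<lambda>x. f x / g x)"
  using smooth_on_mult[of U f "\<lambda>x. inverse (g x)"] smooth_on_inverse[of U g] by (simp add: divide_inverse)

lemma smooth_on_ln: "smooth_on U f \<Longrightarrow> (\<And>x. x \<in> U \<Longrightarrow> 0 < f x) \<Longrightarrow> smooth_on U (\<lambda>x. ln (f x))"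
  by (rule smooth_on_compose_real[OF smooth_on_ln_real]) auto

lemma smooth_on_sqrt:
  assumes "smooth_on U f" "\<And>x. x \<in> U \<Longrightarrow> 0 < f x"
  shows "smooth_on U (\<lambda>x. sqrt (f x))"
proof -
  have "smooth_on U (\<lambda>x. exp (ln (f x) / 2))"
    using assms smooth_on_open[OF assms(1)] by (intro smooth_on_exp smooth_on_divide smooth_on_ln) auto
  moreover have "exp (ln (f x) / 2) = sqrt (f x)" if "x \<in> U" for x
    using assms(2)[OF that] by (simp flip: ln_sqrt)
  ultimately show ?thesis by (rule iffD1[OF smooth_on_cong, rotated])
qed

section \<open>Flat functions and the smooth step\<close>

definition flat_exp :: "nat \<Rightarrow> real \<Rightarrow> real" where
  "flat_exp n x = (if x > 0 then inverse x ^ n * exp (- inverse x) else 0)"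

text \<open>The power \<open>n\<close> is carried along because differentiation then leads only to
  other members of the family, so smoothness follows by one induction. At 0 the difference quotient
  from the right is \<open>flat_exp (n + 1)\<close>, which tends to 0 after substituting
  1/x.\<close>

lemma flat_exp_deriv:
  "(flat_exp n has_real_derivative flat_exp (n + 2) x - real n * flat_exp (n + 1) x) (at x)"
proof (cases "x = 0")
  case False
  show ?thesis
  proof (cases "x > 0")
    case True
    have "((\<lambda>x. inverse x ^ n * exp (- inverse x)) has_real_derivative
       flat_exp (n + 2) x - real n * flat_exp (n + 1) x) (at x)"
    proof -
      have inv: "(inverse has_real_derivative - (inverse x * inverse x)) (at x)"
        using True by (auto intro!: derivative_eq_intros simp: power2_eq_square)
      have "((\<lambda>x. inverse x ^ n) has_real_derivative - real n * inverse x ^ (n + 1)) (at x)"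
        using DERIV_power[OF inv, of n] by (cases n) (auto simp: algebra_simps)
      from DERIV_mult[OF this DERIV_chain2[OF DERIV_exp DERIV_minus[OF inv]]] show ?thesis
        using True by (simp add: flat_exp_def algebra_simps)
    qed
    then show ?thesis
      by (rule has_field_derivative_transform_within_open[where S="{0<..}"])
        (use True in \<open>auto simp: flat_exp_def\<close>)
  next
    case neg: False
    have "((\<lambda>x. 0) has_real_derivative 0) (at x)" by simp
    then have "(flat_exp n has_real_derivative 0) (at x)"
      by (rule has_field_derivative_transform_within_open[where S="{..<0}"])
        (use neg False in \<open>auto simp: flat_exp_def\<close>)
    with neg show ?thesis by (simp add: flat_exp_def)
  qed
next
  case True
  have "((\<lambda>y::real. y ^ (n + 1) * exp (- y)) \<longlongrightarrow> 0) at_top"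
    using tendsto_power_div_exp_0[of "n + 1"] by (simp add: exp_minus divide_inverse)
  then have "((\<lambda>y::real. inverse y ^ (n + 1) * exp (- inverse y)) \<longlongrightarrow> 0) (at_right 0)"
    by (rule filterlim_compose[OF _ filterlim_inverse_at_top_right])
  then have "((\<lambda>y. (flat_exp n y - flat_exp n 0) / (y - 0)) \<longlongrightarrow> 0) (at_right 0)"
    by (rule Lim_transform_eventually)
      (auto simp: eventually_at_right_field flat_exp_def divide_inverse mult_ac intro!: exI[of _ 1])
  moreover have "((\<lambda>y. (flat_exp n y - flat_exp n 0) / (y - 0)) \<longlongrightarrow> 0) (at_left 0)"
    by (rule Lim_transform_eventually[OF tendsto_const])
      (auto simp: eventually_at_left_field flat_exp_def intro!: exI[of _ "-1"])
  ultimately have "((\<lambda>y. (flat_exp n y - flat_exp n 0) / (y - 0)) \<longlongrightarrow> 0) (at 0)"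
    by (simp add: filterlim_split_at)
  then show ?thesis
    using True by (simp add: has_field_derivative_iff flat_exp_def)
qed

lemma smooth_on_flat_exp: "smooth (flat_exp n)"
proof -
  have "Ck_on k UNIV (flat_exp n)" for k
  proof (induction k arbitrary: n)
    case 0
    then show ?case using flat_exp_deriv[of n] DERIV_isCont by (auto simp: continuous_on_eq_continuous_at)
  next
    case (Suc k)
    have "Ck_on k UNIV (\<lambda>x. flat_exp (n + 2) x + (- real n) * flat_exp (n + 1) x)"
      by (intro Ck_on_add Ck_on_mult Ck_on_const Suc) auto
    then show ?case
      by (intro Ck_on_real_SucI[OF _ flat_exp_deriv]) auto
  qed
  then show ?thesis by (simp add: smooth_on_def)
qed

text \<open>The standard cutoff; x and 1 - x are never both nonpositive, so the denominator is
  positive everywhere.\<close>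

definition step :: "real \<Rightarrow> real" where
  "step x = flat_exp 0 x / (flat_exp 0 x + flat_exp 0 (1 - x))"

lemma step_denom_pos: "flat_exp 0 x + flat_exp 0 (1 - x) > 0"
  by (auto simp: flat_exp_def add_pos_pos)

lemma smooth_on_step: "smooth step"
proof -
  have "smooth (\<lambda>x::real. flat_exp 0 (1 - x))"
    by (rule smooth_on_compose_real[OF smooth_on_flat_exp smooth_on_diff[OF smooth_on_const
      smooth_on_linear[OF _ bounded_linear_ident]]]) auto
  then show ?thesis unfolding step_def[abs_def]
    by (intro smooth_on_divide smooth_on_add smooth_on_flat_exp)
      (simp_all add: step_denom_pos[THEN less_imp_neq, THEN not_sym])
qed

lemma step_le_0: "x \<le> 0 \<Longrightarrow> step x = 0"
  and step_ge_1: "x \<ge> 1 \<Longrightarrow> step x = 1"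
  by (auto simp: step_def flat_exp_def)

lemma step_nonneg: "0 \<le> step x" and step_le1: "step x \<le> 1"
  using step_denom_pos[of x] by (auto simp: step_def flat_exp_def field_simps)

lemmas smooth_on_step' = smooth_on_compose_real[OF smooth_on_step _ UNIV_I]

lemmas smooth_intros = smooth_on_add smooth_on_mult smooth_on_diff smooth_on_uminus smooth_on_power
  smooth_on_exp smooth_on_const smooth_on_step'

section \<open>Traces with respect to an inner product\<close>

definition inner_form :: "('a::euclidean_space \<Rightarrow> 'a \<Rightarrow> real) \<Rightarrow> bool" where
  "inner_form B \<longleftrightarrow> bilinear B \<and> (\<forall>v w. B v w = B w v) \<and> (\<forall>v. v \<noteq> 0 \<longrightarrow> 0 < B v v)"

lemma inner_form_D:
  assumes "inner_form B"
  shows "bilinear B" "B v w = B w v" "v \<noteq> 0 \<Longrightarrow> 0 < B v v" "linear (B v)" "linear (\<lambda>v. B v w)"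
    "0 \<le> B v v" "B v 0 = 0" "B 0 v = 0"
proof -
  show lin: "linear (B v)" "linear (\<lambda>v. B v w)" for v w
    using assms by (auto simp: inner_form_def bilinear_def)
  show "0 \<le> B v v" "B v 0 = 0" "B 0 v = 0"
    using assms linear_0[OF lin(1)[of v]] linear_0[OF lin(2)[of v]]
    by (auto simp: inner_form_def) (metis less_eq_real_def)
qed (use assms in \<open>auto simp: inner_form_def\<close>)

lemma inner_form_eqI:
  assumes "inner_form B" "\<And>z. B v z = B w z"
  shows "v = w"
proof -
  have "B (v - w) (v - w) = 0"
    using assms(2)[of "v - w"] linear_diff[OF inner_form_D(5)[OF assms(1)]] by simp
  then show ?thesis using inner_form_D(3)[OF assms(1), of "v - w"] by auto
qed

definition orthonormal_set :: "('a::euclidean_space \<Rightarrow> 'a \<Rightarrow> real) \<Rightarrow> 'a set \<Rightarrow> bool" where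
  "orthonormal_set B E \<longleftrightarrow> (\<forall>e\<in>E. \<forall>f\<in>E. B e f = (if e = f then 1 else 0))"

lemma orthonormal_basis_iff: "orthonormal_basis g x T E \<longleftrightarrow> span E = T \<and> orthonormal_set (g x) E"
  by (simp add: orthonormal_basis_def orthonormal_set_def)

lemma orthonormal_set_independent:
  fixes B :: "'a::euclidean_space \<Rightarrow> 'a \<Rightarrow> real"
  assumes B: "inner_form B" and E: "orthonormal_set B E"
  shows "independent E" "finite E" "card E \<le> DIM('a)"
proof -
  have "e \<notin> span (E - {e})" if "e \<in> E" for e :: 'a
  proof
    assume "e \<in> span (E - {e})"
    then have "B e e = 0"
      by (rule linear_eq_0_on_span[OF inner_form_D(4)[OF B], rotated])
        (use E that in \<open>auto simp: orthonormal_set_def\<close>)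
    then show False using E that by (auto simp: orthonormal_set_def)
  qed
  then show i: "independent E" by (auto simp: dependent_def)
  then show "finite E" "card E \<le> DIM('a)" using independent_bound by auto
qed

lemma orthonormal_sum:
  assumes B: "inner_form B" and E: "orthonormal_set B E" and "e \<in> E"
  shows "B (\<Sum>f\<in>E. c f *\<^sub>R f) e = c e"
proof -
  have fin: "finite E" using orthonormal_set_independent(2)[OF B E] .
  have "B (\<Sum>f\<in>E. c f *\<^sub>R f) e = (\<Sum>f\<in>E. c f * B f e)"
    by (simp add: linear_sum[OF inner_form_D(5)[OF B]] linear_scale[OF inner_form_D(5)[OF B]])
  also have "\<dots> = (\<Sum>f\<in>E. if f = e then c f else 0)"
    by (rule sum.cong) (use E \<open>e \<in> E\<close> in \<open>auto simp: orthonormal_set_def\<close>)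
  finally show ?thesis using fin \<open>e \<in> E\<close> by simp
qed

text \<open>Subtracting the orthogonal projection onto \<open>E\<close> leaves a vector of
  \<open>T\<close> orthogonal to \<open>E\<close>, which \<open>max\<close> forces to be zero. This
  is Gram-Schmidt stated as a maximality criterion.\<close>

lemma orthonormal_span_eqI:
  assumes B: "inner_form B" and E: "orthonormal_set B E" and T: "subspace T" "E \<subseteq> T"
    and max: "\<And>v. v \<in> T \<Longrightarrow> (\<And>e. e \<in> E \<Longrightarrow> B v e = 0) \<Longrightarrow> v = 0"
  shows "span E = T" "v \<in> T \<Longrightarrow> v = (\<Sum>e\<in>E. B v e *\<^sub>R e)"
proof -
  have *: "v = (\<Sum>e\<in>E. B v e *\<^sub>R e)" if "v \<in> T" for v
  proof -
    have "v - (\<Sum>e\<in>E. B v e *\<^sub>R e) = 0"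
    proof (rule max)
      show "v - (\<Sum>e\<in>E. B v e *\<^sub>R e) \<in> T"
        using T that by (intro subspace_diff subspace_sum subspace_scale) auto
      show "B (v - (\<Sum>e\<in>E. B v e *\<^sub>R e)) e = 0" if "e \<in> E" for e
        using orthonormal_sum[OF B E that, of "B v"] linear_diff[OF inner_form_D(5)[OF B]] by simp
    qed
    then show ?thesis by simp
  qed
  then show "v \<in> T \<Longrightarrow> v = (\<Sum>e\<in>E. B v e *\<^sub>R e)" .
  show "span E = T"
  proof
    show "span E \<subseteq> T" using T by (simp add: span_minimal)
    show "T \<subseteq> span E"
    proof
      fix v assume "v \<in> T"
      show "v \<in> span E" by (subst *[OF \<open>v \<in> T\<close>]) (intro span_sum span_scale span_base)
    qed
  qed
qed

lemma orthonormal_expand: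
  assumes B: "inner_form B" and E: "orthonormal_set B E" and "v \<in> span E"
  shows "v = (\<Sum>e\<in>E. B v e *\<^sub>R e)"
proof (rule orthonormal_span_eqI(2)[OF B E subspace_span])
  fix v assume v: "v \<in> span E" and 0: "\<And>e. e \<in> E \<Longrightarrow> B v e = 0"
  have "B v v = 0"
    by (rule linear_eq_0_on_span[OF inner_form_D(4)[OF B] 0 v])
  then show "v = 0" using inner_form_D(3)[OF B, of v] by auto
qed (use assms span_superset in auto)

text \<open>Independence bounds the cardinality of orthonormal sets by the dimension, so a largest
  one inside \<open>T\<close> exists; a nonzero vector orthogonal to it could be normalised and
  added.\<close>

lemma orthonormal_exists:
  fixes B :: "'a::euclidean_space \<Rightarrow> 'a \<Rightarrow> real"
  assumes B: "inner_form B" and T: "subspace T"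
  obtains E where "orthonormal_set B E" "span E = T"
proof -
  define P where "P E \<longleftrightarrow> orthonormal_set B E \<and> E \<subseteq> T" for E
  have P0: "P {}" by (simp add: P_def orthonormal_set_def)
  have bd: "\<forall>E. P E \<longrightarrow> card E \<le> DIM('a)"
    using orthonormal_set_independent(3)[OF B] by (auto simp: P_def)
  obtain E where E: "P E" "\<And>F. P F \<Longrightarrow> card F \<le> card E"
    using ex_has_greatest_nat[where P=P and k="{}" and f=card and b="Suc (DIM('a))"] bd P0
    by (metis less_Suc_eq_le)
  have on: "orthonormal_set B E" and sub: "E \<subseteq> T" using E(1) by (auto simp: P_def)
  have "v = 0" if v: "v \<in> T" "\<And>e. e \<in> E \<Longrightarrow> B v e = 0" for v
  proof (rule ccontr)
    assume "v \<noteq> 0"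
    then have pos: "B v v > 0" using inner_form_D(3)[OF B] by blast
    define w where "w = inverse (sqrt (B v v)) *\<^sub>R v"
    have lin: "linear (B x)" "linear (\<lambda>v. B v x)" for x using inner_form_D[OF B] by blast+
    have we: "B w e = 0" "B e w = 0" if "e \<in> E" for e
      using v(2)[OF that] inner_form_D(2)[OF B, of e] unfolding w_def
      by (auto simp: linear_scale[OF lin(1)] linear_scale[OF lin(2)])
    have ww: "B w w = 1"
      using pos by (simp add: w_def linear_scale[OF lin(1)] linear_scale[OF lin(2)] field_simps)
    have "w \<notin> E" using we ww by force
    have "P (insert w E)"
      using on sub we ww \<open>w \<notin> E\<close> T v(1) unfolding P_def orthonormal_set_def
      by (auto simp: w_def subspace_scale)
    then have "card (insert w E) \<le> card E" by (rule E(2))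
    then show False using \<open>w \<notin> E\<close> orthonormal_set_independent(2)[OF B on] by simp
  qed
  then have "span E = T" by (rule orthonormal_span_eqI(1)[OF B on T sub])
  with on show ?thesis by (rule that)
qed

text \<open>\<open>metric_trace\<close> chooses its basis by \<open>SOME\<close> and can only be
  evaluated once the sum is known to be the same for all bases. The matrix of inner products between
  the two bases is orthogonal, which is \<open>sumEE\<close>.\<close>

lemma orthonormal_trace_unique:
  fixes L :: "'a::euclidean_space \<Rightarrow> 'a \<Rightarrow> real"
  assumes B: "inner_form B" and E: "orthonormal_set B E" and F: "orthonormal_set B F"
    and span: "span E = span F" and L: "bilinear L"
  shows "(\<Sum>e\<in>E. L e e) = (\<Sum>f\<in>F. L f f)"
proof -
  have fin: "finite E" "finite F" using orthonormal_set_independent(2)[OF B] E F by auto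
  have lin: "linear (L x)" "linear (\<lambda>v. L v x)" for x using L by (auto simp: bilinear_def)
  have expF: "f = (\<Sum>e\<in>E. B f e *\<^sub>R e)" if "f \<in> F" for f
    using orthonormal_expand[OF B E] span that span_base[of f F] by simp
  have expE: "e = (\<Sum>f\<in>F. B e f *\<^sub>R f)" if "e \<in> E" for e
    using orthonormal_expand[OF B F] span that span_base[of e E] by simp
  have sumEE: "(\<Sum>f\<in>F. B f e * B f e') = (if e = e' then 1 else 0)" if "e \<in> E" "e' \<in> E" for e e'
  proof -
    have "(if e = e' then 1 else 0) = B (\<Sum>f\<in>F. B e f *\<^sub>R f) e'"
      using E that expE[OF that(1)] by (simp add: orthonormal_set_def)
    also have "\<dots> = (\<Sum>f\<in>F. B e f * B f e')"
      by (simp add: linear_sum[OF inner_form_D(5)[OF B]] linear_scale[OF inner_form_D(5)[OF B]])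
    finally show ?thesis using inner_form_D(2)[OF B, of e] by simp
  qed
  have "(\<Sum>f\<in>F. L f f) = (\<Sum>f\<in>F. \<Sum>e\<in>E. \<Sum>e'\<in>E. B f e * B f e' * L e e')"
  proof (rule sum.cong[OF refl])
    fix f assume f: "f \<in> F"
    have "L f f = L (\<Sum>e\<in>E. B f e *\<^sub>R e) (\<Sum>e\<in>E. B f e *\<^sub>R e)"
      using expF[OF f] by simp
    also have "\<dots> = (\<Sum>e\<in>E. \<Sum>e'\<in>E. B f e * B f e' * L e e')"
      by (simp add: linear_sum[OF lin(1)] linear_sum[OF lin(2)] linear_scale[OF lin(1)]
          linear_scale[OF lin(2)] sum_distrib_left mult.assoc)
        (subst sum.swap, simp add: mult.left_commute)
    finally show "L f f = (\<Sum>e\<in>E. \<Sum>e'\<in>E. B f e * B f e' * L e e')" .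
  qed
  also have "\<dots> = (\<Sum>e\<in>E. \<Sum>e'\<in>E. (\<Sum>f\<in>F. B f e * B f e') * L e e')"
    by (subst sum.swap, rule sum.cong[OF refl], subst sum.swap) (simp add: sum_distrib_right)
  also have "\<dots> = (\<Sum>e\<in>E. \<Sum>e'\<in>E. if e = e' then L e e' else 0)"
    by (intro sum.cong refl) (simp add: sumEE)
  also have "\<dots> = (\<Sum>e\<in>E. L e e)" using fin by simp
  finally show ?thesis by simp
qed

lemma metric_trace_eq:
  fixes L :: "'a::euclidean_space \<Rightarrow> 'a \<Rightarrow> real"
  assumes "inner_form (g x)" "orthonormal_set (g x) E" "bilinear L"
  shows "metric_trace g x (span E) L = (\<Sum>e\<in>E. L e e)"
proof -
  have "orthonormal_basis g x (span E) (SOME F. orthonormal_basis g x (span E) F)"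
    by (rule someI[of _ E]) (simp add: orthonormal_basis_iff assms)
  then show ?thesis
    unfolding metric_trace_def orthonormal_basis_iff
    using orthonormal_trace_unique[OF assms(1) _ assms(2) _ assms(3)] by blast
qed

text \<open>\<open>ricci\<close> is the trace of an endomorphism taken in the Euclidean basis; this
  moves it to a frame orthonormal for the metric, where curvature components are easy to
  read.\<close>

lemma trace_Basis_eq:
  fixes L :: "'a::euclidean_space \<Rightarrow> 'a"
  assumes B: "inner_form B" and E: "orthonormal_set B E" "span E = UNIV" and L: "linear L"
  shows "(\<Sum>b\<in>Basis. L b \<bullet> b) = (\<Sum>e\<in>E. B (L e) e)"
proof -
  have "(\<Sum>e\<in>E. B (L e) e) = (\<Sum>e\<in>E. \<Sum>b\<in>Basis. (e \<bullet> b) * B (L b) e)"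
  proof (rule sum.cong[OF refl])
    fix e assume "e \<in> E"
    have lin: "linear (\<lambda>v. B (L v) e)"
      using linear_compose[OF L inner_form_D(5)[OF B, of e]] by (simp add: o_def)
    have "B (L (\<Sum>b\<in>Basis. c b *\<^sub>R b)) e = (\<Sum>b\<in>Basis. c b * B (L b) e)" for c
      by (simp add: linear_sum[OF lin] linear_scale[OF lin])
    from this[of "\<lambda>b. e \<bullet> b"] show "B (L e) e = (\<Sum>b\<in>Basis. (e \<bullet> b) * B (L b) e)"
      by (simp add: euclidean_representation)
  qed
  also have "\<dots> = (\<Sum>b\<in>Basis. (\<Sum>e\<in>E. B (L b) e *\<^sub>R e) \<bullet> b)"
    by (subst sum.swap) (simp add: inner_sum_left mult.commute)
  also have "\<dots> = (\<Sum>b\<in>Basis. L b \<bullet> b)"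
    using orthonormal_expand[OF B E(1)] E(2) by simp
  finally show ?thesis by simp
qed

section \<open>The Levi-Civita connection\<close>

lemma bilinear_lin:
  assumes "bilinear f" shows "linear (f x)" "linear (\<lambda>x. f x y)"
  using assms by (auto simp: bilinear_def)

lemma bilinear_Basis_expand:
  fixes f :: "'a::euclidean_space \<Rightarrow> 'b::euclidean_space \<Rightarrow> 'c::real_vector"
  assumes "bilinear f"
  shows "f v w = (\<Sum>b\<in>Basis. \<Sum>c\<in>Basis. ((v \<bullet> b) * (w \<bullet> c)) *\<^sub>R f b c)"
proof -
  note lin = bilinear_lin[OF assms]
  have "f (\<Sum>b\<in>Basis. p b *\<^sub>R b) (\<Sum>c\<in>Basis. q c *\<^sub>R c) =
      (\<Sum>b\<in>Basis. \<Sum>c\<in>Basis. (p b * q c) *\<^sub>R f b c)" for p q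
    by (simp add: linear_sum[OF lin(1)] linear_sum[OF lin(2)] linear_scale[OF lin(1)]
        linear_scale[OF lin(2)] scaleR_sum_right) (subst sum.swap, simp add: mult.commute)
  from this[of "\<lambda>b. v \<bullet> b" "\<lambda>c. w \<bullet> c"] show ?thesis by (simp add: euclidean_representation)
qed

text \<open>The derivative of \<open>T\<close> is known only on constant arguments. Expanding in the
  Euclidean basis reduces moving arguments to finitely many constant ones, and the product rule does
  the rest.\<close>

lemma bilinear_field_derivative:
  fixes T :: "'d::real_normed_vector \<Rightarrow> 'a::euclidean_space \<Rightarrow> 'b::euclidean_space \<Rightarrow> 'c::real_normed_vector"
  assumes U: "open U" "x \<in> U" "\<And>y. y \<in> U \<Longrightarrow> bilinear (T y)"
    and D: "\<And>v w. ((\<lambda>y. T y v w) has_derivative D v w) (at x)"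
    and P: "(P has_derivative P') (at x)" and Q: "(Q has_derivative Q') (at x)"
  shows "((\<lambda>y. T y (P y) (Q y)) has_derivative
    (\<lambda>u. D (P x) (Q x) u + T x (P' u) (Q x) + T x (P x) (Q' u))) (at x)"
proof -
  have ev: "((\<lambda>y. \<Sum>b\<in>Basis. \<Sum>c\<in>Basis. ((p y \<bullet> b) * (q y \<bullet> c)) *\<^sub>R T y b c) has_derivative F) (at x) \<Longrightarrow>
      ((\<lambda>y. T y (p y) (q y)) has_derivative F) (at x)" for p q F
    by (erule has_derivative_transform_within_open[OF _ U(1,2)])
      (use bilinear_Basis_expand[OF U(3)] in auto)
  have Dexp: "D v w = (\<lambda>u. \<Sum>b\<in>Basis. \<Sum>c\<in>Basis. ((v \<bullet> b) * (w \<bullet> c)) *\<^sub>R D b c u)" for v w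
    by (rule has_derivative_unique[OF D]) (intro ev has_derivative_sum has_derivative_scaleR_right D)
  show ?thesis
  proof (rule ev)
    have eq: "D (P x) (Q x) u + T x (P' u) (Q x) + T x (P x) (Q' u) =
      (\<Sum>b\<in>Basis. \<Sum>c\<in>Basis. ((P x \<bullet> b) * (Q x \<bullet> c)) *\<^sub>R D b c u +
        ((P x \<bullet> b) * (Q' u \<bullet> c) + (P' u \<bullet> b) * (Q x \<bullet> c)) *\<^sub>R T x b c)" for u
      unfolding bilinear_Basis_expand[OF U(3)[OF U(2)], of "P' u"]
        bilinear_Basis_expand[OF U(3)[OF U(2)], of "P x"] Dexp[of "P x"]
      by (simp add: sum.distrib scaleR_add_left)
    show "((\<lambda>y. \<Sum>b\<in>Basis. \<Sum>c\<in>Basis. ((P y \<bullet> b) * (Q y \<bullet> c)) *\<^sub>R T y b c) has_derivative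
        (\<lambda>u. D (P x) (Q x) u + T x (P' u) (Q x) + T x (P x) (Q' u))) (at x)"
      unfolding eq
      by (intro has_derivative_sum has_derivative_scaleR has_derivative_mult D
          has_derivative_inner_left P Q)
  qed
qed

text \<open>A linear field is a bilinear one whose second argument is a real factor, here held at
  1.\<close>

lemma linear_field_derivative:
  fixes T :: "'d::real_normed_vector \<Rightarrow> 'a::euclidean_space \<Rightarrow> 'c::real_normed_vector"
  assumes U: "open U" "x \<in> U" "\<And>y. y \<in> U \<Longrightarrow> linear (T y)"
    and D: "\<And>v. ((\<lambda>y. T y v) has_derivative D v) (at x)"
    and P: "(P has_derivative P') (at x)"
  shows "((\<lambda>y. T y (P y)) has_derivative (\<lambda>u. D (P x) u + T x (P' u))) (at x)"
proof -
  have bil: "bilinear (\<lambda>v (c::real). c *\<^sub>R T y v)" if "y \<in> U" for y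
    using U(3)[OF that] by (auto simp: bilinear_def linear_iff algebra_simps)
  have "((\<lambda>y. 1 *\<^sub>R T y (P y)) has_derivative
     (\<lambda>u. 1 *\<^sub>R D (P x) u + 1 *\<^sub>R T x (P' u) + 0 *\<^sub>R T x (P x))) (at x)"
    by (rule bilinear_field_derivative[where T="\<lambda>y v (c::real). c *\<^sub>R T y v" and D="\<lambda>v c u. c *\<^sub>R D v u"
          and Q="\<lambda>_. 1" and Q'="\<lambda>_. 0" and U=U])
      (auto intro!: U bil has_derivative_scaleR_right D P)
  then show ?thesis by simp
qed

text \<open>Names the Christoffel symbols through the Koszul formula, so that the definite
  description in \<open>christoffel\<close> can be replaced by a concrete field. One derivative of
  \<open>g\<close> and one of \<open>\<Gamma>\<close> are all that the curvature takes.\<close>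

definition levi_civita ::
    "'a::euclidean_space set \<Rightarrow> 'a metric \<Rightarrow> ('a \<Rightarrow> 'a \<Rightarrow> 'a \<Rightarrow> 'a) \<Rightarrow> bool" where
  "levi_civita U g \<Gamma> \<longleftrightarrow> open U \<and> (\<forall>x\<in>U. inner_form (g x) \<and>
     (\<forall>v w. (\<lambda>y. g y v w) differentiable (at x)) \<and> (\<forall>v w. (\<lambda>y. \<Gamma> y v w) differentiable (at x)) \<and>
     (\<forall>u v z. 2 * g x (\<Gamma> x u v) z =
        dd (\<lambda>y. g y v z) u x + dd (\<lambda>y. g y u z) v x - dd (\<lambda>y. g y u v) z x))"

lemma levi_civita_subset: "levi_civita U g \<Gamma> \<Longrightarrow> open V \<Longrightarrow> V \<subseteq> U \<Longrightarrow> levi_civita V g \<Gamma>"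
  by (auto simp: levi_civita_def)

context
  fixes U :: "'a::euclidean_space set" and g :: "'a metric" and \<Gamma>
  assumes lc: "levi_civita U g \<Gamma>"
begin

lemma lc_open: "open U" and lc_inner: "x \<in> U \<Longrightarrow> inner_form (g x)"
  and lc_koszul: "x \<in> U \<Longrightarrow> 2 * g x (\<Gamma> x u v) z =
        dd (\<lambda>y. g y v z) u x + dd (\<lambda>y. g y u z) v x - dd (\<lambda>y. g y u v) z x"
  using lc by (auto simp: levi_civita_def)

lemma lc_metric_deriv: "x \<in> U \<Longrightarrow> ((\<lambda>y. g y v w) has_derivative (\<lambda>u. dd (\<lambda>y. g y v w) u x)) (at x)"
  unfolding dd_def using lc by (auto simp: levi_civita_def frechet_derivative_works)

lemma lc_Gamma_deriv:
  "x \<in> U \<Longrightarrow> ((\<lambda>y. \<Gamma> y v w) has_derivative frechet_derivative (\<lambda>y. \<Gamma> y v w) (at x)) (at x)"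
  using lc by (auto simp: levi_civita_def frechet_derivative_works)

lemma lc_bilin: "x \<in> U \<Longrightarrow> bilinear (g x)"
  using lc_inner inner_form_D(1) by blast

lemma lc_metric_sym: "x \<in> U \<Longrightarrow> g x v w = g x w v"
  using lc_inner inner_form_D(2) by blast

lemma lc_dd_sym:
  assumes "x \<in> U" shows "dd (\<lambda>y. g y v w) u x = dd (\<lambda>y. g y w v) u x"
  by (rule dd_eqI, rule has_derivative_transform_within_open[OF lc_metric_deriv[OF assms] lc_open assms])
    (simp add: lc_metric_sym)

lemma lc_dd_bilin:
  assumes x: "x \<in> U" shows "bilinear (\<lambda>v w. dd (\<lambda>y. g y v w) u x)"
proof -
  have "dd (\<lambda>y. g y (v + v') w) u x = dd (\<lambda>y. g y v w) u x + dd (\<lambda>y. g y v' w) u x" for v v' w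
    by (rule dd_eqI, rule has_derivative_transform_within_open[OF
          has_derivative_add[OF lc_metric_deriv[OF x] lc_metric_deriv[OF x]] lc_open x])
      (simp add: linear_add[OF bilinear_lin(2)[OF lc_bilin]])
  moreover have "dd (\<lambda>y. g y (r *\<^sub>R v) w) u x = r * dd (\<lambda>y. g y v w) u x" for r v w
    by (rule dd_eqI, rule has_derivative_transform_within_open[OF
          has_derivative_mult_right[OF lc_metric_deriv[OF x]] lc_open x])
      (simp add: linear_scale[OF bilinear_lin(2)[OF lc_bilin]])
  ultimately have lin: "linear (\<lambda>v. dd (\<lambda>y. g y v w) u x)" for w
    by (simp add: linear_iff)
  moreover have "linear (\<lambda>w. dd (\<lambda>y. g y v w) u x)" for v
    using lin[of v] lc_dd_sym[OF x] by simp
  ultimately show ?thesis by (simp add: bilinear_def)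
qed

lemma lc_dd_lin_dir: "x \<in> U \<Longrightarrow> linear (\<lambda>u. dd (\<lambda>y. g y v w) u x)"
  using has_derivative_linear[OF lc_metric_deriv] by blast

lemma lc_Gamma_sym:
  assumes "x \<in> U" shows "\<Gamma> x u v = \<Gamma> x v u"
proof (rule inner_form_eqI[OF lc_inner[OF assms]])
  fix z show "g x (\<Gamma> x u v) z = g x (\<Gamma> x v u) z"
    using lc_koszul[OF assms, of u v z] lc_koszul[OF assms, of v u z] lc_dd_sym[OF assms, of u v] by simp
qed

lemma lc_Gamma_bilin:
  assumes x: "x \<in> U" shows "bilinear (\<Gamma> x)"
proof -
  note l1 = lc_dd_bilin[OF x, THEN bilinear_lin(1)] lc_dd_bilin[OF x, THEN bilinear_lin(2)]
    lc_dd_lin_dir[OF x]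
  note gl = bilinear_lin(2)[OF lc_bilin[OF x]]
  have "linear (\<Gamma> x u)" for u
  proof (rule linearI)
    show "\<Gamma> x u (v + w) = \<Gamma> x u v + \<Gamma> x u w" for v w
    proof (rule inner_form_eqI[OF lc_inner[OF x]])
      fix z
      have "2 * g x (\<Gamma> x u (v + w)) z = 2 * g x (\<Gamma> x u v) z + 2 * g x (\<Gamma> x u w) z"
        unfolding lc_koszul[OF x] by (simp add: l1[THEN linear_add])
      then show "g x (\<Gamma> x u (v + w)) z = g x (\<Gamma> x u v + \<Gamma> x u w) z"
        by (simp add: linear_add[OF gl])
    qed
    show "\<Gamma> x u (r *\<^sub>R v) = r *\<^sub>R \<Gamma> x u v" for r v
    proof (rule inner_form_eqI[OF lc_inner[OF x]])
      fix z
      have "2 * g x (\<Gamma> x u (r *\<^sub>R v)) z = r * (2 * g x (\<Gamma> x u v) z)"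
        unfolding lc_koszul[OF x] by (simp add: l1[THEN linear_scale] algebra_simps)
      then show "g x (\<Gamma> x u (r *\<^sub>R v)) z = g x (r *\<^sub>R \<Gamma> x u v) z"
        by (simp add: linear_scale[OF gl])
    qed
  qed
  moreover have "linear (\<lambda>u. \<Gamma> x u v)" for v
  proof -
    have "(\<lambda>u. \<Gamma> x u v) = \<Gamma> x v" using lc_Gamma_sym[OF x] by blast
    then show ?thesis using calculation[of v] by simp
  qed
  ultimately show ?thesis by (simp add: bilinear_def)
qed

text \<open>Adding the Koszul formulas for (u, v, w) and (u, w, v) cancels everything except the
  derivative in the direction \<open>u\<close>.\<close>

lemma lc_compat:
  assumes x: "x \<in> U"
  shows "dd (\<lambda>y. g y v w) u x = g x (\<Gamma> x u v) w + g x v (\<Gamma> x u w)"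
  using lc_koszul[OF x, of u v w] lc_koszul[OF x, of u w v] lc_metric_sym[OF x, of v]
    lc_dd_sym[OF x, of v w] lc_dd_sym[OF x, of u v] lc_dd_sym[OF x, of u w] by simp

lemma lc_christoffel:
  assumes x: "x \<in> U" shows "christoffel g x u v = \<Gamma> x u v"
  unfolding christoffel_def
proof (rule the_equality)
  have *: "g x (\<Gamma> x u v) z = (frechet_derivative (\<lambda>y. g y v z) (at x) u
      + frechet_derivative (\<lambda>y. g y u z) (at x) v - frechet_derivative (\<lambda>y. g y u v) (at x) z) / 2" for z
    using lc_koszul[OF x, of u v z] by (simp add: dd_def)
  then show "\<forall>z. g x (\<Gamma> x u v) z = (frechet_derivative (\<lambda>y. g y v z) (at x) u
      + frechet_derivative (\<lambda>y. g y u z) (at x) v - frechet_derivative (\<lambda>y. g y u v) (at x) z) / 2"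
    by blast
  show "w = \<Gamma> x u v" if "\<forall>z. g x w z = (frechet_derivative (\<lambda>y. g y v z) (at x) u
      + frechet_derivative (\<lambda>y. g y u z) (at x) v - frechet_derivative (\<lambda>y. g y u v) (at x) z) / 2" for w
    by (rule inner_form_eqI[OF lc_inner[OF x]]) (simp only: * that[rule_format])
qed

lemma lc_riemann:
  assumes x: "x \<in> U"
    and D: "\<And>v w. ((\<lambda>y. \<Gamma> y v w) has_derivative (\<lambda>u. D u v w)) (at x)"
  shows "riemann g x u v w = D u v w + \<Gamma> x u (\<Gamma> x v w) - D v u w - \<Gamma> x v (\<Gamma> x u w)"
proof -
  have "frechet_derivative (\<lambda>y. christoffel g y v w) (at x) = (\<lambda>u. D u v w)" for v w
    by (rule frechet_derivative_at[symmetric],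
        rule has_derivative_transform_within_open[OF D lc_open x]) (simp add: lc_christoffel)
  then show ?thesis by (simp add: riemann_def cov_deriv_def lc_christoffel[OF x])
qed

lemma lc_Gamma_deriv_bilin:
  assumes x: "x \<in> U"
    and D: "\<And>v w. ((\<lambda>y. \<Gamma> y v w) has_derivative (\<lambda>u. D u v w)) (at x)"
  shows "bilinear (D u)" "linear (\<lambda>u. D u v w)"
proof -
  have "(\<lambda>u. D u (v + v') w) = (\<lambda>u. D u v w + D u v' w)" for v v' w
    by (rule has_derivative_unique[OF D], rule has_derivative_transform_within_open[OF
          has_derivative_add[OF D D] lc_open x])
      (simp add: linear_add[OF bilinear_lin(2)[OF lc_Gamma_bilin]])
  moreover have "(\<lambda>u. D u (r *\<^sub>R v) w) = (\<lambda>u. r *\<^sub>R D u v w)" for r v w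
    by (rule has_derivative_unique[OF D], rule has_derivative_transform_within_open[OF
          has_derivative_scaleR_right[OF D] lc_open x])
      (simp add: linear_scale[OF bilinear_lin(2)[OF lc_Gamma_bilin]])
  moreover have "(\<lambda>u. D u v w) = (\<lambda>u. D u w v)" for v w
    by (rule has_derivative_unique[OF D], rule has_derivative_transform_within_open[OF D lc_open x])
      (rule lc_Gamma_sym)
  ultimately show "bilinear (D u)"
    unfolding bilinear_def linear_iff by (metis (no_types, lifting))
  show "linear (\<lambda>u. D u v w)" using has_derivative_linear[OF D] .
qed

lemma lc_riemann_linear:
  assumes x: "x \<in> U"
  shows "linear (\<lambda>u. riemann g x u v w)" "bilinear (\<lambda>v w. riemann g x u v w)"
proof -
  define D where "D u v w = frechet_derivative (\<lambda>y. \<Gamma> y v w) (at x) u" for u v w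
  have D: "((\<lambda>y. \<Gamma> y v w) has_derivative (\<lambda>u. D u v w)) (at x)" for v w
    unfolding D_def by (rule lc_Gamma_deriv[OF x])
  note R = lc_riemann[OF x D] and l1 = lc_Gamma_deriv_bilin[OF x D]
  note l = l1(2) bilinear_lin[OF l1(1)] bilinear_lin[OF lc_Gamma_bilin[OF x]]
  show "linear (\<lambda>u. riemann g x u v w)"
    unfolding R by (rule linearI) (simp_all add: l[THEN linear_add] l[THEN linear_scale] algebra_simps)
  show "bilinear (\<lambda>v w. riemann g x u v w)"
    unfolding R bilinear_def
    by (intro conjI allI linearI)
      (simp_all add: l[THEN linear_add] l[THEN linear_scale] algebra_simps)
qed

lemma lc_ricci_eq:
  assumes x: "x \<in> U" and E: "orthonormal_set (g x) E" "span E = UNIV"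
  shows "ricci g x v w = (\<Sum>e\<in>E. g x (riemann g x e v w) e)"
  unfolding ricci_def by (rule trace_Basis_eq[OF lc_inner[OF x] E lc_riemann_linear(1)[OF x]])

lemma lc_ricci_bilin:
  assumes x: "x \<in> U" shows "bilinear (ricci g x)"
proof -
  note l = bilinear_lin[OF lc_riemann_linear(2)[OF x]]
  show ?thesis unfolding ricci_def[abs_def] bilinear_def
    by (intro conjI allI linearI)
      (simp_all add: l[THEN linear_add] l[THEN linear_scale] inner_add_left sum.distrib sum_distrib_left)
qed

lemma lc_scalar_curvature:
  assumes x: "x \<in> U" and E: "orthonormal_set (g x) E" "span E = UNIV"
  shows "scalar_curvature g x = (\<Sum>e\<in>E. ricci g x e e)"
  using metric_trace_eq[where g=g, OF lc_inner[OF x] E(1) lc_ricci_bilin[OF x]] E(2)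
  by (simp add: scalar_curvature_def)

end

text \<open>\<open>A\<close>, \<open>H\<close> and \<open>T\<close> are the first three derivatives
  of \<Phi>, and \<open>B\<close> inverts the first. Pointwise invertibility of the differential is
  enough because every transported quantity is local. The third derivative occurs because the new
  connection contains the second one and curvature differentiates it once more.\<close>

locale coordinate_change =
  fixes U :: "'a::euclidean_space set" and V :: "'a set" and g :: "'a metric" and \<Gamma>
    and \<Phi> :: "'a \<Rightarrow> 'a" and A B :: "'a \<Rightarrow> 'a \<Rightarrow> 'a" and H :: "'a \<Rightarrow> 'a \<Rightarrow> 'a \<Rightarrow> 'a"
    and T :: "'a \<Rightarrow> 'a \<Rightarrow> 'a \<Rightarrow> 'a \<Rightarrow> 'a"
  assumes lcV: "levi_civita V g \<Gamma>" and openU: "open U" and maps: "\<And>x. x \<in> U \<Longrightarrow> \<Phi> x \<in> V"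
    and dPhi: "\<And>x. x \<in> U \<Longrightarrow> (\<Phi> has_derivative A x) (at x)"
    and dA: "\<And>x v. x \<in> U \<Longrightarrow> ((\<lambda>y. A y v) has_derivative (\<lambda>u. H x u v)) (at x)"
    and dH: "\<And>x u v. x \<in> U \<Longrightarrow> ((\<lambda>y. H y u v) has_derivative (\<lambda>w. T x w u v)) (at x)"
    and Hsym: "\<And>x u v. x \<in> U \<Longrightarrow> H x u v = H x v u"
    and Tsym: "\<And>x u v w. x \<in> U \<Longrightarrow> T x u v w = T x v u w"
    and Bdiff: "\<And>x v. x \<in> U \<Longrightarrow> (\<lambda>y. B y v) differentiable (at x)"
    and Blin: "\<And>x. x \<in> U \<Longrightarrow> linear (B x)"
    and BA: "\<And>x v. x \<in> U \<Longrightarrow> B x (A x v) = v" and AB: "\<And>x v. x \<in> U \<Longrightarrow> A x (B x v) = v"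
begin

definition g' :: "'a metric" where "g' x v w = g (\<Phi> x) (A x v) (A x w)"

text \<open>The transformation law of Christoffel symbols; the second derivative of \<Phi> is its
  inhomogeneous term.\<close>

definition \<Gamma>' :: "'a \<Rightarrow> 'a \<Rightarrow> 'a \<Rightarrow> 'a" where
  "\<Gamma>' x u v = B x (\<Gamma> (\<Phi> x) (A x u) (A x v) + H x u v)"

lemma Alin: "x \<in> U \<Longrightarrow> linear (A x)"
  using has_derivative_linear[OF dPhi] .

lemma Ainj: "x \<in> U \<Longrightarrow> A x v = A x w \<Longrightarrow> v = w"
  using BA by metis

lemma A_\<Gamma>': "x \<in> U \<Longrightarrow> A x (\<Gamma>' x u v) = \<Gamma> (\<Phi> x) (A x u) (A x v) + H x u v"
  by (simp add: \<Gamma>'_def AB)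

lemma inner': assumes x: "x \<in> U" shows "inner_form (g' x)"
proof -
  note i = lc_inner[OF lcV maps[OF x]]
  note l = inner_form_D(4,5)[OF i]
  have "bilinear (g' x)"
    unfolding bilinear_def g'_def[abs_def]
    by (intro conjI allI linearI)
      (simp_all add: Alin[OF x, THEN linear_add] Alin[OF x, THEN linear_scale] l[THEN linear_add] l[THEN linear_scale])
  moreover have "A x v \<noteq> 0" if "v \<noteq> 0" for v
    using that Ainj[OF x, of v 0] linear_0[OF Alin[OF x]] by auto
  ultimately show ?thesis
    using inner_form_D(2,3)[OF i] by (simp add: inner_form_def g'_def)
qed

lemma Gamma_Phi_deriv:
  assumes x: "x \<in> U"
  shows "((\<lambda>y. \<Gamma> (\<Phi> y) (A y u) (A y v)) has_derivative (\<lambda>w.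
     frechet_derivative (\<lambda>y. \<Gamma> y (A x u) (A x v)) (at (\<Phi> x)) (A x w)
     + \<Gamma> (\<Phi> x) (H x w u) (A x v) + \<Gamma> (\<Phi> x) (A x u) (H x w v))) (at x)"
  by (rule bilinear_field_derivative[OF openU x, where T="\<lambda>y. \<Gamma> (\<Phi> y)"
    and D="\<lambda>v w u. frechet_derivative (\<lambda>y. \<Gamma> y v w) (at (\<Phi> x)) (A x u)"])
   (auto intro!: lc_Gamma_bilin[OF lcV] maps dA x
    has_derivative_compose[OF dPhi[OF x] lc_Gamma_deriv[OF lcV maps[OF x]]])

lemma g'_deriv:
  assumes x: "x \<in> U"
  shows "((\<lambda>y. g' y v w) has_derivative (\<lambda>u.
     dd (\<lambda>y. g y (A x v) (A x w)) (A x u) (\<Phi> x)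
     + g (\<Phi> x) (H x u v) (A x w) + g (\<Phi> x) (A x v) (H x u w))) (at x)"
  unfolding g'_def
  by (rule bilinear_field_derivative[OF openU x, where T="\<lambda>y. g (\<Phi> y)"
    and D="\<lambda>v w u. dd (\<lambda>y. g y v w) (A x u) (\<Phi> x)"])
   (auto intro!: lc_bilin[OF lcV] maps dA x
    has_derivative_compose[OF dPhi[OF x] lc_metric_deriv[OF lcV maps[OF x]]])

lemma Gamma'_diff: assumes x: "x \<in> U" shows "(\<lambda>y. \<Gamma>' y u v) differentiable (at x)"
proof -
  have "((\<lambda>y. \<Gamma>' y u v) has_derivative (\<lambda>w. frechet_derivative (\<lambda>y. B y (A x (\<Gamma>' x u v))) (at x) w
     + B x ((frechet_derivative (\<lambda>y. \<Gamma> y (A x u) (A x v)) (at (\<Phi> x)) (A x w)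
     + \<Gamma> (\<Phi> x) (H x w u) (A x v) + \<Gamma> (\<Phi> x) (A x u) (H x w v)) + T x w u v))) (at x)"
    unfolding A_\<Gamma>'[OF x] unfolding \<Gamma>'_def
    by (rule linear_field_derivative[OF openU x Blin])
     (auto intro!: has_derivative_add Gamma_Phi_deriv dH x
       Bdiff[OF x, unfolded frechet_derivative_works])
  then show ?thesis unfolding differentiable_def by blast
qed

lemma levi_civita': "levi_civita U g' \<Gamma>'"
  unfolding levi_civita_def
proof (intro conjI ballI allI openU)
  fix x u v z assume x: "x \<in> U"
  show "inner_form (g' x)" by (rule inner'[OF x])
  show "(\<lambda>y. g' y v z) differentiable (at x)"
    using g'_deriv[OF x] unfolding differentiable_def by blast
  show "(\<lambda>y. \<Gamma>' y v z) differentiable (at x)" by (rule Gamma'_diff[OF x])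
  note gl = inner_form_D(4,5)[OF lc_inner[OF lcV maps[OF x]]]
  have "2 * g' x (\<Gamma>' x u v) z = 2 * g (\<Phi> x) (\<Gamma> (\<Phi> x) (A x u) (A x v)) (A x z) + 2 * g (\<Phi> x) (H x u v) (A x z)"
    by (simp add: g'_def A_\<Gamma>'[OF x] linear_add[OF gl(2)])
  then show "2 * g' x (\<Gamma>' x u v) z =
        dd (\<lambda>y. g' y v z) u x + dd (\<lambda>y. g' y u z) v x - dd (\<lambda>y. g' y u v) z x"
    unfolding dd_eqI[OF g'_deriv[OF x]] lc_koszul[OF lcV maps[OF x]]
    using Hsym[OF x, of u v] Hsym[OF x, of u z] Hsym[OF x, of v z]
      lc_metric_sym[OF lcV maps[OF x]] by simp
qed

text \<open>Differentiating the identity \<open>A_\<Gamma>'\<close> in two ways gives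
  \<open>key\<close>, so the derivative of the inverse \<open>B\<close> never has to be computed.
  Antisymmetrising in \<open>u\<close> and \<open>v\<close> then cancels all terms with second and
  third derivatives of \<Phi>, by their symmetry.\<close>

lemma riemann':
  assumes x: "x \<in> U"
  shows "A x (riemann g' x u v w) = riemann g (\<Phi> x) (A x u) (A x v) (A x w)"
proof -
  define D where "D u v w = frechet_derivative (\<lambda>y. \<Gamma>' y v w) (at x) u" for u v w
  have D: "((\<lambda>y. \<Gamma>' y v w) has_derivative (\<lambda>u. D u v w)) (at x)" for v w
    unfolding D_def by (rule lc_Gamma_deriv[OF levi_civita' x])
  define G where "G u v w = frechet_derivative (\<lambda>y. \<Gamma> y v w) (at (\<Phi> x)) u" for u v w
  have G: "((\<lambda>y. \<Gamma> y v w) has_derivative (\<lambda>u. G u v w)) (at (\<Phi> x))" for v w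
    unfolding G_def by (rule lc_Gamma_deriv[OF lcV maps[OF x]])
  have key: "H x u (\<Gamma>' x v w) + A x (D u v w) = G (A x u) (A x v) (A x w)
     + \<Gamma> (\<Phi> x) (H x u v) (A x w) + \<Gamma> (\<Phi> x) (A x v) (H x u w) + T x u v w" for u v w
  proof -
    have 1: "((\<lambda>y. A y (\<Gamma>' y v w)) has_derivative (\<lambda>u. H x u (\<Gamma>' x v w) + A x (D u v w))) (at x)"
      by (rule linear_field_derivative[OF openU x Alin]) (auto intro!: dA x D)
    have 2: "((\<lambda>y. \<Gamma> (\<Phi> y) (A y v) (A y w) + H y v w) has_derivative (\<lambda>u. G (A x u) (A x v) (A x w)
     + \<Gamma> (\<Phi> x) (H x u v) (A x w) + \<Gamma> (\<Phi> x) (A x v) (H x u w) + T x u v w)) (at x)"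
      unfolding G_def by (intro has_derivative_add Gamma_Phi_deriv dH x)
    have 3: "((\<lambda>y. A y (\<Gamma>' y v w)) has_derivative (\<lambda>u. G (A x u) (A x v) (A x w)
     + \<Gamma> (\<Phi> x) (H x u v) (A x w) + \<Gamma> (\<Phi> x) (A x v) (H x u w) + T x u v w)) (at x)"
      by (rule has_derivative_transform_within_open[OF 2 openU x]) (simp add: A_\<Gamma>')
    show ?thesis using has_derivative_unique[OF 1 3] by meson
  qed
  have AD: "A x (D u v w) = G (A x u) (A x v) (A x w) + \<Gamma> (\<Phi> x) (H x u v) (A x w)
     + \<Gamma> (\<Phi> x) (A x v) (H x u w) + T x u v w - H x u (\<Gamma>' x v w)" for u v w
    unfolding key[symmetric] by simp
  note Gl = bilinear_lin[OF lc_Gamma_bilin[OF lcV maps[OF x]]]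
  have A\<Gamma>: "A x (\<Gamma>' x u (\<Gamma>' x v w)) = \<Gamma> (\<Phi> x) (A x u) (\<Gamma> (\<Phi> x) (A x v) (A x w))
     + \<Gamma> (\<Phi> x) (A x u) (H x v w) + H x u (\<Gamma>' x v w)" for u v w
    by (simp add: A_\<Gamma>'[OF x] linear_add[OF Gl(1)])
  have "A x (riemann g' x u v w) = (A x (D u v w) + A x (\<Gamma>' x u (\<Gamma>' x v w)))
      - (A x (D v u w) + A x (\<Gamma>' x v (\<Gamma>' x u w)))"
    unfolding lc_riemann[OF levi_civita' x D]
    by (simp add: linear_diff[OF Alin[OF x]] linear_add[OF Alin[OF x]])
  also have "\<dots> = riemann g (\<Phi> x) (A x u) (A x v) (A x w)"
    unfolding A\<Gamma> lc_riemann[OF lcV maps[OF x] G] AD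
    using Hsym[OF x, of u v] Tsym[OF x, of u v w] by simp
  finally show ?thesis .
qed

lemma orthonormal':
  assumes x: "x \<in> U" and E: "orthonormal_set (g (\<Phi> x)) E"
  shows "orthonormal_set (g' x) (B x ` E)" "inj_on (B x) E" "span (B x ` E) = B x ` span E"
proof -
  show "inj_on (B x) E" by (metis AB inj_onI x)
  then show "orthonormal_set (g' x) (B x ` E)"
    using E by (auto simp: orthonormal_set_def g'_def AB[OF x] inj_on_def)
  show "span (B x ` E) = B x ` span E" by (rule span_linear_image[OF Blin[OF x]])
qed

lemma scalar_curvature':
  assumes x: "x \<in> U"
  shows "scalar_curvature g' x = scalar_curvature g (\<Phi> x)"
proof -
  obtain E where E: "orthonormal_set (g (\<Phi> x)) E" "span E = UNIV"
    using orthonormal_exists[OF lc_inner[OF lcV maps[OF x]] subspace_UNIV] .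
  note on = orthonormal'[OF x E(1)]
  have "B x ` UNIV = UNIV" using BA[OF x] by (metis surjI)
  then have sp: "span (B x ` E) = UNIV" using on(3) E(2) by simp
  have ric: "ricci g' x (B x e) (B x f) = ricci g (\<Phi> x) e f" for e f
    unfolding lc_ricci_eq[OF levi_civita' x on(1) sp] lc_ricci_eq[OF lcV maps[OF x] E]
    by (simp add: sum.reindex[OF on(2)] g'_def riemann'[OF x] AB[OF x])
  show ?thesis
    unfolding lc_scalar_curvature[OF levi_civita' x on(1) sp] lc_scalar_curvature[OF lcV maps[OF x] E]
    by (simp add: sum.reindex[OF on(2)] ric)
qed

end

section \<open>Static metrics\<close>

text \<open>The Hessian along the slice through \<open>p\<close>, at frozen time, for the connection
  of the slice metric.\<close>

definition hess :: "('a::euclidean_space \<Rightarrow> 'a \<Rightarrow> 'a \<Rightarrow> 'a) \<Rightarrow> ('a \<times> real \<Rightarrow> real) \<Rightarrow> 'a \<times> real \<Rightarrow> 'a \<Rightarrow> 'a \<Rightarrow> real" where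
  "hess \<Gamma> N p v w = dd (dd N (w, 0)) (v, 0) p - dd N (\<Gamma> (fst p) v w, 0) p"

text \<open>\<open>n\<close> is the gradient of \<open>N\<close> along the slices. It is supplied
  together with its differentiability because \<open>h\<close> is given only as an abstract field of
  forms.\<close>

locale warped =
  fixes V :: "'a::euclidean_space set" and h :: "'a metric" and \<Gamma>
    and W :: "('a \<times> real) set" and N :: "'a \<times> real \<Rightarrow> real" and n :: "'a \<times> real \<Rightarrow> 'a"
  assumes lcV: "levi_civita V h \<Gamma>" and smoothN: "smooth_on W N" and WV: "\<And>p. p \<in> W \<Longrightarrow> fst p \<in> V"
    and Npos: "\<And>p. p \<in> W \<Longrightarrow> 0 < N p"
    and ndiff: "\<And>p. p \<in> W \<Longrightarrow> n differentiable (at p)"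
    and n: "\<And>p z. p \<in> W \<Longrightarrow> h (fst p) (n p) z = dd N (z, 0) p"
begin

definition G :: "('a \<times> real) metric" where
  "G p v w = h (fst p) (fst v) (fst w) + (N p)\<^sup>2 * (snd v * snd w)"

definition \<beta> :: "'a \<times> real \<Rightarrow> 'a \<times> real \<Rightarrow> 'a \<times> real \<Rightarrow> real" where
  "\<beta> p v w = snd v * dd N (fst w, 0) p + snd w * dd N (fst v, 0) p + snd v * snd w * dd N (0, 1) p"

text \<open>Read off from the Koszul formula: two time directions produce - N grad N in space, while
  in the time component one time direction gives dN / N and two give the time derivative of N over
  N.\<close>

definition \<Gamma>G :: "'a \<times> real \<Rightarrow> 'a \<times> real \<Rightarrow> 'a \<times> real \<Rightarrow> 'a \<times> real" where
  "\<Gamma>G p v w = (\<Gamma> (fst p) (fst v) (fst w) - (snd v * snd w * N p) *\<^sub>R n p, \<beta> p v w / N p)"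

definition Dn where "Dn p = frechet_derivative n (at p)"

lemma openW: "open W" using smooth_on_open[OF smoothN] .

lemma dN: "p \<in> W \<Longrightarrow> (N has_derivative (\<lambda>v. dd N v p)) (at p)"
  by (rule smooth_on_deriv[OF smoothN])

lemma ddN: "p \<in> W \<Longrightarrow> (dd N w has_derivative (\<lambda>v. dd (dd N w) v p)) (at p)"
  by (rule smooth_on_deriv[OF smooth_on_dd[OF smoothN]])

lemma dn: "p \<in> W \<Longrightarrow> (n has_derivative Dn p) (at p)"
  unfolding Dn_def using ndiff by (simp add: frechet_derivative_works)

lemma dN_lin: "p \<in> W \<Longrightarrow> linear (\<lambda>v. dd N v p)"
  using has_derivative_linear[OF dN] .

lemma dN_zero: "p \<in> W \<Longrightarrow> dd N (0, 0) p = 0"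
  using linear_0[OF dN_lin] by (simp add: zero_prod_def)

lemma dN_split: "p \<in> W \<Longrightarrow> dd N (v, a) p = dd N (v, 0) p + a * dd N (0, 1) p"
  using linear_add[OF dN_lin, of p "(v, 0)" "(0, a)"] linear_scale[OF dN_lin, of p a "(0, 1)"] by simp

lemma fst_deriv: "(f has_derivative f') (at (fst p)) \<Longrightarrow> ((\<lambda>q. f (fst q)) has_derivative (\<lambda>v. f' (fst v))) (at p)"
  using has_derivative_compose[of fst fst p UNIV f f'] has_derivative_fst[OF has_derivative_ident] by auto

lemma inner_formG: assumes p: "p \<in> W" shows "inner_form (G p)"
proof -
  note i = lc_inner[OF lcV WV[OF p]]
  note l = inner_form_D(4,5)[OF i]
  have "bilinear (G p)"
    unfolding bilinear_def G_def
    by (intro conjI allI linearI)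
      (simp_all add: l[THEN linear_add] l[THEN linear_scale] algebra_simps)
  moreover have "0 < G p v v" if "v \<noteq> 0" for v
  proof (cases "fst v = 0")
    case True
    then have "snd v \<noteq> 0" using that by (simp add: prod_eq_iff)
    then show ?thesis using Npos[OF p] inner_form_D(7)[OF i]
      by (auto simp: G_def True power2_eq_square zero_less_mult_iff)
  next
    case False
    then have "0 < h (fst p) (fst v) (fst v)" using inner_form_D(3)[OF i] by blast
    then show ?thesis by (simp add: G_def add_pos_nonneg)
  qed
  ultimately show ?thesis
    using inner_form_D(2)[OF i] by (simp add: inner_form_def G_def mult.commute)
qed

lemma G_deriv:
  assumes p: "p \<in> W"
  shows "((\<lambda>q. G q v w) has_derivative (\<lambda>u. dd (\<lambda>y. h y (fst v) (fst w)) (fst u) (fst p)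
      + 2 * N p * dd N u p * (snd v * snd w))) (at p)"
proof -
  have "((\<lambda>q. h (fst q) (fst v) (fst w) + (N q)\<^sup>2 * (snd v * snd w)) has_derivative
     (\<lambda>u. dd (\<lambda>y. h y (fst v) (fst w)) (fst u) (fst p) + (2 * N p * dd N u p) * (snd v * snd w))) (at p)"
    by (intro has_derivative_add fst_deriv lc_metric_deriv[OF lcV WV[OF p]] has_derivative_mult_left)
      (use has_derivative_power[OF dN[OF p], of 2] in \<open>simp add: mult_ac\<close>)
  then show ?thesis by (simp add: G_def mult_ac)
qed

lemma Gamma_fst_deriv:
  "p \<in> W \<Longrightarrow> ((\<lambda>q. \<Gamma> (fst q) v w) has_derivative
    (\<lambda>u. frechet_derivative (\<lambda>y. \<Gamma> y v w) (at (fst p)) (fst u))) (at p)"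
  by (rule fst_deriv[OF lc_Gamma_deriv[OF lcV WV]])

lemma \<beta>_deriv: "p \<in> W \<Longrightarrow> ((\<lambda>q. \<beta> q v w) has_derivative (\<lambda>u. snd v * dd (dd N (fst w, 0)) u p
   + snd w * dd (dd N (fst v, 0)) u p + snd v * snd w * dd (dd N (0, 1)) u p)) (at p)"
  unfolding \<beta>_def by (intro has_derivative_add has_derivative_mult_right ddN)

definition DG where
  "DG p u v w = (frechet_derivative (\<lambda>y. \<Gamma> y (fst v) (fst w)) (at (fst p)) (fst u)
      - (snd v * snd w) *\<^sub>R (dd N u p *\<^sub>R n p + N p *\<^sub>R Dn p u),
     (snd v * dd (dd N (fst w, 0)) u p + snd w * dd (dd N (fst v, 0)) u p
       + snd v * snd w * dd (dd N (0, 1)) u p) / N p - \<beta> p v w * dd N u p / (N p)\<^sup>2)"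

lemma \<Gamma>G_deriv:
  assumes p: "p \<in> W" shows "((\<lambda>q. \<Gamma>G q v w) has_derivative (\<lambda>u. DG p u v w)) (at p)"
  unfolding \<Gamma>G_def DG_def
proof (rule has_derivative_Pair)
  have "((\<lambda>q. \<Gamma> (fst q) (fst v) (fst w) - (snd v * snd w) *\<^sub>R (N q *\<^sub>R n q)) has_derivative
      (\<lambda>u. frechet_derivative (\<lambda>y. \<Gamma> y (fst v) (fst w)) (at (fst p)) (fst u)
        - (snd v * snd w) *\<^sub>R (N p *\<^sub>R Dn p u + dd N u p *\<^sub>R n p))) (at p)"
    by (intro has_derivative_diff Gamma_fst_deriv p has_derivative_scaleR_right has_derivative_scaleR dN dn)
  then show "((\<lambda>q. \<Gamma> (fst q) (fst v) (fst w) - (snd v * snd w * N q) *\<^sub>R n q) has_derivative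
      (\<lambda>u. frechet_derivative (\<lambda>y. \<Gamma> y (fst v) (fst w)) (at (fst p)) (fst u)
      - (snd v * snd w) *\<^sub>R (dd N u p *\<^sub>R n p + N p *\<^sub>R Dn p u))) (at p)"
    by (simp add: add.commute)
  have N0: "N p \<noteq> 0" using Npos[OF p] by simp
  show "((\<lambda>q. \<beta> q v w / N q) has_derivative (\<lambda>u. (snd v * dd (dd N (fst w, 0)) u p
      + snd w * dd (dd N (fst v, 0)) u p + snd v * snd w * dd (dd N (0, 1)) u p) / N p
      - \<beta> p v w * dd N u p / (N p)\<^sup>2)) (at p)"
    by (rule has_derivative_eq_rhs[OF has_derivative_divide[OF \<beta>_deriv[OF p] dN[OF p] N0]])
      (use N0 in \<open>auto simp: field_simps power2_eq_square\<close>)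
qed

lemma levi_civitaG: "levi_civita W G \<Gamma>G"
  unfolding levi_civita_def
proof (intro conjI ballI allI openW)
  fix p u v z assume p: "p \<in> W"
  show "inner_form (G p)" by (rule inner_formG[OF p])
  show "(\<lambda>q. G q v z) differentiable (at p)"
    using G_deriv[OF p] unfolding differentiable_def by blast
  show "(\<lambda>q. \<Gamma>G q v z) differentiable (at p)"
    using \<Gamma>G_deriv[OF p] unfolding differentiable_def by blast
  note l = inner_form_D(5)[OF lc_inner[OF lcV WV[OF p]]]
  have N0: "N p \<noteq> 0" using Npos[OF p] by simp
  have "2 * G p (\<Gamma>G p u v) z = 2 * h (fst p) (\<Gamma> (fst p) (fst u) (fst v)) (fst z)
      - 2 * (snd u * snd v * N p) * dd N (fst z, 0) p + 2 * N p * (\<beta> p u v * snd z)"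
    using N0 by (simp add: G_def \<Gamma>G_def linear_diff[OF l] linear_scale[OF l] n[OF p]
        power2_eq_square)
  then show "2 * G p (\<Gamma>G p u v) z =
      dd (\<lambda>q. G q v z) u p + dd (\<lambda>q. G q u z) v p - dd (\<lambda>q. G q u v) z p"
    unfolding dd_eqI[OF G_deriv[OF p]] lc_koszul[OF lcV WV[OF p]]
    using dN_split[OF p, of "fst u" "snd u"] dN_split[OF p, of "fst v" "snd v"] dN_split[OF p, of "fst z" "snd z"]
    by (simp add: \<beta>_def algebra_simps)
qed

text \<open>Differentiate h(n, w) = dN(w) along the slice and use metric compatibility: the
  covariant derivative of the gradient is the Hessian.\<close>

lemma hess_n:
  assumes p: "p \<in> W"
  shows "h (fst p) (Dn p (v, 0) + \<Gamma> (fst p) v (n p)) w = hess \<Gamma> N p v w"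
proof -
  note x = WV[OF p]
  note l = inner_form_D(5)[OF lc_inner[OF lcV x]]
  have opn: "open (fst -` V :: ('a \<times> real) set)"
    by (intro open_vimage lc_open[OF lcV] continuous_on_fst continuous_on_id)
  have "((\<lambda>q. h (fst q) (n q) w) has_derivative (\<lambda>u. dd (\<lambda>y. h y (n p) w) (fst u) (fst p)
      + h (fst p) (Dn p u) w + h (fst p) (n p) 0)) (at p)"
    by (rule bilinear_field_derivative[where T="\<lambda>q. h (fst q)" and U="fst -` V"
          and D="\<lambda>v w u. dd (\<lambda>y. h y v w) (fst u) (fst p)"])
      (auto intro!: opn x lc_bilin[OF lcV] fst_deriv lc_metric_deriv[OF lcV x] dn p)
  then have "(dd N (w, 0) has_derivative (\<lambda>u. dd (\<lambda>y. h y (n p) w) (fst u) (fst p)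
      + h (fst p) (Dn p u) w + h (fst p) (n p) 0)) (at p)"
    by (rule has_derivative_transform_within_open[OF _ openW p]) (simp add: n)
  from dd_eqI[OF this, of "(v, 0)"] show ?thesis
    by (simp add: hess_def lc_compat[OF lcV x] linear_add[OF l] n[OF p]
        inner_form_D(7)[OF lc_inner[OF lcV x]])
qed

text \<open>The frame consists of an orthonormal frame of the slice and the unit normal (0, 1/N).
  Each slice direction contributes - Hess N / N and the normal contributes minus the whole trace
  over N, whence the factor 2. The components used, \<open>r1\<close>, \<open>r2\<close> and
  \<open>r3\<close>, contain no time derivative of \<open>N\<close>, which is why an arbitrary
  dependence on time is allowed.\<close>

theorem scalar_curvatureG:
  assumes p: "p \<in> W" and E: "orthonormal_set (h (fst p)) E" "span E = UNIV"
  shows "scalar_curvature G p = scalar_curvature h (fst p) - 2 * (\<Sum>e\<in>E. hess \<Gamma> N p e e) / N p"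
proof -
  define c where "c = inverse (N p)"
  have N0: "N p > 0" using Npos[OF p] by simp
  note x = WV[OF p]
  note i = lc_inner[OF lcV x]
  note l = inner_form_D(4,5)[OF i]
  note Gl = bilinear_lin[OF lc_Gamma_bilin[OF lcV x]]
  have G0: "\<Gamma> (fst p) v 0 = 0" "\<Gamma> (fst p) 0 v = 0" for v
    using linear_0[OF Gl(1)] linear_0[OF Gl(2)] by auto
  define F where "F = (\<lambda>e. (e, 0::real)) ` E"
  have fin: "finite E" using orthonormal_set_independent(2)[OF i E(1)] .
  have inj: "inj_on (\<lambda>e. (e, 0::real)) E" by (auto intro: inj_onI)
  have cF: "(0, c) \<notin> F" using N0 by (auto simp: F_def c_def)
  have on: "orthonormal_set (G p) (insert (0, c) F)"
    using E(1) N0 inner_form_D(7,8)[OF i] right_inverse[of "N p * N p"]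
    by (auto simp: orthonormal_set_def F_def G_def c_def power2_eq_square inverse_mult_distrib)
  have sp: "span (insert (0, c) F) = UNIV"
  proof (rule orthonormal_span_eqI(1)[OF inner_formG[OF p] on subspace_UNIV])
    fix v assume v: "\<And>e. e \<in> insert (0, c) F \<Longrightarrow> G p v e = 0"
    have "h (fst p) (fst v) e = 0" if "e \<in> E" for e
      using v[of "(e, 0)"] that by (simp add: F_def G_def)
    then have "fst v = 0"
      using orthonormal_expand[OF i E(1), of "fst v"] E(2) by simp
    moreover have "snd v = 0"
      using v[of "(0, c)"] N0 inner_form_D(7)[OF i] by (auto simp: G_def c_def)
    ultimately show "v = 0" by (simp add: prod_eq_iff)
  qed simp
  note lcG = levi_civitaG
  note R = lc_riemann[OF lcG p \<Gamma>G_deriv[OF p]]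
  have frz: "frechet_derivative (\<lambda>y. \<Gamma> y v w) (at (fst p)) 0 = 0" for v w
    using has_derivative_linear[OF lc_Gamma_deriv[OF lcV x]] by (rule linear_0)
  have fr0: "frechet_derivative (\<lambda>y. \<Gamma> y v w) (at (fst p)) u = 0" if "v = 0 \<or> w = 0" for u v w
  proof -
    note bl = bilinear_lin[OF lc_Gamma_deriv_bilin(1)[OF lcV x lc_Gamma_deriv[OF lcV x], of u]]
    show ?thesis using that linear_0[OF bl(1), of v] linear_0[OF bl(2), of w] by auto
  qed
  have r1: "fst (riemann G p (f, 0) (v, 0) (w, 0)) = riemann h (fst p) f v w" for f v w
    unfolding R lc_riemann[OF lcV x lc_Gamma_deriv[OF lcV x]]
    by (simp add: DG_def \<Gamma>G_def \<beta>_def)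
  have r2: "snd (riemann G p (0, c) (v, 0) (w, 0)) = - c * hess \<Gamma> N p v w / N p" for v w
    unfolding R using N0
    by (simp add: DG_def \<Gamma>G_def \<beta>_def G0 dN_zero[OF p] hess_def field_simps power2_eq_square)
  have r2': "(N p)\<^sup>2 * (snd (riemann G p (0, c) (v, 0) (w, 0)) * c) = - (hess \<Gamma> N p v w / N p)" for v w
    unfolding r2 using N0 by (simp add: c_def field_simps power2_eq_square)
  have r3: "fst (riemann G p (e, 0) (0, c) (0, c)) = - (c\<^sup>2 * N p) *\<^sub>R (Dn p (e, 0) + \<Gamma> (fst p) e (n p))" for e
  proof -
    have "c * (c * dd N (e, 0) p / N p) * N p = c * c * dd N (e, 0) p" using N0 by simp
    then show ?thesis
      unfolding R using N0
      by (simp add: DG_def \<Gamma>G_def \<beta>_def G0 dN_zero[OF p] linear_diff[OF Gl(1)] linear_scale[OF Gl(1)]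
          frz fr0 linear_0[OF Gl(1)] algebra_simps power2_eq_square linear_neg[OF Gl(1)])
  qed
  have r4: "riemann G p u u w = 0" for u w by (simp add: R)
  have ric1: "ricci G p (e, 0) (e, 0) = ricci h (fst p) e e - hess \<Gamma> N p e e / N p" for e
    unfolding lc_ricci_eq[OF lcG p on sp] lc_ricci_eq[OF lcV x E]
    using N0 fin cF
    by (simp add: F_def sum.reindex[OF inj] G_def r1 r2' inner_form_D(7)[OF i])
  have ric2: "ricci G p (0, c) (0, c) = - (\<Sum>e\<in>E. hess \<Gamma> N p e e) / N p"
  proof -
    have "c\<^sup>2 * N p = 1 / N p" using N0 by (simp add: c_def power2_eq_square divide_inverse)
    then show ?thesis
    unfolding lc_ricci_eq[OF lcG p on sp]
    using fin cF
    by (simp add: F_def sum.reindex[OF inj] G_def r3 r4 linear_scale[OF l(2)] linear_neg[OF l(2)] hess_n[OF p]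
       sum_negf sum_divide_distrib inner_form_D(8)[OF i])
  qed
  show ?thesis
    unfolding lc_scalar_curvature[OF lcG p on sp] lc_scalar_curvature[OF lcV x E]
    using fin cF by (simp add: F_def sum.reindex[OF inj] ric1 ric2 sum_subtractf flip: sum_divide_distrib)
qed

end

section \<open>Mean curvature of level sets\<close>

definition hessian :: "('a::euclidean_space \<Rightarrow> 'a \<Rightarrow> 'a \<Rightarrow> 'a) \<Rightarrow> ('a \<Rightarrow> real) \<Rightarrow> 'a \<Rightarrow> 'a \<Rightarrow> 'a \<Rightarrow> real" where
  "hessian \<Gamma> F p v w = dd (dd F w) v p - dd F (\<Gamma> p v w) p"

text \<open>A competitor minus its projection onto \<open>q\<close> is tangent, hence orthogonal to
  both \<open>q\<close> and the competitor, hence to itself. Length one and the sign of the pairing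
  with \<open>n p\<close> then fix the multiple of \<open>q\<close>.\<close>

lemma unit_normal_eq:
  assumes i: "inner_form (g p)" and n: "\<And>v. n p \<bullet> v = L v"
    and q: "\<And>z. g p q z = L z" and q0: "q \<noteq> 0"
  shows "unit_normal g n p = (1 / sqrt (g p q q)) *\<^sub>R q"
proof -
  note l = inner_form_D(4,5)[OF i]
  have pos: "g p q q > 0" using inner_form_D(3)[OF i q0] .
  show ?thesis
    unfolding unit_normal_def
  proof (rule the_equality)
    show "(\<forall>v\<in>tangent_space n p. g p ((1 / sqrt (g p q q)) *\<^sub>R q) v = 0) \<and>
      g p ((1 / sqrt (g p q q)) *\<^sub>R q) ((1 / sqrt (g p q q)) *\<^sub>R q) = 1 \<and>
      0 < (1 / sqrt (g p q q)) *\<^sub>R q \<bullet> n p"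
      using pos by (auto simp: linear_scale[OF l(1)] linear_scale[OF l(2)] q tangent_space_def
          inner_commute[of _ "n p"] n)
  next
    fix \<eta> assume \<eta>: "(\<forall>v\<in>tangent_space n p. g p \<eta> v = 0) \<and> g p \<eta> \<eta> = 1 \<and> 0 < \<eta> \<bullet> n p"
    define a where "a = g p q \<eta> / g p q q"
    define v where "v = \<eta> - a *\<^sub>R q"
    have qv: "g p q v = 0" using pos by (simp add: v_def a_def linear_diff[OF l(1)] linear_scale[OF l(1)])
    then have "v \<in> tangent_space n p" by (simp add: tangent_space_def inner_commute[of _ "n p"] n q)
    then have "g p \<eta> v = 0" using \<eta> by blast
    with qv have "g p v v = 0" by (subst v_def) (simp add: linear_diff[OF l(2)] linear_scale[OF l(2)])
    then have "v = 0" using inner_form_D(3)[OF i, of v] by auto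
    then have eq: "\<eta> = a *\<^sub>R q" by (simp add: v_def)
    have "g p q \<eta> > 0" using \<eta> by (simp add: inner_commute[of _ "n p"] n q)
    then have a: "a > 0" using pos by (simp add: a_def)
    have "a\<^sup>2 * g p q q = 1"
      using \<eta> unfolding eq by (simp add: linear_scale[OF l(1)] linear_scale[OF l(2)] power2_eq_square)
    then have "sqrt (g p q q) = 1 / a"
      using a by (intro real_sqrt_unique) (auto simp: field_simps power2_eq_square)
    then show "\<eta> = (1 / sqrt (g p q q)) *\<^sub>R q" using eq a by simp
  qed
qed

text \<open>Normalising the gradient changes its covariant derivative, apart from the scalar factor,
  only by a multiple of the gradient, and that is orthogonal to tangent vectors. The conormal has to
  be dF on an open set since the unit normal field is differentiated.\<close>

lemma mean_curvature_eq:
  assumes lc: "levi_civita U g \<Gamma>"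
    and n: "\<And>y v. y \<in> U \<Longrightarrow> n y \<bullet> v = dd F v y"
    and q: "\<And>y z. y \<in> U \<Longrightarrow> g y (q y) z = dd F z y" and q0: "\<And>y. y \<in> U \<Longrightarrow> q y \<noteq> 0"
    and p: "p \<in> U" and qd: "q differentiable (at p)"
    and E: "orthonormal_set (g p) E" "span E = tangent_space n p"
  shows "mean_curvature g n p = (\<Sum>e\<in>E. hessian \<Gamma> F p e e) / sqrt (g p (q p) (q p))"
proof -
  note i = lc_inner[OF lc p]
  note l = inner_form_D(4,5)[OF i]
  define q' where "q' = frechet_derivative q (at p)"
  have dq: "(q has_derivative q') (at p)" using qd by (simp add: q'_def frechet_derivative_works)
  have dg: "((\<lambda>y. g y (q y) w) has_derivative (\<lambda>u. dd (\<lambda>y. g y (q p) w) u p + g p (q' u) w + g p (q p) 0)) (at p)" for w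
    by (rule bilinear_field_derivative[OF lc_open[OF lc] p lc_bilin[OF lc] lc_metric_deriv[OF lc p] dq])
      auto
  have hes: "g p (q' v + \<Gamma> p v (q p)) w = hessian \<Gamma> F p v w" for v w
  proof -
    have "(dd F w has_derivative (\<lambda>u. dd (\<lambda>y. g y (q p) w) u p + g p (q' u) w + g p (q p) 0)) (at p)"
      by (rule has_derivative_transform_within_open[OF dg lc_open[OF lc] p]) (simp add: q)
    from dd_eqI[OF this, of v] show ?thesis
      by (simp add: hessian_def lc_compat[OF lc p] linear_add[OF l(2)] q[OF p] inner_form_D(7)[OF i])
  qed
  define \<phi> where "\<phi> y = 1 / sqrt (g y (q y) (q y))" for y
  have pos: "g y (q y) (q y) > 0" if "y \<in> U" for y
    using inner_form_D(3)[OF lc_inner[OF lc that] q0[OF that]] .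
  have "(\<lambda>y. g y (q y) (q y)) differentiable (at p)"
    unfolding differentiable_def
    using bilinear_field_derivative[OF lc_open[OF lc] p lc_bilin[OF lc] lc_metric_deriv[OF lc p] dq dq] by blast
  moreover have "(\<lambda>x. 1 / sqrt x) differentiable (at (g p (q p) (q p)))"
    unfolding real_differentiable_def
    using pos[OF p] by (intro exI) (rule derivative_eq_intros refl | simp)+
  ultimately have "\<phi> differentiable (at p)"
    unfolding \<phi>_def using differentiable_compose[of "\<lambda>x. 1 / sqrt x" "\<lambda>y. g y (q y) (q y)"] by blast
  then have d\<phi>: "(\<phi> has_derivative frechet_derivative \<phi> (at p)) (at p)"
    by (simp add: frechet_derivative_works)
  have un: "unit_normal g n y = \<phi> y *\<^sub>R q y" if "y \<in> U" for y
    unfolding \<phi>_def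
    by (rule unit_normal_eq[where g=g and p=y and n=n and q="q y", OF lc_inner[OF lc that] n[OF that] q[OF that] q0[OF that]])
  have dun: "(unit_normal g n has_derivative (\<lambda>u. \<phi> p *\<^sub>R q' u + frechet_derivative \<phi> (at p) u *\<^sub>R q p)) (at p)"
    by (rule has_derivative_transform_within_open[OF has_derivative_scaleR[OF d\<phi> dq] lc_open[OF lc] p])
      (simp add: un)
  note Gl = bilinear_lin[OF lc_Gamma_bilin[OF lc p]]
  have cov: "cov_deriv g (unit_normal g n) p v = \<phi> p *\<^sub>R (q' v + \<Gamma> p v (q p)) + frechet_derivative \<phi> (at p) v *\<^sub>R q p" for v
    unfolding cov_deriv_def frechet_derivative_at[OF dun, symmetric] lc_christoffel[OF lc p] un[OF p]
    by (simp add: linear_scale[OF Gl(1)] algebra_simps)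
  have lins: "linear q'" "linear (frechet_derivative \<phi> (at p))"
    using has_derivative_linear dq d\<phi> by auto
  have "bilinear (\<lambda>v w. g p (cov_deriv g (unit_normal g n) p v) w)"
    unfolding cov bilinear_def
    by (intro conjI allI linearI)
      (simp_all add: l[THEN linear_add] l[THEN linear_scale] lins[THEN linear_add] lins[THEN linear_scale]
        Gl[THEN linear_add] Gl[THEN linear_scale] algebra_simps)
  from metric_trace_eq[where g=g, OF i E(1) this]
  have "mean_curvature g n p = (\<Sum>e\<in>E. g p (cov_deriv g (unit_normal g n) p e) e)"
    by (simp add: mean_curvature_def E(2))
  also have "\<dots> = (\<Sum>e\<in>E. \<phi> p * hessian \<Gamma> F p e e)"
  proof (rule sum.cong[OF refl])
    fix e assume "e \<in> E"
    then have "e \<in> tangent_space n p" using E(2) span_base by blast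
    then have "g p (q p) e = 0" by (simp add: q[OF p] n[OF p, symmetric] tangent_space_def inner_commute)
    then show "g p (cov_deriv g (unit_normal g n) p e) e = \<phi> p * hessian \<Gamma> F p e e"
      unfolding cov hes[symmetric] by (simp add: linear_add[OF l(2)] linear_scale[OF l(2)])
  qed
  finally show ?thesis by (simp add: \<phi>_def sum_divide_distrib)
qed

context coordinate_change
begin

lemma dd_comp:
  assumes F: "smooth_on V F" and x: "x \<in> U"
  shows "dd (\<lambda>y. F (\<Phi> y)) v x = dd F (A x v) (\<Phi> x)"
  by (rule dd_eqI) (rule has_derivative_compose[OF dPhi[OF x] smooth_on_deriv[OF F maps[OF x]]])

lemma hessian':
  assumes F: "smooth_on V F" and x: "x \<in> U"
  shows "hessian \<Gamma>' (\<lambda>y. F (\<Phi> y)) x v w = hessian \<Gamma> F (\<Phi> x) (A x v) (A x w)"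
proof -
  note lin = has_derivative_linear[OF smooth_on_deriv[OF F]]
  have "((\<lambda>y. dd F (A y w) (\<Phi> y)) has_derivative
      (\<lambda>u. dd (dd F (A x w)) (A x u) (\<Phi> x) + dd F (H x u w) (\<Phi> x))) (at x)"
    by (rule linear_field_derivative[where T="\<lambda>y v. dd F v (\<Phi> y)" and D="\<lambda>v u. dd (dd F v) (A x u) (\<Phi> x)",
      OF openU x lin[OF maps] has_derivative_compose[OF dPhi[OF x]
        smooth_on_deriv[OF smooth_on_dd[OF F] maps[OF x]]] dA[OF x]])
  then have "(dd (\<lambda>y. F (\<Phi> y)) w has_derivative
      (\<lambda>u. dd (dd F (A x w)) (A x u) (\<Phi> x) + dd F (H x u w) (\<Phi> x))) (at x)"
    by (rule has_derivative_transform_within_open[OF _ openU x]) (simp add: dd_comp[OF F])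
  then show ?thesis
    unfolding hessian_def
    by (simp add: dd_eqI dd_comp[OF F x] A_\<Gamma>'[OF x] linear_add[OF lin[OF maps[OF x]]])
qed

definition pull :: "('a \<Rightarrow> 'a) \<Rightarrow> 'a \<Rightarrow> 'a" where "pull q x = B x (q (\<Phi> x))"

lemma A_pull: "x \<in> U \<Longrightarrow> A x (pull q x) = q (\<Phi> x)"
  by (simp add: pull_def AB)

lemma pull_nonzero: "x \<in> U \<Longrightarrow> q (\<Phi> x) \<noteq> 0 \<Longrightarrow> pull q x \<noteq> 0"
  using A_pull[of x q] linear_0[OF Alin[of x]] by auto

lemma pull_gradient:
  assumes "x \<in> U" "smooth_on V F" "\<And>z. g (\<Phi> x) (q (\<Phi> x)) z = dd F z (\<Phi> x)"
  shows "g' x (pull q x) z = dd (\<lambda>y. F (\<Phi> y)) z x"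
  using assms by (simp add: g'_def A_pull dd_comp)

lemma unit_normal':
  assumes x: "x \<in> U" and F: "smooth_on V F" and n: "\<And>v. n x \<bullet> v = dd (\<lambda>y. F (\<Phi> y)) v x"
    and q: "\<And>z. g (\<Phi> x) (q (\<Phi> x)) z = dd F z (\<Phi> x)" and q0: "q (\<Phi> x) \<noteq> 0"
  shows "unit_normal g' n x = (1 / sqrt (g (\<Phi> x) (q (\<Phi> x)) (q (\<Phi> x)))) *\<^sub>R pull q x"
  using unit_normal_eq[where g=g' and p=x and n=n and q="pull q x", OF inner'[OF x] n
      pull_gradient[where q=q, OF x F q] pull_nonzero[where q=q, OF x q0]]
  by (simp add: g'_def A_pull[OF x])

text \<open>The conormal field is prescribed in the source chart while the Hessian is computed in
  the target chart. The link is a function \<open>F\<close> whose pullback has exactly the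
  prescribed field as its differential.\<close>

lemma mean_curvature':
  assumes F: "smooth_on V F" and n: "\<And>y v. y \<in> U \<Longrightarrow> n y \<bullet> v = dd (\<lambda>y. F (\<Phi> y)) v y"
    and q: "\<And>y z. y \<in> V \<Longrightarrow> g y (q y) z = dd F z y" and q0: "\<And>y. y \<in> V \<Longrightarrow> q y \<noteq> 0"
    and qd: "\<And>y. y \<in> V \<Longrightarrow> q differentiable (at y)" and x: "x \<in> U"
    and E: "orthonormal_set (g (\<Phi> x)) E" "span E = {v. dd F v (\<Phi> x) = 0}"
  shows "mean_curvature g' n x = (\<Sum>e\<in>E. hessian \<Gamma> F (\<Phi> x) e e) / sqrt (g (\<Phi> x) (q (\<Phi> x)) (q (\<Phi> x)))"
proof -
  note on = orthonormal'[OF x E(1)]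
  have qPhi: "((\<lambda>y. q (\<Phi> y)) has_derivative (\<lambda>u. frechet_derivative q (at (\<Phi> x)) (A x u))) (at x)"
    using has_derivative_compose[OF dPhi[OF x], of q] qd[OF maps[OF x]]
    by (simp add: frechet_derivative_works)
  have diff: "pull q differentiable (at x)"
    unfolding differentiable_def pull_def[abs_def]
    using linear_field_derivative[where T=B, OF openU x Blin Bdiff[OF x, unfolded frechet_derivative_works] qPhi]
    by blast
  have "span (B x ` E) = tangent_space n x"
  proof -
    have "B x ` {v. dd F v (\<Phi> x) = 0} = {v. dd F (A x v) (\<Phi> x) = 0}"
    proof (intro set_eqI iffI)
      fix v assume "v \<in> {v. dd F (A x v) (\<Phi> x) = 0}"
      then show "v \<in> B x ` {v. dd F v (\<Phi> x) = 0}"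
        using BA[OF x, of v] by (intro image_eqI[of _ _ "A x v"]) auto
    qed (auto simp: AB[OF x])
    moreover have "v \<bullet> n x = dd F (A x v) (\<Phi> x)" for v
      using n[OF x, of v] dd_comp[OF F x, of v] by (simp add: inner_commute)
    ultimately show ?thesis
      unfolding on(3) E(2) tangent_space_def by simp
  qed
  from mean_curvature_eq[OF levi_civita' n pull_gradient[where q=q, OF _ F q[OF maps]] pull_nonzero[where q=q, OF _ q0[OF maps]] x diff on(1) this]
  have "mean_curvature g' n x = (\<Sum>e\<in>B x ` E. hessian \<Gamma>' (\<lambda>y. F (\<Phi> y)) x e e) / sqrt (g' x (pull q x) (pull q x))"
    by simp
  then show ?thesis
    by (simp add: sum.reindex[OF on(2)] hessian'[OF F x] AB[OF x] g'_def A_pull[OF x])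
qed

end

section \<open>Metrics on the plane\<close>

lemma differentiable_smooth_components:
  fixes f :: "'a::euclidean_space \<Rightarrow> 'b::euclidean_space"
  assumes "\<And>b. b \<in> Basis \<Longrightarrow> smooth_on U (\<lambda>x. f x \<bullet> b)" "x \<in> U"
  shows "f differentiable (at x)"
proof -
  have "((\<lambda>x. \<Sum>b\<in>Basis. (f x \<bullet> b) *\<^sub>R b) has_derivative (\<lambda>v. \<Sum>b\<in>Basis. dd (\<lambda>x. f x \<bullet> b) v x *\<^sub>R b)) (at x)"
    by (intro has_derivative_sum has_derivative_scaleR_left smooth_on_deriv[OF assms(1) assms(2)])
  then show ?thesis by (auto simp: euclidean_representation differentiable_def)
qed

lemma inner_vec2: "(v::real^2) \<bullet> w = v$1 * w$1 + v$2 * w$2"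
  by (simp add: inner_vec_def sum_2)

lemma vec2_eq_iff: "(v::'a^2) = w \<longleftrightarrow> v$1 = w$1 \<and> v$2 = w$2"
  by (simp add: vec_eq_iff forall_2)

lemma Basis_vec2: "(Basis :: (real^2) set) = {axis 1 1, axis 2 1}"
  by (auto simp: Basis_vec_def UNIV_2)

lemma axis2_nth [simp]: "axis 1 (1::real) $ (1::2) = 1" "axis 1 (1::real) $ (2::2) = 0"
  "axis 2 (1::real) $ (1::2) = 0" "axis 2 (1::real) $ (2::2) = 1"
  by (simp_all add: axis_def)

lemma axis2_neq [simp]: "axis 1 (1::real) \<noteq> axis (2::2) 1"
  by (simp add: vec2_eq_iff)

lemma vec2_axis: "(v::real^2) = v$1 *\<^sub>R axis 1 1 + v$2 *\<^sub>R axis 2 1"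
  by (simp add: vec2_eq_iff)

lemma smooth_on_nth: "open U \<Longrightarrow> smooth_on U (\<lambda>x::real^'n. x $ i)"
  by (intro smooth_on_linear bounded_linear_vec_nth)

lemma smooth_on_fst_comp:
  assumes f: "smooth f" and U: "open U" shows "smooth_on U (\<lambda>p. f (fst p))"
proof (rule smooth_on_compose[OF f U])
  show "smooth_on U (\<lambda>x. fst x \<bullet> b)" for b :: 'a
    by (intro smooth_on_linear U bounded_linear_inner_left_comp bounded_linear_fst)
qed simp

lemma smooth_on_snd_comp:
  fixes f :: "'b::euclidean_space \<Rightarrow> real" and U :: "('a::euclidean_space \<times> 'b) set"
  assumes f: "smooth f" and U: "open U" shows "smooth_on U (\<lambda>p. f (snd p))"
proof (rule smooth_on_compose[OF f U])
  show "smooth_on U (\<lambda>x. snd x \<bullet> b)" for b :: 'b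
    by (intro smooth_on_linear U bounded_linear_inner_left_comp bounded_linear_snd)
qed simp

definition J :: "real^2 \<Rightarrow> real^2" where "J v = vector [- v$2, v$1]"

lemma J_nth [simp]: "J v $ 1 = - v$2" "J v $ 2 = v$1"
  by (simp_all add: J_def)

locale plane_metric =
  fixes E F G :: "real^2 \<Rightarrow> real"
  assumes smoothE: "smooth E" and smoothF: "smooth F" and smoothG: "smooth G"
    and Epos: "0 < E x" and det_pos: "0 < E x * G x - (F x)\<^sup>2"
begin

definition met :: "(real^2) metric" where
  "met x v w = E x * (v$1 * w$1) + F x * (v$1 * w$2 + v$2 * w$1) + G x * (v$2 * w$2)"

definition D :: "real^2 \<Rightarrow> real" where "D x = E x * G x - (F x)\<^sup>2"

text \<open>The inverse matrix of the metric applied to a covector, that is, raising an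
  index.\<close>

definition sharp :: "real^2 \<Rightarrow> real^2 \<Rightarrow> real^2" where
  "sharp x l = vector [(G x * l$1 - F x * l$2) / D x, (E x * l$2 - F x * l$1) / D x]"

text \<open>Contraction with the inverse matrix. Unlike \<open>metric_trace\<close> it chooses no
  frame, so its smooth dependence on the point is visible.\<close>

definition trh :: "real^2 \<Rightarrow> (real^2 \<Rightarrow> real^2 \<Rightarrow> real) \<Rightarrow> real" where
  "trh x B = (G x * B (axis 1 1) (axis 1 1) - F x * (B (axis 1 1) (axis 2 1) + B (axis 2 1) (axis 1 1))
     + E x * B (axis 2 1) (axis 2 1)) / D x"

definition koszul :: "real^2 \<Rightarrow> real^2 \<Rightarrow> real^2 \<Rightarrow> real^2 \<Rightarrow> real" where
  "koszul x u v z = (dd (\<lambda>y. met y v z) u x + dd (\<lambda>y. met y u z) v x - dd (\<lambda>y. met y u v) z x) / 2"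

definition \<Gamma> :: "real^2 \<Rightarrow> real^2 \<Rightarrow> real^2 \<Rightarrow> real^2" where
  "\<Gamma> x u v = sharp x (vector [koszul x u v (axis 1 1), koszul x u v (axis 2 1)])"

lemma Dpos: "0 < D x" and D0 [simp]: "D x \<noteq> 0"
  using det_pos[of x] by (auto simp: D_def)

lemma Gpos: "0 < G x"
proof -
  have "0 < E x * G x" using det_pos[of x] zero_le_power2[of "F x"] by linarith
  then show ?thesis using Epos[of x] by (simp add: zero_less_mult_iff)
qed

lemma smoothD: "smooth D"
  unfolding D_def by (intro smooth_intros smoothE smoothF smoothG)

lemma inner_form_met: "inner_form (met x)"
proof -
  have "0 < met x v v" if "v \<noteq> 0" for v
  proof -
    have eq: "E x * met x v v = (E x * v$1 + F x * v$2)\<^sup>2 + D x * (v$2)\<^sup>2"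
      by (simp add: met_def D_def power2_eq_square algebra_simps)
    have "0 < E x * met x v v"
    proof (cases "v$2 = 0")
      case True
      then have "v$1 \<noteq> 0" using that by (simp add: vec2_eq_iff)
      then show ?thesis unfolding eq using Epos[of x] True by simp
    next
      case False
      then show ?thesis unfolding eq using Dpos[of x] by (intro add_nonneg_pos) auto
    qed
    then show ?thesis using Epos[of x] by (simp add: zero_less_mult_iff)
  qed
  moreover have "bilinear (met x)"
    unfolding bilinear_def met_def by (intro conjI allI linearI) (simp_all add: algebra_simps)
  ultimately show ?thesis by (simp add: inner_form_def met_def algebra_simps)
qed

lemma sharp_eq: "met x (sharp x l) z = l \<bullet> z"
proof -
  have "met x (sharp x l) z = (E x * G x - (F x)\<^sup>2) * (l \<bullet> z) / D x"
    by (simp add: met_def sharp_def inner_vec2 field_simps power2_eq_square)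
  then show ?thesis by (simp flip: D_def)
qed

lemma sharp_lin: "linear (sharp x)"
  by (rule linearI) (simp_all add: sharp_def vec2_eq_iff algebra_simps add_divide_distrib diff_divide_distrib)

lemma smooth_met: "smooth (\<lambda>y. met y v w)"
  unfolding met_def by (intro smooth_intros smoothE smoothF smoothG) auto

lemma dd_met: "dd (\<lambda>y. met y v w) u x = dd E u x * (v$1 * w$1) + dd F u x * (v$1 * w$2 + v$2 * w$1) + dd G u x * (v$2 * w$2)"
  unfolding met_def
  by (rule dd_eqI) (intro has_derivative_add has_derivative_mult_left smooth_on_deriv[OF smoothE]
    smooth_on_deriv[OF smoothF] smooth_on_deriv[OF smoothG] UNIV_I)

lemma smooth_koszul: "smooth (\<lambda>x. koszul x u v z)"
  unfolding koszul_def by (intro smooth_on_divide smooth_intros smooth_on_dd smooth_met) auto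

lemma smooth_sharp:
  assumes "open U" "smooth_on U (\<lambda>p. l p $ 1)" "smooth_on U (\<lambda>p. l p $ 2)"
    "\<And>f. smooth f \<Longrightarrow> smooth_on U (\<lambda>p. f (x p))"
  shows "smooth_on U (\<lambda>p. sharp (x p) (l p) $ i)"
  using exhaust_2[of i] smoothE smoothF smoothG smoothD
  by (auto simp: sharp_def intro!: smooth_on_divide smooth_intros assms)

lemma smooth_Gamma: "smooth (\<lambda>x. \<Gamma> x u v $ i)"
  unfolding \<Gamma>_def by (rule smooth_sharp) (simp_all add: smooth_koszul)

lemma Gamma_deriv:
  "((\<lambda>x. \<Gamma> x u v) has_derivative (\<lambda>w. vector [dd (\<lambda>x. \<Gamma> x u v $ 1) w x, dd (\<lambda>x. \<Gamma> x u v $ 2) w x])) (at x)"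
  by (subst has_derivative_componentwise_within)
    (auto simp: Basis_vec2 inner_vec2 intro!: smooth_on_deriv[OF smooth_Gamma])

lemma levi_civita_met: "levi_civita UNIV met \<Gamma>"
  unfolding levi_civita_def
proof (intro conjI ballI allI open_UNIV)
  fix x u v z
  show "inner_form (met x)" by (rule inner_form_met)
  show "(\<lambda>y. met y v z) differentiable (at x)"
    using smooth_on_deriv[OF smooth_met] unfolding differentiable_def by blast
  show "(\<lambda>y. \<Gamma> y v z) differentiable (at x)"
    using Gamma_deriv unfolding differentiable_def by blast
  have lin: "linear (koszul x u v)"
  proof -
    note efg = has_derivative_linear[OF smooth_on_deriv[OF smoothE UNIV_I]]
      has_derivative_linear[OF smooth_on_deriv[OF smoothF UNIV_I]]
      has_derivative_linear[OF smooth_on_deriv[OF smoothG UNIV_I]]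
    then show ?thesis unfolding koszul_def dd_met
      by (intro linearI) (simp_all add: efg[THEN linear_add] efg[THEN linear_scale] field_simps)
  qed
  have "met x (\<Gamma> x u v) z = koszul x u v (axis 1 1) * z$1 + koszul x u v (axis 2 1) * z$2"
    by (simp add: \<Gamma>_def sharp_eq inner_vec2)
  also have "\<dots> = koszul x u v z"
    by (subst (3) vec2_axis[of z]) (simp add: linear_add[OF lin] linear_scale[OF lin])
  finally show "2 * met x (\<Gamma> x u v) z =
        dd (\<lambda>y. met y v z) u x + dd (\<lambda>y. met y u z) v x - dd (\<lambda>y. met y u v) z x"
    by (simp add: koszul_def)
qed

lemmas Gamma_bilin = lc_Gamma_bilin[OF levi_civita_met UNIV_I]

lemma trace_trh:
  assumes B: "bilinear B" and Q: "orthonormal_set (met x) Q" "span Q = UNIV"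
  shows "(\<Sum>e\<in>Q. B e e) = trh x B"
proof -
  define L where "L v = sharp x (vector [B v (axis 1 1), B v (axis 2 1)])" for v
  note l = bilinear_lin[OF B]
  have "linear L"
  proof (rule linearI)
    have "vector [B (v + w) (axis 1 1), B (v + w) (axis 2 1)] =
        (vector [B v (axis 1 1), B v (axis 2 1)] + vector [B w (axis 1 1), B w (axis 2 1)] :: real^2)" for v w
      by (simp add: vec2_eq_iff linear_add[OF l(2)])
    then show "L (v + w) = L v + L w" for v w by (simp add: L_def linear_add[OF sharp_lin])
    have "vector [B (r *\<^sub>R v) (axis 1 1), B (r *\<^sub>R v) (axis 2 1)] =
        (r *\<^sub>R vector [B v (axis 1 1), B v (axis 2 1)] :: real^2)" for r v
      by (simp add: vec2_eq_iff linear_scale[OF l(2)])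
    then show "L (r *\<^sub>R v) = r *\<^sub>R L v" for r v by (simp add: L_def linear_scale[OF sharp_lin])
  qed
  moreover have "met x (L e) e = B e e" for e
  proof -
    have "B e e = B e (e$1 *\<^sub>R axis 1 1 + e$2 *\<^sub>R axis 2 1)" using vec2_axis[of e] by simp
    then show ?thesis
      by (simp add: L_def sharp_eq inner_vec2 linear_add[OF l(1)] linear_scale[OF l(1)] mult.commute)
  qed
  ultimately have "(\<Sum>e\<in>Q. B e e) = (\<Sum>b\<in>Basis. L b \<bullet> b)"
    using trace_Basis_eq[OF inner_form_met Q, of L] by simp
  also have "\<dots> = trh x B"
    by (simp add: Basis_vec2 L_def sharp_def inner_vec2 trh_def field_simps)
  finally show ?thesis .
qed

lemma scalar_curvature_trh: "scalar_curvature met x = trh x (ricci met x)"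
proof -
  obtain Q where Q: "orthonormal_set (met x) Q" "span Q = UNIV"
    using orthonormal_exists[OF inner_form_met subspace_UNIV] .
  show ?thesis
    unfolding lc_scalar_curvature[OF levi_civita_met UNIV_I Q]
    by (rule trace_trh[OF lc_ricci_bilin[OF levi_civita_met UNIV_I] Q])
qed

lemma smooth_scalar_curvature: "smooth (scalar_curvature met)"
proof -
  have G2: "smooth (\<lambda>x. \<Gamma> x u (\<Gamma> x v w) $ i)" for u v w i
  proof -
    have "\<Gamma> x u (\<Gamma> x v w) $ i = \<Gamma> x v w $ 1 * \<Gamma> x u (axis 1 1) $ i + \<Gamma> x v w $ 2 * \<Gamma> x u (axis 2 1) $ i" for x
      by (subst vec2_axis[of "\<Gamma> x v w"])
        (simp add: linear_add[OF bilinear_lin(1)[OF Gamma_bilin]] linear_scale[OF bilinear_lin(1)[OF Gamma_bilin]])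
    then show ?thesis by (simp add: smooth_on_add smooth_on_mult smooth_Gamma)
  qed
  have R: "smooth (\<lambda>x. riemann met x u v w $ i)" for u v w i
  proof -
    have "riemann met x u v w $ i = dd (\<lambda>x. \<Gamma> x v w $ i) u x + \<Gamma> x u (\<Gamma> x v w) $ i
        - dd (\<lambda>x. \<Gamma> x u w $ i) v x - \<Gamma> x v (\<Gamma> x u w) $ i" for x
      unfolding lc_riemann[OF levi_civita_met UNIV_I Gamma_deriv] using exhaust_2[of i] by auto
    then show ?thesis
      by (simp add: smooth_on_add smooth_on_diff smooth_on_dd smooth_Gamma G2)
  qed
  have "smooth (\<lambda>x. trh x (ricci met x))"
    unfolding trh_def ricci_def
    by (simp add: Basis_vec2 inner_vec2)
      (intro smooth_on_divide smooth_intros smoothE smoothF smoothG smoothD R; simp)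
  then show ?thesis by (simp add: scalar_curvature_trh[abs_def])
qed

definition grad :: "((real^2) \<times> real \<Rightarrow> real) \<Rightarrow> (real^2) \<times> real \<Rightarrow> real^2" where
  "grad N p = sharp (fst p) (vector [dd N (axis 1 1, 0) p, dd N (axis 2 1, 0) p])"

definition lapl :: "((real^2) \<times> real \<Rightarrow> real) \<Rightarrow> (real^2) \<times> real \<Rightarrow> real" where
  "lapl N p = trh (fst p) (hess \<Gamma> N p)"

lemma dd_space:
  fixes N :: "(real^2) \<times> real \<Rightarrow> real"
  assumes "smooth_on W N" "p \<in> W"
  shows "dd N (v, a) p = v$1 * dd N (axis 1 1, 0) p + v$2 * dd N (axis 2 1, 0) p + a * dd N (0, 1) p"
proof -
  have lin: "linear (\<lambda>v. dd N v p)" using has_derivative_linear[OF smooth_on_deriv[OF assms]] .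
  have "(v, a) = v$1 *\<^sub>R (axis 1 1, 0) + v$2 *\<^sub>R (axis 2 1, 0) + a *\<^sub>R (0, 1)"
    by (simp add: prod_eq_iff vec2_eq_iff)
  then have "dd N (v, a) p = dd N (v$1 *\<^sub>R (axis 1 1, 0) + v$2 *\<^sub>R (axis 2 1, 0) + a *\<^sub>R (0, 1)) p"
    by metis
  then show ?thesis by (simp only: linear_add[OF lin] linear_scale[OF lin] real_scaleR_def)
qed

lemma warped_plane:
  assumes N: "smooth_on W N" and pos: "\<And>p. p \<in> W \<Longrightarrow> 0 < N p"
  shows "warped UNIV met \<Gamma> W N (grad N)"
proof
  show "levi_civita UNIV met \<Gamma>" by (rule levi_civita_met)
  have "smooth_on W (\<lambda>p. grad N p $ i)" for i
    unfolding grad_def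
    by (rule smooth_sharp[OF smooth_on_open[OF N]])
      (simp_all add: smooth_on_dd[OF N] smooth_on_fst_comp smooth_on_open[OF N])
  then show "grad N differentiable at p" if "p \<in> W" for p
    by (intro differentiable_smooth_components[OF _ that]) (auto simp: Basis_vec2 inner_vec2)
  show "met (fst p) (grad N p) z = dd N (z, 0) p" if "p \<in> W" for p z
    using dd_space[OF N that, of z 0] by (simp add: grad_def sharp_eq inner_vec2 mult.commute)
qed (use assms in auto)

lemma hess_bilin:
  assumes "smooth_on W N" "p \<in> W" shows "bilinear (hess \<Gamma> N p)"
proof -
  note lin = has_derivative_linear[OF smooth_on_deriv[OF assms]]
  note lin2 = has_derivative_linear[OF smooth_on_deriv[OF smooth_on_dd[OF assms(1)] assms(2)]]
  note Gl = bilinear_lin[OF Gamma_bilin]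
  have d2: "dd (dd N (w, 0)) v p = w$1 * dd (dd N (axis 1 1, 0)) v p + w$2 * dd (dd N (axis 2 1, 0)) v p" for v w
  proof -
    have "((\<lambda>q. w$1 * dd N (axis 1 1, 0) q + w$2 * dd N (axis 2 1, 0) q) has_derivative
       (\<lambda>v. w$1 * dd (dd N (axis 1 1, 0)) v p + w$2 * dd (dd N (axis 2 1, 0)) v p)) (at p)"
      by (intro has_derivative_add has_derivative_mult_right smooth_on_deriv[OF smooth_on_dd[OF assms(1)] assms(2)])
    then have "(dd N (w, 0) has_derivative
       (\<lambda>v. w$1 * dd (dd N (axis 1 1, 0)) v p + w$2 * dd (dd N (axis 2 1, 0)) v p)) (at p)"
      by (rule has_derivative_transform_within_open[OF _ smooth_on_open[OF assms(1)] assms(2)])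
        (simp add: dd_space[OF assms(1), of _ w 0])
    then show ?thesis by (rule dd_eqI)
  qed
  have a1: "dd f (v + v', 0) p = dd f (v, 0) p + dd f (v', 0) p" if "linear (\<lambda>v. dd f v p)" for f :: "(real^2) \<times> real \<Rightarrow> real" and v v'
    using linear_add[OF that, of "(v, 0)" "(v', 0)"] by simp
  have a2: "dd f (r *\<^sub>R v, 0) p = r * dd f (v, 0) p" if "linear (\<lambda>v. dd f v p)" for f :: "(real^2) \<times> real \<Rightarrow> real" and r v
    using linear_scale[OF that, of r "(v, 0)"] by simp
  show ?thesis
    unfolding bilinear_def hess_def
  proof (intro conjI allI linearI)
    fix x :: "real^2" and y :: "real^2" and z :: "real^2" and r :: real
    show "dd (dd N (y + z, 0)) (x, 0) p - dd N (\<Gamma> (fst p) x (y + z), 0) p =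
       dd (dd N (y, 0)) (x, 0) p - dd N (\<Gamma> (fst p) x y, 0) p +
       (dd (dd N (z, 0)) (x, 0) p - dd N (\<Gamma> (fst p) x z, 0) p)"
      by (simp add: d2[of "y + z"] d2[of y] d2[of z] a1[OF lin] linear_add[OF Gl(1)] algebra_simps)
    show "dd (dd N (r *\<^sub>R y, 0)) (x, 0) p - dd N (\<Gamma> (fst p) x (r *\<^sub>R y), 0) p =
       r *\<^sub>R (dd (dd N (y, 0)) (x, 0) p - dd N (\<Gamma> (fst p) x y, 0) p)"
      by (simp add: d2[of "r *\<^sub>R y"] d2[of y] a2[OF lin] linear_scale[OF Gl(1)] algebra_simps)
    show "dd (dd N (x, 0)) (y + z, 0) p - dd N (\<Gamma> (fst p) (y + z) x, 0) p =
       dd (dd N (x, 0)) (y, 0) p - dd N (\<Gamma> (fst p) y x, 0) p +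
       (dd (dd N (x, 0)) (z, 0) p - dd N (\<Gamma> (fst p) z x, 0) p)"
      by (simp add: a1[OF lin] a1[OF lin2] linear_add[OF Gl(2)])
    show "dd (dd N (x, 0)) (r *\<^sub>R y, 0) p - dd N (\<Gamma> (fst p) (r *\<^sub>R y) x, 0) p =
       r *\<^sub>R (dd (dd N (x, 0)) (y, 0) p - dd N (\<Gamma> (fst p) y x, 0) p)"
      by (simp add: a2[OF lin] a2[OF lin2] linear_scale[OF Gl(2)] algebra_simps)
  qed
qed

lemma scalar_curvature_warped:
  assumes N: "smooth_on W N" and pos: "\<And>p. p \<in> W \<Longrightarrow> 0 < N p" and p: "p \<in> W"
  shows "scalar_curvature (warped.G met N) p = scalar_curvature met (fst p) - 2 * lapl N p / N p"
proof -
  interpret warped UNIV met \<Gamma> W N "grad N" by (rule warped_plane[OF N pos])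
  obtain Q where Q: "orthonormal_set (met (fst p)) Q" "span Q = UNIV"
    using orthonormal_exists[OF inner_form_met subspace_UNIV] .
  show ?thesis
    unfolding scalar_curvatureG[OF p Q] trace_trh[OF hess_bilin[OF N p] Q] lapl_def ..
qed

end

section \<open>The boundary of a moving disk\<close>

context plane_metric
begin

text \<open>The squared length of the covector \<xi> in the dual metric.\<close>

definition Xn :: "real^2 \<Rightarrow> real^2 \<Rightarrow> real" where "Xn x \<xi> = \<xi> \<bullet> sharp x \<xi>"

text \<open>The Hessian at \<open>x\<close> of half the squared Euclidean distance from a fixed
  point, \<xi> being the displacement from that point: the differential is \<xi> and the matrix of
  second partial derivatives is the identity.\<close>

definition Hr :: "real^2 \<Rightarrow> real^2 \<Rightarrow> real^2 \<Rightarrow> real^2 \<Rightarrow> real" where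
  "Hr x \<xi> v w = v \<bullet> w - \<xi> \<bullet> \<Gamma> x v w"

text \<open>J \<xi> is tangent to the Euclidean circle and has squared length
  \<open>D x * Xn x \<xi>\<close> by \<open>met_J\<close>. So \<open>Yn\<close> divided by
  \<open>Xn\<close> is the value of \<open>Hr\<close> on a unit tangent vector.\<close>

definition Yn :: "real^2 \<Rightarrow> real^2 \<Rightarrow> real" where "Yn x \<xi> = Hr x \<xi> (J \<xi>) (J \<xi>) / D x"

definition Lr :: "real^2 \<Rightarrow> real^2 \<Rightarrow> real" where "Lr x \<xi> = trh x (Hr x \<xi>)"

lemma Xn_eq: "Xn x \<xi> = (G x * (\<xi>$1)\<^sup>2 - 2 * F x * (\<xi>$1 * \<xi>$2) + E x * (\<xi>$2)\<^sup>2) / D x"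
proof -
  have "Xn x \<xi> = (\<xi>$1 * (G x * \<xi>$1 - F x * \<xi>$2) + \<xi>$2 * (E x * \<xi>$2 - F x * \<xi>$1)) / D x"
    by (simp add: Xn_def sharp_def inner_vec2 add_divide_distrib)
  then show ?thesis by (simp add: power2_eq_square algebra_simps)
qed

lemma met_sharp: "met x (sharp x \<xi>) (sharp x \<xi>) = Xn x \<xi>"
  by (simp add: sharp_eq Xn_def)

lemma Xn_pos: assumes "\<xi> \<noteq> 0" shows "0 < Xn x \<xi>"
proof -
  have "sharp x \<xi> \<noteq> 0"
  proof
    assume "sharp x \<xi> = 0"
    then have "\<xi> \<bullet> \<xi> = 0" using sharp_eq[of x \<xi> \<xi>] inner_form_D(8)[OF inner_form_met] by simp
    then show False using assms by simp
  qed
  then show ?thesis using inner_form_D(3)[OF inner_form_met] by (simp flip: met_sharp)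
qed

lemma met_J: "met x (J \<xi>) (J \<xi>) = D x * Xn x \<xi>"
proof -
  have "D x * Xn x \<xi> = G x * (\<xi>$1)\<^sup>2 - 2 * F x * (\<xi>$1 * \<xi>$2) + E x * (\<xi>$2)\<^sup>2"
    unfolding Xn_eq by simp
  then show ?thesis by (simp add: met_def power2_eq_square algebra_simps)
qed

lemma met_sharp_J: "met x (sharp x \<xi>) (J \<xi>) = 0"
  by (simp add: sharp_eq inner_vec2)

lemma bilinear_Hr: "bilinear (Hr x \<xi>)"
  unfolding Hr_def bilinear_def
  by (intro conjI allI linearI)
    (simp_all add: inner_add_left inner_add_right Gamma_bilin[THEN bilinear_lin(1), THEN linear_add]
      Gamma_bilin[THEN bilinear_lin(2), THEN linear_add] Gamma_bilin[THEN bilinear_lin(1), THEN linear_scale]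
      Gamma_bilin[THEN bilinear_lin(2), THEN linear_scale] algebra_simps)

text \<open>J \<xi> and \<open>sharp x \<xi>\<close> are orthogonal with squared lengths D X and X,
  where X = \<open>Xn x \<xi>\<close>; for \<xi> nonzero this is the trace in that frame, multiplied
  by X. In this form it also holds at \<xi> = 0.\<close>

lemma trh_frame:
  assumes B: "bilinear B"
  shows "B (J \<xi>) (J \<xi>) / D x + B (sharp x \<xi>) (sharp x \<xi>) = Xn x \<xi> * trh x B"
proof -
  note l = bilinear_lin[OF B]
  have exp: "B v v = (v$1)\<^sup>2 * B (axis 1 1) (axis 1 1) + v$1 * v$2 * (B (axis 1 1) (axis 2 1) + B (axis 2 1) (axis 1 1))
     + (v$2)\<^sup>2 * B (axis 2 1) (axis 2 1)" for v
  proof -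
    have "B (a *\<^sub>R axis 1 1 + b *\<^sub>R axis 2 1) (a *\<^sub>R axis 1 1 + b *\<^sub>R axis 2 1) =
      a\<^sup>2 * B (axis 1 1) (axis 1 1) + a * b * (B (axis 1 1) (axis 2 1) + B (axis 2 1) (axis 1 1)) + b\<^sup>2 * B (axis 2 1) (axis 2 1)" for a b
      by (simp add: linear_add[OF l(1)] linear_add[OF l(2)] linear_scale[OF l(1)] linear_scale[OF l(2)]
        algebra_simps power2_eq_square)
    from this[of "v$1" "v$2"] show ?thesis by (simp flip: vec2_axis)
  qed
  define b11 b12 b22 where "b11 = B (axis 1 1) (axis 1 1)"
    and "b12 = B (axis 1 1) (axis 2 1) + B (axis 2 1) (axis 1 1)" and "b22 = B (axis 2 1) (axis 2 1)"
  have c1: "(\<xi>$2)\<^sup>2 / D x + (sharp x \<xi> $ 1)\<^sup>2 = Xn x \<xi> * G x / D x"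
    and c2: "- (\<xi>$2) * \<xi>$1 / D x + sharp x \<xi> $ 1 * sharp x \<xi> $ 2 = - (Xn x \<xi> * F x / D x)"
    and c3: "(\<xi>$1)\<^sup>2 / D x + (sharp x \<xi> $ 2)\<^sup>2 = Xn x \<xi> * E x / D x"
    unfolding Xn_eq sharp_def by (simp_all add: field_simps power2_eq_square) (simp_all add: D_def power2_eq_square algebra_simps)
  have "B (J \<xi>) (J \<xi>) / D x + B (sharp x \<xi>) (sharp x \<xi>) =
     b11 * ((\<xi>$2)\<^sup>2 / D x + (sharp x \<xi> $ 1)\<^sup>2) + b12 * (- (\<xi>$2) * \<xi>$1 / D x + sharp x \<xi> $ 1 * sharp x \<xi> $ 2)
     + b22 * ((\<xi>$1)\<^sup>2 / D x + (sharp x \<xi> $ 2)\<^sup>2)"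
    unfolding exp[of "J \<xi>"] exp[of "sharp x \<xi>"] b11_def[symmetric] b12_def[symmetric] b22_def[symmetric]
    by (simp add: field_simps)
  also have "\<dots> = Xn x \<xi> * trh x B"
    unfolding c1 c2 c3 trh_def b11_def[symmetric] b12_def[symmetric] b22_def[symmetric]
    by (simp add: field_simps)
  finally show ?thesis .
qed

end

text \<open>The moving disk has centre \<open>k t *\<^sub>R P\<close> and radius \<open>sqrt (2 * S t)\<close>. At its boundary, \<open>Z N\<close> is
  the mean curvature with respect to \<open>met + N\<^sup>2 dt\<^sup>2\<close> up to a positive factor.\<close>

locale moving_wall = plane_metric +
  fixes P :: "real^2" and k k1 k2 S S1 S2 :: "real \<Rightarrow> real"
  assumes k1: "\<And>t. (k has_real_derivative k1 t) (at t)" and k2: "\<And>t. (k1 has_real_derivative k2 t) (at t)"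
    and S1: "\<And>t. (S has_real_derivative S1 t) (at t)" and S2: "\<And>t. (S1 has_real_derivative S2 t) (at t)"
    and ksmooth: "smooth k" and Ssmooth: "smooth S" and Spos: "\<And>t. 0 < S t"
begin

definition \<xi> :: "(real^2) \<times> real \<Rightarrow> real^2" where "\<xi> p = fst p - k (snd p) *\<^sub>R P"

definition wallf :: "(real^2) \<times> real \<Rightarrow> real" where "wallf p = (\<xi> p \<bullet> \<xi> p) / 2 - S (snd p)"

text \<open>The time derivative of \<open>wallf\<close>; \<open>Ftt\<close> below is its second time
  derivative.\<close>

definition \<zeta> :: "(real^2) \<times> real \<Rightarrow> real" where "\<zeta> p = - (k1 (snd p) * (\<xi> p \<bullet> P) + S1 (snd p))"

definition Ftt :: "(real^2) \<times> real \<Rightarrow> real" where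
  "Ftt p = (k1 (snd p))\<^sup>2 * (P \<bullet> P) - k2 (snd p) * (\<xi> p \<bullet> P) - S2 (snd p)"

definition Z :: "((real^2) \<times> real \<Rightarrow> real) \<Rightarrow> (real^2) \<times> real \<Rightarrow> real" where
  "Z N p = (let x = fst p; X = Xn x (\<xi> p); m = sharp x (\<xi> p); dm = dd N (m, 0) p in
     (N p)\<^sup>2 * Yn x (\<xi> p) + (\<zeta> p)\<^sup>2 * Lr x (\<xi> p) + 2 * \<zeta> p * k1 (snd p) * (m \<bullet> P) + X * Ftt p
     + X * N p * dm + 2 * (\<zeta> p)\<^sup>2 * dm / N p - \<zeta> p * X * dd N (0, 1) p / N p)"

lemma smooth_\<xi>: "open U \<Longrightarrow> smooth_on U (\<lambda>p. \<xi> p $ i)"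
  unfolding \<xi>_def
  by (simp, intro smooth_intros smooth_on_fst_comp[of "\<lambda>x. x $ i"] smooth_on_snd_comp[OF ksmooth] smooth_on_nth) auto

lemma smooth_wallf: "open U \<Longrightarrow> smooth_on U wallf"
  unfolding wallf_def inner_vec2
  by (intro smooth_on_diff smooth_on_divide smooth_on_add smooth_on_mult smooth_\<xi> smooth_on_snd_comp[OF Ssmooth]) auto

lemma compose_snd: "(f has_real_derivative f') (at (snd p)) \<Longrightarrow> ((\<lambda>q. f (snd q)) has_derivative (\<lambda>v. f' * snd v)) (at p)"
  using has_derivative_compose[of snd snd p UNIV f "\<lambda>h. f' * h"] has_derivative_snd[OF has_derivative_ident]
  by (auto simp: has_field_derivative_def)

lemma \<xi>_deriv: "(\<xi> has_derivative (\<lambda>v. fst v - (k1 (snd p) * snd v) *\<^sub>R P)) (at p)"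
  unfolding \<xi>_def
  by (intro has_derivative_diff has_derivative_fst has_derivative_ident has_derivative_scaleR_left compose_snd k1)

lemma dd_wallf: "dd wallf v p = \<xi> p \<bullet> fst v + snd v * \<zeta> p"
proof (rule dd_eqI[where D="\<lambda>v. \<xi> p \<bullet> fst v + snd v * \<zeta> p"])
  have "((\<lambda>p. (1 / 2) * (\<xi> p \<bullet> \<xi> p) - S (snd p)) has_derivative (\<lambda>v. (1 / 2) * (\<xi> p \<bullet> (fst v - (k1 (snd p) * snd v) *\<^sub>R P)
      + (fst v - (k1 (snd p) * snd v) *\<^sub>R P) \<bullet> \<xi> p) - S1 (snd p) * snd v)) (at p)"
    by (intro has_derivative_diff has_derivative_mult_right has_derivative_inner \<xi>_deriv compose_snd S1)
  then have "((\<lambda>p. (\<xi> p \<bullet> \<xi> p) / 2 - S (snd p)) has_derivative (\<lambda>v. (1 / 2) * (\<xi> p \<bullet> (fst v - (k1 (snd p) * snd v) *\<^sub>R P)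
      + (fst v - (k1 (snd p) * snd v) *\<^sub>R P) \<bullet> \<xi> p) - S1 (snd p) * snd v)) (at p)" by simp
  then show "(wallf has_derivative (\<lambda>v. \<xi> p \<bullet> fst v + snd v * \<zeta> p)) (at p)"
    unfolding wallf_def[abs_def]
    by (rule has_derivative_eq_rhs) (auto simp: \<zeta>_def inner_diff inner_commute algebra_simps fun_eq_iff)
qed

lemma dd_dd_wallf: "dd (dd wallf w) v p = fst v \<bullet> fst w - snd v * k1 (snd p) * (P \<bullet> fst w)
   - snd w * k1 (snd p) * (fst v \<bullet> P) + snd v * snd w * Ftt p"
proof -
  have "((\<lambda>p. \<xi> p \<bullet> fst w + snd w * (- (k1 (snd p) * (\<xi> p \<bullet> P) + S1 (snd p)))) has_derivative
     (\<lambda>v. (fst v - (k1 (snd p) * snd v) *\<^sub>R P) \<bullet> fst w + snd w * (- ((k1 (snd p) * ((fst v - (k1 (snd p) * snd v) *\<^sub>R P) \<bullet> P)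
       + k2 (snd p) * snd v * (\<xi> p \<bullet> P)) + S2 (snd p) * snd v)))) (at p)"
    by (intro has_derivative_add has_derivative_inner_left \<xi>_deriv has_derivative_mult_right has_derivative_minus
        has_derivative_mult compose_snd k2 S2)
  moreover have "dd wallf w = (\<lambda>p. \<xi> p \<bullet> fst w + snd w * (- (k1 (snd p) * (\<xi> p \<bullet> P) + S1 (snd p))))"
    by (simp add: fun_eq_iff dd_wallf \<zeta>_def)
  ultimately have "(dd wallf w has_derivative (\<lambda>v. (fst v - (k1 (snd p) * snd v) *\<^sub>R P) \<bullet> fst w + snd w * (- ((k1 (snd p) * ((fst v - (k1 (snd p) * snd v) *\<^sub>R P) \<bullet> P)
       + k2 (snd p) * snd v * (\<xi> p \<bullet> P)) + S2 (snd p) * snd v)))) (at p)" by simp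
  then show ?thesis
    by (subst dd_eqI) (auto simp: Ftt_def inner_diff_left algebra_simps power2_eq_square)
qed

text \<open>The tangent plane of the wall is spanned by (J \<xi>, 0) and by (- \<zeta> m, X) with m
  = \<open>sharp x \<xi>\<close>; the differential of \<open>wallf\<close> kills the latter because
  \<xi> paired with m is X. In the sum of the two Hessian values the terms with \<zeta>^2 combine to
  the full trace \<open>Lr\<close> by \<open>trh_frame\<close>.\<close>

lemma wall_trace:
  assumes N: "smooth_on W N" and pos: "\<And>p. p \<in> W \<Longrightarrow> 0 < N p" and p: "p \<in> W" and x0: "\<xi> p \<noteq> 0"
  obtains Q where "orthonormal_set (warped.G met N p) Q" "span Q = {v. dd wallf v p = 0}"
    "(\<Sum>e\<in>Q. hessian (warped.\<Gamma>G \<Gamma> N (grad N)) wallf p e e) =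
       Z N p / ((\<zeta> p)\<^sup>2 + (N p)\<^sup>2 * Xn (fst p) (\<xi> p))"
proof -
  interpret w: warped UNIV met \<Gamma> W N "grad N" by (rule warped_plane[OF N pos])
  define x X m z q y where "x = fst p" and "X = Xn x (\<xi> p)" and "m = sharp x (\<xi> p)" and "z = \<zeta> p"
    and "q = z\<^sup>2 + (N p)\<^sup>2 * X" and "y = \<xi> p"
  have Np: "0 < N p" by (rule pos[OF p])
  have X: "0 < X" unfolding X_def by (rule Xn_pos[OF x0])
  have q: "0 < q" unfolding q_def using X Np by (intro add_nonneg_pos) auto
  define e0 where "e0 = ((1 / sqrt (D x * X)) *\<^sub>R J y, 0::real)"
  define e1 where "e1 = (1 / sqrt (X * q)) *\<^sub>R ((- z) *\<^sub>R m, X)"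
  note ml = inner_form_D(4,5)[OF inner_form_met[of x]]
  have mJm: "met x (J y) m = 0" "met x m (J y) = 0"
    using met_sharp_J[of x y] inner_form_D(2)[OF inner_form_met] by (auto simp: m_def y_def)
  have hmm: "met x m m = X" "met x (J y) (J y) = D x * X"
    by (simp_all add: m_def X_def met_sharp met_J y_def)
  have DX: "0 < D x * X" "0 < X * q" using Dpos X q by auto
  have s1: "1 / sqrt (D x * X) * (1 / sqrt (D x * X)) * (D x * X) = 1"
    "1 / sqrt (X * q) * (1 / sqrt (X * q)) * (X * q) = 1"
    using DX by (auto simp: field_simps simp flip: real_sqrt_mult)
  have g00: "w.G p e0 e0 = 1"
    using s1(1) by (simp add: w.G_def e0_def x_def[symmetric] linear_scale[OF ml(1)] linear_scale[OF ml(2)] hmm mult.assoc)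
  have g01: "w.G p e0 e1 = 0" "w.G p e1 e0 = 0"
    by (simp_all add: w.G_def e0_def e1_def x_def[symmetric] linear_scale[OF ml(1)] linear_scale[OF ml(2)] mJm
      linear_neg[OF ml(1)] linear_neg[OF ml(2)])
  have g11: "w.G p e1 e1 = 1"
  proof -
    have "w.G p e1 e1 = 1 / sqrt (X * q) * (1 / sqrt (X * q)) * (z\<^sup>2 * X + (N p)\<^sup>2 * (X * X))"
      by (simp add: w.G_def e1_def x_def[symmetric] linear_scale[OF ml(1)] linear_scale[OF ml(2)] hmm
        linear_neg[OF ml(1)] linear_neg[OF ml(2)] power2_eq_square algebra_simps)
    also have "z\<^sup>2 * X + (N p)\<^sup>2 * (X * X) = X * q" by (simp add: q_def algebra_simps)
    finally show ?thesis using s1(2) by simp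
  qed
  have ne: "e0 \<noteq> e1" using g00 g01 by auto
  have on: "orthonormal_set (w.G p) {e0, e1}"
    using g00 g01 g11 ne by (auto simp: orthonormal_set_def)
  have ym: "y \<bullet> m = X" by (simp add: X_def Xn_def m_def y_def)
  have yJ: "y \<bullet> J y = 0" by (simp add: inner_vec2)
  have sp: "span {e0, e1} = {v. dd wallf v p = 0}"
  proof (rule orthonormal_span_eqI(1)[OF w.inner_formG[OF p] on])
    show "subspace {v. dd wallf v p = 0}"
      by (auto simp: subspace_def dd_wallf inner_add_right algebra_simps)
        (metis add.commute distrib_left mult.commute mult_zero_right)
    show "{e0, e1} \<subseteq> {v. dd wallf v p = 0}"
      using yJ ym by (auto simp: dd_wallf e0_def e1_def y_def[symmetric] z_def[symmetric])
  next
    fix v assume v: "v \<in> {v. dd wallf v p = 0}" and v0: "\<And>e. e \<in> {e0, e1} \<Longrightarrow> w.G p v e = 0"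
    have h0: "met x (fst v) (J y) = 0"
      using v0[of e0] DX X by (simp add: w.G_def e0_def x_def[symmetric] linear_scale[OF ml(1)])
    have h1: "- z * met x (fst v) m + (N p)\<^sup>2 * (snd v * X) = 0"
    proof -
      have "1 / sqrt (X * q) * (- z * met x (fst v) m + (N p)\<^sup>2 * (snd v * X)) = 0"
        using v0[of e1]
        by (simp add: w.G_def e1_def x_def[symmetric] linear_scale[OF ml(1)] linear_neg[OF ml(1)] algebra_simps)
      then show ?thesis using DX X q by simp
    qed
    have h2: "met x (fst v) m + snd v * z = 0"
      using v inner_form_D(2)[OF inner_form_met, of x "fst v" m]
      by (simp add: dd_wallf m_def sharp_eq z_def)
    have "met x (fst v) m = - (snd v * z)" using h2 by simp
    with h1 have "snd v * q = 0" by (simp add: q_def power2_eq_square algebra_simps)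
    then have s0: "snd v = 0" using q by simp
    then have "y \<bullet> fst v = 0" using v by (simp add: dd_wallf y_def)
    then have e: "y$1 * fst v $ 1 = - (y$2 * fst v $ 2)" by (simp add: inner_vec2)
    define r where "r = (J y \<bullet> fst v) / (y \<bullet> y)"
    have "y \<bullet> y \<noteq> 0" using x0 by (simp add: y_def)
    have fv: "fst v = r *\<^sub>R J y"
    proof -
      have "(y \<bullet> y) * fst v $ 1 = (J y \<bullet> fst v) * J y $ 1" "(y \<bullet> y) * fst v $ 2 = (J y \<bullet> fst v) * J y $ 2"
        using arg_cong[OF e, of "(*) (y$1)"] arg_cong[OF e, of "(*) (y$2)"]
        by (simp_all add: inner_vec2 algebra_simps)
      then show ?thesis using \<open>y \<bullet> y \<noteq> 0\<close> by (simp add: vec2_eq_iff r_def field_simps)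
    qed
    have "r * (D x * X) = 0" using h0 by (simp add: fv linear_scale[OF ml(2)] hmm)
    then have "r = 0" using DX by auto
    then show "v = 0" using fv s0 by (simp add: prod_eq_iff)
  qed
  define dm where "dm = dd N (m, 0) p"
  have yn: "y \<bullet> grad N p = dm"
    using sharp_eq[of x y "grad N p"] w.n[OF p, of m] inner_form_D(2)[OF inner_form_met, of x "grad N p" m]
    by (simp add: m_def dm_def x_def y_def)
  have hw: "hessian w.\<Gamma>G wallf p (v, a) (v, a) = Hr x y v v - 2 * a * k1 (snd p) * (P \<bullet> v) + a\<^sup>2 * Ftt p
      + a\<^sup>2 * N p * dm - z * (2 * a * dd N (v, 0) p + a\<^sup>2 * dd N (0, 1) p) / N p" for v a
    unfolding hessian_def dd_dd_wallf dd_wallf w.\<Gamma>G_def w.\<beta>_def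
    using Np by (simp add: x_def[symmetric] y_def[symmetric] z_def[symmetric] Hr_def inner_diff_right yn inner_commute[of v P]
       power2_eq_square field_simps)
  note Hl = bilinear_lin[OF bilinear_Hr[of x y]]
  have dNl: "dd N (r *\<^sub>R v, 0) p = r * dd N (v, 0) p" for r v
    using linear_scale[OF w.dN_lin[OF p], of r "(v, 0)"] by simp
  have t0: "hessian w.\<Gamma>G wallf p e0 e0 = Yn x y / X"
  proof -
    have "hessian w.\<Gamma>G wallf p e0 e0 = 1 / sqrt (D x * X) * (1 / sqrt (D x * X)) * Hr x y (J y) (J y)"
      unfolding e0_def hw by (simp add: linear_scale[OF Hl(1)] linear_scale[OF Hl(2)])
    also have "1 / sqrt (D x * X) * (1 / sqrt (D x * X)) = 1 / (D x * X)"
      using s1(1) DX by (simp add: field_simps)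
    finally show ?thesis by (simp add: Yn_def)
  qed
  have t1: "hessian w.\<Gamma>G wallf p e1 e1 = (z\<^sup>2 * Hr x y m m + 2 * X * z * k1 (snd p) * (P \<bullet> m) + X\<^sup>2 * Ftt p
      + X\<^sup>2 * N p * dm - z * (- 2 * X * z * dm + X\<^sup>2 * dd N (0, 1) p) / N p) / (X * q)"
  proof -
    define r where "r = 1 / sqrt (X * q)"
    have r2: "r * r = 1 / (X * q)" using s1(2) DX unfolding r_def by (simp add: field_simps)
    have "hessian w.\<Gamma>G wallf p e1 e1 = r * r * (z\<^sup>2 * Hr x y m m + 2 * X * z * k1 (snd p) * (P \<bullet> m) + X\<^sup>2 * Ftt p
      + X\<^sup>2 * N p * dm - z * (- 2 * X * z * dm + X\<^sup>2 * dd N (0, 1) p) / N p)"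
      unfolding e1_def r_def[symmetric] using Np
      by (simp add: hw dNl[of "- (r * z)"] linear_scale[OF Hl(1)] linear_scale[OF Hl(2)] linear_neg[OF Hl(1)] linear_neg[OF Hl(2)]
          power2_eq_square dm_def[symmetric] field_simps flip: scaleR_minus_left)
    then show ?thesis unfolding r2 by simp
  qed
  have fr: "Yn x y + Hr x y m m = X * Lr x y"
    using trh_frame[OF bilinear_Hr, where x=x] by (simp add: Yn_def m_def X_def Lr_def y_def)
  have "(\<Sum>e\<in>{e0, e1}. hessian w.\<Gamma>G wallf p e e) = Z N p / q"
  proof -
    have Zeq: "Z N p = (N p)\<^sup>2 * Yn x y + z\<^sup>2 * Lr x y + 2 * z * k1 (snd p) * (m \<bullet> P) + X * Ftt p
     + X * N p * dm + 2 * z\<^sup>2 * dm / N p - z * X * dd N (0, 1) p / N p"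
      by (simp add: Z_def Let_def x_def X_def m_def z_def dm_def y_def)
    have "(\<Sum>e\<in>{e0, e1}. hessian w.\<Gamma>G wallf p e e) = (Yn x y * q + (z\<^sup>2 * Hr x y m m + 2 * X * z * k1 (snd p) * (P \<bullet> m) + X\<^sup>2 * Ftt p
      + X\<^sup>2 * N p * dm - z * (- 2 * X * z * dm + X\<^sup>2 * dd N (0, 1) p) / N p)) / (X * q)"
      using ne t0 t1 X q by (simp add: add_divide_distrib)
    also have "Yn x y * q + (z\<^sup>2 * Hr x y m m + 2 * X * z * k1 (snd p) * (P \<bullet> m) + X\<^sup>2 * Ftt p
      + X\<^sup>2 * N p * dm - z * (- 2 * X * z * dm + X\<^sup>2 * dd N (0, 1) p) / N p)
      = z\<^sup>2 * (Yn x y + Hr x y m m) + X * ((N p)\<^sup>2 * Yn x y + 2 * z * k1 (snd p) * (m \<bullet> P) + X * Ftt p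
     + X * N p * dm + 2 * z\<^sup>2 * dm / N p - z * X * dd N (0, 1) p / N p)"
      using Np by (simp add: q_def inner_commute field_simps power2_eq_square)
    also have "\<dots> = X * Z N p" unfolding fr Zeq by (simp add: algebra_simps)
    finally show ?thesis using X by simp
  qed
  with on sp show ?thesis using that unfolding q_def z_def X_def x_def by blast
qed

end

section \<open>Bending the lapse at the wall\<close>

lemma compact_bounded_real:
  fixes f :: "'a::topological_space \<Rightarrow> real"
  assumes "compact K" "continuous_on K f"
  obtains C where "0 < C" "\<And>x. x \<in> K \<Longrightarrow> \<bar>f x\<bar> \<le> C"
proof -
  have "bounded (f ` K)" by (rule compact_imp_bounded[OF compact_continuous_image[OF assms(2,1)]])
  then show ?thesis using that by (auto simp: bounded_pos)
qed

lemma compact_positive_lower: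
  fixes f :: "'a::topological_space \<Rightarrow> real"
  assumes "compact K" "continuous_on K f" "\<And>x. x \<in> K \<Longrightarrow> 0 < f x"
  obtains d where "0 < d" "\<And>x. x \<in> K \<Longrightarrow> d \<le> f x"
proof (cases "K = {}")
  case False
  then obtain q where "q \<in> K" "\<forall>x\<in>K. f q \<le> f x" using continuous_attains_inf assms by blast
  then show ?thesis using that assms(3) by blast
qed (use that[of 1] in auto)

text \<open>Where \<open>M\<close> is more than half of a positive lower bound for its values on F =
  0, the term with 1/l outweighs \<open>T\<close> for small \<open>l\<close>. Elsewhere compactness
  keeps \<open>F\<close> away from 0, so both exponential terms are negligible against the positive
  minimum of \<open>A\<close>.\<close>

lemma boundary_layer_positive:
  fixes A B T M F :: "'a::topological_space \<Rightarrow> real"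
  assumes K: "compact K" and cont: "continuous_on K A" "continuous_on K B" "continuous_on K T"
      "continuous_on K M" "continuous_on K F"
    and A: "\<And>p. p \<in> K \<Longrightarrow> 0 < A p" and F: "\<And>p. p \<in> K \<Longrightarrow> F p \<le> 0"
    and M: "\<And>p. p \<in> K \<Longrightarrow> F p = 0 \<Longrightarrow> 0 < M p"
  shows "\<exists>r>0. \<forall>l. 0 < l \<and> l < r \<longrightarrow> (\<forall>p\<in>K.
    0 < A p + l * (1 - exp (F p / l)) * B p + exp (F p / l) * T p + exp (F p / l) / l * M p)"
proof -
  have bounded: "\<exists>C>0. \<forall>p\<in>K. \<bar>f p\<bar> \<le> C" if "continuous_on K f" for f :: "'a \<Rightarrow> real"
    by (rule compact_bounded_real[OF K that]) blast
  have lower: "\<exists>d>0. \<forall>p\<in>K'. d \<le> f p" if "compact K'" "continuous_on K' f" "\<And>p. p \<in> K' \<Longrightarrow> 0 < f p"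
    for f :: "'a \<Rightarrow> real" and K'
    by (rule compact_positive_lower[OF that]) blast+
  obtain d where d: "d > 0" "\<And>p. p \<in> K \<Longrightarrow> d \<le> A p" using lower[OF K cont(1) A] by blast
  obtain cB where cB: "cB > 0" "\<And>p. p \<in> K \<Longrightarrow> \<bar>B p\<bar> \<le> cB" using bounded[OF cont(2)] by blast
  obtain cT where cT: "cT > 0" "\<And>p. p \<in> K \<Longrightarrow> \<bar>T p\<bar> \<le> cT" using bounded[OF cont(3)] by blast
  obtain cM where cM: "cM > 0" "\<And>p. p \<in> K \<Longrightarrow> \<bar>M p\<bar> \<le> cM" using bounded[OF cont(4)] by blast
  have closedin_comp: "compact (K \<inter> f -` S)" if cf: "continuous_on K f" and cl: "closed S" for f :: "'a \<Rightarrow> real" and S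
  proof -
    obtain D where "closed D" "D \<inter> K = f -` S \<inter> K"
      using cf cl unfolding continuous_on_closed_invariant by blast
    then show ?thesis using compact_Int_closed[OF K, of D] by (metis inf_commute)
  qed
  obtain m where m: "m > 0" "\<And>p. p \<in> K \<Longrightarrow> F p = 0 \<Longrightarrow> m \<le> M p"
    using lower[of "K \<inter> F -` {0}" M, OF closedin_comp[OF cont(5) closed_singleton]
        continuous_on_subset[OF cont(4)]] M by auto
  obtain e where e: "e > 0" "\<And>p. p \<in> K \<Longrightarrow> M p \<le> m / 2 \<Longrightarrow> F p \<le> - e"
  proof -
    have "0 < - F p" if "p \<in> K \<inter> M -` {..m / 2}" for p
      using F[of p] m(1) m(2)[of p] that by (cases "F p = 0") auto
    from lower[of "K \<inter> M -` {..m / 2}" "\<lambda>p. - F p", OF closedin_comp[OF cont(4) closed_atMost]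
        continuous_on_minus[OF continuous_on_subset[OF cont(5)]] this]
    obtain e where "e > 0" "\<forall>p\<in>K \<inter> M -` {..m / 2}. e \<le> - F p" by auto
    then show ?thesis by (intro that[of e]) force+
  qed
  have "((\<lambda>l::real. exp (- e / l) * (cT + cM / l)) \<longlongrightarrow> 0) (at_right 0)"
  proof -
    have 1: "((\<lambda>y::real. y ^ n / exp y) \<longlongrightarrow> 0) at_top" for n by (rule tendsto_power_div_exp_0)
    have "((\<lambda>y::real. cT * (y ^ 0 / exp y) + cM / e * (y ^ 1 / exp y)) \<longlongrightarrow> cT * 0 + cM / e * 0) at_top"
      by (intro tendsto_intros 1)
    moreover have "filterlim (\<lambda>l. e * inverse l) at_top (at_right 0)"
      by (rule filterlim_tendsto_pos_mult_at_top[OF tendsto_const e(1) filterlim_inverse_at_top_right])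
    ultimately have "((\<lambda>l. cT * ((e * inverse l) ^ 0 / exp (e * inverse l)) + cM / e * ((e * inverse l) ^ 1 / exp (e * inverse l))) \<longlongrightarrow> cT * 0 + cM / e * 0) (at_right 0)"
      by (rule filterlim_compose)
    moreover have "cT * ((e * inverse l) ^ 0 / exp (e * inverse l)) + cM / e * ((e * inverse l) ^ 1 / exp (e * inverse l)) =
        exp (- e / l) * (cT + cM / l)" for l
    proof -
      have "exp (- e / l) = 1 / exp (e * inverse l)" by (simp add: exp_minus divide_inverse)
      moreover have "cM / e * (e * inverse l) = cM / l" using e(1) by (simp add: divide_inverse)
      ultimately show ?thesis by (simp add: distrib_left)
    qed
    ultimately show ?thesis by simp
  qed
  then have "\<forall>\<^sub>F l in at_right 0. exp (- e / l) * (cT + cM / l) < d / 4"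
    using d(1) by (intro order_tendstoD) auto
  then obtain r0 where r0: "r0 > 0" "\<And>l. 0 < l \<Longrightarrow> l < r0 \<Longrightarrow> exp (- e / l) * (cT + cM / l) < d / 4"
    by (auto simp: eventually_at_right_field)
  define r where "r = min r0 (min (d / (4 * cB)) (m / (2 * cT)))"
  have "0 < A p + l * (1 - exp (F p / l)) * B p + exp (F p / l) * T p + exp (F p / l) / l * M p"
    if l: "0 < l" "l < r" and p: "p \<in> K" for l p
  proof -
    define x where "x = exp (F p / l)"
    have x: "0 < x" "x \<le> 1" using F[OF p] l by (auto simp: x_def divide_nonpos_pos)
    have "l * cB < d / 4" using l cB(1) by (simp add: r_def field_simps)
    moreover have "\<bar>l * (1 - x) * B p\<bar> \<le> l * 1 * cB"
      unfolding abs_mult using l x cB(2)[OF p] by (intro mult_mono) auto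
    ultimately have b: "- (d / 4) < l * (1 - x) * B p" by linarith
    show ?thesis
    proof (cases "M p \<le> m / 2")
      case False
      have "cT \<le> m / 2 / l" using l cT(1) by (simp add: r_def field_simps)
      then have "0 \<le> x * (T p + M p / l)"
        using cT(2)[OF p] False x l divide_right_mono[of "m / 2" "M p" l] by (intro mult_nonneg_nonneg) auto
      then show ?thesis using b d(1) d(2)[OF p] unfolding x_def[symmetric] by (simp add: algebra_simps)
    next
      case True
      have "x \<le> exp (- e / l)" using divide_right_mono[OF e(2)[OF p True], of l] l by (simp add: x_def)
      moreover have "\<bar>T p + M p / l\<bar> \<le> cT + cM / l"
        using cT(2)[OF p] cM(2)[OF p] l by (intro order_trans[OF abs_triangle_ineq] add_mono) (auto simp: divide_right_mono)
      ultimately have "\<bar>x * (T p + M p / l)\<bar> \<le> exp (- e / l) * (cT + cM / l)"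
        unfolding abs_mult using x by (intro mult_mono) auto
      also have "\<dots> < d / 4" using r0(2) l by (simp add: r_def)
      finally have "- (d / 4) < x * (T p + M p / l)" by (metis abs_less_iff minus_less_iff)
      then show ?thesis using b d(1) d(2)[OF p] unfolding x_def[symmetric] by (simp add: algebra_simps)
    qed
  qed
  moreover have "r > 0" using r0 d cB m cT by (simp add: r_def)
  ultimately show ?thesis by blast
qed

context plane_metric
begin

lemma smooth_lapl:
  assumes N: "smooth_on W N" shows "smooth_on W (lapl N)"
proof -
  note o = smooth_on_open[OF N]
  have eq: "hess \<Gamma> N p v w = dd (dd N (w, 0)) (v, 0) p - (\<Gamma> (fst p) v w $ 1 * dd N (axis 1 1, 0) p
      + \<Gamma> (fst p) v w $ 2 * dd N (axis 2 1, 0) p)" if "p \<in> W" for p v w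
    using dd_space[OF N that, of "\<Gamma> (fst p) v w" 0] by (simp add: hess_def)
  have h: "smooth_on W (\<lambda>p. hess \<Gamma> N p v w)" for v w
    by (subst smooth_on_cong[OF eq], assumption)
      (intro smooth_intros smooth_on_dd N smooth_on_fst_comp[OF smooth_Gamma] o)
  show ?thesis
    unfolding lapl_def trh_def
    by (intro smooth_on_divide smooth_intros h smooth_on_fst_comp[OF smoothE]
        smooth_on_fst_comp[OF smoothF] smooth_on_fst_comp[OF smoothG] smooth_on_fst_comp[OF smoothD] o) simp
qed

end

context moving_wall
begin

lemma smooth_sharp\<xi>: "open W \<Longrightarrow> smooth_on W (\<lambda>p. sharp (fst p) (\<xi> p) $ i)"
  by (rule smooth_sharp) (auto intro: smooth_\<xi> smooth_on_fst_comp)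

lemma smooth_Xn: assumes "open W" shows "smooth_on W (\<lambda>p. Xn (fst p) (\<xi> p))"
  unfolding Xn_def inner_vec2 by (intro smooth_intros smooth_\<xi> smooth_sharp\<xi> assms)

lemma smooth_Hr: assumes "open W" shows "smooth_on W (\<lambda>p. Hr (fst p) (\<xi> p) v w)"
  unfolding Hr_def inner_vec2 by (intro smooth_intros smooth_\<xi> smooth_on_fst_comp[OF smooth_Gamma] assms)

lemma smooth_Lr: assumes "open W" shows "smooth_on W (\<lambda>p. Lr (fst p) (\<xi> p))"
  unfolding Lr_def trh_def
  by (intro smooth_on_divide smooth_intros smooth_Hr smooth_on_fst_comp[OF smoothE]
        smooth_on_fst_comp[OF smoothF] smooth_on_fst_comp[OF smoothG] smooth_on_fst_comp[OF smoothD] assms) simp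

lemma smooth_Yn: assumes "open W" shows "smooth_on W (\<lambda>p. Yn (fst p) (\<xi> p))"
proof -
  have eq: "Yn (fst p) (\<xi> p) = Xn (fst p) (\<xi> p) * Lr (fst p) (\<xi> p)
     - (\<Sum>i\<in>UNIV. \<Sum>j\<in>UNIV. (sharp (fst p) (\<xi> p) $ i * sharp (fst p) (\<xi> p) $ j) * Hr (fst p) (\<xi> p) (axis i 1) (axis j 1))" for p
  proof -
    define m where "m = sharp (fst p) (\<xi> p)"
    note l = bilinear_lin[OF bilinear_Hr[of "fst p" "\<xi> p"]]
    have "Hr (fst p) (\<xi> p) (a *\<^sub>R axis 1 1 + b *\<^sub>R axis 2 1) (a *\<^sub>R axis 1 1 + b *\<^sub>R axis 2 1) =
      a * a * Hr (fst p) (\<xi> p) (axis 1 1) (axis 1 1) + a * b * Hr (fst p) (\<xi> p) (axis 1 1) (axis 2 1) +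
      b * a * Hr (fst p) (\<xi> p) (axis 2 1) (axis 1 1) + b * b * Hr (fst p) (\<xi> p) (axis 2 1) (axis 2 1)" for a b
      by (simp add: linear_add[OF l(1)] linear_add[OF l(2)] linear_scale[OF l(1)] linear_scale[OF l(2)] algebra_simps)
    from this[of "m$1" "m$2"] show ?thesis
      using trh_frame[OF bilinear_Hr[of "fst p" "\<xi> p"], where x="fst p" and \<xi>="\<xi> p"]
      by (simp add: Yn_def Lr_def m_def sum_2 flip: vec2_axis)
  qed
  show ?thesis
    unfolding eq by (intro smooth_intros smooth_on_sum smooth_Xn smooth_Lr smooth_Hr smooth_sharp\<xi> assms)
qed

lemma smooth_k1: "smooth k1" and smooth_k2: "smooth k2"
  and smooth_S1: "smooth S1" and smooth_S2: "smooth S2"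
proof -
  have *: "f' = dd f 1" if "\<And>t. (f has_real_derivative f' t) (at t)" for f f' :: "real \<Rightarrow> real"
    using that dd_eqI[of f "\<lambda>v. f' t * v" t 1 for t] by (auto simp: has_field_derivative_def fun_eq_iff)
  show "smooth k1" "smooth S1"
    unfolding *[OF k1] *[OF S1] by (intro smooth_on_dd ksmooth Ssmooth)+
  then show "smooth k2" "smooth S2"
    unfolding *[OF k2] *[OF S2] by (auto intro: smooth_on_dd)
qed

lemmas smooth_time = smooth_on_snd_comp[OF smooth_k1] smooth_on_snd_comp[OF smooth_k2]
  smooth_on_snd_comp[OF smooth_S1] smooth_on_snd_comp[OF smooth_S2]

lemma smooth_\<zeta>: assumes "open W" shows "smooth_on W \<zeta>"
  unfolding \<zeta>_def inner_vec2 by (intro smooth_intros smooth_\<xi> smooth_time assms)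

lemma smooth_Ftt: assumes "open W" shows "smooth_on W Ftt"
  unfolding Ftt_def inner_vec2 by (intro smooth_intros smooth_\<xi> smooth_time assms)

lemma smooth_Z:
  assumes N: "smooth_on W N" and pos: "\<And>p. p \<in> W \<Longrightarrow> 0 < N p"
  shows "smooth_on W (Z N)"
proof -
  note o = smooth_on_open[OF N]
  have dm: "smooth_on W (\<lambda>p. dd N (sharp (fst p) (\<xi> p), 0) p)"
    by (subst smooth_on_cong[OF dd_space[OF N]], assumption)
      (intro smooth_intros smooth_sharp\<xi> smooth_on_dd N o)
  have "N p \<noteq> 0" if "p \<in> W" for p using pos[OF that] by simp
  then show ?thesis
    unfolding Z_def[abs_def] Let_def inner_vec2
    by (intro smooth_on_divide smooth_intros smooth_Xn smooth_Yn smooth_Lr smooth_\<zeta> smooth_Ftt smooth_sharp\<xi>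
        smooth_time smooth_on_dd dm N o)
qed

definition domain :: "((real^2) \<times> real) set" where
  "domain = {p. 0 \<le> snd p \<and> snd p \<le> 3 \<and> wallf p \<le> 0}"

lemma compact_domain: "compact domain"
proof (rule compact_eq_bounded_closed[THEN iffD2], rule conjI)
  have cw: "continuous_on UNIV wallf" by (rule smooth_on_cont[OF smooth_wallf[OF open_UNIV]])
  show "closed domain"
    unfolding domain_def by (intro closed_Collect_conj closed_Collect_le continuous_intros cw)
  have cS: "continuous_on {0..3} S" "continuous_on {0..3} k"
    using smooth_on_cont[OF Ssmooth] smooth_on_cont[OF ksmooth] continuous_on_subset by auto
  obtain a where a': "\<forall>x\<in>S ` {0..3}. norm x \<le> a"
    using compact_imp_bounded[OF compact_continuous_image[OF cS(1) compact_Icc]] unfolding bounded_iff by blast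
  have a: "S t \<le> a" if "t \<in> {0..3}" for t
    using a'[rule_format, OF imageI[OF that]] by simp
  obtain b where b': "\<forall>x\<in>k ` {0..3}. norm x \<le> b"
    using compact_imp_bounded[OF compact_continuous_image[OF cS(2) compact_Icc]] unfolding bounded_iff by blast
  have b: "\<bar>k t\<bar> \<le> b" if "t \<in> {0..3}" for t
    using b'[rule_format, OF imageI[OF that]] by simp
  have "norm p \<le> (sqrt (2 * a) + b * norm P) + 3" if p: "p \<in> domain" for p
  proof -
    have t: "snd p \<in> {0..3}" using p by (simp add: domain_def)
    have "\<xi> p \<bullet> \<xi> p \<le> 2 * a" using p a[OF t] by (simp add: domain_def wallf_def)
    then have "norm (\<xi> p) \<le> sqrt (2 * a)" by (simp add: norm_eq_sqrt_inner)
    moreover have "norm (k (snd p) *\<^sub>R P) \<le> b * norm P" using b[OF t] by (simp add: mult_right_mono)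
    moreover have "fst p = \<xi> p + k (snd p) *\<^sub>R P" by (simp add: \<xi>_def)
    ultimately have "norm (fst p) \<le> sqrt (2 * a) + b * norm P" by (metis add_mono norm_triangle_le)
    moreover have "norm p \<le> norm (fst p) + norm (snd p)" by (metis norm_Pair_le prod.collapse)
    ultimately show ?thesis using t by simp
  qed
  then show "bounded domain" unfolding bounded_iff by (intro exI ballI)
qed

text \<open>The first derivatives of the correction at the wall cancel \<open>Z N\<close>, while its second normal
  derivative, of size \<open>1 / l\<close>, only helps the supersolution inequality in the boundary layer.\<close>

lemma bend:
  assumes N: "smooth N" and pos: "\<And>p. p \<in> domain \<Longrightarrow> 0 < N p"
    and super: "\<And>p. p \<in> domain \<Longrightarrow> lapl N p < scalar_curvature met (fst p) / 2 * N p"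
    and Z: "\<And>p. p \<in> domain \<Longrightarrow> wallf p = 0 \<Longrightarrow> 0 < Z N p"
  obtains W N' where "domain \<subseteq> W" "smooth_on W N'" "\<And>p. p \<in> W \<Longrightarrow> 0 < N' p"
    "\<And>p. p \<in> domain \<Longrightarrow> lapl N' p < scalar_curvature met (fst p) / 2 * N' p"
    "\<And>p. p \<in> domain \<Longrightarrow> wallf p = 0 \<Longrightarrow> Z N' p = 0"
proof -
  define V where "V = {p. 0 < N p}"
  have "open V" unfolding V_def
    by (intro open_Collect_less continuous_intros smooth_on_cont[OF N])
  then have NV: "smooth_on V N" using smooth_on_subset[OF N] by simp
  have dV: "domain \<subseteq> V" using pos by (auto simp: V_def)
  have posV: "0 < N p" if "p \<in> V" for p using that by (simp add: V_def)
  define X where "X p = Xn (fst p) (\<xi> p)" for p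
  have Xge: "0 \<le> X p" for p
    using Xn_pos[of "\<xi> p" "fst p"] by (cases "\<xi> p = 0") (auto simp: X_def Xn_def)
  \<comment> \<open>On the wall the last summand vanishes and the rest is the factor that cancels
    \<open>Z N\<close>. At the centre of the disk, where \<open>X\<close> vanishes, the last summand
    keeps the denominator positive, so that \<open>M\<close> is smooth on all of
    \<open>V\<close>.\<close>
  define d where "d p = X p * ((N p)\<^sup>2 * X p + (\<zeta> p)\<^sup>2) + (wallf p)\<^sup>2" for p
  have dpos: "0 < d p" if "p \<in> V" for p
  proof (cases "\<xi> p = 0")
    case True
    then have "wallf p \<noteq> 0" using Spos[of "snd p"] by (simp add: wallf_def)
    then show ?thesis unfolding d_def using Xge[of p] by (intro add_nonneg_pos) auto
  next
    case False
    then have "0 < X p" by (simp add: X_def Xn_pos)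
    then show ?thesis unfolding d_def using posV[OF that]
      by (intro add_pos_nonneg mult_pos_pos) auto
  qed
  \<comment> \<open>Replacing dN by dN - M dwallf on the wall lowers \<open>Z N\<close> by M / N
    times X (N^2 X + \<zeta>^2); this choice makes the loss equal to \<open>Z N\<close>.\<close>
  define M where "M p = N p * Z N p / d p" for p
  have sX: "smooth_on V X" unfolding X_def by (rule smooth_Xn[OF \<open>open V\<close>])
  have sF: "smooth_on V wallf" by (rule smooth_wallf[OF \<open>open V\<close>])
  have sd: "smooth_on V d"
    unfolding d_def by (intro smooth_intros sX NV smooth_\<zeta> sF \<open>open V\<close>)
  have sM: "smooth_on V M"
    unfolding M_def by (intro smooth_on_divide smooth_intros NV smooth_Z posV sd) (use dpos in force)+
  define R :: "(real^2) \<times> real \<Rightarrow> real" where "R p = scalar_curvature met (fst p) / 2" for p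
  have sR: "smooth_on V R"
    unfolding R_def
    by (intro smooth_on_divide smooth_on_fst_comp[OF smooth_scalar_curvature] \<open>open V\<close> smooth_on_const) simp
  define T where "T p v w = dd wallf (v, 0) p * dd M (w, 0) p + dd M (v, 0) p * dd wallf (w, 0) p" for p v w
  \<comment> \<open>The part of the Laplacian of l * M * exp(wallf / l) that is neither multiplied
    nor divided by \<open>l\<close>, up to the exponential factor.\<close>
  define T' where "T' p = trh (fst p) (T p) + M p * lapl wallf p" for p
  have sT: "smooth_on V T'"
    unfolding T'_def T_def trh_def
    by (intro smooth_on_divide smooth_intros smooth_on_dd sM sF smooth_lapl smooth_on_fst_comp[OF smoothE]
        smooth_on_fst_comp[OF smoothF] smooth_on_fst_comp[OF smoothG] smooth_on_fst_comp[OF smoothD] \<open>open V\<close>) simp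
  have MX: "0 < M p * X p" if p: "p \<in> domain" "wallf p = 0" for p
  proof -
    have "\<xi> p \<noteq> 0" using p Spos[of "snd p"] by (auto simp: wallf_def)
    then show ?thesis
      using Z[OF p] pos[OF p(1)] dpos[of p] dV p(1) by (auto simp: X_def M_def Xn_pos)
  qed
  have A: "0 < R p * N p - lapl N p" if "p \<in> domain" for p using super[OF that] by (simp add: R_def)
  have Fle: "wallf p \<le> 0" if "p \<in> domain" for p using that by (simp add: domain_def)
  have cont: "continuous_on domain f" if "smooth_on V f" for f
    using smooth_on_cont[OF that] dV continuous_on_subset by blast
  from boundary_layer_positive[where F=wallf, OF compact_domain
      cont[OF smooth_on_diff[OF smooth_on_mult[OF sR NV] smooth_lapl[OF NV]]]
      cont[OF smooth_on_diff[OF smooth_on_mult[OF sR sM] smooth_lapl[OF sM]]]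
      cont[OF sT] cont[OF smooth_on_mult[OF sM sX]] cont[OF sF] A Fle MX]
  obtain r1 where r1: "r1 > 0" "\<And>l p. 0 < l \<Longrightarrow> l < r1 \<Longrightarrow> p \<in> domain \<Longrightarrow>
    0 < R p * N p - lapl N p + l * (1 - exp (wallf p / l)) * (R p * M p - lapl M p)
     + exp (wallf p / l) * T' p + exp (wallf p / l) / l * (M p * X p)" by blast
  from boundary_layer_positive[where F=wallf and M="\<lambda>_. 1", OF compact_domain cont[OF NV] cont[OF sM]
      continuous_on_const[of _ 0] continuous_on_const cont[OF sF] pos Fle]
  obtain r2 where r2: "r2 > 0" "\<And>l p. 0 < l \<Longrightarrow> l < r2 \<Longrightarrow> p \<in> domain \<Longrightarrow>
    0 < N p + l * (1 - exp (wallf p / l)) * M p + exp (wallf p / l) * 0 + exp (wallf p / l) / l * 1" by auto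
  obtain cM where cM: "cM > 0" "\<And>p. p \<in> domain \<Longrightarrow> \<bar>M p\<bar> \<le> cM"
    using compact_imp_bounded[OF compact_continuous_image[OF cont[OF sM] compact_domain]]
    unfolding bounded_pos by auto
  obtain cN where cN: "cN > 0" "\<And>p. p \<in> domain \<Longrightarrow> cN \<le> N p"
  proof (cases "domain = {}")
    case False
    then obtain q where "q \<in> domain" "\<forall>p\<in>domain. N q \<le> N p"
      using continuous_attains_inf[OF compact_domain False cont[OF NV]] by auto
    then show ?thesis using that pos by blast
  qed (use that[of 1] in auto)
  \<comment> \<open>Below \<open>r1\<close> the supersolution inequality survives; below cN / cM the
    correction, at most l * cM, cannot destroy positivity.\<close>
  define l where "l = min r1 (cN / cM) / 2"
  have l: "0 < l" "l < r1" "l * cM < cN"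
    using r1(1) cN(1) cM(1) by (auto simp: l_def min_def field_simps)
  define e where "e p = exp (wallf p / l)" for p
  have se: "smooth_on V e" unfolding e_def
    using l by (intro smooth_on_exp smooth_on_divide sF smooth_on_const \<open>open V\<close>) auto
  define N' where "N' p = N p + l * (M p * (1 - e p))" for p
  have sN': "smooth_on V N'" unfolding N'_def by (intro smooth_intros NV sM se \<open>open V\<close>)
  have N'pos: "0 < N' p" if p: "p \<in> domain" for p
  proof -
    have "0 \<le> 1 - e p" "1 - e p \<le> 1" using Fle[OF p] l by (auto simp: e_def divide_nonpos_pos)
    then have "\<bar>M p * (1 - e p)\<bar> \<le> cM * 1" unfolding abs_mult using cM(2)[OF p] by (intro mult_mono) auto
    then have "\<bar>l * (M p * (1 - e p))\<bar> \<le> l * cM" unfolding abs_mult using l by simp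
    then show ?thesis using l(3) cN(2)[OF p] by (simp add: N'_def)
  qed
  have de: "(e has_derivative (\<lambda>v. e p / l * dd wallf v p)) (at p)" if "p \<in> V" for p
  proof -
    have "((\<lambda>p. wallf p * (1 / l)) has_derivative (\<lambda>v. dd wallf v p * (1 / l))) (at p)"
      by (intro has_derivative_mult_left smooth_on_deriv[OF sF that])
    from DERIV_compose_FDERIV[OF DERIV_exp this] show ?thesis
      by (simp add: e_def[abs_def] mult_ac)
  qed
  have dN': "dd N' v p = dd N v p + l * (1 - e p) * dd M v p - M p * e p * dd wallf v p" if "p \<in> V" for v p
  proof -
    have "(N' has_derivative (\<lambda>v. dd N v p + l * (M p * (0 - e p / l * dd wallf v p) + dd M v p * (1 - e p)))) (at p)"
      unfolding N'_def
      by (intro has_derivative_add has_derivative_mult_right has_derivative_mult has_derivative_diff has_derivative_const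
        de smooth_on_deriv[OF NV] smooth_on_deriv[OF sM] that)
    then show ?thesis using l by (simp add: dd_eqI algebra_simps)
  qed
  have ddN': "dd (dd N' w) v p = dd (dd N w) v p + l * (1 - e p) * dd (dd M w) v p
     - e p * (dd wallf v p * dd M w p + dd M v p * dd wallf w p)
     - M p * e p / l * (dd wallf v p * dd wallf w p) - M p * e p * dd (dd wallf w) v p" if p: "p \<in> V" for v w p
  proof -
    have "((\<lambda>p. dd N w p + l * ((1 - e p) * dd M w p) - M p * (e p * dd wallf w p)) has_derivative
      (\<lambda>v. dd (dd N w) v p + l * ((1 - e p) * dd (dd M w) v p + (0 - e p / l * dd wallf v p) * dd M w p)
       - (M p * (e p * dd (dd wallf w) v p + (e p / l * dd wallf v p) * dd wallf w p) + dd M v p * (e p * dd wallf w p)))) (at p)"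
      by (intro has_derivative_add has_derivative_mult_right has_derivative_mult has_derivative_diff has_derivative_const
        de smooth_on_deriv[OF smooth_on_dd[OF NV]] smooth_on_deriv[OF smooth_on_dd[OF sM]]
        smooth_on_deriv[OF smooth_on_dd[OF sF]] smooth_on_deriv[OF sM] p)
    then have "(dd N' w has_derivative
      (\<lambda>v. dd (dd N w) v p + l * ((1 - e p) * dd (dd M w) v p + (0 - e p / l * dd wallf v p) * dd M w p)
       - (M p * (e p * dd (dd wallf w) v p + (e p / l * dd wallf v p) * dd wallf w p) + dd M v p * (e p * dd wallf w p)))) (at p)"
      by (rule has_derivative_transform_within_open[OF _ \<open>open V\<close> p]) (simp add: dN' mult_ac)
    then show ?thesis using l by (simp add: dd_eqI algebra_simps)
  qed
  have hN': "hess \<Gamma> N' p v w = hess \<Gamma> N p v w + l * (1 - e p) * hess \<Gamma> M p v w - e p * T p v w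
     - M p * e p / l * ((\<xi> p \<bullet> v) * (\<xi> p \<bullet> w)) - M p * e p * hess \<Gamma> wallf p v w" if p: "p \<in> V" for v w p
    unfolding hess_def ddN'[OF p] dN'[OF p] T_def by (simp add: dd_wallf algebra_simps)
  have lN': "lapl N' p = lapl N p + l * (1 - e p) * lapl M p - e p * T' p - M p * e p / l * X p" if p: "p \<in> V" for p
    unfolding lapl_def trh_def hN'[OF p] T'_def X_def Xn_eq
    using Dpos[of "fst p"] l by (simp add: inner_vec2 field_simps power2_eq_square)
  have super': "lapl N' p < scalar_curvature met (fst p) / 2 * N' p" if p: "p \<in> domain" for p
    using r1(2)[OF l(1,2) p]
    by (simp add: lN'[OF subsetD[OF dV p]] R_def[symmetric] N'_def e_def[symmetric] algebra_simps)
  have Z0: "Z N' p = 0" if p: "p \<in> domain" "wallf p = 0" for p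
  proof -
    have pV: "p \<in> V" using p dV by blast
    have e1: "e p = 1" by (simp add: e_def p)
    have N'eq: "N' p = N p" by (simp add: N'_def e1)
    have dN'eq: "dd N' v p = dd N v p - M p * (\<xi> p \<bullet> fst v + snd v * \<zeta> p)" for v
      by (simp add: dN'[OF pV] e1 dd_wallf)
    have sh: "\<xi> p \<bullet> sharp (fst p) (\<xi> p) = X p" by (simp add: X_def Xn_def)
    have Np: "0 < N p" using pos[OF p(1)] .
    have "Z N' p = Z N p - M p / N p * (X p * ((N p)\<^sup>2 * X p + (\<zeta> p)\<^sup>2))"
      unfolding Z_def Let_def N'eq dN'eq X_def[symmetric] using Np
      by (simp add: sh field_simps power2_eq_square)
    also have "M p / N p * (X p * ((N p)\<^sup>2 * X p + (\<zeta> p)\<^sup>2)) = Z N p"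
      using Np dpos[OF pV] p(2) by (auto simp: M_def d_def)
    finally show ?thesis by simp
  qed
  define W where "W = V \<inter> N' -` {0<..}"
  have "open W" unfolding W_def
    using continuous_open_preimage[OF smooth_on_cont[OF sN'] \<open>open V\<close>] by simp
  then have sW: "smooth_on W N'" using smooth_on_subset[OF sN'] by (simp add: W_def)
  have "domain \<subseteq> W" using dV N'pos by (auto simp: W_def simp del: split_paired_All)
  moreover have "0 < N' p" if "p \<in> W" for p using that by (simp add: W_def)
  ultimately show ?thesis by (rule that[OF _ sW _ super' Z0])
qed

end

section \<open>The concordance over a moving disk\<close>

lemma smooth_real_deriv:
  fixes f :: "real \<Rightarrow> real"
  assumes "smooth f"
  shows "(f has_real_derivative dd f 1 t) (at t)"
proof -
  have "dd f v t = dd f 1 t * v" for v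
    using linear_scale[OF has_derivative_linear[OF smooth_on_deriv[OF assms UNIV_I]], of v 1] by simp
  then have "(\<lambda>v. dd f v t) = (*) (dd f 1 t)" by blast
  then show ?thesis
    using smooth_on_deriv[OF assms UNIV_I, of t] unfolding has_field_derivative_def by metis
qed

lemma Basis_prod2: "(Basis :: ((real^2) \<times> real) set) = {(axis 1 1, 0), (axis 2 1, 0), (0, 1)}"
  by (auto simp: Basis_prod_def Basis_vec2)

context moving_wall
begin

text \<open>Time [0, 3] of the moving disk is rescaled to the interval [0, 1] of the cylinder;
  \<kappa> gives the centre and \<open>b\<close> the Euclidean radius.\<close>

definition \<kappa> :: "real \<Rightarrow> real" where "\<kappa> t = k (3 * t)"
definition b :: "real \<Rightarrow> real" where "b t = sqrt (2 * S (3 * t))"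
definition \<kappa>1 where "\<kappa>1 = dd \<kappa> 1"
definition \<kappa>2 where "\<kappa>2 = dd \<kappa>1 1"
definition \<kappa>3 where "\<kappa>3 = dd \<kappa>2 1"
definition b1 where "b1 = dd b 1"
definition b2 where "b2 = dd b1 1"
definition b3 where "b3 = dd b2 1"

lemma b_pos: "0 < b t" and b_sq: "b t * b t = 2 * S (3 * t)"
  using Spos[of "3 * t"] by (auto simp: b_def)

lemma smooth_rescale: "smooth f \<Longrightarrow> smooth (\<lambda>t::real. f (3 * t))"
  by (erule smooth_on_compose_real) (auto intro!: smooth_on_linear bounded_linear_mult_right)

lemma smooth_\<kappa>: "smooth \<kappa>" and smooth_b: "smooth b"
  unfolding \<kappa>_def b_def
  by (rule smooth_rescale[OF ksmooth],
      rule smooth_on_sqrt[OF smooth_on_mult[OF smooth_on_const smooth_rescale[OF Ssmooth]]])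
    (use Spos in auto)

lemma time_derivs:
  "(\<kappa> has_real_derivative \<kappa>1 t) (at t)" "(\<kappa>1 has_real_derivative \<kappa>2 t) (at t)"
  "(\<kappa>2 has_real_derivative \<kappa>3 t) (at t)" "(b has_real_derivative b1 t) (at t)"
  "(b1 has_real_derivative b2 t) (at t)" "(b2 has_real_derivative b3 t) (at t)"
  "smooth \<kappa>1" "smooth b1"
  unfolding \<kappa>3_def \<kappa>2_def \<kappa>1_def b3_def b2_def b1_def
  by (intro smooth_real_deriv smooth_on_dd smooth_\<kappa> smooth_b)+

definition \<Phi> :: "(real^2) \<times> real \<Rightarrow> (real^2) \<times> real" where
  "\<Phi> q = (\<kappa> (snd q) *\<^sub>R P + b (snd q) *\<^sub>R fst q, 3 * snd q)"

definition \<Phi>A where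
  "\<Phi>A q v = (b (snd q) *\<^sub>R fst v + snd v *\<^sub>R (\<kappa>1 (snd q) *\<^sub>R P + b1 (snd q) *\<^sub>R fst q), 3 * snd v)"

definition \<Phi>H where
  "\<Phi>H q u v = (b1 (snd q) *\<^sub>R (snd u *\<^sub>R fst v + snd v *\<^sub>R fst u)
     + (snd u * snd v) *\<^sub>R (\<kappa>2 (snd q) *\<^sub>R P + b2 (snd q) *\<^sub>R fst q), 0)"

definition \<Phi>T where
  "\<Phi>T q w u v = (b2 (snd q) *\<^sub>R (snd w *\<^sub>R (snd u *\<^sub>R fst v + snd v *\<^sub>R fst u) + (snd u * snd v) *\<^sub>R fst w)
     + (snd w * snd u * snd v) *\<^sub>R (\<kappa>3 (snd q) *\<^sub>R P + b3 (snd q) *\<^sub>R fst q), 0)"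

definition \<Phi>B where
  "\<Phi>B q w = ((1 / b (snd q)) *\<^sub>R (fst w - (snd w / 3) *\<^sub>R (\<kappa>1 (snd q) *\<^sub>R P + b1 (snd q) *\<^sub>R fst q)), snd w / 3)"

lemmas compose_time = compose_snd[OF time_derivs(1)] compose_snd[OF time_derivs(2)]
  compose_snd[OF time_derivs(3)] compose_snd[OF time_derivs(4)] compose_snd[OF time_derivs(5)]
  compose_snd[OF time_derivs(6)]

lemma \<Phi>_derivs:
  "(\<Phi> has_derivative \<Phi>A q) (at q)"
  "((\<lambda>q. \<Phi>A q v) has_derivative (\<lambda>u. \<Phi>H q u v)) (at q)"
  "((\<lambda>q. \<Phi>H q u v) has_derivative (\<lambda>w. \<Phi>T q w u v)) (at q)"
proof -
  have "(\<Phi> has_derivative (\<lambda>v. ((\<kappa>1 (snd q) * snd v) *\<^sub>R P + (b (snd q) *\<^sub>R fst v + (b1 (snd q) * snd v) *\<^sub>R fst q), 3 * snd v))) (at q)"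
    unfolding \<Phi>_def
    by (intro has_derivative_Pair has_derivative_add has_derivative_scaleR_left has_derivative_scaleR
      compose_time has_derivative_fst has_derivative_snd has_derivative_ident has_derivative_mult_right)
  then show "(\<Phi> has_derivative \<Phi>A q) (at q)"
    by (rule has_derivative_eq_rhs) (simp add: \<Phi>A_def fun_eq_iff algebra_simps)
  have "((\<lambda>q. \<Phi>A q v) has_derivative (\<lambda>u. ((b1 (snd q) * snd u) *\<^sub>R fst v + snd v *\<^sub>R ((\<kappa>2 (snd q) * snd u) *\<^sub>R P +
      (b1 (snd q) *\<^sub>R fst u + (b2 (snd q) * snd u) *\<^sub>R fst q)), 0))) (at q)"
    unfolding \<Phi>A_def
    by (intro has_derivative_Pair has_derivative_add has_derivative_scaleR_left has_derivative_scaleR_right has_derivative_scaleR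
      compose_time has_derivative_fst has_derivative_ident has_derivative_const)
  then show "((\<lambda>q. \<Phi>A q v) has_derivative (\<lambda>u. \<Phi>H q u v)) (at q)"
    by (rule has_derivative_eq_rhs) (simp add: \<Phi>H_def fun_eq_iff algebra_simps)
  have "((\<lambda>q. \<Phi>H q u v) has_derivative (\<lambda>w. ((b2 (snd q) * snd w) *\<^sub>R (snd u *\<^sub>R fst v + snd v *\<^sub>R fst u)
     + (snd u * snd v) *\<^sub>R ((\<kappa>3 (snd q) * snd w) *\<^sub>R P + (b2 (snd q) *\<^sub>R fst w + (b3 (snd q) * snd w) *\<^sub>R fst q)), 0))) (at q)"
    unfolding \<Phi>H_def
    by (intro has_derivative_Pair has_derivative_add has_derivative_scaleR_left has_derivative_scaleR_right has_derivative_scaleR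
      compose_time has_derivative_fst has_derivative_ident has_derivative_const)
  then show "((\<lambda>q. \<Phi>H q u v) has_derivative (\<lambda>w. \<Phi>T q w u v)) (at q)"
    by (rule has_derivative_eq_rhs) (simp add: \<Phi>T_def fun_eq_iff algebra_simps)
qed

lemma \<Phi>_smooth: "smooth (\<lambda>q. fst (\<Phi> q) $ i)" "smooth (\<lambda>q. snd (\<Phi> q))"
  and \<Phi>A_smooth: "smooth (\<lambda>q. fst (\<Phi>A q v) $ i)"
proof -
  note sm = smooth_on_snd_comp[OF smooth_\<kappa> open_UNIV] smooth_on_snd_comp[OF smooth_b open_UNIV]
    smooth_on_snd_comp[OF time_derivs(7) open_UNIV] smooth_on_snd_comp[OF time_derivs(8) open_UNIV]
    smooth_on_fst_comp[of "\<lambda>x. x $ i" UNIV, OF smooth_on_nth[OF open_UNIV] open_UNIV]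
  show "smooth (\<lambda>q. fst (\<Phi> q) $ i)" "smooth (\<lambda>q. fst (\<Phi>A q v) $ i)"
    unfolding \<Phi>_def \<Phi>A_def by (simp_all, (intro smooth_intros sm; simp)+)
  show "smooth (\<lambda>q. snd (\<Phi> q))"
    unfolding \<Phi>_def by (simp, intro smooth_intros smooth_on_linear bounded_linear_snd) auto
qed

lemma smooth_comp_\<Phi>:
  assumes f: "smooth_on W f" and U: "open U" "\<And>q. q \<in> U \<Longrightarrow> \<Phi> q \<in> W"
  shows "smooth_on U (\<lambda>q. f (\<Phi> q))"
  by (rule smooth_on_compose[OF f U(1) _ U(2)])
    (auto simp: Basis_prod2 inner_prod_def inner_vec2 intro!: smooth_on_subset[OF _ U(1)] \<Phi>_smooth)

lemma open_\<Phi>: "open W \<Longrightarrow> open (\<Phi> -` W)"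
  using has_derivative_continuous[OF \<Phi>_derivs(1)]
  by (intro open_vimage) (simp_all add: continuous_at_imp_continuous_on)

lemma \<xi>_\<Phi>: "\<xi> (\<Phi> q) = b (snd q) *\<^sub>R fst q"
  by (simp add: \<xi>_def \<Phi>_def \<kappa>_def)

lemma wallf_\<Phi>: "wallf (\<Phi> q) = S (3 * snd q) * (fst q \<bullet> fst q - 1)"
  using b_sq[of "snd q"] by (simp add: wallf_def \<xi>_\<Phi>) (simp add: \<Phi>_def algebra_simps)

lemma domain_\<Phi>: "q \<in> disk \<times> {0..1} \<Longrightarrow> \<Phi> q \<in> domain"
proof -
  assume q: "q \<in> disk \<times> {0..1}"
  then have "norm (fst q) \<le> 1" "snd q \<in> {0..1}" by (auto simp: mem_Times_iff)
  then have "fst q \<bullet> fst q \<le> 1" by (simp add: dot_square_norm power_le_one)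
  then have "wallf (\<Phi> q) \<le> 0"
    unfolding wallf_\<Phi> using Spos[of "3 * snd q"] by (intro mult_nonneg_nonpos) auto
  then show ?thesis using q by (auto simp: domain_def) (auto simp: \<Phi>_def)
qed

lemma coordinate_change_\<Phi>:
  assumes lc: "levi_civita V g Gam" and U: "open U" "\<And>q. q \<in> U \<Longrightarrow> \<Phi> q \<in> V"
  shows "coordinate_change U V g Gam \<Phi> \<Phi>A \<Phi>B \<Phi>H \<Phi>T"
proof (rule coordinate_change.intro)
  fix q v w u :: "(real^2) \<times> real"
  have b0: "b (snd q) \<noteq> 0" using b_pos[of "snd q"] by simp
  show "(\<Phi> has_derivative \<Phi>A q) (at q)" "((\<lambda>q. \<Phi>A q v) has_derivative (\<lambda>u. \<Phi>H q u v)) (at q)"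
    "((\<lambda>q. \<Phi>H q u v) has_derivative (\<lambda>w. \<Phi>T q w u v)) (at q)" by (rule \<Phi>_derivs)+
  show "\<Phi>H q u v = \<Phi>H q v u" "\<Phi>T q u v w = \<Phi>T q v u w"
    by (simp_all add: \<Phi>H_def \<Phi>T_def algebra_simps)
  show "linear (\<Phi>B q)"
    by (rule linearI) (simp_all add: \<Phi>B_def prod_eq_iff algebra_simps add_divide_distrib)
  show "\<Phi>B q (\<Phi>A q v) = v" "\<Phi>A q (\<Phi>B q v) = v"
    using b0 by (simp_all add: \<Phi>A_def \<Phi>B_def prod_eq_iff)
  have "(\<lambda>q. b1 (snd q)) differentiable (at q)" "(\<lambda>q. \<kappa>1 (snd q)) differentiable (at q)"
    unfolding differentiable_def using compose_time(2,5) by blast+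
  moreover have "fst differentiable (at q)"
    unfolding differentiable_def using has_derivative_fst[OF has_derivative_ident] by blast
  moreover have "(\<lambda>q. 1 / b (snd q)) differentiable (at q)"
    unfolding differentiable_def
    using has_derivative_divide[OF has_derivative_const compose_time(4) b0] by blast
  ultimately have "(\<lambda>q. ((1 / b (snd q)) *\<^sub>R (fst v - (snd v / 3) *\<^sub>R (\<kappa>1 (snd q) *\<^sub>R P + b1 (snd q) *\<^sub>R fst q)), snd v / 3)) differentiable (at q)"
    by (intro differentiable_Pair differentiable_scaleR differentiable_diff differentiable_add differentiable_const)
  then show "(\<lambda>q. \<Phi>B q v) differentiable (at q)" by (simp add: \<Phi>B_def)
qed (use lc U in auto)

text \<open>The static metric is pulled back to the fixed cylinder by \<Phi>. Here
  \<open>super\<close> becomes positivity of the scalar curvature and \<open>Z0\<close> minimality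
  of the wall, while \<open>stat\<close> makes the wall vertical at both ends, so that it meets the
  end slices orthogonally.\<close>

theorem concordance_metric:
  assumes N: "smooth_on W N" and dW: "domain \<subseteq> W" and pos: "\<And>p. p \<in> W \<Longrightarrow> 0 < N p"
    and super: "\<And>p. p \<in> domain \<Longrightarrow> lapl N p < scalar_curvature met (fst p) / 2 * N p"
    and Z0: "\<And>p. p \<in> domain \<Longrightarrow> wallf p = 0 \<Longrightarrow> Z N p = 0"
    and ends: "k 0 = 0" "k 3 = 1" "S 0 = 1 / 2" "S 3 = 1 / 2"
    and stat: "k1 0 = 0" "k1 3 = 0" "S1 0 = 0" "S1 3 = 0"
  obtains g where "riemannian_metric_on (disk \<times> {0..1}) g"
    "\<And>p. p \<in> disk \<times> {0..1} \<Longrightarrow> 0 < scalar_curvature g p"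
    "\<And>p. p \<in> sphere 0 1 \<times> {0..1} \<Longrightarrow> mean_curvature g wall_conormal p = 0"
    "\<And>x v w. g (x, 0) (v, 0) (w, 0) = met x v w" "\<And>x v w. g (x, 1) (v, 0) (w, 0) = met (P + x) v w"
    "free_boundary_minimal_slice g 0" "free_boundary_minimal_slice g 1"
proof -
  interpret w: warped UNIV met \<Gamma> W N "grad N" by (rule warped_plane[OF N pos])
  define U where "U = \<Phi> -` W"
  have U: "open U" unfolding U_def by (rule open_\<Phi>[OF w.openW])
  have UW: "\<Phi> q \<in> W" if "q \<in> U" for q using that by (simp add: U_def)
  interpret c: coordinate_change U W w.G w.\<Gamma>G \<Phi> \<Phi>A \<Phi>B \<Phi>H \<Phi>T
    by (rule coordinate_change_\<Phi>[OF w.levi_civitaG U UW])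
  have dU: "q \<in> U" if "q \<in> disk \<times> {0..1}" for q
    using domain_\<Phi>[OF that] dW by (auto simp: U_def)

  have riem: "riemannian_metric_on (disk \<times> {0..1}) c.g'"
    unfolding riemannian_metric_on_def
  proof (intro exI conjI allI ballI)
    show "disk \<times> {0..1} \<subseteq> U" using dU by blast
    fix v w :: "(real^2) \<times> real"
    have sE: "smooth_on U (\<lambda>q. f (fst (\<Phi> q)))" if "smooth f" for f
      using smooth_comp_\<Phi>[OF smooth_on_fst_comp[OF that open_UNIV] U] by simp
    show "smooth_on U (\<lambda>q. c.g' q v w)"
      unfolding c.g'_def w.G_def met_def
      by (intro smooth_intros sE smoothE smoothF smoothG smooth_comp_\<Phi>[OF N U UW] smooth_on_subset[OF \<Phi>A_smooth U])
        (auto simp: \<Phi>A_def U)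
  next
    fix q assume "q \<in> U"
    note i = c.inner'[OF this]
    show "bilinear (c.g' q)" by (rule inner_form_D(1)[OF i])
    show "c.g' q v w = c.g' q w v" for v w by (rule inner_form_D(2)[OF i])
    show "v \<noteq> 0 \<longrightarrow> 0 < c.g' q v v" for v using inner_form_D(3)[OF i] by blast
  qed

  have curv: "0 < scalar_curvature c.g' q" if q: "q \<in> disk \<times> {0..1}" for q
  proof -
    have W: "\<Phi> q \<in> W" using dU[OF q] UW by blast
    have "0 < N (\<Phi> q)" by (rule pos[OF W])
    moreover have "scalar_curvature w.G (\<Phi> q) = scalar_curvature met (fst (\<Phi> q)) - 2 * lapl N (\<Phi> q) / N (\<Phi> q)"
      by (rule scalar_curvature_warped[OF N pos W])
    ultimately have "0 < N (\<Phi> q) * scalar_curvature w.G (\<Phi> q)"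
      using super[OF domain_\<Phi>[OF q]] by (simp add: field_simps)
    then show ?thesis
      using \<open>0 < N (\<Phi> q)\<close> c.scalar_curvature'[OF dU[OF q]] by (simp add: zero_less_mult_iff)
  qed

  \<comment> \<open>A defining function of the wall whose pullback is exactly |x|^2/2, with
    differential \<open>wall_conormal\<close> at every point. The pullback of \<open>wallf\<close>
    has this differential only on the wall, and only up to the factor 2 S.\<close>
  define K where "K p = wallf p / (2 * S (snd p)) + 1 / 2" for p
  define r where "r p = 1 / (2 * S (snd p))" for p :: "(real^2) \<times> real"
  have K_eq: "K p = r p * wallf p + 1 / 2" for p by (simp add: K_def r_def)
  have rpos: "0 < r p" for p using Spos[of "snd p"] by (simp add: r_def)
  have sr: "smooth r"
    unfolding r_def using Spos
    by (intro smooth_on_divide smooth_on_mult smooth_on_snd_comp[OF Ssmooth] smooth_on_const)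
      (auto simp: less_imp_neq[THEN not_sym])
  note sF = smooth_wallf[OF open_UNIV]
  have sK: "smooth_on V K" if "open V" for V
    unfolding K_eq[abs_def]
    by (intro smooth_on_add smooth_on_mult smooth_on_subset[OF sr that] smooth_wallf smooth_on_const that) auto
  have dK: "dd K v p = r p * dd wallf v p + dd r v p * wallf p" for v p
  proof -
    have "((\<lambda>p. r p * wallf p + 1 / 2) has_derivative (\<lambda>v. r p * dd wallf v p + dd r v p * wallf p + 0)) (at p)"
      by (intro has_derivative_add has_derivative_mult has_derivative_const smooth_on_deriv[OF sr]
          smooth_on_deriv[OF sF] UNIV_I)
    then show ?thesis unfolding K_eq[abs_def] by (subst dd_eqI) auto
  qed
  have ddK: "dd (dd K w) v p = r p * dd (dd wallf w) v p + dd r v p * dd wallf w p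
      + dd r w p * dd wallf v p + dd (dd r w) v p * wallf p" for v w p
  proof -
    have "((\<lambda>p. r p * dd wallf w p + dd r w p * wallf p) has_derivative
       (\<lambda>v. (r p * dd (dd wallf w) v p + dd r v p * dd wallf w p) + (dd r w p * dd wallf v p + dd (dd r w) v p * wallf p))) (at p)"
      by (intro has_derivative_add has_derivative_mult smooth_on_deriv[OF sr] smooth_on_deriv[OF sF]
         smooth_on_deriv[OF smooth_on_dd[OF sr]] smooth_on_deriv[OF smooth_on_dd[OF sF]] UNIV_I)
    moreover have "dd K w = (\<lambda>p. r p * dd wallf w p + dd r w p * wallf p)" by (simp add: fun_eq_iff dK)
    ultimately have "(dd K w has_derivative
       (\<lambda>v. (r p * dd (dd wallf w) v p + dd r v p * dd wallf w p) + (dd r w p * dd wallf v p + dd (dd r w) v p * wallf p))) (at p)"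
      by simp
    then show ?thesis by (simp add: dd_eqI)
  qed
  have K_\<Phi>: "K (\<Phi> q) = (fst q \<bullet> fst q) / 2" for q
    using Spos[of "3 * snd q"] by (simp add: K_def wallf_\<Phi>) (simp add: \<Phi>_def field_simps)
  have nK: "wall_conormal q \<bullet> v = dd (\<lambda>q. K (\<Phi> q)) v q" for q v
  proof -
    have "((\<lambda>q. (1 / 2) * (fst q \<bullet> fst q)) has_derivative (\<lambda>v. (1 / 2) * (fst q \<bullet> fst v + fst v \<bullet> fst q))) (at q)"
      by (intro has_derivative_mult_right has_derivative_inner has_derivative_fst has_derivative_ident)
    then have "dd (\<lambda>q. (1 / 2) * (fst q \<bullet> fst q)) v q = fst q \<bullet> fst v"
      by (simp add: dd_eqI inner_commute)
    then show ?thesis by (simp add: K_\<Phi> wall_conormal_def inner_prod_def)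
  qed
  \<comment> \<open>The gradient of \<open>K\<close>: the factor \<open>r\<close> depends on time
    alone, so the spatial part is \<open>r\<close> times that of \<open>wallf\<close>.\<close>
  define qK where "qK p = (r p *\<^sub>R sharp (fst p) (\<xi> p), dd K (0, 1) p / (N p)\<^sup>2)" for p
  have dr0: "dd r (v, 0) p = 0" for v p
  proof -
    have "(r has_derivative (\<lambda>v. - (S1 (snd p) * snd v) / (2 * (S (snd p))\<^sup>2))) (at p)"
      unfolding r_def
      by (rule has_derivative_eq_rhs, rule has_derivative_divide[OF has_derivative_const
            has_derivative_mult_right[OF compose_snd[OF S1]]])
        (use Spos[of "snd p"] in \<open>auto simp: fun_eq_iff field_simps power2_eq_square\<close>)
    then show ?thesis by (simp add: dd_eqI)
  qed
  have qK: "w.G p (qK p) z = dd K z p" if "p \<in> W" for p z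
  proof -
    have "w.G p (qK p) z = r p * (\<xi> p \<bullet> fst z) + dd K (0, 1) p * snd z"
      using pos[OF that] by (simp add: w.G_def qK_def linear_scale[OF inner_form_D(5)[OF inner_form_met]] sharp_eq)
    also have "r p * (\<xi> p \<bullet> fst z) = dd K (fst z, 0) p" by (simp add: dK dd_wallf dr0)
    also have "dd K (fst z, 0) p + dd K (0, 1) p * snd z = dd K z p"
    proof -
      have lin: "linear (\<lambda>v. dd K v p)" by (rule has_derivative_linear[OF smooth_on_deriv[OF sK[OF open_UNIV] UNIV_I]])
      have "dd K ((fst z, 0) + snd z *\<^sub>R (0, 1)) p = dd K (fst z, 0) p + snd z * dd K (0, 1) p"
        unfolding linear_add[OF lin] linear_scale[OF lin] by simp
      then show ?thesis by (simp add: mult.commute)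
    qed
    finally show ?thesis .
  qed
  \<comment> \<open>The gradient of \<open>K\<close> may vanish on the axis \<xi> = 0, whereas the
    mean curvature formula wants it nonzero on an open set.\<close>
  define Wx where "Wx = W \<inter> {p. \<xi> p \<noteq> 0}"
  have "open {p. \<xi> p \<noteq> 0}"
  proof -
    have "continuous_on UNIV \<xi>"
      using has_derivative_continuous[OF \<xi>_deriv] by (simp add: continuous_at_imp_continuous_on)
    then show ?thesis using continuous_open_preimage[of UNIV \<xi> "- {0}"] by (simp add: vimage_def open_Compl)
  qed
  then have oWx: "open Wx" unfolding Wx_def using w.openW by blast
  define Ux where "Ux = \<Phi> -` Wx"
  have Ux: "open Ux" unfolding Ux_def by (rule open_\<Phi>[OF oWx])
  have lcx: "levi_civita Wx w.G w.\<Gamma>G"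
    by (rule levi_civita_subset[OF w.levi_civitaG oWx]) (simp add: Wx_def)
  interpret cx: coordinate_change Ux Wx w.G w.\<Gamma>G \<Phi> \<Phi>A \<Phi>B \<Phi>H \<Phi>T
    by (rule coordinate_change_\<Phi>[OF lcx Ux]) (simp add: Ux_def)
  have qK0: "qK p \<noteq> 0" if "p \<in> Wx" for p
  proof -
    have "\<xi> p \<noteq> 0" using that by (simp add: Wx_def)
    then have "met (fst p) (sharp (fst p) (\<xi> p)) (\<xi> p) \<noteq> 0" by (simp add: sharp_eq)
    then have "sharp (fst p) (\<xi> p) \<noteq> 0" using inner_form_D(8)[OF inner_form_met] by auto
    then show ?thesis using rpos[of p] by (simp add: qK_def prod_eq_iff)
  qed
  have qKd: "qK differentiable (at p)" if "p \<in> W" for p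
  proof (rule differentiable_smooth_components[OF _ that])
    fix c :: "(real^2) \<times> real" assume "c \<in> Basis"
    have "smooth_on W (\<lambda>p. r p * sharp (fst p) (\<xi> p) $ i)" for i
      by (intro smooth_on_mult smooth_on_subset[OF sr w.openW] smooth_sharp\<xi> w.openW) auto
    moreover have "smooth_on W (\<lambda>p. dd K (0, 1) p / (N p)\<^sup>2)"
      by (intro smooth_on_divide smooth_on_dd sK w.openW smooth_on_power N) (use pos in force)
    ultimately show "smooth_on W (\<lambda>p. qK p \<bullet> c)"
      using \<open>c \<in> Basis\<close> by (auto simp: qK_def Basis_prod2 inner_prod_def inner_vec2)
  qed
  have wall: "mean_curvature c.g' wall_conormal q = 0" if q: "q \<in> sphere 0 1 \<times> {0..1}" for q
  proof -
    have q': "q \<in> disk \<times> {0..1}" using q by auto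
    have f0: "fst q \<noteq> 0" "fst q \<bullet> fst q = 1" using q by (auto simp: mem_Times_iff dot_square_norm)
    have x0: "\<xi> (\<Phi> q) \<noteq> 0" using f0 b_pos[of "snd q"] by (simp add: \<xi>_\<Phi>)
    then have qU: "q \<in> Ux" using dU[OF q'] by (simp add: Ux_def Wx_def U_def)
    have wf: "wallf (\<Phi> q) = 0" by (simp add: wallf_\<Phi> f0)
    have W: "\<Phi> q \<in> W" using dU[OF q'] UW by blast
    obtain Q where Q: "orthonormal_set (w.G (\<Phi> q)) Q" "span Q = {v. dd wallf v (\<Phi> q) = 0}"
      "(\<Sum>e\<in>Q. hessian w.\<Gamma>G wallf (\<Phi> q) e e) = Z N (\<Phi> q) / ((\<zeta> (\<Phi> q))\<^sup>2 + (N (\<Phi> q))\<^sup>2 * Xn (fst (\<Phi> q)) (\<xi> (\<Phi> q)))"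
      using wall_trace[OF N pos W x0] by blast
    have sp: "span Q = {v. dd K v (\<Phi> q) = 0}"
      using Q(2) rpos[of "\<Phi> q"] by (simp add: dK wf)
    \<comment> \<open>On the wall the Hessian of \<open>K\<close> differs from \<open>r\<close>
      times that of \<open>wallf\<close> by terms containing \<open>wallf\<close> or the derivative
      of \<open>wallf\<close> along \<open>e\<close>; both vanish for tangent
      \<open>e\<close>.\<close>
    have "hessian w.\<Gamma>G K (\<Phi> q) e e = r (\<Phi> q) * hessian w.\<Gamma>G wallf (\<Phi> q) e e" if "e \<in> Q" for e
    proof -
      have "dd wallf e (\<Phi> q) = 0" using that Q(2) span_base by blast
      then show ?thesis by (simp add: hessian_def dK ddK wf algebra_simps)
    qed
    then have "(\<Sum>e\<in>Q. hessian w.\<Gamma>G K (\<Phi> q) e e) = r (\<Phi> q) * (\<Sum>e\<in>Q. hessian w.\<Gamma>G wallf (\<Phi> q) e e)"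
      by (simp add: sum_distrib_left)
    also have "\<dots> = 0" unfolding Q(3) using Z0[OF domain_\<Phi>[OF q'] wf] by simp
    finally have "mean_curvature cx.g' wall_conormal q = 0"
      using cx.mean_curvature'[where q=qK and F=K, OF sK[OF oWx] nK qK qK0 qKd qU Q(1) sp] by (simp add: Wx_def)
    then show ?thesis .
  qed

  \<comment> \<open>Slices are level sets of time. \<open>L\<close> pulls back to the time
    coordinate of the cylinder, whose differential is \<open>slice_conormal\<close>.\<close>
  define L where "L p = snd p / 3" for p :: "(real^2) \<times> real"
  have sL: "smooth_on V L" if "open V" for V
    unfolding L_def by (intro smooth_on_divide smooth_on_linear bounded_linear_snd smooth_on_const that) auto
  have dL: "dd L v = (\<lambda>p. snd v / 3)" for v
  proof (rule ext)
    fix p show "dd L v p = snd v / 3"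
      unfolding L_def[abs_def]
      by (rule dd_eqI[where D="\<lambda>v. snd v / 3"])
        (auto intro!: bounded_linear_imp_has_derivative bounded_linear_divide[THEN bounded_linear_compose] bounded_linear_snd)
  qed
  have L_\<Phi>: "(\<lambda>q. L (\<Phi> q)) = snd" by (simp add: L_def \<Phi>_def fun_eq_iff)
  have nL: "slice_conormal q \<bullet> v = dd (\<lambda>q. L (\<Phi> q)) v q" for q v
  proof -
    have "dd snd v q = snd v"
      by (rule dd_eqI[where D=snd]) (intro bounded_linear_imp_has_derivative bounded_linear_snd)
    then show ?thesis by (simp add: L_\<Phi> slice_conormal_def inner_prod_def)
  qed
  define qL where "qL p = (0 :: real^2, 1 / (3 * (N p)\<^sup>2))" for p
  have qL: "w.G p (qL p) z = dd L z p" if "p \<in> W" for p z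
    using pos[OF that] by (simp add: w.G_def qL_def dL inner_form_D(8)[OF inner_form_met])
  have qL0: "qL p \<noteq> 0" if "p \<in> W" for p
    using pos[OF that] by (simp add: qL_def prod_eq_iff)
  have qLd: "qL differentiable (at p)" if "p \<in> W" for p
  proof (rule differentiable_smooth_components[OF _ that])
    fix c :: "(real^2) \<times> real" assume "c \<in> Basis"
    have "smooth_on W (\<lambda>p. 1 / (3 * (N p)\<^sup>2))"
      by (intro smooth_on_divide smooth_on_mult smooth_on_power N smooth_on_const w.openW) (use pos in force)
    then show "smooth_on W (\<lambda>p. qL p \<bullet> c)"
      using \<open>c \<in> Basis\<close> w.openW by (auto simp: qL_def Basis_prod2 inner_prod_def inner_vec2)
  qed
  have slice: "free_boundary_minimal_slice c.g' s" if s: "s \<in> {0, 1}" for s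
    unfolding free_boundary_minimal_slice_def
  proof (intro conjI ballI)
    fix x :: "real^2" assume x: "x \<in> disk"
    have qU: "(x, s) \<in> U" using dU x s by auto
    have W: "\<Phi> (x, s) \<in> W" using UW[OF qU] .
    have "subspace {v. dd L v (\<Phi> (x, s)) = 0}"
      by (auto simp: dL subspace_def)
    then obtain Q where Q: "orthonormal_set (w.G (\<Phi> (x, s))) Q" "span Q = {v. dd L v (\<Phi> (x, s)) = 0}"
      using orthonormal_exists[OF w.inner_formG[OF W]] by blast
    \<comment> \<open>Two horizontal vectors produce no time component in the connection: every
      slice is totally geodesic.\<close>
    have "hessian w.\<Gamma>G L (\<Phi> (x, s)) e e = 0" if "e \<in> Q" for e
    proof -
      have "e \<in> span Q" using that by (rule span_base)
      then have "snd e = 0" unfolding Q(2) by (simp add: dL)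
      moreover have "dd (\<lambda>p. c) v q = 0" for c v and q :: "(real^2) \<times> real"
        by (rule dd_eqI[where D="\<lambda>v. 0"]) simp
      ultimately show ?thesis by (simp add: hessian_def dL w.\<Gamma>G_def w.\<beta>_def)
    qed
    then show "mean_curvature c.g' slice_conormal (x, s) = 0"
      using c.mean_curvature'[where q=qL and F=L, OF sL[OF w.openW] nL qL qL0 qLd qU Q] by simp
  next
    fix x :: "real^2" assume x: "x \<in> sphere 0 1"
    then have x': "x \<in> disk" by simp
    have qU: "(x, s) \<in> U" using dU x' s by auto
    define p where "p = \<Phi> (x, s)"
    have W: "p \<in> W" using UW[OF qU] by (simp add: p_def)
    have "x \<bullet> x = 1" "x \<noteq> 0" using x by (auto simp: dot_square_norm)
    then have "\<xi> p \<noteq> 0" using b_pos[of s] by (simp add: p_def \<xi>_\<Phi>)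
    with W have Wx: "p \<in> Wx" by (simp add: Wx_def)
    have "snd p = 0 \<or> snd p = 3" using s by (auto simp: p_def \<Phi>_def)
    then have z: "\<zeta> p = 0" "S1 (snd p) = 0" using stat by (auto simp: \<zeta>_def)
    have wf: "wallf p = 0" using \<open>x \<bullet> x = 1\<close> by (simp add: p_def wallf_\<Phi>)
    have uL: "unit_normal c.g' slice_conormal (x, s) = (1 / sqrt (w.G p (qL p) (qL p))) *\<^sub>R c.pull qL (x, s)"
      unfolding p_def by (rule c.unit_normal'[where x="(x, s)" and n=slice_conormal and q=qL and F=L, OF qU sL[OF w.openW] nL qL qL0]) (use W in \<open>simp_all add: p_def\<close>)
    have uK: "unit_normal c.g' wall_conormal (x, s) = (1 / sqrt (w.G p (qK p) (qK p))) *\<^sub>R c.pull qK (x, s)"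
      unfolding p_def by (rule c.unit_normal'[where x="(x, s)" and n=wall_conormal and q=qK and F=K, OF qU sK[OF w.openW] nK qK qK0]) (use W Wx in \<open>simp_all add: p_def\<close>)
    have "c.g' (x, s) (c.pull qL (x, s)) (c.pull qK (x, s)) = w.G p (qK p) (qL p)"
      using inner_form_D(2)[OF w.inner_formG[OF W], of "qL p"] by (simp add: c.g'_def c.A_pull[OF qU] p_def)
    also have "\<dots> = dd K (qL p) p" by (rule qK[OF W])
    also have "\<dots> = 0" by (simp add: dK wf dd_wallf z qL_def)
    finally show "c.g' (x, s) (unit_normal c.g' slice_conormal (x, s)) (unit_normal c.g' wall_conormal (x, s)) = 0"
      unfolding uL uK
      by (simp add: linear_scale[OF inner_form_D(4)[OF c.inner'[OF qU]]] linear_scale[OF inner_form_D(5)[OF c.inner'[OF qU]]])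
  qed
  have b01: "b 0 = 1" "b 1 = 1" using ends by (simp_all add: b_def)
  have g0: "c.g' (x, 0) (v, 0) (w, 0) = met x v w" and g1: "c.g' (x, 1) (v, 0) (w, 0) = met (P + x) v w" for x v w
    by (simp_all add: c.g'_def w.G_def \<Phi>_def \<Phi>A_def b01 \<kappa>_def ends)
  show ?thesis by (rule that[OF riem curv wall g0 g1 slice slice]) simp_all
qed

end

section \<open>Choice of the parameters\<close>

lemma cont_smooth: "smooth f \<Longrightarrow> continuous_on S f"
  using smooth_on_cont continuous_on_subset by blast

lemma norm_vec2: "(norm (v::real^2))\<^sup>2 = (v$1)\<^sup>2 + (v$2)\<^sup>2"
  by (simp add: norm_eq_sqrt_inner inner_vec2 power2_eq_square)

lemma norm_J [simp]: "norm (J v) = norm v"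
  by (simp add: norm_eq_sqrt_inner inner_vec2)

context plane_metric
begin

text \<open>\<xi> and J \<xi> are Euclidean orthogonal of equal length, so the sum is the Euclidean
  trace of the inverse matrix times the squared length.\<close>

lemma Xn_J: "Xn x \<xi> + Xn x (J \<xi>) = (E x + G x) / D x * (norm \<xi>)\<^sup>2"
  by (simp add: Xn_eq norm_vec2 add_divide_distrib[symmetric] algebra_simps)

lemma Xn_nonneg: "0 \<le> Xn x \<xi>"
  using Xn_pos[of \<xi> x] by (cases "\<xi> = 0") (auto simp: Xn_def)

lemma Xn_upper: "Xn x \<xi> \<le> (E x + G x) / D x * (norm \<xi>)\<^sup>2"
  using Xn_J[of x \<xi>] Xn_nonneg[of x "J \<xi>"] by simp

text \<open>Cayley-Hamilton for a symmetric 2 by 2 matrix A: tr(A) A - det(A) equals A^2, which is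
  nonnegative. Here A is the adjugate of the metric.\<close>

lemma Xn_lower: "(norm \<xi>)\<^sup>2 / (E x + G x) \<le> Xn x \<xi>"
proof -
  have T: "0 < E x + G x" using Epos Gpos by (simp add: add_pos_pos)
  have "(G x * (\<xi>$1)\<^sup>2 - 2 * F x * (\<xi>$1 * \<xi>$2) + E x * (\<xi>$2)\<^sup>2) * (E x + G x) - D x * (norm \<xi>)\<^sup>2
      = (G x * \<xi>$1 - F x * \<xi>$2)\<^sup>2 + (E x * \<xi>$2 - F x * \<xi>$1)\<^sup>2"
    unfolding D_def norm_vec2 by (simp add: power2_eq_square algebra_simps)
  then have "D x * (norm \<xi>)\<^sup>2 \<le> (G x * (\<xi>$1)\<^sup>2 - 2 * F x * (\<xi>$1 * \<xi>$2) + E x * (\<xi>$2)\<^sup>2) * (E x + G x)"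
    by (smt (verit) zero_le_power2)
  then show ?thesis
    using T Dpos[of x] by (simp add: Xn_eq field_simps)
qed

lemma sharp_sym: "sharp x l \<bullet> k = l \<bullet> sharp x k"
  by (simp add: sharp_def inner_vec2 algebra_simps add_divide_distrib diff_divide_distrib)

lemma Gamma_bound: "norm (\<Gamma> x v w) \<le> norm v * norm w * (\<Sum>b\<in>Basis. \<Sum>c\<in>Basis. norm (\<Gamma> x b c))"
proof -
  have "norm (\<Gamma> x v w) \<le> (\<Sum>b\<in>Basis. \<Sum>c\<in>Basis. norm (((v \<bullet> b) * (w \<bullet> c)) *\<^sub>R \<Gamma> x b c))"
    unfolding bilinear_Basis_expand[OF Gamma_bilin, of x v w]
    by (intro order_trans[OF norm_sum] sum_mono norm_sum)
  also have "\<dots> \<le> (\<Sum>b\<in>Basis. \<Sum>c\<in>Basis. norm v * norm w * norm (\<Gamma> x b c))"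
    by (intro sum_mono) (auto simp: abs_mult intro!: mult_right_mono mult_mono Basis_le_norm)
  finally show ?thesis by (simp add: sum_distrib_left)
qed

lemma cont_Gamma: "continuous_on S (\<lambda>x. \<Gamma> x v w)"
  using has_derivative_continuous[OF Gamma_deriv] by (simp add: continuous_at_imp_continuous_on)

text \<open>Up to errors from the Christoffel symbols, which carry one more factor |\<xi>|, the
  quantities \<open>Lr\<close> and \<open>Yn\<close> have the values (E + G) / D and |\<xi>|^2 / D.
  All constants come from continuity on the compact set.\<close>

lemma frame_bounds:
  assumes "compact K"
  obtains c C d where "0 < c" "0 < C" "0 < d"
    "\<And>x \<xi>. x \<in> K \<Longrightarrow> c * (norm \<xi>)\<^sup>2 \<le> Xn x \<xi> \<and> Xn x \<xi> \<le> C * (norm \<xi>)\<^sup>2"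
    "\<And>x \<xi>. x \<in> K \<Longrightarrow> (E x + G x) / D x - C * norm \<xi> \<le> Lr x \<xi>"
    "\<And>x \<xi>. x \<in> K \<Longrightarrow> \<bar>Lr x \<xi>\<bar> \<le> C * (1 + norm \<xi>)"
    "\<And>x \<xi>. x \<in> K \<Longrightarrow> (norm \<xi>)\<^sup>2 * (d - C * norm \<xi>) \<le> Yn x \<xi>"
    "\<And>x \<xi>. x \<in> K \<Longrightarrow> norm (sharp x \<xi>) \<le> C * norm \<xi>"
proof -
  define T where "T x = E x + G x" for x
  have T: "0 < T x" for x using Epos Gpos by (simp add: T_def add_pos_pos)
  have cE: "continuous_on K E" "continuous_on K F" "continuous_on K G" "continuous_on K D"
    by (intro cont_smooth smoothE smoothF smoothG smoothD)+
  have cT: "continuous_on K T" unfolding T_def by (intro continuous_intros cE)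
  define g where "g x = (\<Sum>b\<in>Basis. \<Sum>c\<in>Basis. norm (\<Gamma> x b c))" for x :: "real^2"
  have cg: "continuous_on K g" unfolding g_def by (intro continuous_intros cont_Gamma)
  have g0: "0 \<le> g x" for x by (simp add: g_def sum_nonneg)
  obtain C1 where C1: "0 < C1" "\<And>x. x \<in> K \<Longrightarrow> \<bar>T x\<bar> \<le> C1"
    by (rule compact_bounded_real[OF assms cT]) blast
  obtain C2 where C2: "0 < C2" "\<And>x. x \<in> K \<Longrightarrow> \<bar>T x / D x\<bar> \<le> C2"
    by (rule compact_bounded_real[OF assms continuous_on_divide[OF cT cE(4)]]) auto
  obtain C3 where C3: "0 < C3" "\<And>x. x \<in> K \<Longrightarrow> \<bar>g x / D x\<bar> \<le> C3"
    by (rule compact_bounded_real[OF assms continuous_on_divide[OF cg cE(4)]]) auto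
  obtain C4 where C4: "0 < C4" "\<And>x. x \<in> K \<Longrightarrow> \<bar>D x\<bar> \<le> C4"
    by (rule compact_bounded_real[OF assms cE(4)]) blast
  define q where "q x = (\<bar>G x\<bar> + 2 * \<bar>F x\<bar> + \<bar>E x\<bar>) * (g x + 1) / D x" for x
  have cq: "continuous_on K q" unfolding q_def by (intro continuous_intros cE cg) auto
  obtain C5 where C5: "0 < C5" "\<And>x. x \<in> K \<Longrightarrow> \<bar>q x\<bar> \<le> C5"
    by (rule compact_bounded_real[OF assms cq]) blast
  define C where "C = C2 + C3 + C5"
  have "0 < 1 / C1" "0 < C" "0 < 1 / C4" using C1 C2 C3 C4 C5 by (auto simp: C_def)
  moreover have "1 / C1 * (norm \<xi>)\<^sup>2 \<le> Xn x \<xi> \<and> Xn x \<xi> \<le> C * (norm \<xi>)\<^sup>2" if x: "x \<in> K" for x \<xi>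
  proof
    have "1 / C1 * (norm \<xi>)\<^sup>2 \<le> 1 / T x * (norm \<xi>)\<^sup>2"
      using C1(2)[OF x] T[of x] by (intro mult_right_mono divide_left_mono) auto
    also have "\<dots> \<le> Xn x \<xi>" using Xn_lower[of \<xi> x] by (simp add: T_def)
    finally show "1 / C1 * (norm \<xi>)\<^sup>2 \<le> Xn x \<xi>" .
    have "Xn x \<xi> \<le> T x / D x * (norm \<xi>)\<^sup>2" using Xn_upper by (simp add: T_def)
    also have "\<dots> \<le> C * (norm \<xi>)\<^sup>2"
      using abs_le_D1[OF C2(2)[OF x]] C3(1) C5(1) by (intro mult_right_mono) (auto simp: C_def)
    finally show "Xn x \<xi> \<le> C * (norm \<xi>)\<^sup>2" .
  qed
  moreover have Lr: "\<bar>Lr x \<xi> - T x / D x\<bar> \<le> C5 * norm \<xi>" if x: "x \<in> K" for x \<xi>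
  proof -
    define B where "B v w = \<xi> \<bullet> \<Gamma> x v w" for v w
    have Bb: "\<bar>B b c\<bar> \<le> norm \<xi> * g x" if "b \<in> Basis" "c \<in> Basis" for b c
    proof -
      have "\<bar>B b c\<bar> \<le> norm \<xi> * norm (\<Gamma> x b c)" unfolding B_def by (rule Cauchy_Schwarz_ineq2)
      also have "norm (\<Gamma> x b c) \<le> norm b * norm c * g x" unfolding g_def by (rule Gamma_bound)
      finally show ?thesis using that by (simp add: mult_left_mono)
    qed
    have ax: "axis 1 1 \<in> (Basis::(real^2) set)" "axis 2 1 \<in> (Basis::(real^2) set)" by (auto simp: Basis_vec2)
    have "Lr x \<xi> = trh x (\<bullet>) - trh x B"
      by (simp add: Lr_def Hr_def[abs_def] trh_def B_def inner_vec2 diff_divide_distrib[symmetric] algebra_simps)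
    moreover have "trh x (\<bullet>) = T x / D x" by (simp add: trh_def inner_vec2 T_def)
    moreover have "\<bar>trh x B\<bar> \<le> (\<bar>G x\<bar> * (norm \<xi> * g x) + \<bar>F x\<bar> * (norm \<xi> * g x + norm \<xi> * g x) + \<bar>E x\<bar> * (norm \<xi> * g x)) / D x"
    proof -
      have "\<bar>G x * B (axis 1 1) (axis 1 1) - F x * (B (axis 1 1) (axis 2 1) + B (axis 2 1) (axis 1 1)) + E x * B (axis 2 1) (axis 2 1)\<bar>
         \<le> \<bar>G x * B (axis 1 1) (axis 1 1)\<bar> + \<bar>F x * (B (axis 1 1) (axis 2 1) + B (axis 2 1) (axis 1 1))\<bar> + \<bar>E x * B (axis 2 1) (axis 2 1)\<bar>"
        by linarith
      also have "\<dots> \<le> \<bar>G x\<bar> * (norm \<xi> * g x) + \<bar>F x\<bar> * (norm \<xi> * g x + norm \<xi> * g x) + \<bar>E x\<bar> * (norm \<xi> * g x)"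
        unfolding abs_mult by (intro add_mono mult_left_mono order_trans[OF abs_triangle_ineq] Bb ax) auto
      finally show ?thesis using Dpos[of x] by (simp add: trh_def divide_right_mono)
    qed
    moreover have "(\<bar>G x\<bar> * (norm \<xi> * g x) + \<bar>F x\<bar> * (norm \<xi> * g x + norm \<xi> * g x) + \<bar>E x\<bar> * (norm \<xi> * g x)) / D x
       = (\<bar>G x\<bar> + 2 * \<bar>F x\<bar> + \<bar>E x\<bar>) * g x / D x * norm \<xi>"
      by (simp add: algebra_simps)
    moreover have "\<dots> \<le> q x * norm \<xi>"
      unfolding q_def using Dpos[of x] by (intro mult_right_mono divide_right_mono mult_left_mono) auto
    moreover have "q x * norm \<xi> \<le> C5 * norm \<xi>" using C5(2)[OF x] by (intro mult_right_mono) auto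
    ultimately show ?thesis by linarith
  qed
  moreover have "T x / D x - C * norm \<xi> \<le> Lr x \<xi>" if x: "x \<in> K" for x \<xi>
    using Lr[OF x, of \<xi>] mult_right_mono[of C5 C "norm \<xi>"] C2(1) C3(1) by (auto simp: C_def)
  moreover have "\<bar>Lr x \<xi>\<bar> \<le> C * (1 + norm \<xi>)" if x: "x \<in> K" for x \<xi>
  proof -
    have "\<bar>Lr x \<xi>\<bar> \<le> C5 * norm \<xi> + C2" using Lr[OF x, of \<xi>] C2(2)[OF x] by linarith
    also have "\<dots> \<le> C * norm \<xi> + C"
      using C2(1) C3(1) C5(1) by (intro add_mono mult_right_mono) (auto simp: C_def)
    finally show ?thesis by (simp add: algebra_simps)
  qed
  moreover have "(norm \<xi>)\<^sup>2 * (1 / C4 - C * norm \<xi>) \<le> Yn x \<xi>" if x: "x \<in> K" for x \<xi>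
  proof -
    have "\<bar>\<xi> \<bullet> \<Gamma> x (J \<xi>) (J \<xi>)\<bar> \<le> norm \<xi> * (norm (J \<xi>) * norm (J \<xi>) * g x)"
      unfolding g_def by (intro order_trans[OF Cauchy_Schwarz_ineq2] mult_left_mono Gamma_bound) auto
    then have "\<xi> \<bullet> \<Gamma> x (J \<xi>) (J \<xi>) / D x \<le> norm \<xi> * (norm \<xi> * norm \<xi> * g x) / D x"
      using Dpos[of x] by (intro divide_right_mono) auto
    also have "\<dots> = (norm \<xi>)\<^sup>2 * norm \<xi> * (g x / D x)" by (simp add: power2_eq_square)
    also have "\<dots> \<le> (norm \<xi>)\<^sup>2 * norm \<xi> * C"
      using abs_le_D1[OF C3(2)[OF x]] C2(1) C5(1) by (intro mult_left_mono) (auto simp: C_def)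
    finally have "\<xi> \<bullet> \<Gamma> x (J \<xi>) (J \<xi>) / D x \<le> (norm \<xi>)\<^sup>2 * norm \<xi> * C" .
    moreover have "(norm \<xi>)\<^sup>2 * (1 / C4) \<le> (norm \<xi>)\<^sup>2 * (1 / D x)"
      using C4(2)[OF x] Dpos[of x] by (intro mult_left_mono divide_left_mono) auto
    moreover have "Yn x \<xi> = (norm \<xi>)\<^sup>2 * (1 / D x) - \<xi> \<bullet> \<Gamma> x (J \<xi>) (J \<xi>) / D x"
      by (simp add: Yn_def Hr_def diff_divide_distrib dot_square_norm)
    ultimately show ?thesis by (simp add: algebra_simps)
  qed
  moreover have "norm (sharp x \<xi>) \<le> C * norm \<xi>" if x: "x \<in> K" for x \<xi>
  proof -
    have "norm (sharp x \<xi>) \<le> \<bar>sharp x \<xi> $ 1\<bar> + \<bar>sharp x \<xi> $ 2\<bar>"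
      using norm_le_l1_cart[of "sharp x \<xi>"] by (simp add: sum_2)
    also have "\<bar>sharp x \<xi> $ 1\<bar> \<le> (\<bar>G x\<bar> * norm \<xi> + \<bar>F x\<bar> * norm \<xi>) / D x"
      unfolding sharp_def using Dpos[of x]
      by (simp add: divide_right_mono) (intro divide_right_mono order_trans[OF abs_triangle_ineq4] add_mono;
        simp add: abs_mult mult_left_mono component_le_norm_cart)
    also have "\<bar>sharp x \<xi> $ 2\<bar> \<le> (\<bar>E x\<bar> * norm \<xi> + \<bar>F x\<bar> * norm \<xi>) / D x"
      unfolding sharp_def using Dpos[of x]
      by (simp add: divide_right_mono) (intro divide_right_mono order_trans[OF abs_triangle_ineq4] add_mono;
        simp add: abs_mult mult_left_mono component_le_norm_cart)
    also have "(\<bar>G x\<bar> * norm \<xi> + \<bar>F x\<bar> * norm \<xi>) / D x + (\<bar>E x\<bar> * norm \<xi> + \<bar>F x\<bar> * norm \<xi>) / D x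
       = (\<bar>G x\<bar> + 2 * \<bar>F x\<bar> + \<bar>E x\<bar>) * 1 / D x * norm \<xi>"
      by (simp add: add_divide_distrib[symmetric] algebra_simps)
    also have "\<dots> \<le> q x * norm \<xi>"
      unfolding q_def using Dpos[of x] g0[of x] by (intro mult_right_mono divide_right_mono mult_left_mono) auto
    also have "\<dots> \<le> C * norm \<xi>"
      using C5(2)[OF x] C2(1) C3(1) by (intro mult_right_mono) (auto simp: C_def)
    finally show ?thesis by simp
  qed
  ultimately show ?thesis using that[of "1 / C1" C "1 / C4"] by (simp add: T_def)
qed

lemma log_gradient_bound:
  assumes K: "compact K" and u: "smooth u" and pos: "\<And>x. x \<in> K \<Longrightarrow> 0 < u x"
  obtains C where "0 < C" "\<And>x \<xi>. x \<in> K \<Longrightarrow> \<bar>dd u (sharp x \<xi>) x / u x\<bar> \<le> C * norm \<xi>"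
proof -
  define du where "du x = (vector [dd u (axis 1 1) x, dd u (axis 2 1) x] :: real^2)" for x
  have lin: "linear (\<lambda>v. dd u v x)" for x using has_derivative_linear[OF smooth_on_deriv[OF u UNIV_I]] .
  have du: "dd u v x = du x \<bullet> v" for v x
    using linear_add[OF lin[of x], of "v$1 *\<^sub>R axis 1 1" "v$2 *\<^sub>R axis 2 1"]
      linear_scale[OF lin[of x], of "v$1" "axis 1 1"]
      linear_scale[OF lin[of x], of "v$2" "axis 2 1"] vec2_axis[of v]
    by (simp add: du_def inner_vec2 mult.commute)
  have cs: "continuous_on K (\<lambda>x. sharp x (du x) $ i)" for i
    by (intro cont_smooth smooth_sharp) (simp_all add: du_def smooth_on_dd[OF u])
  have "continuous_on K (\<lambda>x. (\<bar>sharp x (du x) $ 1\<bar> + \<bar>sharp x (du x) $ 2\<bar>) / u x)"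
    by (intro continuous_intros cs cont_smooth[OF u]) (use pos in force)
  from compact_bounded_real[OF K this]
  obtain C where C: "0 < C" "\<And>x. x \<in> K \<Longrightarrow> \<bar>(\<bar>sharp x (du x) $ 1\<bar> + \<bar>sharp x (du x) $ 2\<bar>) / u x\<bar> \<le> C"
    by blast
  have "\<bar>dd u (sharp x \<xi>) x / u x\<bar> \<le> C * norm \<xi>" if x: "x \<in> K" for x \<xi>
  proof -
    have "\<bar>dd u (sharp x \<xi>) x\<bar> \<le> norm (sharp x (du x)) * norm \<xi>"
      unfolding du sharp_sym[symmetric] by (rule Cauchy_Schwarz_ineq2)
    also have "\<dots> \<le> (\<bar>sharp x (du x) $ 1\<bar> + \<bar>sharp x (du x) $ 2\<bar>) * norm \<xi>"
      using norm_le_l1_cart[of "sharp x (du x)"] by (intro mult_right_mono) (simp_all add: sum_2)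
    finally have "\<bar>dd u (sharp x \<xi>) x\<bar> / u x \<le> (\<bar>sharp x (du x) $ 1\<bar> + \<bar>sharp x (du x) $ 2\<bar>) * norm \<xi> / u x"
      using pos[OF x] by (intro divide_right_mono) auto
    also have "\<dots> = (\<bar>sharp x (du x) $ 1\<bar> + \<bar>sharp x (du x) $ 2\<bar>) / u x * norm \<xi>" by simp
    also have "\<dots> \<le> C * norm \<xi>" using abs_le_D1[OF C(2)[OF x]] by (intro mult_right_mono) auto
    finally show ?thesis using pos[OF x] by simp
  qed
  with C(1) that show ?thesis by blast
qed

text \<open>Lower bounds for the coefficients of \<open>S1\<^sup>2\<close> and \<open>l\<^sup>2\<close> in \<open>Z N\<close> for \<open>N = l(t) * u\<close>.\<close>

definition lens_bounds :: "real^2 \<Rightarrow> (real^2 \<Rightarrow> real) \<Rightarrow> real \<Rightarrow> real \<Rightarrow> real \<Rightarrow> real \<Rightarrow> bool" where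
  "lens_bounds c u a m c3 m2 \<longleftrightarrow> (\<forall>x\<in>cball c 1. \<forall>s. x \<noteq> c \<longrightarrow> s = (norm (x - c))\<^sup>2 / 2 \<longrightarrow>
     (let \<xi> = x - c; X = Xn x \<xi>; g = dd u (sharp x \<xi>) x / u x in
       X * (a / s - m) \<le> Lr x \<xi> + 2 * g \<and> X * (c3 - m2 * s) \<le> (u x)\<^sup>2 * (Yn x \<xi> + X * g)))"

lemma lens_bounds_mono:
  assumes "lens_bounds c u a m c3 m2" "a' \<le> a" "m \<le> m'" "c3' \<le> c3" "m2 \<le> m2'"
  shows "lens_bounds c u a' m' c3' m2'"
  unfolding lens_bounds_def Let_def
proof (intro ballI allI impI conjI)
  fix x s assume x: "x \<in> cball c 1" "x \<noteq> c" and s: "s = (norm (x - c))\<^sup>2 / 2"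
  have s0: "0 < s" unfolding s using x by simp
  note b = assms(1)[unfolded lens_bounds_def Let_def, rule_format, OF x s]
  have "Xn x (x - c) * (a' / s - m') \<le> Xn x (x - c) * (a / s - m)"
    using assms s0 by (intro mult_left_mono Xn_nonneg diff_mono divide_right_mono) auto
  then show "Xn x (x - c) * (a' / s - m') \<le> Lr x (x - c) + 2 * (dd u (sharp x (x - c)) x / u x)"
    using b by linarith
  have "Xn x (x - c) * (c3' - m2' * s) \<le> Xn x (x - c) * (c3 - m2 * s)"
    using assms s0 by (intro mult_left_mono Xn_nonneg diff_mono mult_right_mono) auto
  then show "Xn x (x - c) * (c3' - m2' * s) \<le> (u x)\<^sup>2 * (Yn x (x - c) + Xn x (x - c) * (dd u (sharp x (x - c)) x / u x))"
    using b by linarith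
qed

text \<open>By \<open>Xn_J\<close> the trace of the inverse matrix exceeds its value in the
  direction \<xi> by the value in the direction J \<xi>, which is bounded below; this gap lets
  \<open>a\<close> exceed 1/2. Errors linear in |\<xi>| are absorbed into the quadratic terms with
  \<open>m\<close> and \<open>m2\<close>.\<close>

lemma lens_bounds_exist:
  assumes u: "smooth u" and pos: "\<And>x. x \<in> cball c 1 \<Longrightarrow> 0 < u x"
  obtains a m c3 m2 where "1 / 2 < a" "0 < m" "0 < c3" "0 < m2" "lens_bounds c u a m c3 m2"
proof -
  obtain l C d where f: "0 < l" "0 < C" "0 < d"
    "\<And>x \<xi>. x \<in> cball c 1 \<Longrightarrow> l * (norm \<xi>)\<^sup>2 \<le> Xn x \<xi> \<and> Xn x \<xi> \<le> C * (norm \<xi>)\<^sup>2"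
    "\<And>x \<xi>. x \<in> cball c 1 \<Longrightarrow> (E x + G x) / D x - C * norm \<xi> \<le> Lr x \<xi>"
    "\<And>x \<xi>. x \<in> cball c 1 \<Longrightarrow> (norm \<xi>)\<^sup>2 * (d - C * norm \<xi>) \<le> Yn x \<xi>"
    by (rule frame_bounds[OF compact_cball]) blast
  obtain B where B: "0 < B" "\<And>x \<xi>. x \<in> cball c 1 \<Longrightarrow> \<bar>dd u (sharp x \<xi>) x / u x\<bar> \<le> B * norm \<xi>"
    by (rule log_gradient_bound[OF compact_cball u pos]) auto
  obtain u1 where u1: "0 < u1" "\<And>x. x \<in> cball c 1 \<Longrightarrow> u1 \<le> u x"
    by (rule compact_positive_lower[OF compact_cball cont_smooth[OF u] pos]) auto
  obtain u2 where u2: "0 < u2" "\<And>x. x \<in> cball c 1 \<Longrightarrow> \<bar>u x\<bar> \<le> u2"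
    by (rule compact_bounded_real[OF compact_cball cont_smooth[OF u]]) auto
  define K where "K = C + 2 * B"
  \<comment> \<open>With s = |\<xi>|^2 / 2 and y = X / |\<xi>|^2 the term X a / s is 2 a y. Since y
    is at most C, the excess l / (4 C) costs at most l / 2, half of the gap between the trace and y;
    the other half absorbs the linear error.\<close>
  define a where "a = 1 / 2 + l / (4 * C)"
  define m where "m = (K / l)\<^sup>2"
  define \<alpha> where "\<alpha> = u1\<^sup>2 * d"
  define \<beta> where "\<beta> = u2\<^sup>2 * (C + C * B)"
  define c3 where "c3 = \<alpha> / (2 * C)"
  define m2 where "m2 = \<beta>\<^sup>2 / (\<alpha> * l)"
  have K: "0 < K" using f B by (simp add: K_def)
  have ab: "0 < \<alpha>" "0 < \<beta>"
    unfolding \<alpha>_def \<beta>_def using f(1-3) B(1) u1(1) u2(1)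
    by (auto intro!: mult_pos_pos add_pos_pos)
  have "lens_bounds c u a m c3 m2"
    unfolding lens_bounds_def Let_def
  proof (intro ballI allI impI conjI)
    fix x s assume x: "x \<in> cball c 1" and xc: "x \<noteq> c" and s: "s = (norm (x - c))\<^sup>2 / 2"
    define \<xi> where "\<xi> = x - c"
    define r where "r = norm \<xi>"
    define X where "X = Xn x \<xi>"
    define g where "g = dd u (sharp x \<xi>) x / u x"
    have r: "0 < r" using xc by (simp add: r_def \<xi>_def)
    have s': "s = r\<^sup>2 / 2" by (simp add: s r_def \<xi>_def)
    have X: "l * r\<^sup>2 \<le> X" "X \<le> C * r\<^sup>2" using f(4)[OF x, of \<xi>] by (auto simp: X_def r_def)
    have g: "\<bar>g\<bar> \<le> B * r" using B(2)[OF x] by (simp add: g_def r_def)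
    have J: "l * r\<^sup>2 \<le> (E x + G x) / D x * r\<^sup>2 - X"
      using f(4)[OF x, of "J \<xi>"] Xn_J[of x \<xi>] by (simp add: X_def r_def)
    define y where "y = X / r\<^sup>2"
    have yX: "X = y * r\<^sup>2" using r by (simp add: y_def)
    have "l * r\<^sup>2 \<le> ((E x + G x) / D x - y) * r\<^sup>2" using J by (simp only: yX left_diff_distrib)
    then have y: "l \<le> y" "y \<le> C" "X = y * r\<^sup>2" "l \<le> (E x + G x) / D x - y"
      using X r yX by auto
    have "X * (a / s - m) = 2 * a * y - m * X" using r by (simp add: s' y(3) field_simps)
    also have "\<dots> \<le> y + l / 2 - m * (l * r\<^sup>2)"
    proof -
      have "2 * a * y = y + l / (2 * C) * y" by (simp add: a_def field_simps)
      moreover have "l / (2 * C) * y \<le> l / (2 * C) * C" using y f by (intro mult_left_mono) auto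
      moreover have "l / (2 * C) * C = l / 2" using f by simp
      moreover have "m * (l * r\<^sup>2) \<le> m * X" using X by (simp add: m_def mult_left_mono)
      ultimately show ?thesis by linarith
    qed
    also have "\<dots> \<le> (E x + G x) / D x - l / 2 - m * (l * r\<^sup>2)" using y(4) by simp
    also have "\<dots> \<le> (E x + G x) / D x - K * r"
    proof -
      define w where "w = K * r / l"
      have "(w - 1)\<^sup>2 = w\<^sup>2 - 2 * w + 1" by (simp add: power2_eq_square algebra_simps)
      then have "w \<le> 1 / 2 + w\<^sup>2"
        using zero_le_power2[of "w - 1"] zero_le_power2[of w] by linarith
      then have "K * r / l \<le> 1 / 2 + (K / l)\<^sup>2 * r\<^sup>2"
        by (simp add: w_def power_mult_distrib power_divide)
      then have "l * (K * r / l) \<le> l * (1 / 2 + (K / l)\<^sup>2 * r\<^sup>2)" using f(1) by (intro mult_left_mono) auto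
      then show ?thesis using f(1) by (simp add: m_def algebra_simps)
    qed
    also have "\<dots> \<le> Lr x \<xi> + 2 * g"
      using f(5)[OF x, of \<xi>] g by (simp add: K_def r_def algebra_simps)
    finally show "Xn x (x - c) * (a / s - m) \<le> Lr x (x - c) + 2 * (dd u (sharp x (x - c)) x / u x)"
      by (simp add: X_def g_def \<xi>_def)
    have Xg: "- (C * r\<^sup>2 * (B * r)) \<le> X * g"
    proof -
      have "\<bar>X * g\<bar> \<le> C * r\<^sup>2 * (B * r)"
        unfolding abs_mult using X g f(1,2) by (intro mult_mono) (auto simp: X_def Xn_nonneg)
      then show ?thesis by linarith
    qed
    have ux: "u1\<^sup>2 \<le> (u x)\<^sup>2" "(u x)\<^sup>2 \<le> u2\<^sup>2"
      using u1 u2(2)[OF x] u1(2)[OF x] by (auto intro: power_mono simp: abs_le_square_iff[symmetric])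
    have "X * c3 \<le> C * r\<^sup>2 * c3" using X ab f by (intro mult_right_mono) (auto simp: c3_def)
    also have "\<dots> = r\<^sup>2 * (\<alpha> / 2)" using f by (simp add: c3_def)
    finally have 1: "X * c3 \<le> r\<^sup>2 * (\<alpha> / 2)" .
    have "l * r\<^sup>2 * (m2 * s) \<le> X * (m2 * s)" using X ab f by (intro mult_right_mono) (auto simp: m2_def s')
    moreover have "l * r\<^sup>2 * (m2 * s) = r\<^sup>2 * (\<beta>\<^sup>2 / (2 * \<alpha>) * r\<^sup>2)"
      using f ab by (simp add: m2_def s' field_simps)
    ultimately have 2: "r\<^sup>2 * (\<beta>\<^sup>2 / (2 * \<alpha>) * r\<^sup>2) \<le> X * (m2 * s)" by simp
    have "X * (c3 - m2 * s) \<le> r\<^sup>2 * (\<alpha> / 2 - \<beta>\<^sup>2 / (2 * \<alpha>) * r\<^sup>2)"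
      using 1 2 by (simp add: algebra_simps)
    also have "\<dots> \<le> r\<^sup>2 * (\<alpha> - \<beta> * r)"
    proof (rule mult_left_mono)
      have "0 \<le> (\<alpha> - \<beta> * r)\<^sup>2 / (2 * \<alpha>)" using ab by simp
      also have "(\<alpha> - \<beta> * r)\<^sup>2 / (2 * \<alpha>) = \<alpha> / 2 - \<beta> * r + \<beta>\<^sup>2 / (2 * \<alpha>) * r\<^sup>2"
        using ab by (simp add: power2_eq_square field_simps)
      finally show "\<alpha> / 2 - \<beta>\<^sup>2 / (2 * \<alpha>) * r\<^sup>2 \<le> \<alpha> - \<beta> * r" by simp
    qed simp
    also have "\<dots> \<le> (u x)\<^sup>2 * (r\<^sup>2 * d) - (u x)\<^sup>2 * (r\<^sup>2 * ((C + C * B) * r))"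
    proof -
      have "u1\<^sup>2 * (r\<^sup>2 * d) \<le> (u x)\<^sup>2 * (r\<^sup>2 * d)" using ux f by (intro mult_right_mono) auto
      moreover have "(u x)\<^sup>2 * (r\<^sup>2 * ((C + C * B) * r)) \<le> u2\<^sup>2 * (r\<^sup>2 * ((C + C * B) * r))"
        using ux f B r by (intro mult_right_mono) auto
      ultimately show ?thesis by (simp add: \<alpha>_def \<beta>_def algebra_simps)
    qed
    also have "\<dots> = (u x)\<^sup>2 * (r\<^sup>2 * (d - C * r) - C * r\<^sup>2 * (B * r))" by (simp add: algebra_simps)
    also have "\<dots> \<le> (u x)\<^sup>2 * (Yn x \<xi> + X * g)"
      using f(6)[OF x, of \<xi>] Xg by (intro mult_left_mono) (auto simp: r_def)
    finally show "Xn x (x - c) * (c3 - m2 * s) \<le> (u x)\<^sup>2 * (Yn x (x - c) + Xn x (x - c) * (dd u (sharp x (x - c)) x / u x))"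
      by (simp add: X_def g_def \<xi>_def)
  qed
  moreover have "1 / 2 < a" "0 < m" "0 < c3" "0 < m2"
    using f K ab by (auto simp: a_def m_def c3_def m2_def)
  ultimately show ?thesis using that by blast
qed

end

section \<open>Laplacians of functions of space and time\<close>

lemma frechet_derivative_cong_open:
  assumes "open U" "x \<in> U" "\<And>y. y \<in> U \<Longrightarrow> f y = g y"
  shows "frechet_derivative f (at x) = frechet_derivative g (at x)"
proof -
  have "(f has_derivative D) (at x) \<longleftrightarrow> (g has_derivative D) (at x)" for D
    using has_derivative_transform_within_open[of f D x UNIV U g]
      has_derivative_transform_within_open[of g D x UNIV U f] assms by auto
  then show ?thesis by (simp add: frechet_derivative_def)
qed

lemma dd_cong: "open U \<Longrightarrow> x \<in> U \<Longrightarrow> (\<And>y. y \<in> U \<Longrightarrow> f y = g y) \<Longrightarrow> dd f v x = dd g v x"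
  unfolding dd_def by (rule fun_cong[OF frechet_derivative_cong_open])

lemma dd_real: "(f has_real_derivative d) (at t) \<Longrightarrow> dd f 1 t = d"
  by (subst dd_eqI[of f "(*) d"]) (auto simp: has_field_derivative_def)

context plane_metric
begin

lemma hess_time:
  assumes a: "smooth a" and f: "smooth f"
  shows "hess \<Gamma> (\<lambda>p. a (snd p) * f p) p v w = a (snd p) * hess \<Gamma> f p v w"
proof -
  have der: "((\<lambda>p. a (snd p) * g p) has_derivative (\<lambda>v. a (snd p) * dd g v p + dd a 1 (snd p) * snd v * g p)) (at p)"
    if "smooth g" for g :: "(real^2) \<times> real \<Rightarrow> real" and p
  proof -
    have "((\<lambda>p::(real^2) \<times> real. a (snd p)) has_derivative (\<lambda>v. dd a 1 (snd p) * snd v)) (at p)"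
      using has_derivative_compose[of snd snd p UNIV a "(*) (dd a 1 (snd p))"] smooth_real_deriv[OF a, of "snd p"]
        has_derivative_snd[OF has_derivative_ident] by (auto simp: has_field_derivative_def)
    then show ?thesis by (intro has_derivative_mult smooth_on_deriv[OF that]) auto
  qed
  have 1: "dd (\<lambda>p. a (snd p) * g p) (w, 0) = (\<lambda>p. a (snd p) * dd g (w, 0) p)" if "smooth g" for g :: "(real^2) \<times> real \<Rightarrow> real" and w
    by (rule ext, subst dd_eqI[OF der[OF that]]) simp
  show ?thesis
    unfolding hess_def 1[OF f] 1[OF smooth_on_dd[OF f]] by (simp add: algebra_simps)
qed

lemma lapl_time:
  assumes "smooth a" "smooth f"
  shows "lapl (\<lambda>p. a (snd p) * f p) p = a (snd p) * lapl f p"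
  unfolding lapl_def trh_def hess_time[OF assms] by (simp add: algebra_simps)

lemma lapl_add:
  assumes f: "smooth f" and g: "smooth g"
  shows "lapl (\<lambda>p. f p + g p) p = lapl f p + lapl g p"
proof -
  have 1: "dd (\<lambda>p. f p + g p) v = (\<lambda>p. dd f v p + dd g v p)"
    if "smooth f" "smooth g" for f g :: "(real^2) \<times> real \<Rightarrow> real" and v
    by (rule ext, rule dd_eqI, rule has_derivative_add) (auto intro: smooth_on_deriv that)
  show ?thesis
    by (simp add: lapl_def trh_def hess_def 1[OF f g] 1[OF smooth_on_dd[OF f] smooth_on_dd[OF g]]
        add_divide_distrib[symmetric] algebra_simps)
qed

lemma dd_fst:
  assumes "smooth u" shows "dd (\<lambda>p. u (fst p)) v p = dd u (fst v) (fst p)"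
  by (rule dd_eqI, rule has_derivative_compose[OF has_derivative_fst[OF has_derivative_ident]])
    (rule smooth_on_deriv[OF assms UNIV_I])

lemma lapl_fst:
  assumes u: "smooth u"
  shows "lapl (\<lambda>p. u (fst p)) p = trh (fst p) (hessian \<Gamma> u (fst p))"
proof -
  have "dd (\<lambda>p. u (fst p)) v = (\<lambda>p. dd u (fst v) (fst p))" for v :: "(real^2) \<times> real"
    by (rule ext) (rule dd_fst[OF u])
  then show ?thesis
    by (simp add: lapl_def trh_def hess_def hessian_def dd_fst[OF u] dd_fst[OF smooth_on_dd[OF u]])
qed

lemma lapl_local:
  assumes "open U" "p \<in> U" "\<And>q. q \<in> U \<Longrightarrow> f q = g q" shows "lapl f p = lapl g p"
proof -
  have "dd f v q = dd g v q" if "q \<in> U" for v q by (rule dd_cong[OF assms(1) that assms(3)])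
  then have "hess \<Gamma> f p v w = hess \<Gamma> g p v w" for v w
    unfolding hess_def using dd_cong[OF assms(1,2), of "dd f (w, 0)" "dd g (w, 0)"] assms(2) by simp
  then show ?thesis by (simp add: lapl_def trh_def)
qed

end

section \<open>Positivity of the mean curvature of the wall before bending\<close>

context moving_wall
begin

lemma wall_norm: "wallf p = 0 \<Longrightarrow> (norm (\<xi> p))\<^sup>2 = 2 * S (snd p)"
  by (simp add: wallf_def dot_square_norm)

lemma wall_\<xi>0: "wallf p = 0 \<Longrightarrow> \<xi> p \<noteq> 0"
  using wall_norm[of p] Spos[of "snd p"] by auto

lemma product_dd:
  assumes O: "open O'" "p \<in> O'" "\<And>q. q \<in> O' \<Longrightarrow> N q = l (snd q) * n q"
    and n: "smooth n" and l: "(l has_real_derivative l') (at (snd p))"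
  shows "dd N v p = l (snd p) * dd n v p + l' * snd v * n p"
proof -
  have "((\<lambda>q. l (snd q) * n q) has_derivative (\<lambda>v. l (snd p) * dd n v p + l' * snd v * n p)) (at p)"
    by (intro has_derivative_mult compose_snd l smooth_on_deriv[OF n] UNIV_I)
  then have "dd (\<lambda>q. l (snd q) * n q) v p = l (snd p) * dd n v p + l' * snd v * n p" by (rule dd_eqI)
  then show ?thesis using dd_cong[OF O] by simp
qed

text \<open>With the centre at rest, \<zeta> is - S1. The prescribed logarithmic derivative of
  \<open>l\<close> turns the last term of \<open>Z\<close> into - S1^2 X (a / S - m), which the
  first half of \<open>lens_bounds\<close> outweighs. By the second half, what remains is at least X
  times the positive difference in \<open>ineq\<close>.\<close>

lemma Z_side:
  assumes O: "open O'" "p \<in> O'" "\<And>q. q \<in> O' \<Longrightarrow> N q = l (snd q) * u (fst q)"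
    and u: "smooth u" and l: "(l has_real_derivative l (snd p) * (m * S1 (snd p) - a * S1 (snd p) / S (snd p))) (at (snd p))"
    and lpos: "0 < l (snd p)" and upos: "0 < u (fst p)"
    and wall: "wallf p = 0" and S: "S (snd p) \<le> 1 / 2" and k0: "k1 (snd p) = 0" "k2 (snd p) = 0"
    and lens: "lens_bounds (k (snd p) *\<^sub>R P) u a m c3 m2"
    and ineq: "S2 (snd p) < (l (snd p))\<^sup>2 * (c3 - m2 * S (snd p))"
  shows "0 < Z N p"
proof -
  define t x X g L s where "t = snd p" and "x = fst p" and "X = Xn x (\<xi> p)"
    and "g = dd u (sharp x (\<xi> p)) x / u x" and "L = l t" and "s = S t"
  have s: "0 < s" using Spos by (simp add: s_def)
  have nx: "(norm (\<xi> p))\<^sup>2 = 2 * s" using wall_norm[OF wall] by (simp add: s_def t_def)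
  have xi: "\<xi> p = x - k t *\<^sub>R P" by (simp add: \<xi>_def x_def t_def)
  have "(norm (\<xi> p))\<^sup>2 \<le> 1" using nx S by (simp add: s_def t_def)
  then have "norm (\<xi> p) \<le> 1" by (simp add: power_le_one_iff)
  then have xb: "x \<in> cball (k t *\<^sub>R P) 1" by (simp add: xi dist_norm norm_minus_commute)
  have x0: "\<xi> p \<noteq> 0" by (rule wall_\<xi>0[OF wall])
  have X: "0 < X" unfolding X_def by (rule Xn_pos[OF x0])
  have ux: "0 < u x" using upos by (simp add: x_def)
  have L: "0 < L" using lpos by (simp add: L_def t_def)
  have "x \<noteq> k t *\<^sub>R P" "s = (norm (x - k t *\<^sub>R P))\<^sup>2 / 2" using x0 nx by (auto simp: xi)
  from lens[unfolded lens_bounds_def Let_def, folded t_def, rule_format, OF xb this]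
  have b1: "X * (a / s - m) \<le> Lr x (\<xi> p) + 2 * g"
    and b2: "X * (c3 - m2 * s) \<le> (u x)\<^sup>2 * (Yn x (\<xi> p) + X * g)"
    by (simp_all add: X_def g_def xi)
  have smu: "smooth (\<lambda>q::(real^2) \<times> real. u (fst q))" by (rule smooth_on_fst_comp[OF u open_UNIV])
  have dN: "dd N (v, b) p = L * dd u v x + L * (m * S1 t - a * S1 t / s) * b * u x" for v b
    using product_dd[OF O smu l, of "(v, b)"] dd_fst[OF u, of "(v, b)" p] by (simp add: L_def t_def x_def s_def)
  have Np: "N p = L * u x" using O(3)[OF O(2)] by (simp add: L_def t_def x_def)
  have z: "\<zeta> p = - S1 t" "Ftt p = - S2 t" using k0 by (simp_all add: \<zeta>_def Ftt_def t_def)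
  have gu: "dd u (sharp x (\<xi> p)) x = g * u x" using ux by (simp add: g_def)
  have d0: "dd u 0 x = 0" using linear_0[OF has_derivative_linear[OF smooth_on_deriv[OF u UNIV_I]]] .
  have "Z N p = L\<^sup>2 * ((u x)\<^sup>2 * (Yn x (\<xi> p) + X * g)) + (S1 t)\<^sup>2 * (Lr x (\<xi> p) + 2 * g - X * (a / s - m)) - X * S2 t"
    unfolding Z_def Let_def x_def[symmetric] X_def[symmetric] Np dN z gu
    using ux L s k0 d0 by (simp add: t_def[symmetric] gu field_simps power2_eq_square)
  also have "\<dots> \<ge> L\<^sup>2 * (X * (c3 - m2 * s)) + 0 - X * S2 t"
    using b1 b2 X by (intro diff_mono add_mono mult_left_mono mult_nonneg_nonneg) auto
  finally have "X * (L\<^sup>2 * (c3 - m2 * s) - S2 t) \<le> Z N p" by (simp add: algebra_simps)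
  moreover have "0 < X * (L\<^sup>2 * (c3 - m2 * s) - S2 t)"
    using X ineq by (simp add: L_def s_def t_def)
  ultimately show ?thesis by linarith
qed

text \<open>With S constant, \<zeta> is at most C^2 |\<xi>|, so all error terms are of order
  |\<xi>|^2 with constants independent of \<open>l\<close>. The terms quadratic in \<open>N\<close>
  are at least l^2 |\<xi>|^2 \<delta>^2 d / 2 for small |\<xi>| and win once \<open>l\<close> is
  large; \<open>large\<close> lists the five error constants.\<close>

lemma Z_neck:
  assumes O: "open O'" "p \<in> O'" "\<And>q. q \<in> O' \<Longrightarrow> N q = l (snd q) * n q"
    and n: "smooth n" and l: "(l has_real_derivative 0) (at (snd p))"
    and lpos: "0 < l (snd p)" and wall: "wallf p = 0" and S0: "S1 (snd p) = 0" "S2 (snd p) = 0"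
    and c: "0 < d" "0 < \<delta>" "\<delta> \<le> n p" "n p \<le> C" "\<bar>k1 (snd p)\<bar> \<le> C" "\<bar>k2 (snd p)\<bar> \<le> C" "\<bar>dd n (0, 1) p\<bar> \<le> C"
      "norm P \<le> C" "1 \<le> C"
      "\<bar>dd n (sharp (fst p) (\<xi> p), 0) p\<bar> \<le> C * norm (\<xi> p)" "norm (sharp (fst p) (\<xi> p)) \<le> C * norm (\<xi> p)"
      "\<bar>Lr (fst p) (\<xi> p)\<bar> \<le> C * (1 + norm (\<xi> p))" "Xn (fst p) (\<xi> p) \<le> C * (norm (\<xi> p))\<^sup>2"
      "(norm (\<xi> p))\<^sup>2 * (d - C * norm (\<xi> p)) \<le> Yn (fst p) (\<xi> p)"
    and small: "norm (\<xi> p) \<le> 1" "(C * \<delta>\<^sup>2 + C ^ 3) * norm (\<xi> p) \<le> \<delta>\<^sup>2 * d / 2" "C * norm (\<xi> p) \<le> d"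
    and large: "2 * C ^ 5 + 2 * C ^ 5 + 2 * C ^ 5 + 2 * C ^ 5 / \<delta> + C ^ 4 / \<delta> < (l (snd p))\<^sup>2 * (\<delta>\<^sup>2 * d / 2)"
  shows "0 < Z N p"
proof -
  define t x X Y r L D' e K1 where "t = snd p" and "x = fst p" and "X = Xn x (\<xi> p)" and "Y = Yn x (\<xi> p)"
    and "r = norm (\<xi> p)" and "L = l t" and "D' = dd n (sharp x (\<xi> p), 0) p" and "e = dd n (0, 1) p" and "K1 = k1 t"
  have r: "0 < r" "r \<le> 1" using wall_\<xi>0[OF wall] small(1) by (auto simp: r_def)
  have L: "0 < L" using lpos by (simp add: L_def t_def)
  have np: "0 < n p" using c by linarith
  have C0: "0 \<le> C" using c by linarith
  have Np: "N p = L * n p" using O(3)[OF O(2)] by (simp add: L_def t_def)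
  have dN: "dd N v p = L * dd n v p" for v using product_dd[OF O n l, of v] by (simp add: L_def t_def)
  have X: "0 \<le> X" "X \<le> C * r\<^sup>2" using c by (auto simp: X_def Xn_nonneg r_def x_def)
  have D': "\<bar>D'\<bar> \<le> C * r" using c by (simp add: D'_def r_def x_def)
  have z: "\<zeta> p = - (K1 * (\<xi> p \<bullet> P))" using S0 by (simp add: \<zeta>_def t_def K1_def)
  have xP: "\<bar>\<xi> p \<bullet> P\<bar> \<le> r * C"
    unfolding r_def by (intro order_trans[OF Cauchy_Schwarz_ineq2] mult_left_mono c) auto
  have zb: "\<bar>\<zeta> p\<bar> \<le> C\<^sup>2 * r"
  proof -
    have "\<bar>\<zeta> p\<bar> \<le> C * (r * C)" unfolding z abs_minus abs_mult using xP c(5) C0 by (intro mult_mono) (simp_all add: K1_def t_def)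
    then show ?thesis by (simp add: power2_eq_square mult_ac)
  qed
  have z2: "(\<zeta> p)\<^sup>2 \<le> C ^ 4 * r\<^sup>2"
    using power_mono[OF zb, of 2] by (simp add: power_mult_distrib flip: power_mult)
  have pow: "C ^ i \<le> C ^ j" if "i \<le> j" for i j using c(9) that by (rule power_increasing[rotated])
  have T0: "L\<^sup>2 * (r\<^sup>2 * (\<delta>\<^sup>2 * d / 2)) \<le> (N p)\<^sup>2 * Y + X * N p * (L * D')"
  proof -
    have dC: "0 \<le> d - C * r" using small by (simp add: r_def)
    have "\<delta>\<^sup>2 * (r\<^sup>2 * (d - C * r)) \<le> (n p)\<^sup>2 * (r\<^sup>2 * (d - C * r))"
      using c dC by (intro mult_right_mono power_mono) auto
    also have "\<dots> \<le> (n p)\<^sup>2 * Y" using c by (intro mult_left_mono) (auto simp: Y_def r_def x_def)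
    finally have 1: "\<delta>\<^sup>2 * (r\<^sup>2 * (d - C * r)) \<le> (n p)\<^sup>2 * Y" .
    have "\<bar>X * n p * D'\<bar> \<le> (C * r\<^sup>2) * C * (C * r)"
      unfolding abs_mult using X D' c np C0 by (intro mult_mono) auto
    then have 2: "- (r\<^sup>2 * (C ^ 3 * r)) \<le> X * n p * D'" by (simp add: power3_eq_cube mult_ac abs_le_iff)
    have "r\<^sup>2 * (\<delta>\<^sup>2 * d / 2) \<le> r\<^sup>2 * (\<delta>\<^sup>2 * d - (C * \<delta>\<^sup>2 + C ^ 3) * r)"
      using small(2) unfolding r_def by (intro mult_left_mono) (linarith, simp)
    also have "\<dots> \<le> (n p)\<^sup>2 * Y + X * n p * D'" using 1 2 by (simp add: algebra_simps)
    finally have "L\<^sup>2 * (r\<^sup>2 * (\<delta>\<^sup>2 * d / 2)) \<le> L\<^sup>2 * ((n p)\<^sup>2 * Y + X * n p * D')" by (intro mult_left_mono) auto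
    then show ?thesis by (simp add: Np power2_eq_square algebra_simps)
  qed
  have cK: "\<bar>K1\<bar> \<le> C" "\<bar>k2 t\<bar> \<le> C" and ce: "\<bar>e\<bar> \<le> C" using c(5,6,7) by (simp_all add: K1_def t_def e_def)
  have T1: "\<bar>(\<zeta> p)\<^sup>2 * Lr x (\<xi> p)\<bar> \<le> 2 * C ^ 5 * r\<^sup>2"
  proof -
    have "\<bar>Lr x (\<xi> p)\<bar> \<le> C * (1 + r)" using c by (simp add: x_def r_def)
    also have "\<dots> \<le> C * 2" using r C0 by (intro mult_left_mono) auto
    finally have "\<bar>(\<zeta> p)\<^sup>2 * Lr x (\<xi> p)\<bar> \<le> C ^ 4 * r\<^sup>2 * (C * 2)"
      unfolding abs_mult using z2 C0 by (intro mult_mono) auto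
    then show ?thesis by (simp add: eval_nat_numeral mult_ac)
  qed
  have T2: "\<bar>2 * \<zeta> p * K1 * (sharp x (\<xi> p) \<bullet> P)\<bar> \<le> 2 * C ^ 5 * r\<^sup>2"
  proof -
    have "\<bar>sharp x (\<xi> p) \<bullet> P\<bar> \<le> C * r * C"
      using c(8,11) C0 r by (intro order_trans[OF Cauchy_Schwarz_ineq2] mult_mono) (simp_all add: x_def r_def)
    then have "\<bar>2 * \<zeta> p * K1 * (sharp x (\<xi> p) \<bullet> P)\<bar> \<le> 2 * (C\<^sup>2 * r) * C * (C * r * C)"
      unfolding abs_mult using zb cK C0 r by (intro mult_mono) (simp_all add: mult_nonneg_nonneg)
    then show ?thesis by (simp add: eval_nat_numeral mult_ac)
  qed
  have T3: "\<bar>X * Ftt p\<bar> \<le> 2 * C ^ 5 * r\<^sup>2"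
  proof -
    have "\<bar>Ftt p\<bar> \<le> \<bar>K1\<^sup>2 * (P \<bullet> P)\<bar> + \<bar>k2 t * (\<xi> p \<bullet> P)\<bar>"
      using S0 unfolding Ftt_def K1_def t_def by (simp only: diff_zero abs_triangle_ineq4)
    also have "\<dots> \<le> C\<^sup>2 * C\<^sup>2 + C * (r * C)"
    proof (intro add_mono)
      have "K1\<^sup>2 \<le> C\<^sup>2" using cK C0 by (simp add: abs_le_square_iff[symmetric])
      moreover have "P \<bullet> P \<le> C\<^sup>2" using c(8) by (simp add: dot_square_norm power_mono)
      ultimately have "K1\<^sup>2 * (P \<bullet> P) \<le> C\<^sup>2 * C\<^sup>2" by (intro mult_mono) auto
      then show "\<bar>K1\<^sup>2 * (P \<bullet> P)\<bar> \<le> C\<^sup>2 * C\<^sup>2" by (simp only: abs_of_nonneg zero_le_power2 inner_ge_zero mult_nonneg_nonneg)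
      show "\<bar>k2 t * (\<xi> p \<bullet> P)\<bar> \<le> C * (r * C)"
        unfolding abs_mult using xP cK C0 by (intro mult_mono) simp_all
    qed
    finally have "\<bar>Ftt p\<bar> \<le> C\<^sup>2 * C\<^sup>2 + C * (r * C)" .
    moreover have "C * (r * C) \<le> C\<^sup>2" using r mult_right_mono[of r 1 "C * C"] by (simp add: power2_eq_square mult_ac)
    moreover have "C\<^sup>2 \<le> C ^ 4" by (rule pow) simp
    moreover have "C\<^sup>2 * C\<^sup>2 = C ^ 4" by (simp flip: power_add)
    ultimately have "\<bar>Ftt p\<bar> \<le> 2 * C ^ 4" by linarith
    then have "\<bar>X * Ftt p\<bar> \<le> (C * r\<^sup>2) * (2 * C ^ 4)"
      unfolding abs_mult using X by (intro mult_mono) auto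
    then show ?thesis by (simp add: eval_nat_numeral mult_ac)
  qed
  have r3: "r ^ 3 \<le> r\<^sup>2" using r by (intro power_decreasing) auto
  have T4: "\<bar>2 * (\<zeta> p)\<^sup>2 * (L * D') / (L * n p)\<bar> \<le> 2 * C ^ 5 / \<delta> * r\<^sup>2"
  proof -
    have "\<bar>2 * (\<zeta> p)\<^sup>2 * D'\<bar> \<le> 2 * (C ^ 4 * r\<^sup>2) * (C * r)"
      unfolding abs_mult using z2 D' by (intro mult_mono) auto
    also have "\<dots> = 2 * C ^ 5 * r ^ 3" by (simp add: eval_nat_numeral mult_ac)
    also have "\<dots> \<le> 2 * C ^ 5 * r\<^sup>2" using r3 C0 by (intro mult_left_mono) auto
    finally have "\<bar>2 * (\<zeta> p)\<^sup>2 * D'\<bar> / n p \<le> 2 * C ^ 5 * r\<^sup>2 / \<delta>"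
      using c np C0 by (intro frac_le) auto
    then show ?thesis using L np by (simp add: abs_mult)
  qed
  have T5: "\<bar>\<zeta> p * X * (L * e) / (L * n p)\<bar> \<le> C ^ 4 / \<delta> * r\<^sup>2"
  proof -
    have "\<bar>\<zeta> p * X * e\<bar> \<le> (C\<^sup>2 * r) * (C * r\<^sup>2) * C"
      unfolding abs_mult using zb X ce r C0 by (intro mult_mono) (simp_all add: mult_nonneg_nonneg)
    also have "\<dots> = C ^ 4 * r ^ 3" by (simp add: eval_nat_numeral mult_ac)
    also have "\<dots> \<le> C ^ 4 * r\<^sup>2" using r3 C0 by (intro mult_left_mono) auto
    finally have "\<bar>\<zeta> p * X * e\<bar> / n p \<le> C ^ 4 * r\<^sup>2 / \<delta>"
      using c np C0 by (intro frac_le) auto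
    then show ?thesis using L np by (simp add: abs_mult)
  qed
  have "Z N p = ((N p)\<^sup>2 * Y + X * N p * (L * D')) + (\<zeta> p)\<^sup>2 * Lr x (\<xi> p) + 2 * \<zeta> p * K1 * (sharp x (\<xi> p) \<bullet> P)
     + X * Ftt p + 2 * (\<zeta> p)\<^sup>2 * (L * D') / (L * n p) - \<zeta> p * X * (L * e) / (L * n p)"
    unfolding Z_def Let_def dN by (simp add: x_def X_def Y_def D'_def e_def K1_def t_def Np)
  also have "\<dots> \<ge> L\<^sup>2 * (r\<^sup>2 * (\<delta>\<^sup>2 * d / 2)) - 2 * C ^ 5 * r\<^sup>2 - 2 * C ^ 5 * r\<^sup>2 - 2 * C ^ 5 * r\<^sup>2
     - 2 * C ^ 5 / \<delta> * r\<^sup>2 - C ^ 4 / \<delta> * r\<^sup>2"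
    using T0 T1 T2 T3 T4 T5 unfolding abs_le_iff by linarith
  also have "L\<^sup>2 * (r\<^sup>2 * (\<delta>\<^sup>2 * d / 2)) - 2 * C ^ 5 * r\<^sup>2 - 2 * C ^ 5 * r\<^sup>2 - 2 * C ^ 5 * r\<^sup>2
     - 2 * C ^ 5 / \<delta> * r\<^sup>2 - C ^ 4 / \<delta> * r\<^sup>2 = r\<^sup>2 * (L\<^sup>2 * (\<delta>\<^sup>2 * d / 2) - (2 * C ^ 5 + 2 * C ^ 5 + 2 * C ^ 5 + 2 * C ^ 5 / \<delta> + C ^ 4 / \<delta>))"
    by (simp add: algebra_simps)
  finally have "r\<^sup>2 * (L\<^sup>2 * (\<delta>\<^sup>2 * d / 2) - (2 * C ^ 5 + 2 * C ^ 5 + 2 * C ^ 5 + 2 * C ^ 5 / \<delta> + C ^ 4 / \<delta>)) \<le> Z N p" .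
  moreover have "0 < r\<^sup>2 * (L\<^sup>2 * (\<delta>\<^sup>2 * d / 2) - (2 * C ^ 5 + 2 * C ^ 5 + 2 * C ^ 5 + 2 * C ^ 5 / \<delta> + C ^ 4 / \<delta>))"
    using r large by (simp add: L_def t_def)
  ultimately show ?thesis by linarith
qed

end

text \<open>A smooth stand-in for max 1 z, equal to it for z \<le> 1 and for z \<ge> 2.\<close>

definition \<Theta> :: "real \<Rightarrow> real" where "\<Theta> z = 1 + (z - 1) * step (z - 1)"

lemma smooth_ident: "smooth (\<lambda>x::real. x)"
  by (intro smooth_on_linear bounded_linear_ident) simp

lemma smooth_\<Theta>: "smooth \<Theta>"
  unfolding \<Theta>_def by (intro smooth_intros smooth_ident) auto

lemma \<Theta>_le1: "z \<le> 1 \<Longrightarrow> \<Theta> z = 1" and \<Theta>_ge2: "2 \<le> z \<Longrightarrow> \<Theta> z = z"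
  by (auto simp: \<Theta>_def step_le_0 step_ge_1)

lemma \<Theta>_ge1: "1 \<le> \<Theta> z"
  using step_nonneg[of "z - 1"] by (cases "z \<le> 1") (auto simp: \<Theta>_le1, simp add: \<Theta>_def)

lemma \<Theta>_le2: assumes "z \<le> 2" shows "\<Theta> z \<le> 2"
proof (cases "z \<le> 1")
  case False
  then have "(z - 1) * step (z - 1) \<le> 1 * 1"
    using assms step_nonneg step_le1 by (intro mult_mono) auto
  then show ?thesis by (simp add: \<Theta>_def)
qed (simp add: \<Theta>_le1)

definition \<Theta>1 :: "real \<Rightarrow> real" where "\<Theta>1 = dd \<Theta> 1"
definition \<Theta>2 :: "real \<Rightarrow> real" where "\<Theta>2 = dd \<Theta>1 1"

lemma \<Theta>_deriv: "(\<Theta> has_real_derivative \<Theta>1 z) (at z)" "(\<Theta>1 has_real_derivative \<Theta>2 z) (at z)"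
  unfolding \<Theta>2_def \<Theta>1_def by (intro smooth_real_deriv smooth_on_dd smooth_\<Theta>)+

lemma smooth_\<Theta>12: "smooth \<Theta>1" "smooth \<Theta>2"
  unfolding \<Theta>2_def \<Theta>1_def by (intro smooth_on_dd smooth_\<Theta>)+

lemma \<Theta>_deriv_low: assumes "z < 1" shows "\<Theta>1 z = 0" "\<Theta>2 z = 0"
proof -
  have 1: "\<Theta>1 y = 0" if "y < 1" for y
    unfolding \<Theta>1_def
    using dd_cong[of "{..<1}" y \<Theta> "\<lambda>_. 1" 1] that by (simp add: \<Theta>_le1 dd_real)
  then show "\<Theta>1 z = 0" using assms by blast
  show "\<Theta>2 z = 0"
    unfolding \<Theta>2_def using dd_cong[of "{..<1}" z \<Theta>1 "\<lambda>_. 0" 1] assms by (simp add: 1 dd_real)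
qed

lemma \<Theta>_deriv_high: assumes "2 < z" shows "\<Theta>1 z = 1" "\<Theta>2 z = 0"
proof -
  have 1: "\<Theta>1 y = 1" if "2 < y" for y
    unfolding \<Theta>1_def
    using dd_cong[of "{2<..}" y \<Theta> "\<lambda>z. z" 1] that by (simp add: \<Theta>_ge2 dd_real)
  then show "\<Theta>1 z = 1" using assms by blast
  show "\<Theta>2 z = 0"
    unfolding \<Theta>2_def using dd_cong[of "{2<..}" z \<Theta>1 "\<lambda>_. 1" 1] assms by (simp add: 1 dd_real)
qed

lemma \<Theta>_deriv_bound:
  obtains B where "0 < B" "\<And>z. z \<le> 2 \<Longrightarrow> \<bar>\<Theta>1 z\<bar> \<le> B" "\<And>z. z \<le> 2 \<Longrightarrow> \<bar>\<Theta>2 z\<bar> \<le> B"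
proof -
  have c: "continuous_on {0..2} \<Theta>1" "continuous_on {0..2} \<Theta>2"
    using smooth_\<Theta>12 smooth_on_cont continuous_on_subset by blast+
  obtain B1 where B1: "0 < B1" "\<And>z. z \<in> {0..2} \<Longrightarrow> \<bar>\<Theta>1 z\<bar> \<le> B1"
    by (rule compact_bounded_real[OF compact_Icc c(1)]) blast
  obtain B2 where B2: "0 < B2" "\<And>z. z \<in> {0..2} \<Longrightarrow> \<bar>\<Theta>2 z\<bar> \<le> B2"
    by (rule compact_bounded_real[OF compact_Icc c(2)]) blast
  have "\<bar>\<Theta>1 z\<bar> \<le> max B1 B2 \<and> \<bar>\<Theta>2 z\<bar> \<le> max B1 B2" if "z \<le> 2" for z
  proof (cases "z < 0")
    case False
    then show ?thesis using B1(2)[of z] B2(2)[of z] that by auto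
  qed (use B1 in \<open>simp add: \<Theta>_deriv_low\<close>)
  then show ?thesis using that[of "max B1 B2"] B1(1) by auto
qed

text \<open>Half the squared radius of the moving disk: it decreases from \<open>1 / 2\<close> to \<open>\<sigma>\<close>, stays there for
  \<open>1 \<le> t \<le> 2\<close>, and returns to \<open>1 / 2\<close> at time 3.\<close>

definition radius_fun :: "real \<Rightarrow> real \<Rightarrow> real" where
  "radius_fun \<sigma> t = \<sigma> * (\<Theta> ((1 / 2 - t\<^sup>2) / \<sigma>) + \<Theta> ((1 / 2 - (3 - t)\<^sup>2) / \<sigma>) - 1)"

lemma radius_fun:
  assumes \<sigma>: "0 < \<sigma>" "\<sigma> < 1 / 4"
  defines "S \<equiv> radius_fun \<sigma>" and "S1 \<equiv> dd (radius_fun \<sigma>) 1" and "S2 \<equiv> dd (dd (radius_fun \<sigma>) 1) 1"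
  shows "smooth S" "(S has_real_derivative S1 t) (at t)" "(S1 has_real_derivative S2 t) (at t)"
    "0 < S t" "S (3 - t) = S t" "S1 (3 - t) = - S1 t" "S2 (3 - t) = S2 t"
    "S 0 = 1 / 2" "S1 0 = 0"
    "0 \<le> t \<Longrightarrow> t \<le> 1 \<Longrightarrow> 2 * \<sigma> < 1 / 2 - t\<^sup>2 \<Longrightarrow> S t = 1 / 2 - t\<^sup>2 \<and> S2 t = - 2"
    "0 \<le> t \<Longrightarrow> t \<le> 1 \<Longrightarrow> 1 / 2 - t\<^sup>2 \<le> 2 * \<sigma> \<Longrightarrow> S t = \<sigma> * \<Theta> ((1 / 2 - t\<^sup>2) / \<sigma>) \<and>
       S2 t = 4 * t\<^sup>2 / \<sigma> * \<Theta>2 ((1 / 2 - t\<^sup>2) / \<sigma>) - 2 * \<Theta>1 ((1 / 2 - t\<^sup>2) / \<sigma>)"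
    "1 \<le> t \<Longrightarrow> t \<le> 2 \<Longrightarrow> S t = \<sigma> \<and> S1 t = 0 \<and> S2 t = 0"
proof -
  have sz: "smooth (\<lambda>t::real. \<Theta> ((1 / 2 - (c + d * t)\<^sup>2) / \<sigma>))" for c d
  proof (rule smooth_on_compose_real[OF smooth_\<Theta>])
    show "smooth (\<lambda>t::real. (1 / 2 - (c + d * t)\<^sup>2) / \<sigma>)"
      using \<sigma> by (intro smooth_on_divide smooth_intros smooth_ident) auto
  qed simp
  show sm: "smooth S"
    unfolding S_def radius_fun_def using sz[of 0 1] sz[of 3 "-1"]
    by (intro smooth_intros) auto
  show d1: "(S has_real_derivative S1 t) (at t)" for t
    unfolding S_def S1_def by (rule smooth_real_deriv[OF sm[unfolded S_def]])
  have sm1: "smooth S1" unfolding S1_def by (rule smooth_on_dd[OF sm[unfolded S_def]])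
  show d2: "(S1 has_real_derivative S2 t) (at t)" for t
    using smooth_real_deriv[OF sm1] unfolding S2_def S1_def .
  show "0 < S t"
    unfolding S_def radius_fun_def using \<sigma> \<Theta>_ge1[of "(1 / 2 - t\<^sup>2) / \<sigma>"] \<Theta>_ge1[of "(1 / 2 - (3 - t)\<^sup>2) / \<sigma>"]
    by (intro mult_pos_pos) auto
  show sym: "S (3 - t) = S t" for t by (simp add: S_def radius_fun_def)
  show sym1: "S1 (3 - t) = - S1 t" for t
  proof -
    have "((\<lambda>t. S (3 - t)) has_real_derivative - S1 (3 - t)) (at t)"
      using DERIV_chain2[OF d1 DERIV_diff[OF DERIV_const DERIV_ident], of 3 t] by simp
    then have "(S has_real_derivative - S1 (3 - t)) (at t)" by (simp add: sym)
    from DERIV_unique[OF this d1] show ?thesis by simp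
  qed
  show "S2 (3 - t) = S2 t" for t
  proof -
    have "((\<lambda>t. - S1 (3 - t)) has_real_derivative S2 (3 - t)) (at t)"
      using DERIV_minus[OF DERIV_chain2[OF d2 DERIV_diff[OF DERIV_const DERIV_ident], of 3 t]] by simp
    then have "(S1 has_real_derivative S2 (3 - t)) (at t)" by (simp add: sym1)
    from DERIV_unique[OF this d2] show ?thesis by simp
  qed
  define z where "z t = (1 / 2 - t\<^sup>2) / \<sigma>" for t :: real
  \<comment> \<open>For t < 11/5 the distance 3 - t exceeds 4/5, and (4/5)^2 > 1/2. So the second
    \<Theta> is 1 there and cancels the - 1; the other half of the time interval follows by the
    symmetry exchanging t and 3 - t.\<close>
  have Seq: "S t = \<sigma> * \<Theta> (z t)" if "t < 11/5" for t
  proof -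
    have "4 / 5 \<le> 3 - t" using that by simp
    then have "(4 / 5)\<^sup>2 \<le> (3 - t)\<^sup>2" by (intro power_mono) auto
    then have "1 / 2 - (3 - t)\<^sup>2 \<le> 0" by (simp add: power2_eq_square)
    then have "(1 / 2 - (3 - t)\<^sup>2) / \<sigma> \<le> 1" using divide_nonpos_pos[of _ \<sigma>] \<sigma> by force
    then show ?thesis by (simp add: S_def radius_fun_def \<Theta>_le1 z_def)
  qed
  have dz: "(z has_real_derivative - 2 * t / \<sigma>) (at t)" for t
    unfolding z_def using \<sigma> by (auto intro!: derivative_eq_intros)
  have S1eq: "S1 t = - 2 * t * \<Theta>1 (z t)" if t: "t < 11/5" for t
  proof -
    have "((\<lambda>t. \<sigma> * \<Theta> (z t)) has_real_derivative \<sigma> * (\<Theta>1 (z t) * (- 2 * t / \<sigma>))) (at t)"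
      by (intro DERIV_cmult DERIV_chain2[OF \<Theta>_deriv(1) dz])
    then have "(S has_real_derivative \<sigma> * (\<Theta>1 (z t) * (- 2 * t / \<sigma>))) (at t)"
      by (rule has_field_derivative_transform_within_open[where S="{..<11/5}"]) (use t Seq in auto)
    from DERIV_unique[OF d1 this] show ?thesis using \<sigma> by simp
  qed
  have S2eq: "S2 t = 4 * t\<^sup>2 / \<sigma> * \<Theta>2 (z t) - 2 * \<Theta>1 (z t)" if t: "t < 11/5" for t
  proof -
    have "((\<lambda>t. - 2 * t * \<Theta>1 (z t)) has_real_derivative - 2 * \<Theta>1 (z t) + (\<Theta>2 (z t) * (- 2 * t / \<sigma>)) * (- 2 * t)) (at t)"
      by (intro DERIV_mult DERIV_chain2[OF \<Theta>_deriv(2) dz]) (auto intro!: derivative_eq_intros)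
    then have "(S1 has_real_derivative - 2 * \<Theta>1 (z t) + (\<Theta>2 (z t) * (- 2 * t / \<sigma>)) * (- 2 * t)) (at t)"
      by (rule has_field_derivative_transform_within_open[where S="{..<11/5}"]) (use t S1eq in auto)
    from DERIV_unique[OF d2 this] show ?thesis by (simp add: power2_eq_square algebra_simps)
  qed
  have z0: "z 0 > 2" using \<sigma> by (simp add: z_def field_simps)
  show "S 0 = 1 / 2" using Seq[of 0] z0 \<sigma> by (simp add: \<Theta>_ge2 z_def)
  show "S1 0 = 0" using S1eq[of 0] by simp
  show "S t = 1 / 2 - t\<^sup>2 \<and> S2 t = - 2" if "0 \<le> t" "t \<le> 1" "2 * \<sigma> < 1 / 2 - t\<^sup>2" for t
  proof -
    have "2 < z t" using that \<sigma> by (simp add: z_def field_simps)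
    then show ?thesis using Seq[of t] S2eq[of t] that \<sigma> by (simp add: \<Theta>_ge2 \<Theta>_deriv_high z_def)
  qed
  show "S t = \<sigma> * \<Theta> ((1 / 2 - t\<^sup>2) / \<sigma>) \<and>
       S2 t = 4 * t\<^sup>2 / \<sigma> * \<Theta>2 ((1 / 2 - t\<^sup>2) / \<sigma>) - 2 * \<Theta>1 ((1 / 2 - t\<^sup>2) / \<sigma>)" if "t \<le> 1" for t
    using Seq[of t] S2eq[of t] that by (simp add: z_def)
  show "S t = \<sigma> \<and> S1 t = 0 \<and> S2 t = 0" if t: "1 \<le> t" "t \<le> 2" for t
  proof -
    have "1 \<le> t\<^sup>2" using t by (simp add: power2_eq_square mult_mono[of 1 t 1 t, simplified])
    then have "z t < 1" using \<sigma> by (simp add: z_def field_simps)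
    then show ?thesis using Seq[of t] S1eq[of t] S2eq[of t] t by (simp add: \<Theta>_le1 \<Theta>_deriv_low)
  qed
qed

text \<open>The graph of \<open>c\<close> over the closed interval is compact and lies in the open
  set where \<open>f\<close> is positive, so one radius serves all times.\<close>

lemma tube:
  fixes f :: "(real^2) \<times> real \<Rightarrow> real" and c :: "real \<Rightarrow> real^2"
  assumes f: "continuous_on UNIV f" and c: "continuous_on {a..b} c"
    and pos: "\<And>t. t \<in> {a..b} \<Longrightarrow> 0 < f (c t, t)"
  obtains \<rho> where "0 < \<rho>" "\<And>x t. t \<in> {a..b} \<Longrightarrow> norm (x - c t) \<le> \<rho> \<Longrightarrow> 0 < f (x, t)"
proof -
  define V where "V = {p. 0 < f p}"
  have V: "open V" unfolding V_def by (intro open_Collect_less continuous_intros f)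
  define K where "K = (\<lambda>t. (c t, t)) ` {a..b}"
  have K: "compact K" unfolding K_def by (intro compact_continuous_image continuous_intros c) auto
  have "K \<subseteq> V" using pos by (auto simp: K_def V_def)
  then obtain e where e: "0 < e" "\<And>x. x \<in> K \<Longrightarrow> cball x e \<subseteq> V"
    using compact_subset_open_imp_cball_epsilon_subset[OF K V]
    by (metis (no_types, lifting) UN_subset_iff)
  show ?thesis
  proof (rule that[OF e(1)])
    fix x t assume t: "t \<in> {a..b}" and x: "norm (x - c t) \<le> e"
    have "dist (c t, t) (x, t) = norm (x - c t)" by (simp add: dist_Pair_Pair dist_norm norm_minus_commute)
    then have "(x, t) \<in> V" using e(2)[of "(c t, t)"] t x by (auto simp: K_def)
    then show "0 < f (x, t)" by (simp add: V_def)
  qed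
qed

lemma (in moving_wall) lapl_wallf: "lapl wallf p = Lr (fst p) (\<xi> p)"
proof -
  have "hess \<Gamma> wallf p v w = Hr (fst p) (\<xi> p) v w" for v w
    by (simp add: hess_def dd_wallf dd_dd_wallf Hr_def)
  then show ?thesis by (simp add: lapl_def Lr_def trh_def)
qed

section \<open>The lapse along the neck\<close>

context plane_metric
begin

text \<open>A moving wall with constant S = 1 is interpreted only for its derivative formulas: the
  paraboloid is an affine function of its \<open>wallf\<close>.\<close>

lemma lapl_paraboloid:
  assumes k: "smooth k"
  shows "smooth (\<lambda>p. 1 - \<kappa> * ((fst p - k (snd p) *\<^sub>R P) \<bullet> (fst p - k (snd p) *\<^sub>R P)))"
    "lapl (\<lambda>p. 1 - \<kappa> * ((fst p - k (snd p) *\<^sub>R P) \<bullet> (fst p - k (snd p) *\<^sub>R P))) p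
      = - 2 * \<kappa> * Lr (fst p) (fst p - k (snd p) *\<^sub>R P)"
proof -
  interpret w: moving_wall E F G P k "dd k 1" "dd (dd k 1) 1" "\<lambda>_. 1" "\<lambda>_. 0" "\<lambda>_. 0"
    by unfold_locales (auto intro!: smooth_real_deriv k smooth_on_dd)
  have eq: "(\<lambda>p. 1 - \<kappa> * ((fst p - k (snd p) *\<^sub>R P) \<bullet> (fst p - k (snd p) *\<^sub>R P)))
      = (\<lambda>p. (\<lambda>_. 1 - 2 * \<kappa>) (snd p) * 1 + (\<lambda>_. - 2 * \<kappa>) (snd p) * w.wallf p)"
  proof -
    have "1 - \<kappa> * q = (1 - 2 * \<kappa>) * 1 + - 2 * \<kappa> * (q / 2 - 1)" for q by (simp add: algebra_simps)
    then show ?thesis by (simp only: w.wallf_def w.\<xi>_def)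
  qed
  have sw: "smooth w.wallf" by (rule w.smooth_wallf) simp
  show "smooth (\<lambda>p. 1 - \<kappa> * ((fst p - k (snd p) *\<^sub>R P) \<bullet> (fst p - k (snd p) *\<^sub>R P)))"
    unfolding eq by (intro smooth_intros sw) auto
  have "lapl (\<lambda>p. 1) p = 0"
  proof -
    have "dd (\<lambda>p::(real^2) \<times> real. c::real) v = (\<lambda>p. 0)" for c v
      by (rule ext, rule dd_eqI[where D="\<lambda>v. 0"]) simp
    then show ?thesis by (simp add: lapl_def trh_def hess_def)
  qed
  then show "lapl (\<lambda>p. 1 - \<kappa> * ((fst p - k (snd p) *\<^sub>R P) \<bullet> (fst p - k (snd p) *\<^sub>R P))) p
      = - 2 * \<kappa> * Lr (fst p) (fst p - k (snd p) *\<^sub>R P)"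
    using lapl_time[of "\<lambda>_. 1 - 2 * \<kappa>" "\<lambda>_. 1" p] lapl_time[of "\<lambda>_. - 2 * \<kappa>" w.wallf p]
      lapl_add[of "\<lambda>p. (1 - 2 * \<kappa>) * 1" "\<lambda>p. - 2 * \<kappa> * w.wallf p" p] smooth_on_mult[OF smooth_on_const sw, of "- 2 * \<kappa>"] sw
    unfolding eq by (simp add: w.lapl_wallf w.\<xi>_def)
qed

lemma Lr_zero: "Lr x 0 = (E x + G x) / D x"
  by (simp add: Lr_def Hr_def trh_def inner_vec2)

definition strict_supersolution :: "real^2 \<Rightarrow> (real^2 \<Rightarrow> real) \<Rightarrow> bool" where
  "strict_supersolution c u \<longleftrightarrow> smooth u \<and> (\<forall>x\<in>cball c 1. 0 < u x \<and>
     trh x (hessian \<Gamma> u x) < scalar_curvature met x / 2 * u x)"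

text \<open>The centre moves only while the profile is the pure paraboloid, so \<open>u0\<close> is
  active only at centre 0 and \<open>u1\<close> only at centre \<open>P\<close>. On the path of the
  centre each active summand satisfies the strict inequalities, and so does the sum;
  \<open>tube\<close> extends them to a fixed radius around the path.\<close>

lemma neck_profile:
  assumes u0: "strict_supersolution 0 u0" and u1: "strict_supersolution P u1"
  obtains k n \<rho> where "smooth k" "smooth n"
    "\<And>t. t < 6/5 \<Longrightarrow> k t = 0" "\<And>t. 9/5 < t \<Longrightarrow> k t = 1"
    "\<And>p. snd p < 6/5 \<Longrightarrow> n p = u0 (fst p)" "\<And>p. 9/5 < snd p \<Longrightarrow> n p = u1 (fst p)"
    "0 < \<rho>" "\<And>x t. t \<in> {1..2} \<Longrightarrow> norm (x - k t *\<^sub>R P) \<le> \<rho> \<Longrightarrow> 0 < n (x, t)"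
    "\<And>x t. t \<in> {1..2} \<Longrightarrow> norm (x - k t *\<^sub>R P) \<le> \<rho> \<Longrightarrow> lapl n (x, t) < scalar_curvature met x / 2 * n (x, t)"
proof -
  have sm: "smooth u0" "smooth u1" using u0 u1 by (auto simp: strict_supersolution_def)
  \<comment> \<open>\<open>u0\<close> fades out on [6/5, 7/5], the centre moves on [7/5, 8/5], and
    \<open>u1\<close> fades in on [8/5, 9/5].\<close>
  define k where "k t = step (5 * t - 7)" for t
  define \<alpha> where "\<alpha> t = 1 - step (5 * t - 6)" for t
  define \<gamma> where "\<gamma> t = step (5 * t - 8)" for t
  define \<beta> where "\<beta> t = step (5 * t - 6) * (1 - step (5 * t - 8))" for t
  have st: "smooth (\<lambda>t. step (5 * t - c))" for c
    by (intro smooth_intros smooth_ident) auto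
  have smt: "smooth k" "smooth \<alpha>" "smooth \<beta>" "smooth \<gamma>"
    unfolding k_def \<alpha>_def \<beta>_def \<gamma>_def by (auto intro!: smooth_on_diff smooth_on_mult smooth_on_const st)
  have ck: "continuous_on A k" for A by (rule cont_smooth[OF smt(1)])
  define R where "R x = scalar_curvature met x / 2" for x
  have sR: "smooth R" unfolding R_def by (intro smooth_on_divide smooth_scalar_curvature smooth_on_const) auto
  define Q where "Q = (\<lambda>t. k t *\<^sub>R P) ` {1..2}"
  have Q: "compact Q" unfolding Q_def by (intro compact_continuous_image continuous_intros ck) auto
  obtain B where B: "0 < B" "\<And>x. x \<in> Q \<Longrightarrow> \<bar>R x\<bar> \<le> B"
    by (rule compact_bounded_real[OF Q cont_smooth[OF sR]]) blast
  have cEG: "continuous_on Q (\<lambda>x. (E x + G x) / D x)"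
    by (intro continuous_intros cont_smooth smoothE smoothG smoothD) auto
  have EG: "0 < (E x + G x) / D x" for x using Epos Gpos Dpos by (simp add: add_pos_pos)
  obtain e where e: "0 < e" "\<And>x. x \<in> Q \<Longrightarrow> e \<le> (E x + G x) / D x"
    by (rule compact_positive_lower[OF Q cEG EG]) blast
  \<comment> \<open>At its vertex the paraboloid is 1 and its Laplacian is - 2 \<kappa> (E + G) / D,
    at most - 2 B by the choice of \<open>e\<close>. This beats the bound \<open>B\<close> for half
    the scalar curvature.\<close>
  define \<kappa> where "\<kappa> = B / e"
  define w where "w p = 1 - \<kappa> * ((fst p - k (snd p) *\<^sub>R P) \<bullet> (fst p - k (snd p) *\<^sub>R P))" for p
  have sw: "smooth w" unfolding w_def by (rule lapl_paraboloid[OF smt(1)])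
  have lw: "lapl w p = - 2 * \<kappa> * Lr (fst p) (fst p - k (snd p) *\<^sub>R P)" for p
    unfolding w_def by (rule lapl_paraboloid[OF smt(1)])
  define n where "n p = \<alpha> (snd p) * u0 (fst p) + \<beta> (snd p) * w p + \<gamma> (snd p) * u1 (fst p)" for p
  have sf: "smooth (\<lambda>p::(real^2) \<times> real. u0 (fst p))" "smooth (\<lambda>p::(real^2) \<times> real. u1 (fst p))"
    by (rule smooth_on_fst_comp[OF sm(1) open_UNIV], rule smooth_on_fst_comp[OF sm(2) open_UNIV])
  note ss = smooth_on_snd_comp[OF smt(2) open_UNIV] smooth_on_snd_comp[OF smt(3) open_UNIV] smooth_on_snd_comp[OF smt(4) open_UNIV]
  have sn: "smooth n" unfolding n_def by (intro smooth_on_add smooth_on_mult ss sf sw)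
  have ln: "lapl n p = \<alpha> (snd p) * trh (fst p) (hessian \<Gamma> u0 (fst p)) + \<beta> (snd p) * lapl w p
      + \<gamma> (snd p) * trh (fst p) (hessian \<Gamma> u1 (fst p))" for p
  proof -
    have "lapl n p = lapl (\<lambda>p. \<alpha> (snd p) * u0 (fst p)) p + lapl (\<lambda>p. \<beta> (snd p) * w p) p + lapl (\<lambda>p. \<gamma> (snd p) * u1 (fst p)) p"
      unfolding n_def
      by (subst lapl_add[OF smooth_on_add[OF smooth_on_mult[OF ss(1) sf(1)] smooth_on_mult[OF ss(2) sw]] smooth_on_mult[OF ss(3) sf(2)]],
          subst lapl_add[OF smooth_on_mult[OF ss(1) sf(1)] smooth_on_mult[OF ss(2) sw]]) simp
    then show ?thesis
      by (simp add: lapl_time[OF smt(2) sf(1)] lapl_time[OF smt(3) sw] lapl_time[OF smt(4) sf(2)] lapl_fst sm)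
  qed
  define f where "f p = R (fst p) * n p - lapl n p" for p
  have cf: "continuous_on UNIV f" "continuous_on UNIV n"
    unfolding f_def by (intro continuous_on_diff continuous_on_mult cont_smooth smooth_on_fst_comp[OF sR] sn smooth_lapl open_UNIV)+
  have nonneg: "0 \<le> \<alpha> t" "0 \<le> \<beta> t" "0 \<le> \<gamma> t" for t
    using step_nonneg step_le1 by (auto simp: \<alpha>_def \<beta>_def \<gamma>_def intro!: mult_nonneg_nonneg)
  have some: "0 < \<alpha> t \<or> 0 < \<beta> t \<or> 0 < \<gamma> t" for t
    using step_nonneg[of "5 * t - 8"] step_le1[of "5 * t - 6"]
    by (auto simp: \<alpha>_def \<beta>_def \<gamma>_def less_le intro!: mult_pos_pos)
  have \<alpha>0: "k t = 0" if "0 < \<alpha> t" for t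
  proof (rule ccontr)
    assume "k t \<noteq> 0"
    then have "0 < 5 * t - 7" using step_le_0[of "5 * t - 7"] by (force simp: k_def)
    then show False using that by (simp add: \<alpha>_def step_ge_1)
  qed
  have \<gamma>1: "k t = 1" if "0 < \<gamma> t" for t
  proof -
    have "0 < 5 * t - 8" using that step_le_0[of "5 * t - 8"] by (force simp: \<gamma>_def)
    then show ?thesis by (simp add: k_def step_ge_1)
  qed
  have combine: "0 < \<alpha> t * a + \<beta> t * b + \<gamma> t * c"
    if "0 < \<alpha> t \<Longrightarrow> 0 < a" "0 < b" "0 < \<gamma> t \<Longrightarrow> 0 < c" for t a b c
  proof -
    have "0 \<le> x * y \<and> (0 < x \<longrightarrow> 0 < x * y)" if "0 \<le> x" "0 < x \<Longrightarrow> 0 < y" for x y :: real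
      using that by (cases "x = 0") auto
    from this[OF nonneg(1)[of t] that(1)] this[OF nonneg(2)[of t] that(2)] this[OF nonneg(3)[of t] that(3)]
    show ?thesis using some[of t] by linarith
  qed
  have posn: "0 < n (k t *\<^sub>R P, t)" for t
    unfolding n_def
    by (simp, rule combine) (use u0 u1 \<alpha>0[of t] \<gamma>1[of t] in \<open>auto simp: strict_supersolution_def w_def\<close>)
  have posf: "0 < f (k t *\<^sub>R P, t)" if t: "t \<in> {1..2}" for t
  proof -
    define x where "x = k t *\<^sub>R P"
    have "x \<in> Q" using t by (auto simp: x_def Q_def)
    define q where "q = (E x + G x) / D x"
    have L0: "Lr x 0 = q" by (simp add: q_def Lr_zero)
    have "f (x, t) = \<alpha> t * (R x * u0 x - trh x (hessian \<Gamma> u0 x)) + \<beta> t * (R x + 2 * \<kappa> * q)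
        + \<gamma> t * (R x * u1 x - trh x (hessian \<Gamma> u1 x))"
      by (simp add: f_def n_def ln lw x_def[symmetric] w_def L0 algebra_simps)
    moreover have "0 < \<alpha> t * (R x * u0 x - trh x (hessian \<Gamma> u0 x)) + \<beta> t * (R x + 2 * \<kappa> * q)
        + \<gamma> t * (R x * u1 x - trh x (hessian \<Gamma> u1 x))"
    proof (rule combine)
      have "B \<le> \<kappa> * q"
        using mult_left_mono[OF e(2)[OF \<open>x \<in> Q\<close>], of \<kappa>] e(1) B(1) by (simp add: \<kappa>_def q_def)
      then show "0 < R x + 2 * \<kappa> * q" using B(1) B(2)[OF \<open>x \<in> Q\<close>] by linarith
    qed (use u0 u1 \<alpha>0[of t] \<gamma>1[of t] in \<open>auto simp: strict_supersolution_def x_def R_def\<close>)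
    ultimately show ?thesis by (simp add: x_def)
  qed
  obtain \<rho>1 where \<rho>1: "0 < \<rho>1" "\<And>x t. t \<in> {1..2} \<Longrightarrow> norm (x - k t *\<^sub>R P) \<le> \<rho>1 \<Longrightarrow> 0 < n (x, t)"
    by (rule tube[where f=n and c="\<lambda>t. k t *\<^sub>R P" and a=1 and b=2, OF cf(2)]) (auto intro!: continuous_intros ck posn)
  obtain \<rho>2 where \<rho>2: "0 < \<rho>2" "\<And>x t. t \<in> {1..2} \<Longrightarrow> norm (x - k t *\<^sub>R P) \<le> \<rho>2 \<Longrightarrow> 0 < f (x, t)"
    by (rule tube[where f=f and c="\<lambda>t. k t *\<^sub>R P" and a=1 and b=2, OF cf(1)]) (auto intro!: continuous_intros ck posf)
  show ?thesis
  proof (rule that[OF smt(1) sn])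
    show "0 < min \<rho>1 \<rho>2" using \<rho>1 \<rho>2 by simp
    show "0 < n (x, t)" if "t \<in> {1..2}" "norm (x - k t *\<^sub>R P) \<le> min \<rho>1 \<rho>2" for x t
      using \<rho>1(2) that by simp
    show "lapl n (x, t) < scalar_curvature met x / 2 * n (x, t)" if "t \<in> {1..2}" "norm (x - k t *\<^sub>R P) \<le> min \<rho>1 \<rho>2" for x t
      using \<rho>2(2)[of t x] that by (simp add: f_def R_def)
  qed (auto simp: k_def n_def \<alpha>_def \<beta>_def \<gamma>_def step_le_0 step_ge_1)
qed

text \<open>The tube is the image of a compact cylinder, so the constants wanted by
  \<open>Z_neck\<close> exist at once. They do not refer to the radius of the disk, which is chosen
  only afterwards.\<close>

lemma neck_bounds:
  fixes k :: "real \<Rightarrow> real"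
  assumes k: "smooth k" and n: "smooth n"
    and pos: "\<And>x t. t \<in> {1..2} \<Longrightarrow> norm (x - k t *\<^sub>R P) \<le> \<rho> \<Longrightarrow> 0 < n (x, t)"
  obtains C d \<delta> where "0 < d" "0 < \<delta>" "1 \<le> C" "norm P \<le> C"
    "\<And>t. t \<in> {1..2} \<Longrightarrow> \<bar>dd k 1 t\<bar> \<le> C \<and> \<bar>dd (dd k 1) 1 t\<bar> \<le> C"
    "\<And>p. snd p \<in> {1..2} \<Longrightarrow> norm (fst p - k (snd p) *\<^sub>R P) \<le> \<rho> \<Longrightarrow>
       \<delta> \<le> n p \<and> n p \<le> C \<and> \<bar>dd n (0, 1) p\<bar> \<le> C \<and> (\<forall>\<xi>. \<bar>dd n (sharp (fst p) \<xi>, 0) p\<bar> \<le> C * norm \<xi> \<and>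
       norm (sharp (fst p) \<xi>) \<le> C * norm \<xi> \<and> \<bar>Lr (fst p) \<xi>\<bar> \<le> C * (1 + norm \<xi>) \<and>
       Xn (fst p) \<xi> \<le> C * (norm \<xi>)\<^sup>2 \<and> (norm \<xi>)\<^sup>2 * (d - C * norm \<xi>) \<le> Yn (fst p) \<xi>)"
proof -
  define T where "T = (\<lambda>(y, t). (k t *\<^sub>R P + y, t)) ` (cball 0 \<rho> \<times> {1..2})"
  have T: "compact T"
    unfolding T_def case_prod_unfold
    by (intro compact_continuous_image compact_Times compact_cball compact_Icc continuous_intros
        continuous_on_compose2[OF cont_smooth[OF k, of UNIV]]) auto
  have inT: "p \<in> T" if "snd p \<in> {1..2}" "norm (fst p - k (snd p) *\<^sub>R P) \<le> \<rho>" for p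
    unfolding T_def by (rule image_eqI[of _ _ "(fst p - k (snd p) *\<^sub>R P, snd p)"]) (use that in \<open>auto simp: prod_eq_iff dist_norm norm_minus_commute\<close>)
  have posT: "0 < n p" if "p \<in> T" for p using that pos by (auto simp: T_def)
  have K: "compact (fst ` T)" by (intro compact_continuous_image T continuous_on_fst continuous_on_id)
  obtain l A d where f: "0 < l" "0 < A" "0 < d"
    "\<And>x \<xi>. x \<in> fst ` T \<Longrightarrow> l * (norm \<xi>)\<^sup>2 \<le> Xn x \<xi> \<and> Xn x \<xi> \<le> A * (norm \<xi>)\<^sup>2"
    "\<And>x \<xi>. x \<in> fst ` T \<Longrightarrow> \<bar>Lr x \<xi>\<bar> \<le> A * (1 + norm \<xi>)"
    "\<And>x \<xi>. x \<in> fst ` T \<Longrightarrow> (norm \<xi>)\<^sup>2 * (d - A * norm \<xi>) \<le> Yn x \<xi>"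
    "\<And>x \<xi>. x \<in> fst ` T \<Longrightarrow> norm (sharp x \<xi>) \<le> A * norm \<xi>"
    by (rule frame_bounds[OF K]) blast
  obtain \<delta> where \<delta>: "0 < \<delta>" "\<And>p. p \<in> T \<Longrightarrow> \<delta> \<le> n p"
    by (rule compact_positive_lower[OF T cont_smooth[OF n] posT]) auto
  have bd: "\<exists>C. \<forall>p\<in>T. \<bar>g p\<bar> \<le> C" if "smooth g" for g
    by (rule compact_bounded_real[OF T cont_smooth[OF that]]) blast
  obtain c1 where c1: "\<forall>p\<in>T. \<bar>n p\<bar> \<le> c1" using bd[OF n] by blast
  obtain c2 where c2: "\<forall>p\<in>T. \<bar>dd n (0, 1) p\<bar> \<le> c2" using bd[OF smooth_on_dd[OF n]] by blast
  obtain c3 where c3: "\<forall>p\<in>T. \<bar>dd n (axis 1 1, 0) p\<bar> \<le> c3" using bd[OF smooth_on_dd[OF n]] by blast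
  obtain c4 where c4: "\<forall>p\<in>T. \<bar>dd n (axis 2 1, 0) p\<bar> \<le> c4" using bd[OF smooth_on_dd[OF n]] by blast
  obtain c5 where c5: "\<And>t. t \<in> {1..2} \<Longrightarrow> \<bar>dd k 1 t\<bar> \<le> c5"
    by (rule compact_bounded_real[OF compact_Icc cont_smooth[OF smooth_on_dd[OF k]]]) blast
  obtain c6 where c6: "\<And>t. t \<in> {1..2} \<Longrightarrow> \<bar>dd (dd k 1) 1 t\<bar> \<le> c6"
    by (rule compact_bounded_real[OF compact_Icc cont_smooth[OF smooth_on_dd[OF smooth_on_dd[OF k]]]]) blast
  define C where "C = max 1 (max (norm P) (max A (max c1 (max c2 (max (A * (\<bar>c3\<bar> + \<bar>c4\<bar>)) (max c5 c6))))))"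
  have C: "1 \<le> C" "norm P \<le> C" "A \<le> C" "c1 \<le> C" "c2 \<le> C" "A * (\<bar>c3\<bar> + \<bar>c4\<bar>) \<le> C" "c5 \<le> C" "c6 \<le> C"
    by (simp_all only: C_def le_max_iff_disj order_refl simp_thms)
  show ?thesis
  proof (rule that[OF f(3) \<delta>(1) C(1,2)])
    show "\<bar>dd k 1 t\<bar> \<le> C \<and> \<bar>dd (dd k 1) 1 t\<bar> \<le> C" if "t \<in> {1..2}" for t
      using c5[OF that] c6[OF that] C by linarith
    fix p :: "(real^2) \<times> real" assume p: "snd p \<in> {1..2}" "norm (fst p - k (snd p) *\<^sub>R P) \<le> \<rho>"
    note pT = inT[OF p]
    have px: "fst p \<in> fst ` T" using pT by blast
    have mono: "a * r \<le> C * r" if "0 \<le> r" "a \<le> C" for a r using that by (rule mult_right_mono[rotated])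
    have "\<bar>dd n (sharp (fst p) \<xi>, 0) p\<bar> \<le> C * norm \<xi>" for \<xi>
    proof -
      define m where "m = sharp (fst p) \<xi>"
      have "\<bar>dd n (m, 0) p\<bar> \<le> \<bar>m$1\<bar> * \<bar>c3\<bar> + \<bar>m$2\<bar> * \<bar>c4\<bar>"
      proof -
        have "\<bar>dd n (axis 1 1, 0) p\<bar> \<le> \<bar>c3\<bar>" "\<bar>dd n (axis 2 1, 0) p\<bar> \<le> \<bar>c4\<bar>" using c3 c4 pT by force+
        then show ?thesis
          unfolding dd_space[OF n UNIV_I, of m 0]
          by (simp, intro order_trans[OF abs_triangle_ineq] add_mono) (simp_all add: abs_mult mult_left_mono)
      qed
      also have "\<dots> \<le> norm m * \<bar>c3\<bar> + norm m * \<bar>c4\<bar>"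
        by (intro add_mono mult_right_mono component_le_norm_cart) auto
      also have "\<dots> = norm m * (\<bar>c3\<bar> + \<bar>c4\<bar>)" by (simp add: algebra_simps)
      also have "\<dots> \<le> A * norm \<xi> * (\<bar>c3\<bar> + \<bar>c4\<bar>)" unfolding m_def using f(7)[OF px] by (intro mult_right_mono) auto
      also have "\<dots> = A * (\<bar>c3\<bar> + \<bar>c4\<bar>) * norm \<xi>" by simp
      also have "\<dots> \<le> C * norm \<xi>" using C(6) by (intro mono) auto
      finally show ?thesis by (simp add: m_def)
    qed
    moreover have "(norm \<xi>)\<^sup>2 * (d - C * norm \<xi>) \<le> Yn (fst p) \<xi>" for \<xi>
      using mult_left_mono[of "d - C * norm \<xi>" "d - A * norm \<xi>" "(norm \<xi>)\<^sup>2"] mono[of "norm \<xi>" A] C(3) f(6)[OF px, of \<xi>]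
      by auto
    moreover have "norm (sharp (fst p) \<xi>) \<le> C * norm \<xi>" "\<bar>Lr (fst p) \<xi>\<bar> \<le> C * (1 + norm \<xi>)" "Xn (fst p) \<xi> \<le> C * (norm \<xi>)\<^sup>2" for \<xi>
      using order_trans[OF f(7)[OF px] mono[OF _ C(3)], of \<xi>] order_trans[OF f(5)[OF px] mono[OF _ C(3)], of \<xi>]
        order_trans[OF conjunct2[OF f(4)[OF px]] mono[OF _ C(3)], of \<xi>] by auto
    moreover have "\<delta> \<le> n p" "n p \<le> C" "\<bar>dd n (0, 1) p\<bar> \<le> C"
      using \<delta>(2)[OF pT] c1 c2 pT C by force+
    ultimately show "\<delta> \<le> n p \<and> n p \<le> C \<and> \<bar>dd n (0, 1) p\<bar> \<le> C \<and> (\<forall>\<xi>. \<bar>dd n (sharp (fst p) \<xi>, 0) p\<bar> \<le> C * norm \<xi> \<and>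
       norm (sharp (fst p) \<xi>) \<le> C * norm \<xi> \<and> \<bar>Lr (fst p) \<xi>\<bar> \<le> C * (1 + norm \<xi>) \<and>
       Xn (fst p) \<xi> \<le> C * (norm \<xi>)\<^sup>2 \<and> (norm \<xi>)\<^sup>2 * (d - C * norm \<xi>) \<le> Yn (fst p) \<xi>)"
      by blast
  qed
qed

end

text \<open>Positive powers of \<sigma> tend to 0; the bound a > 1/2 makes 2 a - 1 such a
  power.\<close>

lemma small_radius_exists:
  fixes a B q s x y A :: real
  assumes "1 / 2 < a" "0 < q" "0 < s" "0 < x" "0 < y"
  obtains \<sigma> where "0 < \<sigma>" "\<sigma> < 1 / 4" "\<sigma> < s" "sqrt (2 * \<sigma>) \<le> q"
    "B * \<sigma> powr (2 * a - 1) < x" "A * \<sigma> powr (2 * a) < y"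
proof -
  have p: "((\<lambda>\<sigma>::real. \<sigma> powr e) \<longlongrightarrow> 0) (at_right 0)" if "0 < e" for e
    by (rule tendsto_zero_powrI[OF _ tendsto_const _ that])
      (auto intro: tendsto_ident_at simp: eventually_at_right_field intro!: exI[of _ 1])
  have t: "((\<lambda>\<sigma>. B * \<sigma> powr (2 * a - 1)) \<longlongrightarrow> B * 0) (at_right 0)" "((\<lambda>\<sigma>. A * \<sigma> powr (2 * a)) \<longlongrightarrow> A * 0) (at_right 0)"
    using assms(1) by (intro tendsto_mult tendsto_const p; simp)+
  have "\<forall>\<^sub>F \<sigma> in at_right 0. B * \<sigma> powr (2 * a - 1) < x" "\<forall>\<^sub>F \<sigma> in at_right 0. A * \<sigma> powr (2 * a) < y"
    using order_tendstoD(2)[OF t(1), of x] order_tendstoD(2)[OF t(2), of y] assms(4,5) by simp_all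
  moreover have "\<forall>\<^sub>F \<sigma> in at_right 0. \<sigma> < min (1 / 4) (min s (q\<^sup>2 / 2))"
    using assms(2,3) by (auto simp: eventually_at_right_field intro!: exI[of _ "min (1 / 4) (min s (q\<^sup>2 / 2))"])
  moreover have "\<forall>\<^sub>F \<sigma> in at_right 0. (0::real) < \<sigma>" by (rule eventually_at_right_less)
  ultimately have "\<forall>\<^sub>F \<sigma> in at_right 0. 0 < \<sigma> \<and> \<sigma> < min (1 / 4) (min s (q\<^sup>2 / 2)) \<and>
      B * \<sigma> powr (2 * a - 1) < x \<and> A * \<sigma> powr (2 * a) < y"
    by eventually_elim auto
  then obtain \<sigma> where \<sigma>: "0 < \<sigma>" "\<sigma> < min (1 / 4) (min s (q\<^sup>2 / 2))" "B * \<sigma> powr (2 * a - 1) < x" "A * \<sigma> powr (2 * a) < y"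
    using eventually_happens[of _ "at_right (0::real)"] trivial_limit_at_right_real by blast
  have "sqrt (2 * \<sigma>) \<le> q" using \<sigma>(2) assms(2) by (intro real_le_lsqrt) auto
  with \<sigma> show ?thesis using that by auto
qed

text \<open>On the sides \<open>N\<close> is \<open>l\<close> times a supersolution, and
  \<open>Z_side\<close> applies; in the neck \<open>l\<close> is constant and large, and
  \<open>Z_neck\<close> applies. Constants are fixed in the order geometry, neck profile,
  \<open>l0\<close>, \<sigma>, so that \<sigma> can be small relative to all the others;
  \<open>bend\<close> then makes the wall minimal.\<close>

theorem (in plane_metric) lens_concordance:
  assumes u0: "strict_supersolution 0 u0" and u1: "strict_supersolution P u1"
  obtains g where "riemannian_metric_on (disk \<times> {0..1}) g"
    "\<And>p. p \<in> disk \<times> {0..1} \<Longrightarrow> 0 < scalar_curvature g p"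
    "\<And>p. p \<in> sphere 0 1 \<times> {0..1} \<Longrightarrow> mean_curvature g wall_conormal p = 0"
    "\<And>x v w. g (x, 0) (v, 0) (w, 0) = met x v w" "\<And>x v w. g (x, 1) (v, 0) (w, 0) = met (P + x) v w"
    "free_boundary_minimal_slice g 0" "free_boundary_minimal_slice g 1"
proof -
  have sm: "smooth u0" "smooth u1" using u0 u1 by (auto simp: strict_supersolution_def)
  have pos0: "0 < u0 x" "trh x (hessian \<Gamma> u0 x) < scalar_curvature met x / 2 * u0 x" if "x \<in> cball 0 1" for x
    using u0 that by (auto simp: strict_supersolution_def)
  have pos1: "0 < u1 x" "trh x (hessian \<Gamma> u1 x) < scalar_curvature met x / 2 * u1 x" if "x \<in> cball P 1" for x
    using u1 that by (auto simp: strict_supersolution_def)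
  obtain a0 m0 c0 d0 where l0': "1 / 2 < a0" "0 < m0" "0 < c0" "0 < d0" "lens_bounds 0 u0 a0 m0 c0 d0"
    by (rule lens_bounds_exist[OF sm(1) pos0(1)]) auto
  obtain a1 m1 c1 d1 where l1': "1 / 2 < a1" "0 < m1" "0 < c1" "0 < d1" "lens_bounds P u1 a1 m1 c1 d1"
    by (rule lens_bounds_exist[OF sm(2) pos1(1)]) auto
  define a m c3 m2 where "a = min a0 a1" and "m = max m0 m1" and "c3 = min c0 c1" and "m2 = max d0 d1"
  have par: "1 / 2 < a" "0 < m" "0 < c3" "0 < m2"
    using l0' l1' by (auto simp: a_def m_def c3_def m2_def)
  have lens0: "lens_bounds 0 u0 a m c3 m2" and lens1: "lens_bounds P u1 a m c3 m2"
    by (rule lens_bounds_mono[OF l0'(5)] lens_bounds_mono[OF l1'(5)]; simp add: a_def m_def c3_def m2_def)+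
  obtain k n \<rho> where kn: "smooth k" "smooth n"
    "\<And>t. t < 6/5 \<Longrightarrow> k t = 0" "\<And>t. 9/5 < t \<Longrightarrow> k t = 1"
    "\<And>p. snd p < 6/5 \<Longrightarrow> n p = u0 (fst p)" "\<And>p. 9/5 < snd p \<Longrightarrow> n p = u1 (fst p)"
    "0 < \<rho>" "\<And>x t. t \<in> {1..2} \<Longrightarrow> norm (x - k t *\<^sub>R P) \<le> \<rho> \<Longrightarrow> 0 < n (x, t)"
    "\<And>x t. t \<in> {1..2} \<Longrightarrow> norm (x - k t *\<^sub>R P) \<le> \<rho> \<Longrightarrow> lapl n (x, t) < scalar_curvature met x / 2 * n (x, t)"
    by (rule neck_profile[OF u0 u1]) blast
  define k1 k2 where "k1 = dd k 1" and "k2 = dd (dd k 1) 1"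
  have k0: "k1 t = 0 \<and> k2 t = 0" if "t < 6/5 \<or> 9/5 < t" for t
  proof -
    have *: "k1 s = 0" if "s < 6/5 \<or> 9/5 < s" for s
      using that dd_cong[of "{..<6/5}" s k "\<lambda>_. 0" 1] dd_cong[of "{9/5<..}" s k "\<lambda>_. 1" 1] kn(3,4)
      by (auto simp: k1_def dd_real)
    then show ?thesis
      using that dd_cong[of "{..<6/5}" t k1 "\<lambda>_. 0" 1] dd_cong[of "{9/5<..}" t k1 "\<lambda>_. 0" 1]
      by (auto simp: k2_def k1_def[symmetric] dd_real)
  qed
  obtain C d \<delta> where nb: "0 < d" "0 < \<delta>" "1 \<le> C" "norm P \<le> C"
    "\<And>t. t \<in> {1..2} \<Longrightarrow> \<bar>dd k 1 t\<bar> \<le> C \<and> \<bar>dd (dd k 1) 1 t\<bar> \<le> C"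
    "\<And>p. snd p \<in> {1..2} \<Longrightarrow> norm (fst p - k (snd p) *\<^sub>R P) \<le> \<rho> \<Longrightarrow>
       \<delta> \<le> n p \<and> n p \<le> C \<and> \<bar>dd n (0, 1) p\<bar> \<le> C \<and> (\<forall>\<xi>. \<bar>dd n (sharp (fst p) \<xi>, 0) p\<bar> \<le> C * norm \<xi> \<and>
       norm (sharp (fst p) \<xi>) \<le> C * norm \<xi> \<and> \<bar>Lr (fst p) \<xi>\<bar> \<le> C * (1 + norm \<xi>) \<and>
       Xn (fst p) \<xi> \<le> C * (norm \<xi>)\<^sup>2 \<and> (norm \<xi>)\<^sup>2 * (d - C * norm \<xi>) \<le> Yn (fst p) \<xi>)"
    by (rule neck_bounds[where P=P and \<rho>=\<rho>, OF kn(1,2)]) (rule kn(8), assumption+, rule that, assumption+)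
  obtain B where B: "0 < B" "\<And>z. z \<le> 2 \<Longrightarrow> \<bar>\<Theta>1 z\<bar> \<le> B" "\<And>z. z \<le> 2 \<Longrightarrow> \<bar>\<Theta>2 z\<bar> \<le> B"
    by (rule \<Theta>_deriv_bound) blast
  \<comment> \<open>Small enough that l^2 is at most 1 / m2 wherever S \<ge> c3 / m2. There c3 - m2
    S is not positive, and the product with l^2, at least - 1/2, stays above S2 = - 2.\<close>
  define l0 where "l0 = exp (a * ln (c3 / m2) - m / 2) / sqrt m2"
  have l0: "0 < l0" using par by (simp add: l0_def)
  define M where "M = 2 * C ^ 5 + 2 * C ^ 5 + 2 * C ^ 5 + 2 * C ^ 5 / \<delta> + C ^ 4 / \<delta>"
  \<comment> \<open>A radius within which \<open>neck_profile\<close> applies and the smallness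
    hypotheses of \<open>Z_neck\<close> hold.\<close>
  define q where "q = min \<rho> (min 1 (min ((\<delta>\<^sup>2 * d / 2) / (C * \<delta>\<^sup>2 + C ^ 3)) (d / C)))"
  have C0: "0 < C" using nb(3) by simp
  have CC: "0 < C * \<delta>\<^sup>2 + C ^ 3" using C0 by (intro add_nonneg_pos) auto
  have q: "0 < q" using nb kn(7) C0 CC by (simp add: q_def)
  \<comment> \<open>Where S levels off, S2 is at most 6 B / \<sigma> while l^2 is at least l0^2 (2
    \<sigma>)^(- 2 a); the first power condition lets the latter win. The second makes
    \<open>l\<close> large enough for the neck, where S = \<sigma>.\<close>
  obtain \<sigma> where \<sigma>: "0 < \<sigma>" "\<sigma> < 1 / 4" "\<sigma> < c3 / (4 * m2)" "sqrt (2 * \<sigma>) \<le> q"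
    "6 * B * \<sigma> powr (2 * a - 1) < l0\<^sup>2 * (c3 / 2) * 2 powr (- 2 * a)"
    "M * \<sigma> powr (2 * a) < l0\<^sup>2 * (\<delta>\<^sup>2 * d / 2)"
    by (rule small_radius_exists[OF par(1) q, of "c3 / (4 * m2)" "l0\<^sup>2 * (c3 / 2) * 2 powr (- 2 * a)" "l0\<^sup>2 * (\<delta>\<^sup>2 * d / 2)" "6 * B" M])
      (use par l0 nb in simp_all)
  define S S1 S2 where "S = radius_fun \<sigma>" and "S1 = dd (radius_fun \<sigma>) 1" and "S2 = dd (dd (radius_fun \<sigma>) 1) 1"
  note rf = radius_fun[OF \<sigma>(1,2), folded S_def S1_def S2_def]
  \<comment> \<open>The multiple of exp(m S) S^(- a) solves l' / l = (m - a / S) S', as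
    \<open>Z_side\<close> demands, and it is stationary where S is.\<close>
  define l where "l t = l0 * exp (m * S t - a * ln (S t))" for t
  have lpos: "0 < l t" for t using l0 by (simp add: l_def)
  have lsm: "smooth l"
    unfolding l_def by (intro smooth_intros smooth_on_ln rf(1,4) open_UNIV)
  have dl: "(l has_real_derivative l t * (m * S1 t - a * S1 t / S t)) (at t)" for t
    unfolding l_def using rf(4)[of t] by (auto intro!: derivative_eq_intros rf(2))
  have lsq: "(l t)\<^sup>2 = l0\<^sup>2 * exp (2 * m * S t) * S t powr (- 2 * a)" for t
  proof -
    have "(exp (m * S t - a * ln (S t)))\<^sup>2 = exp (2 * m * S t) * S t powr (- 2 * a)"
      using rf(4)[of t] by (simp add: powr_def algebra_simps flip: exp_double exp_add)
    then show ?thesis by (simp add: l_def power_mult_distrib)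
  qed
  have lower: "l0\<^sup>2 * S t powr (- 2 * a) \<le> (l t)\<^sup>2" for t
  proof -
    have "1 \<le> exp (2 * m * S t)" using par rf(4)[of t] by simp
    then have "l0\<^sup>2 * 1 * S t powr (- 2 * a) \<le> l0\<^sup>2 * exp (2 * m * S t) * S t powr (- 2 * a)"
      by (intro mult_right_mono mult_left_mono) auto
    then show ?thesis by (simp add: lsq)
  qed
  have side01: "S t \<le> 1 / 2 \<and> S2 t < (l t)\<^sup>2 * (c3 - m2 * S t)" if t: "0 \<le> t" "t \<le> 1" for t
  proof (cases "2 * \<sigma> < 1 / 2 - t\<^sup>2")
    case True
    then have S: "S t = 1 / 2 - t\<^sup>2" "S2 t = - 2" using rf(10) t by auto
    have Sle: "S t \<le> 1 / 2" by (simp add: S)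
    have "- 1 / 2 \<le> (l t)\<^sup>2 * (c3 - m2 * S t)"
    proof (cases "S t < c3 / m2")
      case True
      then have "0 \<le> c3 - m2 * S t" using par by (simp add: field_simps)
      then have "0 \<le> (l t)\<^sup>2 * (c3 - m2 * S t)" by (intro mult_nonneg_nonneg zero_le_power2)
      then show ?thesis by linarith
    next
      case False
      have "ln (c3 / m2) \<le> ln (S t)" using False par rf(4)[of t] by (subst ln_le_cancel_iff) auto
      then have "a * ln (c3 / m2) \<le> a * ln (S t)" using par by (intro mult_left_mono) auto
      moreover have "m * S t \<le> m * (1 / 2)" using Sle par by (intro mult_left_mono) auto
      ultimately have "m * S t - a * ln (S t) \<le> m / 2 - a * ln (c3 / m2)" by linarith
      then have "l t \<le> l0 * exp (m / 2 - a * ln (c3 / m2))" using l0 by (simp add: l_def)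
      also have "\<dots> = 1 / sqrt m2" by (simp add: l0_def flip: exp_add)
      finally have "(l t)\<^sup>2 \<le> (1 / sqrt m2)\<^sup>2" using lpos[of t] by (intro power_mono) auto
      then have "(l t)\<^sup>2 \<le> 1 / m2" using par by (simp add: power_divide)
      then have "(l t)\<^sup>2 * (m2 * S t) \<le> 1 / m2 * (m2 * S t)" using par rf(4)[of t] by (intro mult_right_mono) auto
      then have "(l t)\<^sup>2 * (m2 * S t) \<le> 1 / 2" using par Sle by simp
      moreover have "0 \<le> (l t)\<^sup>2 * c3" using par by simp
      ultimately show ?thesis by (simp add: algebra_simps)
    qed
    then show ?thesis using S Sle by simp
  next
    case False
    define z where "z = (1 / 2 - t\<^sup>2) / \<sigma>"
    have z: "z \<le> 2" using False \<sigma> by (simp add: z_def field_simps)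
    have S: "S t = \<sigma> * \<Theta> z" "S2 t = 4 * t\<^sup>2 / \<sigma> * \<Theta>2 z - 2 * \<Theta>1 z"
      using rf(11)[of t] t False by (auto simp: z_def)
    have Sle: "S t \<le> 2 * \<sigma>" using \<Theta>_le2[OF z] \<sigma> by (simp add: S)
    have "S2 t \<le> 4 / \<sigma> * B + 2 * B"
    proof -
      have "4 * t\<^sup>2 / \<sigma> * \<Theta>2 z \<le> 4 * t\<^sup>2 / \<sigma> * B"
        using B(3)[OF z] \<sigma> by (intro mult_left_mono) auto
      also have "\<dots> \<le> 4 / \<sigma> * B"
        using t \<sigma> B by (intro mult_right_mono divide_right_mono) (auto simp: power_le_one)
      finally show ?thesis using B(2)[OF z] by (simp add: S)
    qed
    also have "\<dots> \<le> 6 * B / \<sigma>" using \<sigma> B by (simp add: field_simps)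
    also have "\<dots> < l0\<^sup>2 * (2 * \<sigma>) powr (- 2 * a) * (c3 / 2)"
    proof -
      have "6 * B * \<sigma> powr (2 * a - 1) * \<sigma> powr (- 2 * a) < l0\<^sup>2 * (c3 / 2) * 2 powr (- 2 * a) * \<sigma> powr (- 2 * a)"
        using \<sigma> by (intro mult_strict_right_mono) auto
      moreover have "\<sigma> powr (2 * a - 1) * \<sigma> powr (- 2 * a) = 1 / \<sigma>"
      proof -
        have "\<sigma> powr (2 * a - 1) * \<sigma> powr (- 2 * a) = \<sigma> powr (2 * a - 1 + - 2 * a)" by (rule powr_add[symmetric])
        also have "2 * a - 1 + - 2 * a = - 1" by simp
        also have "\<sigma> powr - 1 = 1 / \<sigma>" using \<sigma> by (subst powr_minus_divide) simp
        finally show ?thesis .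
      qed
      moreover have "(2 * \<sigma>) powr (- 2 * a) = 2 powr (- 2 * a) * \<sigma> powr (- 2 * a)"
        using \<sigma> by (simp add: powr_mult)
      ultimately show ?thesis by (simp add: mult.assoc mult.left_commute mult.commute)
    qed
    also have "\<dots> \<le> (l t)\<^sup>2 * (c3 - m2 * S t)"
    proof (rule mult_mono)
      have "(2 * \<sigma>) powr (- 2 * a) \<le> S t powr (- 2 * a)"
        using Sle rf(4)[of t] par by (intro powr_mono2') auto
      then show "l0\<^sup>2 * (2 * \<sigma>) powr (- 2 * a) \<le> (l t)\<^sup>2"
        using lower[of t] by (intro order_trans[OF mult_left_mono lower]) auto
      have "m2 * S t \<le> m2 * (2 * (c3 / (4 * m2)))" using Sle \<sigma> par by (intro mult_left_mono) auto
      then show "c3 / 2 \<le> c3 - m2 * S t" using par by simp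
    qed (use par in auto)
    finally show ?thesis using Sle \<sigma> by simp
  qed
  have side: "S t \<le> 1 / 2 \<and> S2 t < (l t)\<^sup>2 * (c3 - m2 * S t)" if "t \<in> {0..1} \<union> {2..3}" for t
  proof (cases "t \<le> 1")
    case False
    then show ?thesis using side01[of "3 - t"] that rf(5,7)[of t] by (simp add: l_def)
  qed (use that side01 in auto)
  define N where "N p = l (snd p) * n p" for p
  have sN: "smooth N" unfolding N_def by (intro smooth_on_mult smooth_on_snd_comp[OF lsm] kn open_UNIV)
  interpret w: moving_wall E F G P k k1 k2 S S1 S2
    by unfold_locales (use kn rf in \<open>auto simp: k1_def k2_def intro!: smooth_real_deriv smooth_on_dd\<close>)
  have N0: "N q = l (snd q) * u0 (fst q)" if "q \<in> {q. snd q < 6/5}" for q using that kn(5) by (simp add: N_def)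
  have N1: "N q = l (snd q) * u1 (fst q)" if "q \<in> {q. 9/5 < snd q}" for q using that kn(6) by (simp add: N_def)
  have op: "open {q :: (real^2) \<times> real. snd q < 6/5}" "open {q :: (real^2) \<times> real. 9/5 < snd q}"
    by (intro open_Collect_less continuous_intros)+
  have in_disk: "fst p \<in> cball (k (snd p) *\<^sub>R P) 1" if "p \<in> w.domain" "snd p \<in> {0..1} \<union> {2..3}" for p
  proof -
    have "(norm (w.\<xi> p))\<^sup>2 \<le> 1"
      using that side[of "snd p"] by (auto simp: w.domain_def w.wallf_def dot_square_norm)
    then have "norm (w.\<xi> p) \<le> 1" by (simp add: power_le_one_iff)
    then show ?thesis by (simp add: w.\<xi>_def dist_norm norm_minus_commute)
  qed
  have in_neck: "norm (w.\<xi> p) \<le> q" if "p \<in> w.domain" "snd p \<in> {1..2}" for p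
  proof -
    have "(norm (w.\<xi> p))\<^sup>2 \<le> 2 * \<sigma>"
      using that rf(12)[of "snd p"] by (auto simp: w.domain_def w.wallf_def dot_square_norm)
    then have "norm (w.\<xi> p) \<le> sqrt (2 * \<sigma>)" by (rule real_le_rsqrt)
    then show ?thesis using \<sigma>(4) by simp
  qed
  have cases: "snd p \<in> {0..1} \<or> snd p \<in> {1..2} \<or> snd p \<in> {2..3}" if "p \<in> w.domain" for p
    using that by (auto simp: w.domain_def)
  have good: "0 < N p \<and> lapl N p < scalar_curvature met (fst p) / 2 * N p \<and> (w.wallf p = 0 \<longrightarrow> 0 < w.Z N p)"
    if p: "p \<in> w.domain" for p
  proof -
    have lN: "lapl N p = l (snd p) * lapl n p" unfolding N_def by (rule lapl_time[OF lsm kn(2)])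
    have scale: "l (snd p) * x < scalar_curvature met (fst p) / 2 * (l (snd p) * y)"
      if "x < scalar_curvature met (fst p) / 2 * y" for x y
      using mult_strict_left_mono[OF that lpos[of "snd p"]] by (simp add: mult.left_commute)
    consider "snd p \<in> {0..1}" | "snd p \<in> {1..2}" | "snd p \<in> {2..3}" using cases[OF p] by blast
    then show ?thesis
    proof cases
      case 1
      have x: "fst p \<in> cball 0 1" using in_disk[OF p] 1 kn(3)[of "snd p"] by auto
      have pO: "p \<in> {q. snd q < 6/5}" using 1 by auto
      have "lapl n p = trh (fst p) (hessian \<Gamma> u0 (fst p))"
        using lapl_local[OF op(1) pO, of n "\<lambda>p. u0 (fst p)"] kn(5) lapl_fst[OF sm(1)] by simp
      moreover have "0 < w.Z N p" if "w.wallf p = 0"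
        by (rule w.Z_side[OF op(1) pO N0 sm(1) dl lpos pos0(1)[OF x] that])
          (use side[of "snd p"] 1 k0[of "snd p"] kn(3)[of "snd p"] lens0 in auto)
      ultimately show ?thesis
        using N0[OF pO] lpos pos0[OF x] scale by (simp add: lN)
    next
      case 3
      have x: "fst p \<in> cball P 1" using in_disk[OF p] 3 kn(4)[of "snd p"] by auto
      have pO: "p \<in> {q. 9/5 < snd q}" using 3 by auto
      have "lapl n p = trh (fst p) (hessian \<Gamma> u1 (fst p))"
        using lapl_local[OF op(2) pO, of n "\<lambda>p. u1 (fst p)"] kn(6) lapl_fst[OF sm(2)] by simp
      moreover have "0 < w.Z N p" if "w.wallf p = 0"
        by (rule w.Z_side[OF op(2) pO N1 sm(2) dl lpos pos1(1)[OF x] that])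
          (use side[of "snd p"] 3 k0[of "snd p"] kn(4)[of "snd p"] lens1 in auto)
      ultimately show ?thesis
        using N1[OF pO] lpos pos1[OF x] scale by (simp add: lN)
    next
      case 2
      have xi: "norm (w.\<xi> p) \<le> q" by (rule in_neck[OF p 2])
      then have r: "norm (fst p - k (snd p) *\<^sub>R P) \<le> \<rho>" by (simp add: w.\<xi>_def q_def)
      have n: "0 < n p" "lapl n p < scalar_curvature met (fst p) / 2 * n p"
        using kn(8)[OF 2 r] kn(9)[OF 2 r] by simp_all
      have S: "S (snd p) = \<sigma>" "S1 (snd p) = 0" "S2 (snd p) = 0" using rf(12)[of "snd p"] 2 by auto
      note b = nb(6)[OF 2 r]
      have dl0: "(l has_real_derivative 0) (at (snd p))" using dl[of "snd p"] S by simp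
      have large: "M < (l (snd p))\<^sup>2 * (\<delta>\<^sup>2 * d / 2)"
      proof -
        have "M * \<sigma> powr (2 * a) * \<sigma> powr (- 2 * a) < l0\<^sup>2 * (\<delta>\<^sup>2 * d / 2) * \<sigma> powr (- 2 * a)"
          using \<sigma> by (intro mult_strict_right_mono) auto
        moreover have "\<sigma> powr (2 * a) * \<sigma> powr (- 2 * a) = 1" using \<sigma> by (simp add: powr_add[symmetric] del: mult_minus_left)
        ultimately have "M < l0\<^sup>2 * \<sigma> powr (- 2 * a) * (\<delta>\<^sup>2 * d / 2)" by (simp add: mult.assoc mult.left_commute mult.commute)
        also have "\<dots> \<le> (l (snd p))\<^sup>2 * (\<delta>\<^sup>2 * d / 2)"
          using lower[of "snd p"] nb by (intro mult_right_mono) (auto simp: S)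
        finally show ?thesis .
      qed
      have "0 < w.Z N p" if wall: "w.wallf p = 0"
      proof (rule w.Z_neck[OF open_UNIV UNIV_I N_def kn(2) dl0 lpos wall S(2,3) nb(1,2)])
        show "norm (w.\<xi> p) \<le> 1" using xi by (simp add: q_def)
        have "norm (w.\<xi> p) \<le> (\<delta>\<^sup>2 * d / 2) / (C * \<delta>\<^sup>2 + C ^ 3)" using xi by (simp add: q_def)
        then show "(C * \<delta>\<^sup>2 + C ^ 3) * norm (w.\<xi> p) \<le> \<delta>\<^sup>2 * d / 2" unfolding pos_le_divide_eq[OF CC] by (subst mult.commute)
        have "norm (w.\<xi> p) \<le> d / C" using xi by (simp add: q_def)
        then show "C * norm (w.\<xi> p) \<le> d" using C0 by (simp add: pos_le_divide_eq mult.commute)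
        show "2 * C ^ 5 + 2 * C ^ 5 + 2 * C ^ 5 + 2 * C ^ 5 / \<delta> + C ^ 4 / \<delta> < (l (snd p))\<^sup>2 * (\<delta>\<^sup>2 * d / 2)"
          using large unfolding M_def .
      qed (use b nb(3,4) nb(5)[OF 2] in \<open>simp_all add: k1_def k2_def\<close>)
      then show ?thesis using n lpos scale[OF n(2)] by (simp add: lN N_def)
    qed
  qed
  obtain W N' where W: "w.domain \<subseteq> W" "smooth_on W N'" "\<And>p. p \<in> W \<Longrightarrow> 0 < N' p"
    "\<And>p. p \<in> w.domain \<Longrightarrow> lapl N' p < scalar_curvature met (fst p) / 2 * N' p"
    "\<And>p. p \<in> w.domain \<Longrightarrow> w.wallf p = 0 \<Longrightarrow> w.Z N' p = 0"
    by (rule w.bend[OF sN]) (use good in blast)+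
  have ends: "k 0 = 0" "k 3 = 1" "S 0 = 1 / 2" "S 3 = 1 / 2" "k1 0 = 0" "k1 3 = 0" "S1 0 = 0" "S1 3 = 0"
    using kn(3)[of 0] kn(4)[of 3] rf(8,9) rf(5,6)[of 0] k0[of 0] k0[of 3] by auto
  show ?thesis by (rule w.concordance_metric[OF W(2,1,3,4,5) ends]) (assumption | rule that)+
qed

section \<open>A kernel almost symmetric under the operator\<close>

lemma dd_add: "smooth f \<Longrightarrow> smooth g \<Longrightarrow> dd (\<lambda>x. f x + g x) v x = dd f v x + dd g v x"
  and dd_diff: "smooth f \<Longrightarrow> smooth g \<Longrightarrow> dd (\<lambda>x. f x - g x) v x = dd f v x - dd g v x"
  and dd_mult: "smooth f \<Longrightarrow> smooth g \<Longrightarrow> dd (\<lambda>x. f x * g x) v x = f x * dd g v x + dd f v x * g x"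
  by (auto intro!: dd_eqI has_derivative_add has_derivative_diff has_derivative_mult smooth_on_deriv)

lemma dd_const [simp]: "dd (\<lambda>x. c) v x = 0"
  by (rule dd_eqI) (rule has_derivative_const)

lemma dd_dir2:
  fixes f :: "real^2 \<Rightarrow> real"
  assumes "smooth f"
  shows "dd f v x = v$1 * dd f (axis 1 1) x + v$2 * dd f (axis 2 1) x"
proof -
  have lin: "linear (\<lambda>v. dd f v x)" by (rule has_derivative_linear[OF smooth_on_deriv[OF assms UNIV_I]])
  show ?thesis
    by (subst vec2_axis[of v]) (simp only: linear_add[OF lin] linear_scale[OF lin] real_scaleR_def)
qed

lemma smooth_line_deriv:
  fixes f :: "real^2 \<Rightarrow> real"
  assumes "smooth f"
  shows "((\<lambda>t. f (z + t *\<^sub>R v)) has_real_derivative dd f v (z + t *\<^sub>R v)) (at t)"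
proof -
  have lin: "linear (\<lambda>w. dd f w (z + t *\<^sub>R v))"
    by (rule has_derivative_linear[OF smooth_on_deriv[OF assms UNIV_I]])
  moreover have "((\<lambda>t. f (z + t *\<^sub>R v)) has_derivative (\<lambda>s. dd f (s *\<^sub>R v) (z + t *\<^sub>R v))) (at t)"
    by (rule has_derivative_compose[OF _ smooth_on_deriv[OF assms UNIV_I]])
      (auto intro!: derivative_eq_intros)
  ultimately have "((\<lambda>t. f (z + t *\<^sub>R v)) has_derivative (\<lambda>s. dd f v (z + t *\<^sub>R v) * s)) (at t)"
    by (simp only: linear_scale[OF lin] real_scaleR_def mult.commute)
  then show ?thesis by (simp add: has_field_derivative_def)
qed

text \<open>A function of a midpoint \<open>z\<close> and a displacement \<open>\<xi>\<close> vanishing to order \<open>n\<close> in \<open>\<xi>\<close>.\<close>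

definition vanishing :: "real \<Rightarrow> nat \<Rightarrow> (real^2 \<Rightarrow> real^2 \<Rightarrow> real) \<Rightarrow> bool" where
  "vanishing R n F \<longleftrightarrow> (\<exists>C\<ge>0. \<forall>z\<in>cball 0 R. \<forall>\<xi>\<in>cball 0 R. \<bar>F z \<xi>\<bar> \<le> C * norm \<xi> ^ n)"

lemma vanishing_mult:
  assumes "vanishing R m F" "vanishing R n G" shows "vanishing R (m + n) (\<lambda>z \<xi>. F z \<xi> * G z \<xi>)"
proof -
  obtain C C' where C: "0 \<le> C" "0 \<le> C'" and F: "\<forall>z\<in>cball 0 R. \<forall>\<xi>\<in>cball 0 R. \<bar>F z \<xi>\<bar> \<le> C * norm \<xi> ^ m"
    and G: "\<forall>z\<in>cball 0 R. \<forall>\<xi>\<in>cball 0 R. \<bar>G z \<xi>\<bar> \<le> C' * norm \<xi> ^ n"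
    using assms unfolding vanishing_def by auto
  have "\<bar>F z \<xi> * G z \<xi>\<bar> \<le> C * C' * norm \<xi> ^ (m + n)" if "z \<in> cball 0 R" "\<xi> \<in> cball 0 R" for z \<xi>
  proof -
    have "\<bar>F z \<xi>\<bar> * \<bar>G z \<xi>\<bar> \<le> (C * norm \<xi> ^ m) * (C' * norm \<xi> ^ n)"
      using F G C that by (intro mult_mono) auto
    then show ?thesis by (simp add: abs_mult power_add algebra_simps)
  qed
  then show ?thesis unfolding vanishing_def using C by (intro exI[of _ "C * C'"]) auto
qed

lemma vanishing_add:
  assumes "vanishing R n F" "vanishing R n G" shows "vanishing R n (\<lambda>z \<xi>. F z \<xi> + G z \<xi>)"
proof -
  obtain C C' where C: "0 \<le> C" "0 \<le> C'" and F: "\<forall>z\<in>cball 0 R. \<forall>\<xi>\<in>cball 0 R. \<bar>F z \<xi>\<bar> \<le> C * norm \<xi> ^ n"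
    and G: "\<forall>z\<in>cball 0 R. \<forall>\<xi>\<in>cball 0 R. \<bar>G z \<xi>\<bar> \<le> C' * norm \<xi> ^ n"
    using assms unfolding vanishing_def by auto
  have "\<bar>F z \<xi> + G z \<xi>\<bar> \<le> (C + C') * norm \<xi> ^ n" if "z \<in> cball 0 R" "\<xi> \<in> cball 0 R" for z \<xi>
    using add_mono[OF bspec[OF bspec[OF F that(1)] that(2)] bspec[OF bspec[OF G that(1)] that(2)]]
    by (intro order_trans[OF abs_triangle_ineq]) (simp add: algebra_simps)
  then show ?thesis unfolding vanishing_def using C by (intro exI[of _ "C + C'"]) auto
qed

lemma vanishing_coord: "vanishing R 1 (\<lambda>z \<xi>. \<xi> $ i)"
  unfolding vanishing_def by (intro exI[of _ 1]) (auto simp: component_le_norm_cart)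

lemma vanishing_base:
  fixes f :: "real^2 \<Rightarrow> real"
  assumes "smooth f" shows "vanishing R 0 (\<lambda>z \<xi>. f z)"
proof -
  obtain C where "0 < C" "\<And>z. z \<in> cball 0 R \<Longrightarrow> \<bar>f z\<bar> \<le> C"
    using compact_bounded_real[OF compact_cball[of 0 R] cont_smooth[OF assms]] by blast
  then show ?thesis unfolding vanishing_def by (intro exI[of _ C]) auto
qed

section \<open>Taylor expansion about a midpoint\<close>

definition even_part :: "(real^2 \<Rightarrow> real) \<Rightarrow> real^2 \<Rightarrow> real^2 \<Rightarrow> real" where
  "even_part f z \<xi> = (f (z + (1/2) *\<^sub>R \<xi>) + f (z - (1/2) *\<^sub>R \<xi>)) / 2"

definition odd_part :: "(real^2 \<Rightarrow> real) \<Rightarrow> real^2 \<Rightarrow> real^2 \<Rightarrow> real" where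
  "odd_part f z \<xi> = (f (z + (1/2) *\<^sub>R \<xi>) - f (z - (1/2) *\<^sub>R \<xi>)) / 2"

fun dir :: "nat \<Rightarrow> (real^2 \<Rightarrow> real) \<Rightarrow> real^2 \<Rightarrow> real^2 \<Rightarrow> real" where
  "dir 0 f v = f"
| "dir (Suc n) f v = dd (dir n f v) v"

lemma smooth_dir: "smooth f \<Longrightarrow> smooth (dir n f v)"
  by (induction n) (simp_all add: smooth_on_dd)

lemma dir_Suc_components:
  assumes "smooth f"
  shows "dir (Suc n) f v = (\<lambda>x. v$1 * dir n (dd f (axis 1 1)) v x + v$2 * dir n (dd f (axis 2 1)) v x)"
proof (induction n)
  case 0
  then show ?case using dd_dir2[OF assms, of v] by auto
next
  case (Suc n)
  have sm: "smooth (dir n (dd f e) v)" for e by (intro smooth_dir smooth_on_dd assms)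
  show ?case
    unfolding dir.simps(2)[of "Suc n"] Suc.IH
    by (rule ext) (simp add: dd_add dd_mult smooth_on_mult sm)
qed

lemma dir_bound:
  "smooth f \<Longrightarrow> \<exists>C\<ge>0. \<forall>x\<in>cball 0 R. \<forall>v. \<bar>dir n f v x\<bar> \<le> C * norm v ^ n"
proof (induction n arbitrary: f)
  case 0
  then show ?case
    using compact_bounded_real[OF compact_cball[of 0 R] cont_smooth[OF 0]] less_imp_le by (metis dir.simps(1) mult.right_neutral power_0)
next
  case (Suc n)
  obtain C1 C2 where C: "0 \<le> C1" "0 \<le> C2"
    and C1: "\<And>x v. x \<in> cball 0 R \<Longrightarrow> \<bar>dir n (dd f (axis 1 1)) v x\<bar> \<le> C1 * norm v ^ n"
    and C2: "\<And>x v. x \<in> cball 0 R \<Longrightarrow> \<bar>dir n (dd f (axis 2 1)) v x\<bar> \<le> C2 * norm v ^ n"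
    using Suc.IH[OF smooth_on_dd[OF Suc.prems], of "axis 1 1"] Suc.IH[OF smooth_on_dd[OF Suc.prems], of "axis 2 1"] by auto
  have "\<bar>dir (Suc n) f v x\<bar> \<le> (C1 + C2) * norm v ^ Suc n" if x: "x \<in> cball 0 R" for x v
  proof -
    have "\<bar>dir (Suc n) f v x\<bar> \<le> \<bar>v$1\<bar> * \<bar>dir n (dd f (axis 1 1)) v x\<bar> + \<bar>v$2\<bar> * \<bar>dir n (dd f (axis 2 1)) v x\<bar>"
      unfolding dir_Suc_components[OF Suc.prems] by (rule order_trans[OF abs_triangle_ineq]) (simp add: abs_mult)
    also have "\<dots> \<le> norm v * (C1 * norm v ^ n) + norm v * (C2 * norm v ^ n)"
      using C1[OF x] C2[OF x] by (intro add_mono mult_mono) (auto simp: component_le_norm_cart)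
    finally show ?thesis by (simp add: algebra_simps)
  qed
  then show ?case using C by (intro exI[of _ "C1 + C2"]) auto
qed

lemma taylor_dir:
  assumes "smooth f"
  obtains t where "\<bar>t\<bar> \<le> \<bar>s\<bar>"
    "f (z + s *\<^sub>R v) = (\<Sum>m<n. dir m f v z / fact m * s ^ m) + dir n f v (z + t *\<^sub>R v) / fact n * s ^ n"
  using Maclaurin_all_le[of "\<lambda>m t. dir m f v (z + t *\<^sub>R v)" "\<lambda>t. f (z + t *\<^sub>R v)" s n]
    smooth_line_deriv[OF smooth_dir[OF assms]] by auto

text \<open>Expand \<open>f\<close> at the midpoint towards both endpoints. In the odd part all even
  orders cancel, so the linear term is the only one below order 3; in the even part the linear term
  cancels.\<close>

lemma vanishing_parity:
  assumes f: "smooth f" and R: "0 \<le> R"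
  shows "vanishing R 1 (odd_part f)" "vanishing R 2 (\<lambda>z \<xi>. even_part f z \<xi> - f z)"
    "vanishing R 3 (\<lambda>z \<xi>. odd_part f z \<xi> - dd f \<xi> z / 2)"
proof -
  have expand: "\<exists>C\<ge>0. \<forall>z\<in>cball 0 R. \<forall>\<xi>\<in>cball 0 R. \<exists>a b. \<bar>a\<bar> \<le> C * norm \<xi> ^ n \<and> \<bar>b\<bar> \<le> C * norm \<xi> ^ n \<and>
      f (z + (1/2) *\<^sub>R \<xi>) = (\<Sum>m<n. dir m f \<xi> z / fact m * (1/2) ^ m) + a / fact n * (1/2) ^ n \<and>
      f (z - (1/2) *\<^sub>R \<xi>) = (\<Sum>m<n. dir m f \<xi> z / fact m * (- 1/2) ^ m) + b / fact n * (- 1/2) ^ n" for n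
  proof -
    obtain C where C: "0 \<le> C" "\<And>x v. x \<in> cball 0 (2 * R) \<Longrightarrow> \<bar>dir n f v x\<bar> \<le> C * norm v ^ n"
      using dir_bound[OF f, of "2 * R" n] by auto
    have ball: "z + t *\<^sub>R \<xi> \<in> cball 0 (2 * R)" if "z \<in> cball 0 R" "\<xi> \<in> cball 0 R" "\<bar>t\<bar> \<le> 1/2" for z \<xi> :: "real^2" and t
    proof -
      have "\<bar>t\<bar> * norm \<xi> \<le> 1 * R" using that by (intro mult_mono) auto
      then show ?thesis using norm_triangle_ineq[of z "t *\<^sub>R \<xi>"] that by auto
    qed
    show ?thesis
    proof (rule exI[of _ C], intro conjI C(1) ballI)
      fix z \<xi> :: "real^2" assume z: "z \<in> cball 0 R" "\<xi> \<in> cball 0 R"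
      obtain s where s: "\<bar>s\<bar> \<le> \<bar>1/2::real\<bar>"
        "f (z + (1/2) *\<^sub>R \<xi>) = (\<Sum>m<n. dir m f \<xi> z / fact m * (1/2) ^ m) + dir n f \<xi> (z + s *\<^sub>R \<xi>) / fact n * (1/2) ^ n"
        by (rule taylor_dir[OF f])
      obtain t where t: "\<bar>t\<bar> \<le> \<bar>- 1/2::real\<bar>"
        "f (z + (- 1/2) *\<^sub>R \<xi>) = (\<Sum>m<n. dir m f \<xi> z / fact m * (- 1/2) ^ m) + dir n f \<xi> (z + t *\<^sub>R \<xi>) / fact n * (- 1/2) ^ n"
        by (rule taylor_dir[OF f])
      show "\<exists>a b. \<bar>a\<bar> \<le> C * norm \<xi> ^ n \<and> \<bar>b\<bar> \<le> C * norm \<xi> ^ n \<and>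
        f (z + (1/2) *\<^sub>R \<xi>) = (\<Sum>m<n. dir m f \<xi> z / fact m * (1/2) ^ m) + a / fact n * (1/2) ^ n \<and>
        f (z - (1/2) *\<^sub>R \<xi>) = (\<Sum>m<n. dir m f \<xi> z / fact m * (- 1/2) ^ m) + b / fact n * (- 1/2) ^ n"
        by (rule exI[of _ "dir n f \<xi> (z + s *\<^sub>R \<xi>)"], rule exI[of _ "dir n f \<xi> (z + t *\<^sub>R \<xi>)"])
          (use s t C(2) ball[OF z] in simp)
    qed
  qed
  have conclude: "vanishing R n F"
    if "\<And>z \<xi> a b C. \<bar>a\<bar> \<le> C \<Longrightarrow> \<bar>b\<bar> \<le> C \<Longrightarrow>
      f (z + (1/2) *\<^sub>R \<xi>) = (\<Sum>m<n. dir m f \<xi> z / fact m * (1/2) ^ m) + a / fact n * (1/2) ^ n \<Longrightarrow>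
      f (z - (1/2) *\<^sub>R \<xi>) = (\<Sum>m<n. dir m f \<xi> z / fact m * (- 1/2) ^ m) + b / fact n * (- 1/2) ^ n \<Longrightarrow> \<bar>F z \<xi>\<bar> \<le> C" for n F
    unfolding vanishing_def using expand[of n] that by meson
  show "vanishing R 1 (odd_part f)" by (rule conclude) (auto simp: odd_part_def abs_le_iff)
  show "vanishing R 2 (\<lambda>z \<xi>. even_part f z \<xi> - f z)"
    by (rule conclude) (auto simp: even_part_def numeral_2_eq_2 lessThan_Suc abs_le_iff field_simps)
  show "vanishing R 3 (\<lambda>z \<xi>. odd_part f z \<xi> - dd f \<xi> z / 2)"
    by (rule conclude) (auto simp: odd_part_def numeral_3_eq_3 numeral_2_eq_2 lessThan_Suc abs_le_iff field_simps)
qed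

lemma dd_real_compose:
  assumes "smooth f" "(\<phi> has_real_derivative d) (at (f x))"
  shows "dd (\<lambda>x. \<phi> (f x)) v x = d * dd f v x"
  by (rule dd_eqI)
    (use has_derivative_compose[OF smooth_on_deriv[OF assms(1) UNIV_I] assms(2)[unfolded has_field_derivative_def]]
      in simp)

lemma vanishing_cmult: "vanishing R n F \<Longrightarrow> vanishing R n (\<lambda>z \<xi>. c * F z \<xi>)" for c :: real
  using vanishing_mult[OF vanishing_base[OF smooth_on_const[OF open_UNIV]], of R n F c] by simp

lemma vanishing_diff:
  "vanishing R n F \<Longrightarrow> vanishing R n G \<Longrightarrow> vanishing R n (\<lambda>z \<xi>. F z \<xi> - G z \<xi>)"
  using vanishing_add[of R n F "\<lambda>z \<xi>. (- 1) * G z \<xi>"] vanishing_cmult[of R n G "- 1"] by simp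

lemma vanishing_pairing:
  assumes "vanishing R m F1" "vanishing R m F2" "vanishing R n G1" "vanishing R n G2" "k = m + n"
  shows "vanishing R k (\<lambda>z \<xi>. F1 z \<xi> * G1 z \<xi> + F2 z \<xi> * G2 z \<xi>)"
  unfolding assms(5) by (intro vanishing_add vanishing_mult assms)

lemma vanishing_contraction:
  assumes "vanishing R m F1" "vanishing R m F2" "vanishing R m F3"
    "vanishing R n G11" "vanishing R n G12" "vanishing R n G21" "vanishing R n G22" "k = m + n"
  shows "vanishing R k (\<lambda>z \<xi>. F3 z \<xi> * G11 z \<xi> - F2 z \<xi> * (G12 z \<xi> + G21 z \<xi>) + F1 z \<xi> * G22 z \<xi>)"
  unfolding assms(8) by (intro vanishing_add vanishing_diff vanishing_mult assms)

lemma odd_even_split: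
  "f (z + (1/2) *\<^sub>R \<xi>) = even_part f z \<xi> + odd_part f z \<xi>"
  "f (z - (1/2) *\<^sub>R \<xi>) = even_part f z \<xi> - odd_part f z \<xi>"
  by (simp_all add: even_part_def odd_part_def field_simps)

text \<open>Determinant one makes the inverse matrix a rearrangement of the entries of
  \<open>b\<close>, and its constancy is what cancels the leading terms in
  \<open>divop_antisymmetry\<close>.\<close>

locale unimodular =
  fixes b1 b2 b3 :: "real^2 \<Rightarrow> real" and c0 :: real
  assumes sb: "smooth b1" "smooth b2" "smooth b3"
    and det1: "b1 x * b3 x - b2 x * b2 x = 1"
    and c0: "0 < c0" "c0 * (norm (\<xi>::real^2))\<^sup>2 \<le> b1 x * (\<xi>$1 * \<xi>$1) + 2 * b2 x * (\<xi>$1 * \<xi>$2) + b3 x * (\<xi>$2 * \<xi>$2)"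
begin

abbreviation d1 :: "(real^2 \<Rightarrow> real) \<Rightarrow> real^2 \<Rightarrow> real" where "d1 f \<equiv> dd f (axis 1 1)"
abbreviation d2 :: "(real^2 \<Rightarrow> real) \<Rightarrow> real^2 \<Rightarrow> real" where "d2 f \<equiv> dd f (axis 2 1)"

text \<open>The divergence form operator of the inverse matrix of \<open>b\<close>, which has entries \<open>b3\<close>, \<open>- b2\<close>, \<open>b1\<close>
  because \<open>b\<close> has determinant one.\<close>

definition divop :: "(real^2 \<Rightarrow> real) \<Rightarrow> real^2 \<Rightarrow> real" where
  "divop u x = d1 (\<lambda>x. b3 x * d1 u x - b2 x * d2 u x) x + d2 (\<lambda>x. b1 x * d2 u x - b2 x * d1 u x) x"

definition A1 :: "real^2 \<Rightarrow> real" where "A1 x = d1 b3 x - d2 b2 x"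
definition A2 :: "real^2 \<Rightarrow> real" where "A2 x = d2 b1 x - d1 b2 x"

lemma smooth_A: "smooth A1" "smooth A2"
  unfolding A1_def A2_def by (intro smooth_on_diff smooth_on_dd sb)+

lemma divop_expand:
  assumes u: "smooth u"
  shows "divop u x = A1 x * d1 u x + A2 x * d2 u x
    + (b3 x * d1 (d1 u) x - b2 x * (d1 (d2 u) x + d2 (d1 u) x) + b1 x * d2 (d2 u) x)"
  unfolding divop_def A1_def A2_def
  by (simp add: dd_diff dd_mult smooth_on_mult smooth_on_dd u sb algebra_simps)

text \<open>The inverse matrix as a quadratic form on covectors (p, q), which is the principal
  symbol of \<open>divop\<close> up to sign.\<close>

definition qform :: "real^2 \<Rightarrow> real \<Rightarrow> real \<Rightarrow> real" where
  "qform x p q = b3 x * (p * p) - 2 * b2 x * (p * q) + b1 x * (q * q)"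

lemma divop_compose:
  assumes u: "smooth u" and \<phi>: "\<And>s. (\<phi> has_real_derivative \<phi>1 s) (at s)" "\<And>s. (\<phi>1 has_real_derivative \<phi>2 s) (at s)"
    and sm: "smooth \<phi>" "smooth \<phi>1"
  shows "divop (\<lambda>x. \<phi> (u x)) x = \<phi>2 (u x) * qform x (d1 u x) (d2 u x) + \<phi>1 (u x) * divop u x"
proof -
  have smc: "smooth (\<lambda>x. \<phi> (u x))" "smooth (\<lambda>x. \<phi>1 (u x))"
    by (rule smooth_on_compose_real[OF sm(1) u]; simp) (rule smooth_on_compose_real[OF sm(2) u]; simp)
  have "dd (\<lambda>x. \<phi> (u x)) v = (\<lambda>x. \<phi>1 (u x) * dd u v x)" for v
    by (rule ext) (rule dd_real_compose[OF u \<phi>(1)])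
  moreover have "dd (\<lambda>x. \<phi>1 (u x)) v = (\<lambda>x. \<phi>2 (u x) * dd u v x)" for v
    by (rule ext) (rule dd_real_compose[OF u \<phi>(2)])
  ultimately show ?thesis
    unfolding divop_expand[OF u] divop_expand[OF smc(1)] qform_def
    by (simp add: dd_mult smc smooth_on_dd[OF u] algebra_simps)
qed

definition \<Psi> :: "real^2 \<Rightarrow> real^2 \<Rightarrow> real" where
  "\<Psi> z \<xi> = b1 z * (\<xi>$1 * \<xi>$1) + 2 * b2 z * (\<xi>$1 * \<xi>$2) + b3 z * (\<xi>$2 * \<xi>$2)"

text \<open>With \<open>z\<close> the midpoint of \<open>x\<close> and \<open>y\<close>, and \<open>\<xi> = x - y\<close>, the terms \<open>P\<close> and \<open>Qf\<close> of the first
  derivatives of the phase come from differentiating \<open>\<xi>\<close> and \<open>z\<close>; exchanging \<open>x\<close> and \<open>y\<close> changes the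
  sign of \<open>P\<close> only.\<close>

definition P1 :: "real^2 \<Rightarrow> real^2 \<Rightarrow> real" where "P1 z \<xi> = 2 * (b1 z * \<xi>$1 + b2 z * \<xi>$2)"
definition P2 :: "real^2 \<Rightarrow> real^2 \<Rightarrow> real" where "P2 z \<xi> = 2 * (b2 z * \<xi>$1 + b3 z * \<xi>$2)"
definition Qf :: "real^2 \<Rightarrow> real^2 \<Rightarrow> real^2 \<Rightarrow> real" where
  "Qf v z \<xi> = (dd b1 v z * (\<xi>$1 * \<xi>$1) + 2 * dd b2 v z * (\<xi>$1 * \<xi>$2) + dd b3 v z * (\<xi>$2 * \<xi>$2)) / 2"
text \<open>Pieces of the second derivatives of the phase: \<open>mf\<close> has both derivatives on
  the coefficients, whereas \<open>N1\<close> and \<open>N2\<close> have one on the coefficients and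
  one on \<xi>.\<close>

definition mf :: "real^2 \<Rightarrow> real^2 \<Rightarrow> real^2 \<Rightarrow> real^2 \<Rightarrow> real" where
  "mf v w z \<xi> = (dd (dd b1 v) w z * (\<xi>$1 * \<xi>$1) + 2 * dd (dd b2 v) w z * (\<xi>$1 * \<xi>$2) + dd (dd b3 v) w z * (\<xi>$2 * \<xi>$2)) / 4"
definition N1 :: "real^2 \<Rightarrow> real^2 \<Rightarrow> real^2 \<Rightarrow> real" where "N1 v z \<xi> = dd b1 v z * \<xi>$1 + dd b2 v z * \<xi>$2"
definition N2 :: "real^2 \<Rightarrow> real^2 \<Rightarrow> real^2 \<Rightarrow> real" where "N2 v z \<xi> = dd b2 v z * \<xi>$1 + dd b3 v z * \<xi>$2"

definition phase :: "real^2 \<Rightarrow> real^2 \<Rightarrow> real" where "phase y x = \<Psi> ((1/2) *\<^sub>R (x + y)) (x - y)"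

lemma mid_deriv:
  assumes "smooth f"
  shows "((\<lambda>x. f ((1/2) *\<^sub>R (x + y))) has_derivative (\<lambda>v. dd f v ((1/2) *\<^sub>R (x + y)) / 2)) (at x)"
proof -
  have lin: "linear (\<lambda>w. dd f w ((1/2) *\<^sub>R (x + y)))"
    by (rule has_derivative_linear[OF smooth_on_deriv[OF assms UNIV_I]])
  have "((\<lambda>x. f ((1/2) *\<^sub>R (x + y))) has_derivative (\<lambda>v. dd f ((1/2) *\<^sub>R v) ((1/2) *\<^sub>R (x + y)))) (at x)"
    by (rule has_derivative_compose[OF _ smooth_on_deriv[OF assms UNIV_I]]) (auto intro!: derivative_eq_intros)
  then show ?thesis by (simp only: linear_scale[OF lin] real_scaleR_def) simp
qed

lemma coord_deriv: "((\<lambda>x. (x - y) $ i) has_derivative (\<lambda>v. v $ i)) (at (x::real^2))"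
  using has_derivative_diff[OF bounded_linear.has_derivative[OF bounded_linear_vec_nth has_derivative_ident]
    has_derivative_const, of i "y $ i"] by simp

lemma smooth_phase: "smooth (phase y)"
proof -
  have l: "smooth (\<lambda>x. x \<bullet> b)" for b :: "real^2"
    by (intro smooth_on_linear bounded_linear_inner_left) simp
  have m: "smooth (\<lambda>x. f ((1/2) *\<^sub>R (x + y)))" if "smooth f" for f
    by (rule smooth_on_compose[OF that])
      (auto simp: inner_add_left intro!: smooth_on_divide smooth_on_add smooth_on_const l)
  have c: "smooth (\<lambda>x. (x - y) $ i)" for i
    by (simp add: smooth_on_diff smooth_on_nth)
  show ?thesis unfolding phase_def \<Psi>_def
    by (intro smooth_on_add smooth_on_mult m[OF sb(1)] m[OF sb(2)] m[OF sb(3)] c smooth_on_const open_UNIV)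
qed

lemma dd_phase:
  "dd (phase y) v x = v$1 * P1 ((1/2) *\<^sub>R (x + y)) (x - y) + v$2 * P2 ((1/2) *\<^sub>R (x + y)) (x - y)
      + Qf v ((1/2) *\<^sub>R (x + y)) (x - y)"
  unfolding phase_def[abs_def] \<Psi>_def
  by (rule dd_eqI)
    (rule has_derivative_eq_rhs,
      (rule has_derivative_add has_derivative_mult has_derivative_const mid_deriv sb coord_deriv)+,
      simp add: fun_eq_iff P1_def P2_def Qf_def field_simps)

lemma dd_phase2:
  fixes x y :: "real^2" defines "z \<equiv> (1/2) *\<^sub>R (x + y)" and "\<xi> \<equiv> x - y"
  shows "dd (dd (phase y) w) v x = 2 * (b1 z * (v$1 * w$1) + b2 z * (v$1 * w$2 + v$2 * w$1) + b3 z * (v$2 * w$2))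
    + (w$1 * N1 v z \<xi> + w$2 * N2 v z \<xi> + v$1 * N1 w z \<xi> + v$2 * N2 w z \<xi>) + mf w v z \<xi>"
  unfolding dd_phase[abs_def] P1_def P2_def Qf_def z_def \<xi>_def
  by (rule dd_eqI)
    (rule has_derivative_eq_rhs,
      (rule has_derivative_add has_derivative_mult has_derivative_const has_derivative_divide' mid_deriv sb smooth_on_dd coord_deriv)+,
      simp_all add: fun_eq_iff N1_def N2_def mf_def field_simps)

lemma det_deriv: "dd b1 v z * b3 z + b1 z * dd b3 v z - 2 * b2 z * dd b2 v z = 0"
proof -
  have "(\<lambda>z. b1 z * b3 z - b2 z * b2 z) = (\<lambda>z. 1)" using det1 by simp
  then have "dd (\<lambda>z. b1 z * b3 z - b2 z * b2 z) v z = 0" by simp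
  then show ?thesis by (simp add: dd_diff dd_mult sb smooth_on_mult)
qed

lemma vanishing_linear_form:
  assumes "smooth f" "smooth g"
  shows "vanishing R 1 (\<lambda>z \<xi>. f z * \<xi>$1 + g z * \<xi>$2)"
  using vanishing_pairing[OF vanishing_base[OF assms(1)] vanishing_base[OF assms(2)] vanishing_coord vanishing_coord, of 1 R 1 2]
  by simp

lemma vanishing_quadratic_form:
  assumes "smooth f" "smooth g" "smooth h"
  shows "vanishing R 2 (\<lambda>z \<xi>. f z * (\<xi>$1 * \<xi>$1) + 2 * g z * (\<xi>$1 * \<xi>$2) + h z * (\<xi>$2 * \<xi>$2))"
proof -
  have "vanishing R (0 + (1 + 1)) (\<lambda>z \<xi>. k z * (\<xi>$i * \<xi>$j))" if "smooth k" for k and i j :: 2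
    by (intro vanishing_mult vanishing_base that vanishing_coord)
  then have q: "vanishing R 2 (\<lambda>z \<xi>. k z * (\<xi>$i * \<xi>$j))" if "smooth k" for k and i j :: 2
    using that by (simp add: numeral_2_eq_2)
  have "smooth (\<lambda>z. 2 * g z)" using assms(2) by (intro smooth_on_mult smooth_on_const) auto
  then show ?thesis by (intro vanishing_add q assms)
qed

lemma vanishing_parts:
  "vanishing R 1 P1" "vanishing R 1 P2" "vanishing R 2 (Qf v)" "vanishing R 2 (mf v w)"
  "vanishing R 1 (N1 v)" "vanishing R 1 (N2 v)"
proof -
  show "vanishing R 1 P1" "vanishing R 1 P2"
    unfolding P1_def[abs_def] P2_def[abs_def] by (intro vanishing_cmult vanishing_linear_form sb)+
  show "vanishing R 1 (N1 v)" "vanishing R 1 (N2 v)"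
    unfolding N1_def[abs_def] N2_def[abs_def] by (intro vanishing_linear_form sb smooth_on_dd)+
  have "vanishing R 2 (\<lambda>z \<xi>. (1/2) * (dd b1 v z * (\<xi>$1 * \<xi>$1) + 2 * dd b2 v z * (\<xi>$1 * \<xi>$2) + dd b3 v z * (\<xi>$2 * \<xi>$2)))"
    by (intro vanishing_cmult vanishing_quadratic_form sb smooth_on_dd)
  then show "vanishing R 2 (Qf v)" unfolding Qf_def[abs_def] by simp
  have "vanishing R 2 (\<lambda>z \<xi>. (1/4) * (dd (dd b1 v) w z * (\<xi>$1 * \<xi>$1) + 2 * dd (dd b2 v) w z * (\<xi>$1 * \<xi>$2) + dd (dd b3 v) w z * (\<xi>$2 * \<xi>$2)))"
    by (intro vanishing_cmult vanishing_quadratic_form sb smooth_on_dd)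
  then show "vanishing R 2 (mf v w)" unfolding mf_def[abs_def] by simp
qed

lemma midpoint_split:
  fixes x y :: "real^2"
  obtains z \<xi> where "x = z + (1/2) *\<^sub>R \<xi>" "y = z - (1/2) *\<^sub>R \<xi>" "x - y = \<xi>" "(1/2) *\<^sub>R (x + y) = z"
  by (rule that[of "(1/2) *\<^sub>R (x + y)" "x - y"]) (simp_all add: vec2_eq_iff field_simps)

lemma midpoint_bound:
  fixes x y :: "real^2"
  assumes "x \<in> cball 0 R" "y \<in> cball 0 R" "(1/2) *\<^sub>R (x + y) = z" "x - y = \<xi>"
  shows "z \<in> cball 0 (2 * R)" "\<xi> \<in> cball 0 (2 * R)"
proof -
  have n: "norm x \<le> R" "norm y \<le> R" "0 \<le> R" using assms(1,2) order_trans[OF norm_ge_zero, of x R] by auto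
  show "\<xi> \<in> cball 0 (2 * R)" using norm_triangle_ineq4[of x y] n by (simp flip: assms(4))
  show "z \<in> cball 0 (2 * R)" using norm_triangle_ineq[of x y] n by (simp flip: assms(3))
qed

text \<open>Let a be the inverse of b at the midpoint and D the derivative along \<xi>. The leading
  part of the difference is 4 a(P, Q) + (D a)(P, P). Since P = 2 b \<xi> and Q is half the gradient
  of b(\<xi>, \<xi>) in the midpoint, the first summand is 4 (D b)(\<xi>, \<xi>); since D a = - a (D
  b) a, the second is its negative.\<close>

lemma symbol_antisymmetry:
  assumes "0 \<le> R"
  obtains C where "0 \<le> C" "\<And>x y. x \<in> cball 0 R \<Longrightarrow> y \<in> cball 0 R \<Longrightarrow>
    \<bar>qform x (d1 (phase y) x) (d2 (phase y) x) - qform y (d1 (phase x) y) (d2 (phase x) y)\<bar> \<le> C * norm (x - y) ^ 5"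
proof -
  let ?Q1 = "Qf (axis 1 1)" and ?Q2 = "Qf (axis 2 1)"
  define F where "F f z \<xi> = even_part f z \<xi> - f z" for f :: "real^2 \<Rightarrow> real" and z \<xi>
  define K where "K f z \<xi> = odd_part f z \<xi> - dd f \<xi> z / 2" for f :: "real^2 \<Rightarrow> real" and z \<xi>
  define con where "con f1 f2 f3 p1 p2 q1 q2 = (\<lambda>z \<xi>. f3 z \<xi> * (p1 z \<xi> * q1 z \<xi>) - f2 z \<xi> * (p1 z \<xi> * q2 z \<xi> + p2 z \<xi> * q1 z \<xi>) + f1 z \<xi> * (p2 z \<xi> * q2 z \<xi>))"
    for f1 f2 f3 p1 p2 q1 q2 :: "real^2 \<Rightarrow> real^2 \<Rightarrow> real"
  have R: "0 \<le> 2 * R" using assms by simp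
  note par = vanishing_parity[OF _ R, folded F_def K_def]
  have con: "vanishing (2*R) k (con f1 f2 f3 p1 p2 q1 q2)"
    if "vanishing (2*R) l f1" "vanishing (2*R) l f2" "vanishing (2*R) l f3" "vanishing (2*R) m p1" "vanishing (2*R) m p2"
      "vanishing (2*R) n q1" "vanishing (2*R) n q2" "k = l + (m + n)" for k l m n f1 f2 f3 p1 p2 q1 q2
    unfolding con_def by (rule vanishing_contraction[OF that(1-3) _ _ _ _ that(8)]) (intro vanishing_mult that)+
  \<comment> \<open>What is left after the cancellation; the three products vanish to the orders 2 +
    1 + 2, 3 + 1 + 1 and 1 + 2 + 2.\<close>
  define T where "T z \<xi> = 4 * con (F b1) (F b2) (F b3) P1 P2 ?Q1 ?Q2 z \<xi> + 2 * con (K b1) (K b2) (K b3) P1 P2 P1 P2 z \<xi>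
    + 2 * con (odd_part b1) (odd_part b2) (odd_part b3) ?Q1 ?Q2 ?Q1 ?Q2 z \<xi>" for z \<xi>
  have "vanishing (2*R) 5 T"
    unfolding T_def
    by (intro vanishing_add vanishing_cmult con[of 2 _ _ _ 1 _ _ 2] con[of 3 _ _ _ 1 _ _ 1] con[of 1 _ _ _ 2 _ _ 2] par sb vanishing_parts) simp_all
  then obtain C where C: "0 \<le> C" and T: "\<And>z \<xi>. z\<in>cball 0 (2*R) \<Longrightarrow> \<xi>\<in>cball 0 (2*R) \<Longrightarrow> \<bar>T z \<xi>\<bar> \<le> C * norm \<xi> ^ 5"
    unfolding vanishing_def by auto
  show thesis
  proof (rule that[OF C])
    fix x y :: "real^2" assume xy: "x \<in> cball 0 R" "y \<in> cball 0 R"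
    obtain z \<xi> where z: "x = z + (1/2) *\<^sub>R \<xi>" "y = z - (1/2) *\<^sub>R \<xi>" "x - y = \<xi>" "(1/2) *\<^sub>R (x + y) = z"
      by (rule midpoint_split)
    have z': "y - x = - \<xi>" "(1/2) *\<^sub>R (y + x) = z" using z by (auto simp: add.commute)
    have odd: "P1 z (- \<xi>) = - P1 z \<xi>" "P2 z (- \<xi>) = - P2 z \<xi>" "Qf v z (- \<xi>) = Qf v z \<xi>" for v
      by (simp_all add: P1_def P2_def Qf_def)
    have d: "d1 (phase y) x = P1 z \<xi> + ?Q1 z \<xi>" "d2 (phase y) x = P2 z \<xi> + ?Q2 z \<xi>"
      "d1 (phase x) y = ?Q1 z \<xi> - P1 z \<xi>" "d2 (phase x) y = ?Q2 z \<xi> - P2 z \<xi>"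
      unfolding dd_phase z(3,4) z' odd by simp_all
    have sp: "b x = F b z \<xi> + b z + (K b z \<xi> + dd b \<xi> z / 2)" "b y = F b z \<xi> + b z - (K b z \<xi> + dd b \<xi> z / 2)" for b
      using odd_even_split[of b z \<xi>] by (simp_all add: F_def K_def z)
    have od: "odd_part b z \<xi> = K b z \<xi> + dd b \<xi> z / 2" for b by (simp add: K_def)
    have Q\<xi>: "2 * (\<xi>$1 * ?Q1 z \<xi> + \<xi>$2 * ?Q2 z \<xi>) = dd b1 \<xi> z * (\<xi>$1 * \<xi>$1) + 2 * dd b2 \<xi> z * (\<xi>$1 * \<xi>$2) + dd b3 \<xi> z * (\<xi>$2 * \<xi>$2)"
      unfolding Qf_def dd_dir2[OF sb(1), of \<xi>] dd_dir2[OF sb(2), of \<xi>] dd_dir2[OF sb(3), of \<xi>] by (simp add: field_simps)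
    have key: "4 * (b3 z * (P1 z \<xi> * q1) - b2 z * (P1 z \<xi> * q2 + P2 z \<xi> * q1) + b1 z * (P2 z \<xi> * q2))
        + (D3 * (P1 z \<xi> * P1 z \<xi>) - 2 * D2 * (P1 z \<xi> * P2 z \<xi>) + D1 * (P2 z \<xi> * P2 z \<xi>)) = 0"
      if q: "2 * (\<xi>$1 * q1 + \<xi>$2 * q2) = D1 * (\<xi>$1 * \<xi>$1) + 2 * D2 * (\<xi>$1 * \<xi>$2) + D3 * (\<xi>$2 * \<xi>$2)"
        and D: "D1 * b3 z + b1 z * D3 - 2 * b2 z * D2 = 0" for q1 q2 D1 D2 D3
    proof -
      \<comment> \<open>Entrywise form of b (D a) b = - D b, the derivative of a b = 1, with the
        entries of a expressed through those of b.\<close>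
      have c: "D3 * b1 z * b1 z - 2 * D2 * b1 z * b2 z + D1 * b2 z * b2 z = - D1"
        "D3 * b1 z * b2 z - D2 * (b1 z * b3 z + b2 z * b2 z) + D1 * b2 z * b3 z = - D2"
        "D3 * b2 z * b2 z - 2 * D2 * b2 z * b3 z + D1 * b3 z * b3 z = - D3"
        using D det1[of z] by algebra+
      have "D3 * (P1 z \<xi> * P1 z \<xi>) - 2 * D2 * (P1 z \<xi> * P2 z \<xi>) + D1 * (P2 z \<xi> * P2 z \<xi>)
        = 4 * ((D3 * b1 z * b1 z - 2 * D2 * b1 z * b2 z + D1 * b2 z * b2 z) * (\<xi>$1 * \<xi>$1)
           + 2 * (D3 * b1 z * b2 z - D2 * (b1 z * b3 z + b2 z * b2 z) + D1 * b2 z * b3 z) * (\<xi>$1 * \<xi>$2)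
           + (D3 * b2 z * b2 z - 2 * D2 * b2 z * b3 z + D1 * b3 z * b3 z) * (\<xi>$2 * \<xi>$2))"
        unfolding P1_def P2_def by (simp add: algebra_simps)
      moreover have "b3 z * (P1 z \<xi> * q1) - b2 z * (P1 z \<xi> * q2 + P2 z \<xi> * q1) + b1 z * (P2 z \<xi> * q2)
        = (b1 z * b3 z - b2 z * b2 z) * (2 * (\<xi>$1 * q1 + \<xi>$2 * q2))"
        unfolding P1_def P2_def by (simp add: algebra_simps)
      ultimately show ?thesis unfolding c q det1 by (simp add: algebra_simps)
    qed
    have "qform x (d1 (phase y) x) (d2 (phase y) x) - qform y (d1 (phase x) y) (d2 (phase x) y) - T z \<xi> = 0"
      unfolding key[OF Q\<xi> det_deriv, symmetric] d qform_def sp[of b1] sp[of b2] sp[of b3]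
        T_def con_def od by (simp add: field_simps)
    then show "\<bar>qform x (d1 (phase y) x) (d2 (phase y) x) - qform y (d1 (phase x) y) (d2 (phase x) y)\<bar> \<le> C * norm (x - y) ^ 5"
      using T[OF midpoint_bound[OF xy z(4,3)]] z(3) by simp
  qed
qed

text \<open>The leading terms are \<open>key1\<close>, which is twice the derivative of det b along
  \<xi>, and the contraction of b with the derivative of its inverse, which is again a derivative of
  the determinant. Both vanish because the determinant is constant, and every remaining product has
  order 3.\<close>

lemma divop_antisymmetry:
  assumes "0 \<le> R"
  obtains C where "0 \<le> C" "\<And>x y. x \<in> cball 0 R \<Longrightarrow> y \<in> cball 0 R \<Longrightarrow>
    \<bar>divop (phase y) x - divop (phase x) y\<bar> \<le> C * norm (x - y) ^ 3"
proof -
  let ?e1 = "axis 1 1 :: real^2" and ?e2 = "axis 2 1 :: real^2"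
  define F where "F f z \<xi> = even_part f z \<xi> - f z" for f :: "real^2 \<Rightarrow> real" and z \<xi>
  define K where "K f z \<xi> = odd_part f z \<xi> - dd f \<xi> z / 2" for f :: "real^2 \<Rightarrow> real" and z \<xi>
  define con where "con f1 f2 f3 g11 g12 g22 = (\<lambda>z \<xi>. f3 z \<xi> * g11 z \<xi> - f2 z \<xi> * (g12 z \<xi> + g12 z \<xi>) + f1 z \<xi> * g22 z \<xi>)"
    for f1 f2 f3 g11 g12 g22 :: "real^2 \<Rightarrow> real^2 \<Rightarrow> real"
  define pair where "pair f1 f2 g1 g2 = (\<lambda>z \<xi>. f1 z \<xi> * g1 z \<xi> + f2 z \<xi> * g2 z \<xi>)" for f1 f2 g1 g2 :: "real^2 \<Rightarrow> real^2 \<Rightarrow> real"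
  have R: "0 \<le> 2 * R" using assms by simp
  note par = vanishing_parity[OF _ R, folded F_def K_def]
  have con: "vanishing (2*R) k (con f1 f2 f3 g11 g12 g22)"
    if "vanishing (2*R) l f1" "vanishing (2*R) l f2" "vanishing (2*R) l f3" "vanishing (2*R) m g11" "vanishing (2*R) m g12"
      "vanishing (2*R) m g22" "k = l + m" for k l m f1 f2 f3 g11 g12 g22
    unfolding con_def by (rule vanishing_contraction[OF that(1-5) that(5-7)])
  have pair: "vanishing (2*R) k (pair f1 f2 g1 g2)"
    if "vanishing (2*R) l f1" "vanishing (2*R) l f2" "vanishing (2*R) m g1" "vanishing (2*R) m g2" "k = l + m" for k l m f1 f2 g1 g2
    unfolding pair_def by (rule vanishing_pairing[OF that])
  define M11 where "M11 z \<xi> = 2 * N1 ?e1 z \<xi>" for z \<xi>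
  define M12 where "M12 z \<xi> = N1 ?e2 z \<xi> + N2 ?e1 z \<xi>" for z \<xi>
  define M22 where "M22 z \<xi> = 2 * N2 ?e2 z \<xi>" for z \<xi>
  have vM: "vanishing (2*R) 1 M11" "vanishing (2*R) 1 M12" "vanishing (2*R) 1 M22"
    unfolding M11_def M12_def M22_def by (intro vanishing_add vanishing_cmult vanishing_parts)+
  define m12 where "m12 z \<xi> = (mf ?e1 ?e2 z \<xi> + mf ?e2 ?e1 z \<xi>) / 2" for z \<xi>
  have "vanishing (2*R) 2 (\<lambda>z \<xi>. (1/2) * (mf ?e1 ?e2 z \<xi> + mf ?e2 ?e1 z \<xi>))"
    by (intro vanishing_add vanishing_cmult vanishing_parts)
  then have vm: "vanishing (2*R) 2 m12" unfolding m12_def by simp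
  define c where "c b = (\<lambda>z (\<xi>::real^2). b z)" for b :: "real^2 \<Rightarrow> real"
  have vc: "vanishing (2*R) 0 (c b)" if "smooth b" for b unfolding c_def by (rule vanishing_base[OF that])
  define T where "T z \<xi> = 2 * pair (F A1) (F A2) P1 P2 z \<xi> + 2 * pair (odd_part A1) (odd_part A2) (Qf ?e1) (Qf ?e2) z \<xi>
    + 2 * con (F b1) (F b2) (F b3) M11 M12 M22 z \<xi> + 4 * con (K b1) (K b2) (K b3) (c b1) (c b2) (c b3) z \<xi>
    + 2 * con (odd_part b1) (odd_part b2) (odd_part b3) (mf ?e1 ?e1) m12 (mf ?e2 ?e2) z \<xi>" for z \<xi>
  have "vanishing (2*R) 3 T"
    unfolding T_def
    by (intro vanishing_add vanishing_cmult con[of 2 _ _ _ 1] con[of 3 _ _ _ 0] con[of 1 _ _ _ 2] pair[of 2 _ _ 1] pair[of 1 _ _ 2]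
      par sb vc vm vM vanishing_parts smooth_A) simp_all
  then obtain C where C: "0 \<le> C" and T: "\<And>z \<xi>. z\<in>cball 0 (2*R) \<Longrightarrow> \<xi>\<in>cball 0 (2*R) \<Longrightarrow> \<bar>T z \<xi>\<bar> \<le> C * norm \<xi> ^ 3"
    unfolding vanishing_def by auto
  show thesis
  proof (rule that[OF C])
    fix x y :: "real^2" assume xy: "x \<in> cball 0 R" "y \<in> cball 0 R"
    obtain z \<xi> where z: "x = z + (1/2) *\<^sub>R \<xi>" "y = z - (1/2) *\<^sub>R \<xi>" "x - y = \<xi>" "(1/2) *\<^sub>R (x + y) = z"
      by (rule midpoint_split)
    have z': "y - x = - \<xi>" "(1/2) *\<^sub>R (y + x) = z" using z by (auto simp: add.commute)
    have odd: "P1 z (- \<xi>) = - P1 z \<xi>" "P2 z (- \<xi>) = - P2 z \<xi>" "Qf v z (- \<xi>) = Qf v z \<xi>"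
      "N1 v z (- \<xi>) = - N1 v z \<xi>" "N2 v z (- \<xi>) = - N2 v z \<xi>" "mf v w z (- \<xi>) = mf v w z \<xi>" for v w
      by (simp_all add: P1_def P2_def Qf_def N1_def N2_def mf_def)
    have d: "d1 (phase y) x = P1 z \<xi> + Qf ?e1 z \<xi>" "d2 (phase y) x = P2 z \<xi> + Qf ?e2 z \<xi>"
      "d1 (phase x) y = Qf ?e1 z \<xi> - P1 z \<xi>" "d2 (phase x) y = Qf ?e2 z \<xi> - P2 z \<xi>"
      unfolding dd_phase z(3,4) z' odd by simp_all
    have dd: "d1 (d1 (phase y)) x = 2 * b1 z + M11 z \<xi> + mf ?e1 ?e1 z \<xi>" "d2 (d2 (phase y)) x = 2 * b3 z + M22 z \<xi> + mf ?e2 ?e2 z \<xi>"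
      "d1 (d2 (phase y)) x + d2 (d1 (phase y)) x = 2 * (2 * b2 z + M12 z \<xi> + m12 z \<xi>)"
      "d1 (d1 (phase x)) y = 2 * b1 z - M11 z \<xi> + mf ?e1 ?e1 z \<xi>" "d2 (d2 (phase x)) y = 2 * b3 z - M22 z \<xi> + mf ?e2 ?e2 z \<xi>"
      "d1 (d2 (phase x)) y + d2 (d1 (phase x)) y = 2 * (2 * b2 z - M12 z \<xi> + m12 z \<xi>)"
      unfolding dd_phase2 z(3,4) z' odd M11_def M12_def M22_def m12_def by simp_all
    have sp: "b x = F b z \<xi> + b z + (K b z \<xi> + dd b \<xi> z / 2)" "b y = F b z \<xi> + b z - (K b z \<xi> + dd b \<xi> z / 2)" for b
      using odd_even_split[of b z \<xi>] by (simp_all add: F_def K_def z)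
    have od: "odd_part b z \<xi> = K b z \<xi> + dd b \<xi> z / 2" for b by (simp add: K_def)
    have spA: "A x = F A z \<xi> + A z + odd_part A z \<xi>" "A y = F A z \<xi> + A z - odd_part A z \<xi>" for A
      using sp[of A] by (simp_all add: od)
    have key1: "A1 z * P1 z \<xi> + A2 z * P2 z \<xi> + (b3 z * M11 z \<xi> - 2 * b2 z * M12 z \<xi> + b1 z * M22 z \<xi>) = 0"
    proof -
      have "A1 z * P1 z \<xi> + A2 z * P2 z \<xi> + (b3 z * M11 z \<xi> - 2 * b2 z * M12 z \<xi> + b1 z * M22 z \<xi>)
        = 2 * (\<xi>$1 * (d1 b1 z * b3 z + b1 z * d1 b3 z - 2 * b2 z * d1 b2 z) + \<xi>$2 * (d2 b1 z * b3 z + b1 z * d2 b3 z - 2 * b2 z * d2 b2 z))"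
        unfolding A1_def A2_def P1_def P2_def M11_def M12_def M22_def N1_def N2_def by (simp add: algebra_simps)
      then show ?thesis unfolding det_deriv by simp
    qed
    have "divop (phase y) x - divop (phase x) y - T z \<xi> =
      2 * (A1 z * P1 z \<xi> + A2 z * P2 z \<xi> + (b3 z * M11 z \<xi> - 2 * b2 z * M12 z \<xi> + b1 z * M22 z \<xi>))
      + 2 * (dd b1 \<xi> z * b3 z + b1 z * dd b3 \<xi> z - 2 * b2 z * dd b2 \<xi> z)"
      unfolding divop_expand[OF smooth_phase] d dd spA[of A1] spA[of A2] sp[of b1] sp[of b2] sp[of b3] T_def pair_def con_def c_def
      unfolding od[of b1] od[of b2] od[of b3] by (simp add: field_simps)
    then have "divop (phase y) x - divop (phase x) y = T z \<xi>" unfolding key1 det_deriv by simp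
    then show "\<bar>divop (phase y) x - divop (phase x) y\<bar> \<le> C * norm (x - y) ^ 3"
      using T[OF midpoint_bound[OF xy z(4,3)]] z(3) by simp
  qed
qed

end

section \<open>The kernel and its defect of symmetry\<close>

definition bump :: "real \<Rightarrow> real" where "bump s = flat_exp 0 (1 - s)"
definition bump1 :: "real \<Rightarrow> real" where "bump1 s = - flat_exp 2 (1 - s)"
definition bump2 :: "real \<Rightarrow> real" where "bump2 s = flat_exp 4 (1 - s) - 2 * flat_exp 3 (1 - s)"

lemma flat_exp_reflect_deriv:
  "((\<lambda>s. flat_exp n (1 - s)) has_real_derivative real n * flat_exp (n + 1) (1 - s) - flat_exp (n + 2) (1 - s)) (at s)"
  by (rule DERIV_cong[OF DERIV_chain2[OF flat_exp_deriv]]) (auto intro!: derivative_eq_intros)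

lemma bump_deriv: "(bump has_real_derivative bump1 s) (at s)" "(bump1 has_real_derivative bump2 s) (at s)"
proof -
  show "(bump has_real_derivative bump1 s) (at s)"
    using flat_exp_reflect_deriv[of 0 s] by (simp add: bump_def[abs_def] bump1_def numeral_2_eq_2)
  have "((\<lambda>s. - flat_exp 2 (1 - s)) has_real_derivative
      - (real 2 * flat_exp (2 + 1) (1 - s) - flat_exp (2 + 2) (1 - s))) (at s)"
    by (rule DERIV_minus[OF flat_exp_reflect_deriv])
  then show "(bump1 has_real_derivative bump2 s) (at s)" by (simp add: bump1_def[abs_def] bump2_def)
qed

lemma smooth_bump: "smooth bump" "smooth bump1" "smooth bump2"
proof -
  have "smooth (\<lambda>s::real. flat_exp n (1 - s))" for n
    by (rule smooth_on_compose_real[OF smooth_on_flat_exp]) (auto intro!: smooth_on_diff smooth_on_const smooth_ident)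
  then show "smooth bump" "smooth bump1" "smooth bump2"
    unfolding bump_def[abs_def] bump1_def[abs_def] bump2_def[abs_def]
    by (auto intro!: smooth_on_diff smooth_on_mult smooth_on_const smooth_on_uminus)
qed

lemma bump_nonneg: "0 \<le> bump s" and bump_pos: "s < 1 \<Longrightarrow> 0 < bump s"
  and bump_zero: "1 \<le> s \<Longrightarrow> bump s = 0" "1 \<le> s \<Longrightarrow> bump1 s = 0" "1 \<le> s \<Longrightarrow> bump2 s = 0"
  by (auto simp: bump_def bump1_def bump2_def flat_exp_def)

lemma bump_antimono: assumes "s \<le> t" shows "bump t \<le> bump s"
proof (rule DERIV_nonpos_imp_nonincreasing[OF assms])
  show "\<exists>y. (bump has_real_derivative y) (at x) \<and> y \<le> 0" for x
    using bump_deriv(1)[of x] by (intro exI[of _ "bump1 x"]) (auto simp: bump1_def flat_exp_def)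
qed

lemma bump_bounds: obtains B where "0 \<le> B" "\<And>s. 0 \<le> s \<Longrightarrow> \<bar>bump s\<bar> \<le> B \<and> \<bar>bump1 s\<bar> \<le> B \<and> \<bar>bump2 s\<bar> \<le> B"
proof -
  have cont: "continuous_on {0..1} f" if "smooth f" for f :: "real \<Rightarrow> real"
    by (rule cont_smooth[OF that])
  obtain B0 B1 B2 where B: "0 < B0" "0 < B1" "0 < B2" "\<And>s. s \<in> {0..1} \<Longrightarrow> \<bar>bump s\<bar> \<le> B0"
    "\<And>s. s \<in> {0..1} \<Longrightarrow> \<bar>bump1 s\<bar> \<le> B1" "\<And>s. s \<in> {0..1} \<Longrightarrow> \<bar>bump2 s\<bar> \<le> B2"
    using compact_bounded_real[OF compact_Icc[of 0 "1::real"] cont[OF smooth_bump(1)]]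
      compact_bounded_real[OF compact_Icc[of 0 "1::real"] cont[OF smooth_bump(2)]]
      compact_bounded_real[OF compact_Icc[of 0 "1::real"] cont[OF smooth_bump(3)]] by metis
  have "\<bar>bump s\<bar> \<le> B0 + B1 + B2 \<and> \<bar>bump1 s\<bar> \<le> B0 + B1 + B2 \<and> \<bar>bump2 s\<bar> \<le> B0 + B1 + B2" if "0 \<le> s" for s
  proof (cases "s \<le> 1")
    case True
    then show ?thesis using B(4-6)[of s] that B(1-3) by auto
  next
    case False
    then show ?thesis using bump_zero[of s] B(1-3) by auto
  qed
  then show ?thesis using B(1-3) by (intro that[of "B0 + B1 + B2"]) auto
qed

locale potential = unimodular +
  fixes V :: "real^2 \<Rightarrow> real"
  assumes sV: "smooth V"
begin

definition op :: "(real^2 \<Rightarrow> real) \<Rightarrow> real^2 \<Rightarrow> real" where "op u x = V x * u x - divop u x"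

definition kern :: "real \<Rightarrow> real^2 \<Rightarrow> real^2 \<Rightarrow> real" where "kern \<epsilon> y x = bump (phase y x / \<epsilon>\<^sup>2)"

text \<open>Since the phase is at least c0 |x - y|^2, the kernel of width \<epsilon> vanishes once
  |x - y| \<ge> \<rho> \<epsilon>.\<close>

definition \<rho> :: real where "\<rho> = 1 / sqrt c0"

lemma \<rho>_pos: "0 < \<rho>" using c0(1) by (simp add: \<rho>_def)

lemma phase_lower: "c0 * (norm (x - y))\<^sup>2 \<le> phase y x"
  unfolding phase_def \<Psi>_def by (rule c0(2))

lemma phase_nonneg: "0 \<le> phase y x"
  using phase_lower[of x y] c0(1) by (smt (verit) mult_nonneg_nonneg zero_le_power2)

lemma phase_sym: "phase y x = phase x y"
  by (simp add: phase_def \<Psi>_def add.commute algebra_simps)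

lemma phase_large:
  assumes "0 < \<epsilon>" "\<rho> * \<epsilon> \<le> norm (x - y)" shows "1 \<le> phase y x / \<epsilon>\<^sup>2"
proof -
  have "(\<rho> * \<epsilon>)\<^sup>2 \<le> (norm (x - y))\<^sup>2" using assms \<rho>_pos by (intro power_mono) auto
  then have "c0 * (\<rho> * \<epsilon>)\<^sup>2 \<le> phase y x"
    using phase_lower[of x y] mult_left_mono[of "(\<rho> * \<epsilon>)\<^sup>2" "(norm (x - y))\<^sup>2" c0] c0(1) by linarith
  moreover have "c0 * (\<rho> * \<epsilon>)\<^sup>2 = \<epsilon>\<^sup>2" using c0(1) by (simp add: \<rho>_def power_mult_distrib power_divide)
  ultimately show ?thesis using assms(1) by simp
qed

lemma kern_nonneg: "0 \<le> kern \<epsilon> y x" by (simp add: kern_def bump_nonneg)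

lemma kern_zero: "0 < \<epsilon> \<Longrightarrow> \<rho> * \<epsilon> \<le> norm (x - y) \<Longrightarrow> kern \<epsilon> y x = 0"
  using phase_large[of \<epsilon> x y] by (simp add: kern_def bump_zero)

lemma scaled_smooth:
  assumes "smooth \<phi>" shows "smooth (\<lambda>s::real. c * \<phi> (s / e))"
proof -
  have "smooth (\<lambda>s. \<phi> (s * (1 / e)))"
    by (rule smooth_on_compose_real[OF assms smooth_on_mult]) (auto intro: smooth_ident)
  then show ?thesis by (intro smooth_on_mult) auto
qed

lemma smooth_kern: "smooth (kern \<epsilon> y)"
  unfolding kern_def[abs_def]
  by (rule smooth_on_compose_real[OF scaled_smooth[OF smooth_bump(1), of 1, simplified] smooth_phase]) simp

lemma op_kern:
  "op (kern \<epsilon> y) x = V x * bump (phase y x / \<epsilon>\<^sup>2)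
    - (bump2 (phase y x / \<epsilon>\<^sup>2) / \<epsilon>^4 * qform x (d1 (phase y) x) (d2 (phase y) x)
      + bump1 (phase y x / \<epsilon>\<^sup>2) / \<epsilon>\<^sup>2 * divop (phase y) x)"
proof -
  have d: "((\<lambda>s. c * \<phi> (s / e)) has_real_derivative c / e * \<phi>' (s / e)) (at s)"
    if "\<And>s. (\<phi> has_real_derivative \<phi>' s) (at s)" for \<phi> \<phi>' :: "real \<Rightarrow> real" and c e s
    by (rule DERIV_cong[OF DERIV_cmult[OF DERIV_chain2[OF that DERIV_cdivide[OF DERIV_ident]]]]) simp
  have "divop (\<lambda>x. bump (phase y x / \<epsilon>\<^sup>2)) x = 1 / \<epsilon>\<^sup>2 / \<epsilon>\<^sup>2 * bump2 (phase y x / \<epsilon>\<^sup>2) * qform x (d1 (phase y) x) (d2 (phase y) x)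
      + 1 / \<epsilon>\<^sup>2 * bump1 (phase y x / \<epsilon>\<^sup>2) * divop (phase y) x"
  proof (rule divop_compose[OF smooth_phase, where ?\<phi>1.0="\<lambda>s. 1 / \<epsilon>\<^sup>2 * bump1 (s / \<epsilon>\<^sup>2)" and ?\<phi>2.0="\<lambda>s. 1 / \<epsilon>\<^sup>2 / \<epsilon>\<^sup>2 * bump2 (s / \<epsilon>\<^sup>2)"])
    show "((\<lambda>s. bump (s / \<epsilon>\<^sup>2)) has_real_derivative 1 / \<epsilon>\<^sup>2 * bump1 (s / \<epsilon>\<^sup>2)) (at s)" for s
      using d[OF bump_deriv(1), of 1 "\<epsilon>\<^sup>2" s] by simp
    show "((\<lambda>s. 1 / \<epsilon>\<^sup>2 * bump1 (s / \<epsilon>\<^sup>2)) has_real_derivative 1 / \<epsilon>\<^sup>2 / \<epsilon>\<^sup>2 * bump2 (s / \<epsilon>\<^sup>2)) (at s)" for s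
      by (rule d[OF bump_deriv(2)])
    show "smooth (\<lambda>s. bump (s / \<epsilon>\<^sup>2))" using scaled_smooth[OF smooth_bump(1), of 1] by simp
    show "smooth (\<lambda>s. 1 / \<epsilon>\<^sup>2 * bump1 (s / \<epsilon>\<^sup>2))" by (rule scaled_smooth[OF smooth_bump(2)])
  qed
  then show ?thesis by (simp add: op_def kern_def[abs_def] power_divide mult.commute flip: power_mult)
qed

text \<open>On the support |x - y| is at most \<rho> \<epsilon>. So the factor \<epsilon>^(-4) of
  \<open>bump2\<close> meets an error of order \<epsilon>^5, the factor \<epsilon>^(-2) of
  \<open>bump1\<close> one of order \<epsilon>^3, and the difference of the potentials is of order
  \<epsilon>.\<close>

lemma op_kern_antisymmetry:
  assumes R: "0 \<le> R"
  obtains C where "0 \<le> C" "\<And>\<epsilon> x y. 0 < \<epsilon> \<Longrightarrow> x \<in> cball 0 R \<Longrightarrow> y \<in> cball 0 R \<Longrightarrow>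
    \<bar>op (kern \<epsilon> y) x - op (kern \<epsilon> x) y\<bar> \<le> (if norm (x - y) \<le> \<rho> * \<epsilon> then C * \<epsilon> else 0)"
proof -
  obtain C5 where C5: "0 \<le> C5" "\<And>x y. x \<in> cball 0 R \<Longrightarrow> y \<in> cball 0 R \<Longrightarrow>
    \<bar>qform x (d1 (phase y) x) (d2 (phase y) x) - qform y (d1 (phase x) y) (d2 (phase x) y)\<bar> \<le> C5 * norm (x - y) ^ 5"
    by (rule symbol_antisymmetry[OF R]) blast
  obtain C3 where C3: "0 \<le> C3" "\<And>x y. x \<in> cball 0 R \<Longrightarrow> y \<in> cball 0 R \<Longrightarrow>
    \<bar>divop (phase y) x - divop (phase x) y\<bar> \<le> C3 * norm (x - y) ^ 3"
    by (rule divop_antisymmetry[OF R]) blast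
  have "vanishing (2*R) 1 (odd_part V)" using vanishing_parity(1)[OF sV, of "2*R"] R by simp
  then obtain C1 where C1: "0 \<le> C1" and odd: "\<And>z \<xi>. z \<in> cball 0 (2*R) \<Longrightarrow> \<xi> \<in> cball 0 (2*R) \<Longrightarrow> \<bar>odd_part V z \<xi>\<bar> \<le> C1 * norm \<xi>"
    unfolding vanishing_def by auto
  have V: "\<bar>V x - V y\<bar> \<le> 2 * C1 * norm (x - y)" if "x \<in> cball 0 R" "y \<in> cball 0 R" for x y
  proof -
    obtain z \<xi> where z: "x = z + (1/2) *\<^sub>R \<xi>" "y = z - (1/2) *\<^sub>R \<xi>" "x - y = \<xi>" "(1/2) *\<^sub>R (x + y) = z"
      by (rule midpoint_split)
    have "V x - V y = 2 * odd_part V z \<xi>" by (simp add: odd_part_def z)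
    then show ?thesis using odd[OF midpoint_bound[OF that z(4,3)]] z(3) by (simp add: abs_mult)
  qed
  obtain B where B: "0 \<le> B" "\<And>s. 0 \<le> s \<Longrightarrow> \<bar>bump s\<bar> \<le> B \<and> \<bar>bump1 s\<bar> \<le> B \<and> \<bar>bump2 s\<bar> \<le> B"
    by (rule bump_bounds) blast
  define C where "C = 2 * C1 * \<rho> * B + B * (C5 * \<rho>^5) + B * (C3 * \<rho>^3)"
  show thesis
  proof (rule that[of C])
    show "0 \<le> C" unfolding C_def using C1 C3(1) C5(1) B(1) \<rho>_pos by auto
    fix \<epsilon> :: real and x y :: "real^2" assume \<epsilon>: "0 < \<epsilon>" and xy: "x \<in> cball 0 R" "y \<in> cball 0 R"
    define s where "s = phase y x / \<epsilon>\<^sup>2"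
    have s0: "0 \<le> s" unfolding s_def using phase_nonneg by simp
    define A where "A = qform x (d1 (phase y) x) (d2 (phase y) x) - qform y (d1 (phase x) y) (d2 (phase x) y)"
    define D where "D = divop (phase y) x - divop (phase x) y"
    have eq: "op (kern \<epsilon> y) x - op (kern \<epsilon> x) y = (V x - V y) * bump s - (bump2 s / \<epsilon>^4 * A + bump1 s / \<epsilon>\<^sup>2 * D)"
      unfolding op_kern phase_sym[of x y] s_def[symmetric] A_def D_def by (simp add: algebra_simps)
    show "\<bar>op (kern \<epsilon> y) x - op (kern \<epsilon> x) y\<bar> \<le> (if norm (x - y) \<le> \<rho> * \<epsilon> then C * \<epsilon> else 0)"
    proof (cases "norm (x - y) \<le> \<rho> * \<epsilon>")
      case False
      then have "1 \<le> s" unfolding s_def using phase_large[OF \<epsilon>, of x y] by simp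
      then show ?thesis unfolding eq using False by (simp add: bump_zero)
    next
      case True
      have n: "norm (x - y) ^ k \<le> (\<rho> * \<epsilon>) ^ k" for k using True by (intro power_mono) auto
      have "\<bar>(V x - V y) * bump s\<bar> \<le> (2 * C1 * (\<rho> * \<epsilon>)) * B"
        unfolding abs_mult using V[OF xy] mult_left_mono[OF True, of "2 * C1"] C1 B s0 \<rho>_pos \<epsilon>
        by (intro mult_mono) auto
      moreover have "\<bar>bump2 s / \<epsilon>^4 * A\<bar> \<le> B / \<epsilon>^4 * (C5 * (\<rho> * \<epsilon>)^5)"
        unfolding abs_mult using C5(2)[OF xy] mult_left_mono[OF n[of 5] C5(1)] B s0 \<epsilon> unfolding A_def
        by (intro mult_mono) (auto intro!: divide_right_mono)
      moreover have "\<bar>bump1 s / \<epsilon>\<^sup>2 * D\<bar> \<le> B / \<epsilon>\<^sup>2 * (C3 * (\<rho> * \<epsilon>)^3)"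
        unfolding abs_mult using C3(2)[OF xy] mult_left_mono[OF n[of 3] C3(1)] B s0 \<epsilon> unfolding D_def
        by (intro mult_mono) (auto intro!: divide_right_mono)
      ultimately have "\<bar>op (kern \<epsilon> y) x - op (kern \<epsilon> x) y\<bar>
          \<le> (2 * C1 * (\<rho> * \<epsilon>)) * B + (B / \<epsilon>^4 * (C5 * (\<rho> * \<epsilon>)^5) + B / \<epsilon>\<^sup>2 * (C3 * (\<rho> * \<epsilon>)^3))"
        unfolding eq by linarith
      also have "\<dots> = C * \<epsilon>"
        unfolding C_def using \<epsilon> by (simp add: power_mult_distrib field_simps power2_eq_square power3_eq_cube eval_nat_numeral)
      finally show ?thesis using True by simp
    qed
  qed
qed

end

section \<open>Existence of a supersolution\<close>

lemma integrable_compact_support: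
  fixes f :: "'a::euclidean_space \<Rightarrow> real"
  assumes "continuous_on UNIV f" "\<And>x. R \<le> norm x \<Longrightarrow> f x = 0"
  shows "integrable lborel f"
proof -
  have "integrable lborel (\<lambda>x. indicator (cball 0 R) x *\<^sub>R f x)"
    by (rule borel_integrable_compact) (use continuous_on_subset[OF assms(1)] in auto)
  moreover have "(\<lambda>x. indicator (cball 0 R) x *\<^sub>R f x) = f"
    using assms(2) by (auto simp: fun_eq_iff indicator_def)
  ultimately show ?thesis by simp
qed

lemma integral_translate:
  fixes f :: "'a::euclidean_space \<Rightarrow> real"
  assumes "f \<in> borel_measurable borel"
  shows "(\<integral>x. f (v + x) \<partial>lborel) = integral\<^sup>L lborel f"
proof -
  have "integral\<^sup>L lborel f = integral\<^sup>L (distr lborel borel ((+) v)) f" by (simp add: lborel_distr_plus)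
  also have "\<dots> = (\<integral>x. f (v + x) \<partial>lborel)" by (rule integral_distr) (use assms in auto)
  finally show ?thesis by simp
qed

lemma integral_dilate:
  fixes f :: "'a::euclidean_space \<Rightarrow> real"
  assumes "f \<in> borel_measurable borel" "0 < s"
  shows "s ^ DIM('a) * (\<integral>x. f (s *\<^sub>R x) \<partial>lborel) = integral\<^sup>L lborel f"
proof -
  have "integral\<^sup>L lborel f = integral\<^sup>L (density (distr lborel borel (\<lambda>x. 0 + s *\<^sub>R x)) (\<lambda>_. ennreal (\<bar>s\<bar> ^ DIM('a)))) f"
    using lborel_affine[of s "0::'a"] assms(2) by simp
  also have "\<dots> = (\<integral>x. \<bar>s\<bar> ^ DIM('a) *\<^sub>R f x \<partial>distr lborel borel (\<lambda>x. 0 + s *\<^sub>R x))"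
    by (rule integral_density) (use assms in auto)
  also have "\<dots> = (\<integral>x. \<bar>s\<bar> ^ DIM('a) *\<^sub>R f (0 + s *\<^sub>R x) \<partial>lborel)"
    by (rule integral_distr) (use assms in auto)
  finally show ?thesis using assms(2) by simp
qed

lemma dd_outside:
  assumes "\<And>x. R \<le> norm x \<Longrightarrow> f x = 0" "R < norm x" shows "dd f v x = 0"
proof -
  have "dd f v x = dd (\<lambda>x. 0) v x"
    by (rule dd_cong[of "{x. R < norm x}"]) (use assms in \<open>auto intro!: open_Collect_less continuous_intros\<close>)
  then show ?thesis by simp
qed

text \<open>A translate of \<open>f\<close> has the same integral, so the integral of the Taylor
  remainder f(x + s v) - f(x) - s df(v) is - s times the integral in question. The remainder is
  O(s^2) on a fixed ball; divide by s and let s tend to 0.\<close>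

lemma integral_dd_zero:
  fixes f :: "real^2 \<Rightarrow> real"
  assumes f: "smooth f" and supp: "\<And>x. R \<le> norm x \<Longrightarrow> f x = 0"
  shows "(\<integral>x. dd f v x \<partial>lborel) = 0"
proof -
  define R' where "R' = R + 1 + norm v"
  obtain C where C: "0 \<le> C" "\<And>x w. x \<in> cball 0 (R' + norm v) \<Longrightarrow> \<bar>dir 2 f w x\<bar> \<le> C * norm w ^ 2"
    using dir_bound[OF f, of "R' + norm v" 2] by auto
  define K where "K = C * norm v ^ 2"
  define S where "S x = indicator (cball 0 R') x *\<^sub>R (1::real)" for x :: "real^2"
  have intS: "integrable lborel S" unfolding S_def by (rule borel_integrable_compact) auto
  have cont: "continuous_on UNIV f" "continuous_on UNIV (dd f v)" using cont_smooth f smooth_on_dd by blast+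
  have int: "integrable lborel f" "integrable lborel (dd f v)"
    by (rule integrable_compact_support[OF cont(1) supp]; simp)
      (rule integrable_compact_support[OF cont(2), of "R + 1"], simp add: dd_outside[of R f, OF supp])
  have bound: "\<bar>f (s *\<^sub>R v + x) - f x - s * dd f v x\<bar> \<le> s\<^sup>2 * K * S x" if s: "0 < s" "s \<le> 1" for s x
  proof (cases "norm x \<le> R'")
    case True
    obtain t where t: "\<bar>t\<bar> \<le> \<bar>s\<bar>" and
      "f (x + s *\<^sub>R v) = (\<Sum>m<2. dir m f v x / fact m * s ^ m) + dir 2 f v (x + t *\<^sub>R v) / fact 2 * s ^ 2"
      by (rule taylor_dir[OF f])
    then have eq: "f (x + s *\<^sub>R v) = f x + dd f v x * s + dir 2 f v (x + t *\<^sub>R v) / 2 * s ^ 2"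
      by (simp add: numeral_2_eq_2 lessThan_Suc)
    have "\<bar>t\<bar> * norm v \<le> 1 * norm v" using t s by (intro mult_right_mono) auto
    then have "x + t *\<^sub>R v \<in> cball 0 (R' + norm v)" using True norm_triangle_ineq[of x "t *\<^sub>R v"] by simp
    then have "\<bar>dir 2 f v (x + t *\<^sub>R v)\<bar> \<le> K" using C(2) by (simp add: K_def)
    then have le: "\<bar>dir 2 f v (x + t *\<^sub>R v)\<bar> * s^2 \<le> K * s^2" by (intro mult_right_mono) auto
    have "f (s *\<^sub>R v + x) - f x - s * dd f v x = dir 2 f v (x + t *\<^sub>R v) * s^2 / 2"
      using eq by (simp add: add.commute)
    then have "\<bar>f (s *\<^sub>R v + x) - f x - s * dd f v x\<bar> = \<bar>dir 2 f v (x + t *\<^sub>R v)\<bar> * s^2 / 2"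
      by (simp only: abs_mult abs_divide) simp
    moreover have "0 \<le> K * s\<^sup>2" using C(1) by (simp add: K_def)
    ultimately show ?thesis using True le by (simp add: S_def mult.commute)
  next
    case False
    have "norm (s *\<^sub>R v) \<le> 1 * norm v" using s mult_right_mono[of s 1 "norm v"] by simp
    then have "R \<le> norm (s *\<^sub>R v + x)" using False norm_triangle_ineq4[of "s *\<^sub>R v + x" "s *\<^sub>R v"] by (simp add: R'_def)
    moreover have "R < norm x" using False norm_ge_zero[of v] unfolding R'_def by linarith
    ultimately show ?thesis using supp dd_outside[of R f, OF supp] False by (simp add: S_def)
  qed
  define I where "I = (\<integral>x. dd f v x \<partial>lborel)"
  have le: "\<bar>I\<bar> \<le> s * (K * integral\<^sup>L lborel S)" if s: "0 < s" "s \<le> 1" for s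
  proof -
    have meas: "f \<in> borel_measurable borel" using cont(1) by (rule borel_measurable_continuous_onI)
    have int': "integrable lborel (\<lambda>x. f (s *\<^sub>R v + x))"
    proof (rule integrable_compact_support[of _ "R + norm v"])
      show "continuous_on UNIV (\<lambda>x. f (s *\<^sub>R v + x))"
        by (intro continuous_on_compose2[OF cont(1)] continuous_intros) auto
      fix x :: "real^2" assume "R + norm v \<le> norm x"
      moreover have "norm (s *\<^sub>R v) \<le> 1 * norm v" using s mult_right_mono[of s 1 "norm v"] by simp
      ultimately show "f (s *\<^sub>R v + x) = 0"
        using norm_triangle_ineq4[of "s *\<^sub>R v + x" "s *\<^sub>R v"] by (intro supp) simp
    qed
    have "(\<integral>x. f (s *\<^sub>R v + x) - f x - s * dd f v x \<partial>lborel) = - s * I"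
      using int int' integral_translate[OF meas, of "s *\<^sub>R v"] by (simp add: I_def)
    moreover have "\<bar>\<integral>x. f (s *\<^sub>R v + x) - f x - s * dd f v x \<partial>lborel\<bar> \<le> (\<integral>x. s\<^sup>2 * K * S x \<partial>lborel)"
      by (rule order_trans[OF integral_abs_bound], rule integral_mono) (use int int' intS bound[OF s] in auto)
    ultimately have "s * \<bar>I\<bar> \<le> s * (s * (K * integral\<^sup>L lborel S))"
      using s by (simp add: abs_mult power2_eq_square algebra_simps)
    then show ?thesis using s by simp
  qed
  have "\<bar>I\<bar> \<le> 0"
  proof (rule tendsto_lowerbound[of _ _ "at_right (0::real)"])
    show "((\<lambda>s. s * (K * integral\<^sup>L lborel S)) \<longlongrightarrow> 0) (at_right 0)"
      by (auto intro!: tendsto_eq_intros)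
    show "\<forall>\<^sub>F s in at_right 0. \<bar>I\<bar> \<le> s * (K * integral\<^sup>L lborel S)"
      unfolding eventually_at_right_field using le by (intro exI[of _ 1]) auto
  qed simp
  then show ?thesis by (simp add: I_def)
qed

text \<open>Approachability: in each round, answer the positive parts of the accumulated sums, so that the
  sum of their squares grows at most linearly.\<close>

lemma blackwell:
  fixes \<phi> :: "'a \<Rightarrow> 'b \<Rightarrow> real" and \<delta> :: real
  assumes X: "finite X" and B: "\<And>x y. x \<in> X \<Longrightarrow> y \<in> K \<Longrightarrow> \<bar>\<phi> x y\<bar> \<le> B" and \<delta>: "0 < \<delta>"
    and no: "\<And>c. (\<And>x. 0 \<le> c x) \<Longrightarrow> \<exists>y\<in>K. (\<Sum>x\<in>X. c x * \<phi> x y) \<le> 0"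
  obtains T :: nat and y where "0 < T" "\<And>t. y t \<in> K" "\<And>x. x \<in> X \<Longrightarrow> (\<Sum>t<T. \<phi> x (y t)) \<le> \<delta> * T"
proof -
  obtain y0 where y0: "y0 \<in> K" using no[of "\<lambda>_. 0"] by auto
  have "\<exists>y. (\<forall>t. y t \<in> K) \<and> (\<Sum>x\<in>X. (max 0 (\<Sum>t<T. \<phi> x (y t)))\<^sup>2) \<le> real T * (card X * B\<^sup>2)" for T :: nat
  proof (induction T)
    case 0
    then show ?case using y0 by (intro exI[of _ "\<lambda>_. y0"]) auto
  next
    case (Suc T)
    then obtain y where y: "\<And>t. y t \<in> K" and le: "(\<Sum>x\<in>X. (max 0 (\<Sum>t<T. \<phi> x (y t)))\<^sup>2) \<le> real T * (card X * B\<^sup>2)" by auto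
    define S where "S x = (\<Sum>t<T. \<phi> x (y t))" for x
    obtain z where z: "z \<in> K" "(\<Sum>x\<in>X. max 0 (S x) * \<phi> x z) \<le> 0" using no[of "\<lambda>x. max 0 (S x)"] by auto
    define y' where "y' = y(T := z)"
    have S': "(\<Sum>t<Suc T. \<phi> x (y' t)) = S x + \<phi> x z" for x by (simp add: y'_def S_def)
    have sq: "(max 0 (S x + \<phi> x z))\<^sup>2 \<le> (max 0 (S x))\<^sup>2 + 2 * (max 0 (S x) * \<phi> x z) + B\<^sup>2" if "x \<in> X" for x
    proof -
      have "(max 0 (S x + \<phi> x z))\<^sup>2 \<le> (max 0 (S x) + \<phi> x z)\<^sup>2"
        by (rule abs_le_square_iff[THEN iffD1]) auto
      moreover have "(\<phi> x z)\<^sup>2 \<le> B\<^sup>2" using B[OF that z(1)] abs_le_square_iff by fastforce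
      ultimately show ?thesis by (simp add: power2_sum)
    qed
    have "(\<Sum>x\<in>X. (max 0 (S x + \<phi> x z))\<^sup>2) \<le> (\<Sum>x\<in>X. (max 0 (S x))\<^sup>2 + 2 * (max 0 (S x) * \<phi> x z) + B\<^sup>2)"
      by (intro sum_mono sq)
    also have "\<dots> \<le> real (Suc T) * (card X * B\<^sup>2)"
      using z(2) le by (simp add: sum.distrib sum_distrib_left[symmetric] S_def[symmetric] algebra_simps)
    finally show ?case using y z(1) by (intro exI[of _ y']) (simp only: S', simp add: y'_def)
  qed
  note ex = this
  \<comment> \<open>Each positive part is at most B sqrt(T card X), which drops below \<delta> T
    once T is large.\<close>
  obtain T :: nat where T: "card X * B\<^sup>2 / \<delta>\<^sup>2 < T" using reals_Archimedean2 by blast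
  have T0: "0 < T" using T by (metis divide_nonneg_nonneg mult_nonneg_nonneg not_gr_zero of_nat_0 of_nat_0_le_iff not_less zero_le_power2)
  obtain y where y: "\<And>t. y t \<in> K" and le: "(\<Sum>x\<in>X. (max 0 (\<Sum>t<T. \<phi> x (y t)))\<^sup>2) \<le> real T * (card X * B\<^sup>2)" using ex[of T] by auto
  show thesis
  proof (rule that[OF T0 y])
    fix x assume x: "x \<in> X"
    have "(max 0 (\<Sum>t<T. \<phi> x (y t)))\<^sup>2 \<le> (\<Sum>x\<in>X. (max 0 (\<Sum>t<T. \<phi> x (y t)))\<^sup>2)"
      using member_le_sum[OF x _ X, of "\<lambda>x. (max 0 (\<Sum>t<T. \<phi> x (y t)))\<^sup>2"] by simp
    also have "\<dots> \<le> real T * (T * \<delta>\<^sup>2)"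
      using le T \<delta> by (intro order_trans[OF le] mult_left_mono) (auto simp: field_simps)
    finally have "(max 0 (\<Sum>t<T. \<phi> x (y t)))\<^sup>2 \<le> (\<delta> * T)\<^sup>2" by (simp add: power2_eq_square algebra_simps)
    then have "max 0 (\<Sum>t<T. \<phi> x (y t)) \<le> \<delta> * T" by (rule power2_le_imp_le) (use \<delta> in simp)
    then show "(\<Sum>t<T. \<phi> x (y t)) \<le> \<delta> * T" by simp
  qed
qed

lemma small_perturbation:
  fixes H :: "real \<Rightarrow> 'a::euclidean_space \<Rightarrow> real"
  assumes cont: "continuous_on ({1..2} \<times> cball 0 2) (\<lambda>(s, y). H s y)" and zero: "\<And>y. H 1 y = 0" and \<eta>: "0 < \<eta>"
  obtains \<delta> where "0 < \<delta>" "\<And>s y. 1 \<le> s \<Longrightarrow> s \<le> 2 \<Longrightarrow> s \<le> 1 + \<delta> \<Longrightarrow> norm y \<le> 2 \<Longrightarrow> \<bar>H s y\<bar> \<le> \<eta>"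
proof -
  have "uniformly_continuous_on ({1..2} \<times> cball 0 2) (\<lambda>(s, y). H s y)"
    by (rule compact_uniformly_continuous[OF cont]) (intro compact_Times compact_Icc compact_cball)
  then obtain d where d: "0 < d" and unif: "\<And>p q. p \<in> {1..2} \<times> cball 0 2 \<Longrightarrow> q \<in> {1..2} \<times> cball 0 2 \<Longrightarrow> dist q p < d \<Longrightarrow>
      dist (case q of (s, y) \<Rightarrow> H s y) (case p of (s, y) \<Rightarrow> H s y) < \<eta>"
    unfolding uniformly_continuous_on_def using \<eta> by meson
  show thesis
  proof (rule that[of "d / 2"])
    fix s :: real and y :: 'a assume "1 \<le> s" "s \<le> 2" "s \<le> 1 + d / 2" "norm y \<le> 2"
    moreover from this have "dist (s, y) (1, y) < d" using d by (simp add: dist_Pair_Pair dist_real_def)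
    ultimately show "\<bar>H s y\<bar> \<le> \<eta>" using unif[of "(1, y)" "(s, y)"] by (simp add: zero dist_real_def)
  qed (use d in simp)
qed

lemma second_derivative_nonneg_at_min:
  assumes u: "smooth u" and min: "\<And>x. u y \<le> u x"
  shows "dd u v y = 0" "0 \<le> dd (dd u v) v (y::real^2)"
proof -
  note D1 = smooth_line_deriv[OF u, of y v] and D2 = smooth_line_deriv[OF smooth_on_dd[OF u], of v y v]
  show z: "dd u v y = 0"
    using DERIV_local_min[OF D1[of 0], of 1] min by auto
  show "0 \<le> dd (dd u v) v y"
  proof (rule ccontr)
    assume "\<not> 0 \<le> dd (dd u v) v y"
    then have "\<exists>d>0. \<forall>h>0. h < d \<longrightarrow> dd u v (y + (0 + h) *\<^sub>R v) < dd u v (y + 0 *\<^sub>R v)"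
      by (intro DERIV_neg_dec_right[OF D2]) simp
    then obtain d where d: "0 < d" "\<And>h. 0 < h \<Longrightarrow> h < d \<Longrightarrow> dd u v (y + h *\<^sub>R v) < 0" using z by auto
    have "u (y + (d / 2) *\<^sub>R v) < u (y + 0 *\<^sub>R v)"
      by (rule DERIV_neg_imp_decreasing_open[of 0 "d/2" "\<lambda>t. u (y + t *\<^sub>R v)"])
        (use d D1 in \<open>force intro!: continuous_on_compose2[OF cont_smooth[OF u]] continuous_intros\<close>)+
    then show False using min[of "y + (d / 2) *\<^sub>R v"] by simp
  qed
qed

section \<open>Energy and the Dirichlet eigenvalue\<close>

context potential
begin

lemma qform_lower: "c0 * (p\<^sup>2 + q\<^sup>2) \<le> qform x p q"
proof -
  have "(norm (vector [- q, p] :: real^2))\<^sup>2 = p\<^sup>2 + q\<^sup>2" by (simp add: norm_vec2)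
  then show ?thesis using c0(2)[of "vector [- q, p]" x] by (simp add: qform_def algebra_simps)
qed

text \<open>Completing the square: by determinant one, \<open>b1\<close> times the second order part
  is the second derivative along the first axis plus the one in the direction (- b2, b1). Both are
  nonnegative at a minimum, and first derivatives vanish there.\<close>

lemma divop_nonneg_at_min:
  assumes u: "smooth u" and min: "\<And>x. u y \<le> u x"
  shows "0 \<le> divop u y"
proof -
  note g = second_derivative_nonneg_at_min[OF assms]
  have b1: "0 < b1 y" using c0(2)[of "axis 1 1" y] c0(1) by (simp add: norm_vec2)
  define v :: "real^2" where "v = vector [- b2 y, b1 y]"
  have exp: "dd (dd u v) v y = v$1 * (v$1 * d1 (d1 u) y + v$2 * d2 (d1 u) y) + v$2 * (v$1 * d1 (d2 u) y + v$2 * d2 (d2 u) y)"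
  proof -
    have "dd u v = (\<lambda>x. v$1 * d1 u x + v$2 * d2 u x)" using dd_dir2[OF u, of v] by auto
    then have "dd (dd u v) v y = v$1 * dd (d1 u) v y + v$2 * dd (d2 u) v y"
      by (simp add: dd_add dd_mult smooth_on_mult smooth_on_dd u)
    then show ?thesis by (simp add: dd_dir2[OF smooth_on_dd[OF u], of _ v])
  qed
  have "b1 y * (b3 y * d1 (d1 u) y - b2 y * (d1 (d2 u) y + d2 (d1 u) y) + b1 y * d2 (d2 u) y)
      = (b1 y * b3 y - b2 y * b2 y) * d1 (d1 u) y + dd (dd u v) v y"
    unfolding exp by (simp add: v_def algebra_simps)
  then have "b1 y * divop u y = d1 (d1 u) y + dd (dd u v) v y"
    unfolding divop_expand[OF u] g(1) det1 by simp
  then have "0 \<le> b1 y * divop u y" using g(2)[of "axis 1 1"] g(2)[of v] by simp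
  then show ?thesis using b1 by (simp add: zero_le_mult_iff)
qed

definition energy :: "(real^2 \<Rightarrow> real) \<Rightarrow> real" where
  "energy w = (\<integral>x. qform x (d1 w x) (d2 w x) + V x * (w x)\<^sup>2 \<partial>lborel)"

lemma smooth_op: "smooth u \<Longrightarrow> smooth (op u)"
  unfolding op_def[abs_def] divop_def by (intro smooth_on_diff smooth_on_add smooth_on_mult smooth_on_dd sV sb)

lemma smooth_qform:
  "smooth p \<Longrightarrow> smooth q \<Longrightarrow> smooth (\<lambda>x. qform x (p x) (q x))"
  unfolding qform_def by (intro smooth_on_diff smooth_on_add smooth_on_mult sb smooth_on_const) auto

lemma integrable_smooth:
  "smooth f \<Longrightarrow> (\<And>x. R \<le> norm x \<Longrightarrow> f x = 0) \<Longrightarrow> integrable lborel (f :: real^2 \<Rightarrow> real)"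
  by (rule integrable_compact_support[OF cont_smooth])

lemma qform_zero [simp]: "qform x 0 0 = 0" by (simp add: qform_def)

text \<open>The integrands differ by the divergence of w times the flux (F1, F2) of w, which
  integrates to zero.\<close>

lemma energy_eq:
  assumes w: "smooth w" and supp: "\<And>x. R \<le> norm x \<Longrightarrow> w x = 0"
  shows "energy w = (\<integral>x. w x * op w x \<partial>lborel)"
proof -
  define F1 where "F1 x = b3 x * d1 w x - b2 x * d2 w x" for x
  define F2 where "F2 x = b1 x * d2 w x - b2 x * d1 w x" for x
  have sF: "smooth F1" "smooth F2"
    unfolding F1_def F2_def by (intro smooth_on_diff smooth_on_mult sb smooth_on_dd w)+
  have swF: "smooth (\<lambda>x. w x * F1 x)" "smooth (\<lambda>x. w x * F2 x)"
    by (intro smooth_on_mult w sF)+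
  have z: "(\<integral>x. d1 (\<lambda>x. w x * F1 x) x \<partial>lborel) = 0" "(\<integral>x. d2 (\<lambda>x. w x * F2 x) x \<partial>lborel) = 0"
    using integral_dd_zero[OF swF(1), of R] integral_dd_zero[OF swF(2), of R] supp by simp_all
  have int: "integrable lborel (d1 (\<lambda>x. w x * F1 x))" "integrable lborel (d2 (\<lambda>x. w x * F2 x))"
    using integrable_smooth[OF smooth_on_dd[OF swF(1)], of "R + 1"] integrable_smooth[OF smooth_on_dd[OF swF(2)], of "R + 1"]
      dd_outside[of R "\<lambda>x. w x * F1 x"] dd_outside[of R "\<lambda>x. w x * F2 x"] supp by simp_all
  have int2: "integrable lborel (\<lambda>x. w x * op w x)"
    by (rule integrable_smooth[of _ R]) (simp_all add: smooth_on_mult w smooth_op supp)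
  have "qform x (d1 w x) (d2 w x) + V x * (w x)\<^sup>2 = w x * op w x + (d1 (\<lambda>x. w x * F1 x) x + d2 (\<lambda>x. w x * F2 x) x)" for x
    by (simp add: op_def divop_def F1_def[abs_def, symmetric] F2_def[abs_def, symmetric] dd_mult[OF w sF(1)] dd_mult[OF w sF(2)])
      (simp add: F1_def F2_def qform_def power2_eq_square algebra_simps)
  then show ?thesis unfolding energy_def using z int int2 by simp
qed

text \<open>The first Dirichlet eigenvalue of \<open>op\<close> on the ball of radius
  \<open>R\<close>, with the Euclidean L^2 norm, is at least \<mu>. Test functions are smooth on the
  whole plane, so integrals over the plane can be used throughout.\<close>

definition dirichlet_positive :: "real \<Rightarrow> real \<Rightarrow> bool" where
  "dirichlet_positive R \<mu> \<longleftrightarrow> (\<forall>w. smooth w \<longrightarrow> (\<forall>x. R \<le> norm x \<longrightarrow> w x = 0) \<longrightarrow>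
     \<mu> * (\<integral>x. (w x)\<^sup>2 \<partial>lborel) \<le> energy w)"

text \<open>Kernels centred in the disk spill over its boundary by \<rho> \<epsilon>, hence the need
  for a slightly larger ball. Dilating a test function back to the unit disk changes the
  coefficients only a little.\<close>

lemma dirichlet_positive_larger:
  assumes dp: "dirichlet_positive 1 \<mu>" and \<mu>: "0 < \<mu>"
  obtains \<delta> where "0 < \<delta>" "\<And>s. 1 \<le> s \<Longrightarrow> s \<le> 1 + \<delta> \<Longrightarrow> dirichlet_positive s (\<mu> / 4)"
proof -
  obtain Vm where Vm: "0 < Vm" "\<And>x. x \<in> cball 0 2 \<Longrightarrow> \<bar>V x\<bar> \<le> Vm"
    using compact_bounded_real[OF compact_cball[of 0 2] cont_smooth[OF sV]] by blast
  \<comment> \<open>Comparing the dilated energy with (1 + \<omega>) times the original one costs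
    \<omega> (1 + Vm) in the L^2 term: \<omega> from the change of V, and \<omega> Vm from the
    factor 1 + \<omega> in front of V. This must stay below \<mu> / 2.\<close>
  define \<omega> where "\<omega> = min 1 (\<mu> / (2 * (1 + Vm)))"
  have "\<omega> * (1 + Vm) \<le> \<mu> / (2 * (1 + Vm)) * (1 + Vm)"
    using Vm(1) by (intro mult_right_mono) (simp_all add: \<omega>_def)
  moreover have "\<dots> = \<mu> / 2" using Vm(1) by (simp add: field_simps)
  ultimately have "\<omega> * (1 + Vm) \<le> \<mu> / 2" by linarith
  moreover have "0 < \<omega>" "\<omega> \<le> 1" using \<mu> Vm(1) by (auto simp: \<omega>_def)
  ultimately have \<omega>: "0 < \<omega>" "\<omega> \<le> 1" "\<omega> * (1 + Vm) \<le> \<mu> / 2" by auto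
  have cont: "continuous_on ({1..2} \<times> cball 0 2) (\<lambda>(s, y). f ((1 / s) *\<^sub>R y))" if "smooth f" for f :: "real^2 \<Rightarrow> real"
    unfolding case_prod_beta by (intro continuous_on_compose2[OF cont_smooth[OF that, of UNIV]] continuous_intros) auto
  have pert: "\<exists>\<delta>>0. \<forall>s y. 1 \<le> s \<longrightarrow> s \<le> 2 \<longrightarrow> s \<le> 1 + \<delta> \<longrightarrow> norm y \<le> 2 \<longrightarrow> \<bar>s ^ k * f ((1 / s) *\<^sub>R y) - f y\<bar> \<le> \<eta>"
    if f: "smooth f" and \<eta>: "0 < \<eta>" for f :: "real^2 \<Rightarrow> real" and k \<eta>
  proof -
    have "continuous_on ({1..2} \<times> cball 0 2) (\<lambda>p. fst p ^ k * (\<lambda>(s, y). f ((1 / s) *\<^sub>R y)) p - f (snd p))"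
      by (intro continuous_intros cont[OF f] continuous_on_compose2[OF cont_smooth[OF f, of UNIV]]) auto
    then have "continuous_on ({1..2} \<times> cball 0 2) (\<lambda>(s, y). s ^ k * f ((1 / s) *\<^sub>R y) - f y)"
      by (simp add: case_prod_beta)
    then obtain \<delta> where "0 < \<delta>" "\<And>s y. 1 \<le> s \<Longrightarrow> s \<le> 2 \<Longrightarrow> s \<le> 1 + \<delta> \<Longrightarrow> norm y \<le> 2 \<Longrightarrow> \<bar>s ^ k * f ((1 / s) *\<^sub>R y) - f y\<bar> \<le> \<eta>"
      by (rule small_perturbation[OF _ _ \<eta>]) auto
    then show ?thesis by blast
  qed
  \<comment> \<open>Errors of \<eta> in the entries change \<open>qform\<close> by at most 2 \<eta>
    (p^2 + q^2), which is at most \<omega> times \<open>qform\<close> by ellipticity.\<close>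
  define \<eta> where "\<eta> = c0 * \<omega> / 2"
  have \<eta>: "0 < \<eta>" using c0(1) \<omega>(1) by (simp add: \<eta>_def)
  obtain \<delta>1 \<delta>2 \<delta>3 \<delta>4 where \<delta>: "0 < \<delta>1" "0 < \<delta>2" "0 < \<delta>3" "0 < \<delta>4"
    and 1: "\<forall>s y. 1 \<le> s \<longrightarrow> s \<le> 2 \<longrightarrow> s \<le> 1 + \<delta>1 \<longrightarrow> norm y \<le> 2 \<longrightarrow> \<bar>s ^ 2 * b1 ((1 / s) *\<^sub>R y) - b1 y\<bar> \<le> \<eta>"
    and 2: "\<forall>s y. 1 \<le> s \<longrightarrow> s \<le> 2 \<longrightarrow> s \<le> 1 + \<delta>2 \<longrightarrow> norm y \<le> 2 \<longrightarrow> \<bar>s ^ 2 * b2 ((1 / s) *\<^sub>R y) - b2 y\<bar> \<le> \<eta>"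
    and 3: "\<forall>s y. 1 \<le> s \<longrightarrow> s \<le> 2 \<longrightarrow> s \<le> 1 + \<delta>3 \<longrightarrow> norm y \<le> 2 \<longrightarrow> \<bar>s ^ 2 * b3 ((1 / s) *\<^sub>R y) - b3 y\<bar> \<le> \<eta>"
    and 4: "\<forall>s y. 1 \<le> s \<longrightarrow> s \<le> 2 \<longrightarrow> s \<le> 1 + \<delta>4 \<longrightarrow> norm y \<le> 2 \<longrightarrow> \<bar>s ^ 0 * V ((1 / s) *\<^sub>R y) - V y\<bar> \<le> \<omega>"
    using pert[OF sb(1) \<eta>, of 2] pert[OF sb(2) \<eta>, of 2] pert[OF sb(3) \<eta>, of 2] pert[OF sV \<omega>(1), of 0] by (elim exE conjE) blast
  define \<delta> where "\<delta> = min 1 (min (min \<delta>1 \<delta>2) (min \<delta>3 \<delta>4))"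
  show thesis
  proof (rule that[of \<delta>])
    show "0 < \<delta>" using \<delta> by (simp add: \<delta>_def)
    fix s assume s: "1 \<le> s" "s \<le> 1 + \<delta>"
    have s': "s \<le> 2" "s \<le> 1 + \<delta>1" "s \<le> 1 + \<delta>2" "s \<le> 1 + \<delta>3" "s \<le> 1 + \<delta>4" using s unfolding \<delta>_def by auto
    show "dirichlet_positive s (\<mu> / 4)"
      unfolding dirichlet_positive_def
    proof (intro allI impI)
      fix w :: "real^2 \<Rightarrow> real" assume w: "smooth w" and supp: "\<forall>x. s \<le> norm x \<longrightarrow> w x = 0"
      let ?W = "\<integral>x. (w x)\<^sup>2 \<partial>lborel"
      define w' where "w' x = w (s *\<^sub>R x)" for x
      have lin: "linear (\<lambda>v. dd w v x)" for x by (rule has_derivative_linear[OF smooth_on_deriv[OF w UNIV_I]])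
      have sw': "smooth w'"
        unfolding w'_def
      proof (rule smooth_on_compose[OF w])
        show "smooth (\<lambda>x. s *\<^sub>R x \<bullet> b)" for b :: "real^2"
          unfolding inner_scaleR_left by (intro smooth_on_mult smooth_on_const smooth_on_linear bounded_linear_inner_left) auto
      qed auto
      have dw': "dd w' v x = s * dd w v (s *\<^sub>R x)" for v x
      proof -
        have "(w' has_derivative (\<lambda>v. dd w (s *\<^sub>R v) (s *\<^sub>R x))) (at x)"
          unfolding w'_def by (rule has_derivative_compose[OF _ smooth_on_deriv[OF w UNIV_I]]) (auto intro!: derivative_eq_intros)
        then show ?thesis using linear_scale[OF lin] by (simp add: dd_eqI)
      qed
      define g where "g y = s\<^sup>2 * qform ((1/s) *\<^sub>R y) (d1 w y) (d2 w y) + V ((1/s) *\<^sub>R y) * (w y)\<^sup>2" for y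
      have sc: "(1/s) *\<^sub>R s *\<^sub>R x = x" for x :: "real^2" using s by simp
      have en: "energy w' = (\<integral>x. g (s *\<^sub>R x) \<partial>lborel)"
        unfolding energy_def g_def dw' sc by (simp add: w'_def qform_def power2_eq_square algebra_simps)
      have conts: "continuous_on UNIV (\<lambda>y. f ((1/s) *\<^sub>R y))" if "smooth f" for f :: "real^2 \<Rightarrow> real"
        by (intro continuous_on_compose2[OF cont_smooth[OF that, of UNIV]] continuous_intros) auto
      have cg: "continuous_on UNIV g"
        unfolding g_def qform_def by (intro continuous_intros conts sb sV cont_smooth w smooth_on_dd)
      have dz: "dd w v x = 0" if "2 < norm x" for v x
        using dd_outside[of s w x v] supp s' that by auto
      have ig: "integrable lborel g"
        by (rule integrable_compact_support[OF cg, of 3]) (use supp s' in \<open>auto simp: g_def dz\<close>)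
      have iw: "integrable lborel (\<lambda>y. (w y)\<^sup>2)"
        by (rule integrable_smooth[of _ s]) (use w supp in \<open>auto intro: smooth_on_power\<close>)
      have ie: "integrable lborel (\<lambda>y. qform y (d1 w y) (d2 w y) + V y * (w y)\<^sup>2)"
        by (rule integrable_smooth[of _ 3])
          (use w supp s' in \<open>auto intro!: smooth_on_power smooth_on_add smooth_on_mult smooth_qform smooth_on_dd sV simp: dz\<close>)
      have s0: "0 < s" using s by simp
      have D: "s\<^sup>2 * (\<integral>x. f (s *\<^sub>R x) \<partial>lborel) = integral\<^sup>L lborel f" if "continuous_on UNIV f" for f :: "real^2 \<Rightarrow> real"
        using integral_dilate[OF borel_measurable_continuous_onI[OF that] s0] by simp
      have "\<mu> * (\<integral>x. (w' x)\<^sup>2 \<partial>lborel) \<le> energy w'"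
      proof -
        have "w' x = 0" if "1 \<le> norm x" for x
          unfolding w'_def using that s0 mult_left_mono[of 1 "norm x" s] by (intro supp[rule_format]) simp
        then show ?thesis using dp sw' unfolding dirichlet_positive_def by blast
      qed
      then have "s\<^sup>2 * (\<mu> * (\<integral>x. (w' x)\<^sup>2 \<partial>lborel)) \<le> s\<^sup>2 * energy w'" by (intro mult_left_mono) auto
      moreover have "s\<^sup>2 * (\<integral>x. (w' x)\<^sup>2 \<partial>lborel) = ?W"
        unfolding w'_def by (rule D[of "\<lambda>x. (w x)\<^sup>2"]) (intro continuous_intros cont_smooth w)
      moreover have "s\<^sup>2 * energy w' = integral\<^sup>L lborel g" unfolding en by (rule D[OF cg])
      ultimately have le1: "\<mu> * ?W \<le> integral\<^sup>L lborel g" by (simp add: mult.left_commute)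
      have pt: "g y \<le> (1 + \<omega>) * (qform y (d1 w y) (d2 w y) + V y * (w y)\<^sup>2) + \<omega> * (1 + Vm) * (w y)\<^sup>2" for y
      proof (cases "norm y \<le> 2")
        case True
        let ?p = "d1 w y" and ?q = "d2 w y"
        define e1 where "e1 = s\<^sup>2 * b1 ((1 / s) *\<^sub>R y) - b1 y"
        define e2 where "e2 = s\<^sup>2 * b2 ((1 / s) *\<^sub>R y) - b2 y"
        define e3 where "e3 = s\<^sup>2 * b3 ((1 / s) *\<^sub>R y) - b3 y"
        have e: "\<bar>e1\<bar> \<le> \<eta>" "\<bar>e2\<bar> \<le> \<eta>" "\<bar>e3\<bar> \<le> \<eta>" unfolding e1_def e2_def e3_def using 1 2 3 s s' True by auto
        have "s\<^sup>2 * qform ((1/s) *\<^sub>R y) ?p ?q - qform y ?p ?q = e3 * (?p * ?p) - 2 * e2 * (?p * ?q) + e1 * (?q * ?q)"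
          unfolding qform_def e1_def e2_def e3_def by (simp add: algebra_simps)
        also have "\<dots> \<le> 2 * \<eta> * (?p\<^sup>2 + ?q\<^sup>2)"
        proof -
          have "e3 * (?p * ?p) \<le> \<eta> * (?p * ?p)" "e1 * (?q * ?q) \<le> \<eta> * (?q * ?q)"
            using e by (auto intro!: mult_right_mono)
          moreover have "- 2 * e2 * (?p * ?q) \<le> \<eta> * (?p * ?p + ?q * ?q)"
          proof -
            have "\<bar>2 * (?p * ?q)\<bar> \<le> ?p * ?p + ?q * ?q"
              using sum_squares_bound[of ?p ?q] sum_squares_bound[of ?p "- ?q"] by (simp add: power2_eq_square abs_le_iff)
            then have "\<bar>e2\<bar> * \<bar>2 * (?p * ?q)\<bar> \<le> \<eta> * (?p * ?p + ?q * ?q)"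
              using e by (intro mult_mono) auto
            then have "\<bar>e2 * (2 * (?p * ?q))\<bar> \<le> \<eta> * (?p * ?p + ?q * ?q)" by (simp only: abs_mult)
            then show ?thesis by (simp add: abs_le_iff algebra_simps)
          qed
          ultimately show ?thesis by (simp add: power2_eq_square algebra_simps)
        qed
        also have "\<dots> = \<omega> * (c0 * (?p\<^sup>2 + ?q\<^sup>2))" by (simp add: \<eta>_def)
        also have "\<dots> \<le> \<omega> * qform y ?p ?q" using \<omega>(1) by (intro mult_left_mono qform_lower) auto
        finally have q: "s\<^sup>2 * qform ((1/s) *\<^sub>R y) ?p ?q \<le> (1 + \<omega>) * qform y ?p ?q" by (simp add: algebra_simps)
        have V1: "V ((1/s) *\<^sub>R y) \<le> V y + \<omega>" using 4[rule_format, of s y] s s' True by simp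
        have "0 \<le> \<omega> * (Vm + V y)" using Vm(2)[of y] True \<omega>(1) by (auto simp: abs_le_iff)
        then have "V y + \<omega> \<le> (1 + \<omega>) * V y + \<omega> * (1 + Vm)" by (simp add: algebra_simps)
        then have "V ((1/s) *\<^sub>R y) * (w y)\<^sup>2 \<le> ((1 + \<omega>) * V y + \<omega> * (1 + Vm)) * (w y)\<^sup>2"
          using V1 by (intro mult_right_mono) auto
        with q show ?thesis by (simp add: g_def algebra_simps)
      qed (use supp s' dz in \<open>simp add: g_def\<close>)
      have "integral\<^sup>L lborel g \<le> (\<integral>y. (1 + \<omega>) * (qform y (d1 w y) (d2 w y) + V y * (w y)\<^sup>2) + \<omega> * (1 + Vm) * (w y)\<^sup>2 \<partial>lborel)"
        by (rule integral_mono) (use ig ie iw pt in auto)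
      also have "\<dots> = (1 + \<omega>) * energy w + \<omega> * (1 + Vm) * ?W"
        using ie iw by (simp add: energy_def)
      finally have le2: "\<mu> * ?W \<le> (1 + \<omega>) * energy w + \<omega> * (1 + Vm) * ?W" using le1 by linarith
      have nn: "0 \<le> ?W" by simp
      have "\<omega> * (1 + Vm) * ?W \<le> \<mu> / 2 * ?W"
        by (rule mult_right_mono[OF \<omega>(3) nn])
      with le2 have le3: "\<mu> / 2 * ?W \<le> (1 + \<omega>) * energy w" by simp
      have "0 \<le> \<mu> / 2 * ?W" using \<mu> nn by simp
      with le3 have "0 \<le> energy w" using \<omega>(1) by (smt (verit) zero_le_mult_iff)
      then have "(1 + \<omega>) * energy w \<le> 2 * energy w" using \<omega>(2) by (intro mult_right_mono) auto
      with le3 show "\<mu> / 4 * ?W \<le> energy w" by simp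
    qed
  qed
qed

end

lemma finite_net:
  fixes K :: "'a::metric_space set"
  assumes "compact K" "0 < r"
  obtains N where "finite N" "N \<subseteq> K" "K \<subseteq> (\<Union>e\<in>N. ball e r)"
proof -
  have "K \<subseteq> (\<Union>e\<in>K. ball e r)" using assms(2) by auto
  then obtain N where "N \<subseteq> K" "finite N" "K \<subseteq> (\<Union>e\<in>N. ball e r)"
    by (rule compactE_image[OF assms(1), rotated]) auto
  then show ?thesis by (intro that)
qed

section \<open>The game between kernels and points of the disk\<close>

context potential
begin

lemma op_add: "smooth f \<Longrightarrow> smooth g \<Longrightarrow> op (\<lambda>x. f x + g x) x = op f x + op g x"
proof -
  assume f: "smooth f" and g: "smooth g"
  have d: "dd (\<lambda>x. f x + g x) v = (\<lambda>x. dd f v x + dd g v x)" if "smooth f" "smooth g" for f g v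
    using that by (simp add: fun_eq_iff dd_add)
  show ?thesis
    using f g by (simp add: op_def divop_expand d smooth_on_add smooth_on_dd algebra_simps)
qed

lemma op_scale: "smooth f \<Longrightarrow> op (\<lambda>x. c * f x) x = c * op f x"
proof -
  assume f: "smooth f"
  have d: "dd (\<lambda>x. c * g x) v = (\<lambda>x. c * dd g v x)" if "smooth g" for g v
    using that by (simp add: fun_eq_iff dd_mult)
  show ?thesis
    using f by (simp add: op_def divop_expand d smooth_on_mult smooth_on_dd algebra_simps)
qed

lemma op_sum:
  assumes "finite X" "\<And>i. i \<in> X \<Longrightarrow> smooth (f i)"
  shows "op (\<lambda>x. \<Sum>i\<in>X. c i * f i x) x = (\<Sum>i\<in>X. c i * op (f i) x)"
  using assms
proof (induction X rule: finite_induct)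
  case empty
  then show ?case by (simp add: op_def divop_def)
next
  case (insert i X)
  have "op (\<lambda>x. c i * f i x + (\<Sum>i\<in>X. c i * f i x)) x = op (\<lambda>x. c i * f i x) x + op (\<lambda>x. \<Sum>i\<in>X. c i * f i x) x"
    by (intro op_add smooth_on_mult smooth_on_sum) (use insert in auto)
  then show ?case using insert by (simp add: op_scale)
qed

text \<open>Joint continuity in both points is needed to pass from a finite net of kernel centres to
  all of them. It is read off from the explicit formulas, since the phase depends on one point
  through a parameter.\<close>

lemma continuous_op_kern:
  assumes "\<epsilon> \<noteq> 0" shows "continuous_on UNIV (\<lambda>(x, y). op (kern \<epsilon> x) y)"
proof -
  have m: "continuous_on UNIV (\<lambda>p. f ((1/2) *\<^sub>R (snd p + fst p)))" if "smooth f" for f :: "real^2 \<Rightarrow> real"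
    by (intro continuous_on_compose2[OF cont_smooth[OF that, of UNIV]] continuous_intros) auto
  have s: "continuous_on UNIV (\<lambda>p. f (snd p))" if "smooth f" for f :: "real^2 \<Rightarrow> real" and p :: "(real^2) \<times> (real^2)"
    by (intro continuous_on_compose2[OF cont_smooth[OF that, of UNIV]] continuous_intros) auto
  have d: "continuous_on UNIV (\<lambda>p. (snd p - fst p :: real^2) $ i)" for i by (intro continuous_intros)
  have ph: "continuous_on UNIV (\<lambda>p. phase (fst p) (snd p))"
    unfolding phase_def \<Psi>_def by (intro continuous_intros m sb d)
  have b: "continuous_on UNIV (\<lambda>p. \<phi> (phase (fst p) (snd p) / \<epsilon>\<^sup>2))" if "smooth \<phi>" for \<phi>
    by (intro continuous_on_compose2[OF cont_smooth[OF that, of UNIV]] continuous_intros ph) (use assms in auto)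
  have "continuous_on UNIV (\<lambda>p. op (kern \<epsilon> (fst p)) (snd p))"
    unfolding op_kern divop_expand[OF smooth_phase] dd_phase dd_phase2 qform_def P1_def P2_def Qf_def mf_def N1_def N2_def
    by (intro continuous_intros b m s d sb sV smooth_bump smooth_on_dd smooth_A)
      (use assms in auto)
  then show ?thesis by (simp add: case_prod_beta)
qed

text \<open>Counterpart of \<open>kern_zero\<close>: the phase is also at most a multiple of |x -
  y|^2 there, so the kernel is bounded below on a ball whose radius is a fixed multiple of
  \<epsilon>.\<close>

lemma kern_lower:
  obtains r where "0 < r" "\<And>\<epsilon> x y. 0 < \<epsilon> \<Longrightarrow> r * \<epsilon> \<le> 1 \<Longrightarrow> y \<in> disk \<Longrightarrow> norm (x - y) \<le> r * \<epsilon> \<Longrightarrow> bump (1/2) \<le> kern \<epsilon> y x"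
proof -
  obtain C where C: "0 \<le> C" "\<And>z \<xi>. z\<in>cball 0 2 \<Longrightarrow> \<xi>\<in>cball 0 2 \<Longrightarrow> \<bar>\<Psi> z \<xi>\<bar> \<le> C * norm \<xi> ^ 2"
    using vanishing_quadratic_form[OF sb, of 2] unfolding vanishing_def \<Psi>_def by auto
  define r where "r = 1 / sqrt (2 * (C + 1))"
  have r: "0 < r" "(C + 1) * r\<^sup>2 = 1 / 2" using C(1) by (auto simp: r_def power_divide)
  show thesis
  proof (rule that[OF r(1)])
    fix \<epsilon> :: real and x y :: "real^2" assume \<epsilon>: "0 < \<epsilon>" "r * \<epsilon> \<le> 1" and y: "y \<in> disk" and xy: "norm (x - y) \<le> r * \<epsilon>"
    have "norm x \<le> 2" using norm_triangle_ineq[of "x - y" y] y xy \<epsilon>(2) by simp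
    then have z: "(1/2) *\<^sub>R (x + y) \<in> cball 0 2" using norm_triangle_ineq[of x y] y by simp
    have \<xi>: "x - y \<in> cball 0 2" using xy \<epsilon> by simp
    have "phase y x \<le> C * norm (x - y) ^ 2" unfolding phase_def using C(2)[OF z \<xi>] by (simp add: abs_le_iff)
    also have "\<dots> \<le> (C + 1) * (r * \<epsilon>)\<^sup>2" using C(1) xy by (intro mult_mono power_mono) auto
    also have "\<dots> = \<epsilon>\<^sup>2 / 2" using r(2) by (simp add: power_mult_distrib flip: mult.assoc)
    finally have "phase y x / \<epsilon>\<^sup>2 \<le> 1 / 2" using \<epsilon>(1) by (simp add: field_simps)
    then show "bump (1/2) \<le> kern \<epsilon> y x" unfolding kern_def by (rule bump_antimono)
  qed
qed

text \<open>If every nonnegative combination fails at some point of the disk,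
  \<open>blackwell\<close> assembles such points into an average \<open>w\<close> of kernels. With W
  the integral of w^2, its energy would be at least \<mu> / 4 * W but at most 3 \<mu> / 16 * W,
  although W is positive.\<close>

theorem positive_supersolution:
  assumes dp: "dirichlet_positive 1 \<mu>" and \<mu>: "0 < \<mu>"
  obtains u where "smooth u" "\<And>x. x \<in> disk \<Longrightarrow> 0 < u x" "\<And>x. x \<in> disk \<Longrightarrow> 0 < op u x"
proof (rule ccontr)
  note supersolution = that
  assume neg: "\<not> thesis"
  obtain \<delta>0 where \<delta>0: "0 < \<delta>0" "\<And>s. 1 \<le> s \<Longrightarrow> s \<le> 1 + \<delta>0 \<Longrightarrow> dirichlet_positive s (\<mu> / 4)"
    by (rule dirichlet_positive_larger[OF dp \<mu>]) blast
  obtain C where C: "0 \<le> C" "\<And>\<epsilon> x y. 0 < \<epsilon> \<Longrightarrow> x \<in> cball 0 2 \<Longrightarrow> y \<in> cball 0 2 \<Longrightarrow>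
    \<bar>op (kern \<epsilon> y) x - op (kern \<epsilon> x) y\<bar> \<le> (if norm (x - y) \<le> \<rho> * \<epsilon> then C * \<epsilon> else 0)"
    by (rule op_kern_antisymmetry[of 2]) (simp, blast)
  obtain r where r: "0 < r" "\<And>\<epsilon> x y. 0 < \<epsilon> \<Longrightarrow> r * \<epsilon> \<le> 1 \<Longrightarrow> y \<in> disk \<Longrightarrow> norm (x - y) \<le> r * \<epsilon> \<Longrightarrow> bump (1/2) \<le> kern \<epsilon> y x"
    by (rule kern_lower) blast
  define cf where "cf = bump (1/2)"
  have cf: "0 < cf" unfolding cf_def by (rule bump_pos) simp
  \<comment> \<open>Whenever |x - y| \<le> \<rho> \<epsilon>, some x - \<epsilon> e with e in
    \<open>N\<close> is within r \<epsilon> of y, where the kernel is bounded below. So the region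
    where symmetry fails is controlled by a number of translates that does not depend on
    \<epsilon>.\<close>
  obtain N where N: "finite N" "cball (0::real^2) \<rho> \<subseteq> (\<Union>e\<in>N. ball e r)"
    using finite_net[OF compact_cball r(1)] by metis
  \<comment> \<open>The first two bounds keep averages of kernels inside the ball with the Dirichlet
    bound and inside radius 2, the third is for \<open>kern_lower\<close>, and the last limits the
    cost of the symmetry defect to \<mu> / 8.\<close>
  define \<epsilon> where "\<epsilon> = min (min (\<delta>0 / \<rho>) (1 / \<rho>)) (min (1 / r) (\<mu> * cf / (8 * (C * card N + 1))))"
  have "0 < C * card N + 1" using C(1) by (simp add: add_nonneg_pos)
  then have \<epsilon>0: "0 < \<epsilon>" using \<delta>0 \<rho>_pos r(1) \<mu> cf by (simp add: \<epsilon>_def)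
  have "\<epsilon> \<le> \<delta>0 / \<rho>" "\<epsilon> \<le> 1 / \<rho>" "\<epsilon> \<le> 1 / r" "\<epsilon> \<le> \<mu> * cf / (8 * (C * card N + 1))" by (simp_all add: \<epsilon>_def)
  then have \<epsilon>: "\<rho> * \<epsilon> \<le> \<delta>0" "\<rho> * \<epsilon> \<le> 1" "r * \<epsilon> \<le> 1" and "(C * card N + 1) * \<epsilon> \<le> \<mu> / 8 * cf"
    using \<rho>_pos r(1) \<open>0 < C * card N + 1\<close> by (simp_all add: field_simps)
  then have \<epsilon>C: "C * \<epsilon> / cf * card N \<le> \<mu> / 8" using cf \<epsilon>0 by (simp add: field_simps)
  define A where "A = measure lborel (cball (0::real^2) 2)"
  \<comment> \<open>A lower bound for the mass of each kernel centred in the disk, hence of any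
    average of them.\<close>
  define i where "i = cf * measure lborel (cball (0::real^2) (r * \<epsilon>))"
  have A: "0 < A" unfolding A_def by (simp add: content_cball_pos)
  have i: "0 < i" unfolding i_def using cf r(1) \<epsilon>0 by (simp add: content_cball_pos)
  \<comment> \<open>The integral of \<open>w\<close> will be at most A / i times that of w^2, so an
    error of 2 \<delta> in \<open>op w\<close> costs \<mu> / 16.\<close>
  define \<delta> where "\<delta> = \<mu> * i / (32 * A)"
  have \<delta>: "0 < \<delta>" using \<mu> A i by (simp add: \<delta>_def)
  define \<phi> where "\<phi> x y = op (kern \<epsilon> x) y" for x y
  have c\<phi>: "continuous_on S (\<lambda>(x, y). \<phi> x y)" for S
    unfolding \<phi>_def using continuous_on_subset[OF continuous_op_kern, of \<epsilon> S] \<epsilon>0 by simp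
  have cp: "compact (cball (0::real^2) 2 \<times> disk)" by (intro compact_Times compact_cball)
  obtain \<eta> where \<eta>: "0 < \<eta>" and uni: "\<And>p q. p \<in> cball (0::real^2) 2 \<times> disk \<Longrightarrow> q \<in> cball 0 2 \<times> disk \<Longrightarrow> dist q p < \<eta> \<Longrightarrow>
      dist (case q of (x, y) \<Rightarrow> \<phi> x y) (case p of (x, y) \<Rightarrow> \<phi> x y) < \<delta>"
    using compact_uniformly_continuous[OF c\<phi> cp] \<delta> unfolding uniformly_continuous_on_def by meson
  \<comment> \<open>\<open>blackwell\<close> allows only finitely many kernel centres; uniform
    continuity extends its conclusion to all centres at the price of another \<delta>.\<close>
  obtain X where X: "finite X" "X \<subseteq> cball 0 2" "cball (0::real^2) 2 \<subseteq> (\<Union>x\<in>X. ball x \<eta>)"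
    using finite_net[OF compact_cball \<eta>] by metis
  obtain B where B: "\<And>p. p \<in> cball (0::real^2) 2 \<times> disk \<Longrightarrow> \<bar>case p of (x, y) \<Rightarrow> \<phi> x y\<bar> \<le> B"
    using compact_bounded_real[OF cp c\<phi>] by blast
  obtain T :: nat and y where T: "0 < T" and y: "\<And>t. y t \<in> disk" and avg: "\<And>x. x \<in> X \<Longrightarrow> (\<Sum>t<T. \<phi> x (y t)) \<le> \<delta> * T"
  proof (rule blackwell[OF X(1) _ \<delta>, of disk \<phi> B])
    show "\<bar>\<phi> x z\<bar> \<le> B" if "x \<in> X" "z \<in> disk" for x z using B[of "(x, z)"] X(2) that by auto
    fix c :: "real^2 \<Rightarrow> real" assume c: "\<And>x. 0 \<le> c x"
    show "\<exists>z\<in>disk. (\<Sum>x\<in>X. c x * \<phi> x z) \<le> 0"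
    proof (rule ccontr)
      assume "\<not> (\<exists>z\<in>disk. (\<Sum>x\<in>X. c x * \<phi> x z) \<le> 0)"
      then have pos: "\<And>z. z \<in> disk \<Longrightarrow> 0 < (\<Sum>x\<in>X. c x * \<phi> x z)" by force
      define u where "u z = (\<Sum>x\<in>X. c x * kern \<epsilon> x z)" for z
      have su: "smooth u" unfolding u_def by (intro smooth_on_sum smooth_on_mult smooth_kern smooth_on_const) auto
      have ou: "op u z = (\<Sum>x\<in>X. c x * \<phi> x z)" for z unfolding u_def[abs_def] \<phi>_def by (rule op_sum[OF X(1) smooth_kern])
      have u0: "0 \<le> u z" for z unfolding u_def by (intro sum_nonneg mult_nonneg_nonneg c kern_nonneg)
      \<comment> \<open>A zero of the nonnegative \<open>u\<close> would be a minimum, where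
        \<open>op u\<close> is at most 0, against \<open>pos\<close>.\<close>
      have "0 < u z" if z: "z \<in> disk" for z
      proof (rule ccontr)
        assume "\<not> 0 < u z"
        then have uz: "u z = 0" using u0[of z] by simp
        then have "0 \<le> divop u z" by (intro divop_nonneg_at_min[OF su]) (simp add: u0)
        then have "op u z \<le> 0" by (simp add: op_def uz)
        then show False using pos[OF z] ou by simp
      qed
      then show False using neg supersolution[OF su] pos ou by simp
    qed
  qed blast
  have near: "(\<Sum>t<T. \<phi> x (y t)) \<le> 2 * \<delta> * T" if x: "x \<in> cball 0 2" for x
  proof -
    obtain x' where x': "x' \<in> X" "dist x' x < \<eta>" using X(3) x by auto
    have "\<phi> x (y t) \<le> \<phi> x' (y t) + \<delta>" for t
      using uni[of "(x', y t)" "(x, y t)"] x x' X(2) y[of t] by (auto simp: dist_Pair_Pair dist_commute dist_real_def)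
    then have "(\<Sum>t<T. \<phi> x (y t)) \<le> (\<Sum>t<T. \<phi> x' (y t) + \<delta>)" by (intro sum_mono)
    also have "\<dots> \<le> 2 * \<delta> * T" using avg[OF x'(1)] by (simp add: sum.distrib mult.commute)
    finally show ?thesis .
  qed
  \<comment> \<open>The roles of the two points are exchanged: \<open>avg\<close> bounds the
    operator acting at \<open>y t\<close> on kernels centred at \<open>x\<close>, while here it acts
    at \<open>x\<close> on kernels centred at \<open>y t\<close>. The antisymmetry estimate mediates
    between the two.\<close>
  define w where "w x = (\<Sum>t<T. 1 / T * kern \<epsilon> (y t) x)" for x
  define s where "s = 1 + \<rho> * \<epsilon>"
  have s: "1 \<le> s" "s \<le> 2" "s \<le> 1 + \<delta>0" using \<rho>_pos \<epsilon>0 \<epsilon> by (simp_all add: s_def)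
  have sw: "smooth w" unfolding w_def by (intro smooth_on_sum smooth_on_mult smooth_kern smooth_on_const) auto
  have ow: "op w x = (\<Sum>t<T. 1 / T * op (kern \<epsilon> (y t)) x)" for x unfolding w_def[abs_def] by (rule op_sum) (auto intro: smooth_kern)
  have w0: "0 \<le> w x" for x unfolding w_def by (intro sum_nonneg mult_nonneg_nonneg kern_nonneg) simp
  have supp: "w x = 0" if "s \<le> norm x" for x
  proof -
    have "kern \<epsilon> (y t) x = 0" for t
      using that y[of t] norm_triangle_ineq2[of x "y t"] by (intro kern_zero[OF \<epsilon>0]) (simp add: s_def)
    then show ?thesis by (simp add: w_def)
  qed
  have wS: "w x * op w x \<le> 2 * \<delta> * w x + C * \<epsilon> / cf * (\<Sum>e\<in>N. ((w x)\<^sup>2 + (w (x - \<epsilon> *\<^sub>R e))\<^sup>2) / 2)" for x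
  proof (cases "norm x \<le> 2")
    case False
    then show ?thesis using supp[of x] s C(1) \<epsilon>0 cf by (simp add: sum_nonneg)
  next
    case True
    \<comment> \<open>Indicator of the region where the symmetry defect lives; it is dominated by
      translates of the kernel, whose average over \<open>t\<close> is again
      \<open>w\<close>.\<close>
    define h where "h t = (if norm (x - y t) \<le> \<rho> * \<epsilon> then 1 else 0 :: real)" for t
    have h: "cf * h t \<le> (\<Sum>e\<in>N. kern \<epsilon> (y t) (x - \<epsilon> *\<^sub>R e))" for t
    proof (cases "norm (x - y t) \<le> \<rho> * \<epsilon>")
      case True
      then have "norm ((1 / \<epsilon>) *\<^sub>R (x - y t)) \<le> \<rho>"
        unfolding norm_scaleR using \<epsilon>0 by (simp add: pos_divide_le_eq)
      then have "(1 / \<epsilon>) *\<^sub>R (x - y t) \<in> cball 0 \<rho>" by (simp only: mem_cball_0)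
      then obtain e where e: "e \<in> N" "dist e ((1 / \<epsilon>) *\<^sub>R (x - y t)) < r"
        using N(2) unfolding mem_ball[symmetric] by blast
      have "(x - \<epsilon> *\<^sub>R e) - y t = \<epsilon> *\<^sub>R ((1 / \<epsilon>) *\<^sub>R (x - y t) - e)" using \<epsilon>0 by (simp add: algebra_simps)
      then have "norm ((x - \<epsilon> *\<^sub>R e) - y t) = \<epsilon> * dist e ((1 / \<epsilon>) *\<^sub>R (x - y t))"
        using \<epsilon>0 by (simp add: dist_norm norm_minus_commute)
      also have "\<dots> \<le> r * \<epsilon>" using e(2) \<epsilon>0 by (simp add: mult.commute)
      finally have "cf \<le> kern \<epsilon> (y t) (x - \<epsilon> *\<^sub>R e)" unfolding cf_def by (rule r(2)[OF \<epsilon>0 \<epsilon>(3) y])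
      also have "\<dots> \<le> (\<Sum>e\<in>N. kern \<epsilon> (y t) (x - \<epsilon> *\<^sub>R e))"
        by (rule member_le_sum[OF e(1) _ N(1), of "\<lambda>e. kern \<epsilon> (y t) (x - \<epsilon> *\<^sub>R e)"]) (rule kern_nonneg)
      finally show ?thesis using True by (simp add: h_def)
    next
      case False
      then show ?thesis by (simp add: h_def sum_nonneg kern_nonneg)
    qed
    have m1: "op (kern \<epsilon> (y t)) x \<le> \<phi> x (y t) + C * \<epsilon> * h t" for t
      using C(2)[OF \<epsilon>0, of x "y t"] True y[of t] by (auto simp: \<phi>_def h_def abs_le_iff split: if_splits)
    have m2: "C * \<epsilon> * h t \<le> C * \<epsilon> / cf * (\<Sum>e\<in>N. kern \<epsilon> (y t) (x - \<epsilon> *\<^sub>R e))" for t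
      using mult_left_mono[OF h[of t], of "C * \<epsilon> / cf"] C(1) \<epsilon>0 cf by simp
    have "op (kern \<epsilon> (y t)) x \<le> \<phi> x (y t) + C * \<epsilon> / cf * (\<Sum>e\<in>N. kern \<epsilon> (y t) (x - \<epsilon> *\<^sub>R e))" for t
      using m1[of t] m2[of t] by linarith
    then have "op w x \<le> (\<Sum>t<T. 1 / T * (\<phi> x (y t) + C * \<epsilon> / cf * (\<Sum>e\<in>N. kern \<epsilon> (y t) (x - \<epsilon> *\<^sub>R e))))"
      unfolding ow by (intro sum_mono mult_left_mono) auto
    also have "\<dots> = (\<Sum>t<T. \<phi> x (y t)) / T + C * \<epsilon> / cf * (\<Sum>t<T. 1 / T * (\<Sum>e\<in>N. kern \<epsilon> (y t) (x - \<epsilon> *\<^sub>R e)))"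
      by (simp add: sum.distrib sum_distrib_left sum_divide_distrib algebra_simps)
    also have "(\<Sum>t<T. 1 / T * (\<Sum>e\<in>N. kern \<epsilon> (y t) (x - \<epsilon> *\<^sub>R e))) = (\<Sum>e\<in>N. w (x - \<epsilon> *\<^sub>R e))"
      unfolding w_def sum_distrib_left by (rule sum.swap)
    also have "(\<Sum>t<T. \<phi> x (y t)) / T \<le> 2 * \<delta>" using near[of x] True T by (simp add: field_simps)
    finally have "op w x \<le> 2 * \<delta> + C * \<epsilon> / cf * (\<Sum>e\<in>N. w (x - \<epsilon> *\<^sub>R e))" by simp
    then have "w x * op w x \<le> w x * (2 * \<delta> + C * \<epsilon> / cf * (\<Sum>e\<in>N. w (x - \<epsilon> *\<^sub>R e)))" by (rule mult_left_mono) (rule w0)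
    also have "\<dots> = 2 * \<delta> * w x + C * \<epsilon> / cf * (\<Sum>e\<in>N. w x * w (x - \<epsilon> *\<^sub>R e))"
      by (simp add: sum_distrib_left algebra_simps)
    also have "\<dots> \<le> 2 * \<delta> * w x + C * \<epsilon> / cf * (\<Sum>e\<in>N. ((w x)\<^sup>2 + (w (x - \<epsilon> *\<^sub>R e))\<^sup>2) / 2)"
    proof (intro add_left_mono mult_left_mono sum_mono)
      show "w x * w (x - \<epsilon> *\<^sub>R e) \<le> ((w x)\<^sup>2 + (w (x - \<epsilon> *\<^sub>R e))\<^sup>2) / 2" for e
        using sum_squares_bound[of "w x" "w (x - \<epsilon> *\<^sub>R e)"] by simp
    qed (use C(1) \<epsilon>0 cf in simp)
    finally show ?thesis .
  qed
  have cw: "continuous_on UNIV w" by (rule cont_smooth[OF sw])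
  have iw: "integrable lborel w" by (rule integrable_smooth[OF sw supp])
  have cw2: "continuous_on UNIV (\<lambda>x. (w x)\<^sup>2)" by (intro continuous_intros cw)
  have iw2: "integrable lborel (\<lambda>x. (w x)\<^sup>2)" by (rule integrable_compact_support[OF cw2, of s]) (simp add: supp)
  have meas: "(\<lambda>x. (w x)\<^sup>2) \<in> borel_measurable borel" by (rule borel_measurable_continuous_onI[OF cw2])
  have shift: "integrable lborel (\<lambda>x. (w (x - a))\<^sup>2)" "(\<integral>x. (w (x - a))\<^sup>2 \<partial>lborel) = (\<integral>x. (w x)\<^sup>2 \<partial>lborel)" for a
  proof -
    show "integrable lborel (\<lambda>x. (w (x - a))\<^sup>2)"
    proof (rule integrable_compact_support[of _ "s + norm a"])
      show "continuous_on UNIV (\<lambda>x. (w (x - a))\<^sup>2)" by (intro continuous_intros continuous_on_compose2[OF cw]) auto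
      show "(w (x - a))\<^sup>2 = 0" if "s + norm a \<le> norm x" for x using that norm_triangle_ineq2[of x a] by (simp add: supp)
    qed
    show "(\<integral>x. (w (x - a))\<^sup>2 \<partial>lborel) = (\<integral>x. (w x)\<^sup>2 \<partial>lborel)"
      using integral_translate[OF meas, of "- a"] by simp
  qed
  define W where "W = (\<integral>x. (w x)\<^sup>2 \<partial>lborel)"
  have iop: "integrable lborel (\<lambda>x. w x * op w x)"
    by (rule integrable_smooth[of _ s]) (simp_all add: smooth_on_mult sw smooth_op supp)
  have "energy w = (\<integral>x. w x * op w x \<partial>lborel)" by (rule energy_eq[OF sw supp])
  also have "\<dots> \<le> (\<integral>x. 2 * \<delta> * w x + C * \<epsilon> / cf * (\<Sum>e\<in>N. ((w x)\<^sup>2 + (w (x - \<epsilon> *\<^sub>R e))\<^sup>2) / 2) \<partial>lborel)"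
    by (rule integral_mono) (use iop iw iw2 shift(1) wS in auto)
  also have "\<dots> = 2 * \<delta> * integral\<^sup>L lborel w + C * \<epsilon> / cf * (card N * W)"
    using iw iw2 shift by (simp add: W_def)
  finally have e1: "energy w \<le> 2 * \<delta> * integral\<^sup>L lborel w + C * \<epsilon> / cf * card N * W" by simp
  have e2: "\<mu> / 4 * W \<le> energy w" using \<delta>0(2)[OF s(1,3)] sw supp unfolding dirichlet_positive_def W_def by blast
  have W0: "0 \<le> W" by (simp add: W_def)
  have ilow: "i \<le> integral\<^sup>L lborel w"
  proof -
    have fin: "integrable lborel (\<lambda>x. cf * indicator (cball a \<tau>) x)" for a :: "real^2" and \<tau>
      using emeasure_lborel_cball_finite[of a \<tau>] by (intro integrable_mult_right) simp
    have k: "i \<le> integral\<^sup>L lborel (kern \<epsilon> (y t))" and ik: "integrable lborel (kern \<epsilon> (y t))" for t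
    proof -
      show ik: "integrable lborel (kern \<epsilon> (y t))"
      proof (rule integrable_smooth[OF smooth_kern, of s])
        show "kern \<epsilon> (y t) x = 0" if "s \<le> norm x" for x
          using that y[of t] norm_triangle_ineq2[of x "y t"] by (intro kern_zero[OF \<epsilon>0]) (simp add: s_def)
      qed
      have "i = (\<integral>x. cf * indicator (cball (y t) (r * \<epsilon>)) x \<partial>lborel)"
        using r(1) \<epsilon>0 by (simp add: i_def content_cball)
      also have "\<dots> \<le> integral\<^sup>L lborel (kern \<epsilon> (y t))"
        by (rule integral_mono[OF fin ik])
          (use r(2)[OF \<epsilon>0 \<epsilon>(3) y] kern_nonneg in \<open>auto simp: indicator_def cf_def dist_norm norm_minus_commute\<close>)
      finally show "i \<le> integral\<^sup>L lborel (kern \<epsilon> (y t))" .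
    qed
    have "i = (\<Sum>t<T. 1 / T * i)" using T by simp
    also have "\<dots> \<le> (\<Sum>t<T. 1 / T * integral\<^sup>L lborel (kern \<epsilon> (y t)))" by (intro sum_mono mult_left_mono k) simp
    also have "\<dots> = integral\<^sup>L lborel w" unfolding w_def using ik by simp
    finally show ?thesis .
  qed
  have "integral\<^sup>L lborel w \<le> A / i * W"
  proof -
    have ind: "integrable lborel (indicator (cball 0 2) :: real^2 \<Rightarrow> real)"
      using emeasure_lborel_cball_finite[of "0::real^2" 2] by simp
    \<comment> \<open>Weighted arithmetic-geometric mean inequality. The constant term integrates to
      i / 2, at most half of the integral of \<open>w\<close> by \<open>ilow\<close>, and is
      absorbed on the left.\<close>
    have pt: "w x \<le> i / (2 * A) * indicator (cball 0 2) x + A / (2 * i) * (w x)\<^sup>2" for x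
    proof (cases "norm x \<le> 2")
      case True
      have "0 \<le> (i - A * w x)\<^sup>2" by simp
      then have "2 * (i * (A * w x)) \<le> i\<^sup>2 + A\<^sup>2 * (w x)\<^sup>2" by (simp add: power2_diff power_mult_distrib)
      then show ?thesis using True A i by (simp add: field_simps power2_eq_square)
    qed (use supp[of x] s in simp)
    have "integral\<^sup>L lborel w \<le> (\<integral>x. i / (2 * A) * indicator (cball 0 2) x + A / (2 * i) * (w x)\<^sup>2 \<partial>lborel)"
      by (rule integral_mono[OF iw _ pt]) (intro Bochner_Integration.integrable_add integrable_mult_right ind iw2)
    also have "\<dots> = i / 2 + A / (2 * i) * W"
      using ind iw2 A by (simp add: W_def flip: A_def)
    finally have "integral\<^sup>L lborel w \<le> i / 2 + A / (2 * i) * W" .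
    then show ?thesis using ilow by simp
  qed
  then have "2 * \<delta> * integral\<^sup>L lborel w \<le> 2 * \<delta> * (A / i * W)" using \<delta> by (intro mult_left_mono) auto
  also have "\<dots> = \<mu> / 16 * W" using A i by (simp add: \<delta>_def)
  finally have "\<mu> / 4 * W \<le> \<mu> / 16 * W + \<mu> / 8 * W"
    using e1 e2 mult_right_mono[OF \<epsilon>C W0] by linarith
  then have "\<mu> * W \<le> 0" by (simp add: mult.commute)
  then have "W \<le> 0" using \<mu> by (simp add: mult_le_0_iff)
  then have "integral\<^sup>L lborel w \<le> 0" using \<open>integral\<^sup>L lborel w \<le> A / i * W\<close> W0 by simp
  then show False using ilow i by simp
qed

end

section \<open>From the principal eigenvalue to the concordance\<close>

text \<open>Curvature takes two derivatives, so agreement of the metrics near the point is what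
  makes the curvatures comparable, in particular on the boundary circle.\<close>

lemma scalar_curvature_cong_open:
  assumes U: "open U" "x \<in> U" and eq: "\<And>y. y \<in> U \<Longrightarrow> g y = h y"
  shows "scalar_curvature g x = scalar_curvature h x"
proof -
  have chr: "christoffel g y v w = christoffel h y v w" if y: "y \<in> U" for y v w
    unfolding christoffel_def eq[OF y]
    using frechet_derivative_cong_open[OF U(1) y, of "\<lambda>y. g y a b" "\<lambda>y. h y a b" for a b] eq by simp
  have "frechet_derivative (\<lambda>y. christoffel g y v w) (at x) = frechet_derivative (\<lambda>y. christoffel h y v w) (at x)" for v w
    by (rule frechet_derivative_cong_open[OF U]) (rule chr)
  then have "riemann g x = riemann h x"
    by (simp add: fun_eq_iff riemann_def cov_deriv_def chr[OF U(2)])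
  then show ?thesis
    by (simp add: scalar_curvature_def metric_trace_def orthonormal_basis_def ricci_def eq[OF U(2)])
qed

text \<open>A convex combination of positive definite forms is positive definite, so a cutoff
  between \<open>h\<close> and the Euclidean metric suffices. Agreement beyond radius 1 secures
  equal derivatives at the boundary circle.\<close>

lemma metric_global_extension:
  assumes h: "riemannian_metric_on disk h"
  obtains E F G r where "plane_metric E F G" "0 < r"
    "\<And>x. norm x < 1 + r \<Longrightarrow> plane_metric.met E F G x = h x"
    "\<And>x. 2 \<le> norm x \<Longrightarrow> E x = 1 \<and> F x = 0 \<and> G x = 1"
proof -
  obtain U where U: "disk \<subseteq> U" and sm: "\<And>v w. smooth_on U (\<lambda>x. h x v w)"
    and h: "\<And>x. x \<in> U \<Longrightarrow> bilinear (h x)" "\<And>x v w. x \<in> U \<Longrightarrow> h x v w = h x w v" "\<And>x v. x \<in> U \<Longrightarrow> v \<noteq> 0 \<Longrightarrow> 0 < h x v v"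
    using h unfolding riemannian_metric_on_def by blast
  obtain e where e: "0 < e" "(\<Union>x\<in>disk. cball x e) \<subseteq> U"
    using compact_subset_open_imp_cball_epsilon_subset[OF compact_cball smooth_on_open[OF sm] U] by blast
  define r where "r = min e 1 / 3"
  have r: "0 < r" "3 * r \<le> e" "3 * r \<le> 1" using e(1) by (auto simp: r_def)
  define B :: "(real^2) set" where "B = {x. norm x < 1 + 3 * r}"
  have oB: "open B" unfolding B_def by (intro open_Collect_less continuous_intros)
  have BU: "B \<subseteq> U"
  proof
    fix x assume x: "x \<in> B"
    define y where "y = (1 / (1 + 3 * r)) *\<^sub>R x"
    have n: "norm y \<le> 1" using x r(1) by (simp add: y_def B_def field_simps)
    have "x - y = (3 * r) *\<^sub>R y" using r(1) by (simp add: y_def algebra_simps flip: scaleR_add_left) (simp add: field_simps flip: scaleR_add_left)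
    then have "norm (x - y) = 3 * r * norm y" using r(1) by simp
    also have "\<dots> \<le> 3 * r * 1" using r(1) by (intro mult_left_mono n) simp
    also have "\<dots> \<le> e" using r(2) by simp
    finally have "dist y x \<le> e" by (simp add: dist_norm norm_minus_commute)
    then have "y \<in> disk" "x \<in> cball y e" using n by simp_all
    then show "x \<in> U" using e(2) by blast
  qed
  define \<kappa> :: "real^2 \<Rightarrow> real" where
    "\<kappa> x = 1 - step ((x \<bullet> x - (1 + r)\<^sup>2) / ((1 + 2 * r)\<^sup>2 - (1 + r)\<^sup>2))" for x
  have den: "0 < (1 + 2 * r)\<^sup>2 - (1 + r)\<^sup>2" using r(1) by (simp add: power2_eq_square algebra_simps add_pos_pos)
  have s\<kappa>: "smooth \<kappa>"
    unfolding \<kappa>_def inner_vec2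
    by (intro smooth_on_diff smooth_on_const smooth_on_step' smooth_on_divide smooth_on_add smooth_on_mult smooth_on_nth open_UNIV)
      (use den in auto)
  have \<kappa>01: "0 \<le> \<kappa> x" "\<kappa> x \<le> 1" for x using step_nonneg step_le1 by (simp_all add: \<kappa>_def)
  have \<kappa>1: "\<kappa> x = 1" if "norm x \<le> 1 + r" for x
  proof -
    have "x \<bullet> x \<le> (1 + r)\<^sup>2" unfolding dot_square_norm using that by (intro power_mono) auto
    then show ?thesis using den by (simp add: \<kappa>_def step_le_0 divide_nonpos_pos)
  qed
  have \<kappa>0: "\<kappa> x = 0" if "1 + 2 * r \<le> norm x" for x
  proof -
    have "(1 + 2 * r)\<^sup>2 \<le> x \<bullet> x" unfolding dot_square_norm using that r by (intro power_mono) auto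
    then show ?thesis using den by (simp add: \<kappa>_def step_ge_1 pos_le_divide_eq)
  qed
  define glue where "glue v w x = (if x \<in> B then \<kappa> x * h x v w + (1 - \<kappa> x) * (v \<bullet> w) else v \<bullet> w)" for v w x
  have sglue: "smooth (glue v w)" for v w
  proof (rule smooth_on_local)
    fix x :: "real^2"
    show "\<exists>V. x \<in> V \<and> smooth_on V (glue v w)"
    proof (cases "x \<in> B")
      case True
      have "smooth_on B (\<lambda>x. \<kappa> x * h x v w + (1 - \<kappa> x) * (v \<bullet> w))"
        by (intro smooth_on_add smooth_on_mult smooth_on_diff smooth_on_const smooth_on_subset[OF sm oB BU] smooth_on_subset[OF s\<kappa> oB] oB) auto
      then have "smooth_on B (glue v w)" by (subst smooth_on_cong) (auto simp: glue_def)
      then show ?thesis using True by blast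
    next
      case False
      define V :: "(real^2) set" where "V = {x. 1 + 2 * r < norm x}"
      have oV: "open V" unfolding V_def by (intro open_Collect_less continuous_intros)
      have "glue v w y = v \<bullet> w" if "y \<in> V" for y using \<kappa>0[of y] that by (simp add: glue_def V_def)
      then have "smooth_on V (glue v w)" by (subst smooth_on_cong[of V _ "\<lambda>_. v \<bullet> w"]) (simp_all add: oV)
      moreover have "x \<in> V" using False r(1) by (simp add: V_def B_def)
      ultimately show ?thesis by blast
    qed
  qed simp
  define E where "E = glue (axis 1 1) (axis 1 1)"
  define F where "F = glue (axis 1 1) (axis 2 1)"
  define G where "G = glue (axis 2 1) (axis 2 1)"
  have exp: "h x v w = h x (axis 1 1) (axis 1 1) * (v$1 * w$1) + h x (axis 1 1) (axis 2 1) * (v$1 * w$2 + v$2 * w$1)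
      + h x (axis 2 1) (axis 2 1) * (v$2 * w$2)" if x: "x \<in> U" for x v w
  proof -
    note l = bilinear_lin[OF h(1)[OF x]]
    show ?thesis
      by (subst vec2_axis[of v], subst vec2_axis[of w])
        (simp add: linear_add[OF l(1)] linear_add[OF l(2)] linear_scale[OF l(1)] linear_scale[OF l(2)]
          h(2)[OF x, of "axis 2 1" "axis 1 1"] algebra_simps)
  qed
  have form: "E x * (v$1 * w$1) + F x * (v$1 * w$2 + v$2 * w$1) + G x * (v$2 * w$2) = glue v w x" for x v w
    using exp[of x v w] BU by (auto simp: E_def F_def G_def glue_def inner_vec2 algebra_simps)
  have pos: "0 < glue v v x" if v: "v \<noteq> 0" for v x
  proof (cases "x \<in> B")
    case True
    have "0 < h x v v" "0 < v \<bullet> v" using h(3) True BU v by auto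
    then show ?thesis using True \<kappa>01[of x]
      by (cases "\<kappa> x = 0") (auto simp: glue_def intro!: add_pos_nonneg mult_pos_pos)
  qed (use v in \<open>simp add: glue_def\<close>)
  have Ep: "0 < E x" for x unfolding E_def by (rule pos) (simp add: vec2_eq_iff)
  have det: "0 < E x * G x - (F x)\<^sup>2" for x
  proof -
    \<comment> \<open>The value of the form on (- F, E) is E times the determinant.\<close>
    define v :: "real^2" where "v = vector [- F x, E x]"
    have "v \<noteq> 0" using Ep[of x] by (auto simp: v_def vec2_eq_iff)
    then have "0 < E x * (v$1 * v$1) + F x * (v$1 * v$2 + v$2 * v$1) + G x * (v$2 * v$2)" unfolding form by (rule pos)
    also have "\<dots> = E x * (E x * G x - (F x)\<^sup>2)" by (simp add: v_def power2_eq_square algebra_simps)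
    finally show ?thesis using Ep[of x] by (simp add: zero_less_mult_iff)
  qed
  have pm: "plane_metric E F G"
    by (rule plane_metric.intro) (use Ep det in \<open>auto simp: E_def F_def G_def sglue\<close>)
  show thesis
  proof (rule that[OF pm r(1)])
    show "plane_metric.met E F G x = h x" if x: "norm x < 1 + r" for x
    proof -
      have "x \<in> B" using x r by (simp add: B_def)
      then have "glue v w x = h x v w" for v w using \<kappa>1[of x] x by (simp add: glue_def)
      then show ?thesis by (simp add: fun_eq_iff plane_metric.met_def[OF pm] form)
    qed
    show "E x = 1 \<and> F x = 0 \<and> G x = 1" if "2 \<le> norm x" for x
    proof -
      have "glue v w x = v \<bullet> w" for v w using \<kappa>0[of x] that r(3) by (simp add: glue_def)
      then show ?thesis by (simp add: E_def F_def G_def inner_vec2)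
    qed
  qed
qed

context plane_metric
begin

lemma flat_region:
  assumes U: "open U" "x \<in> U" and flat: "\<And>y. y \<in> U \<Longrightarrow> E y = 1 \<and> F y = 0 \<and> G y = 1"
  shows "\<Gamma> x v w = 0" "scalar_curvature met x = 0"
proof -
  have met: "met y a b = a \<bullet> b" if "y \<in> U" for y a b
    using flat[OF that] by (simp add: met_def inner_vec2)
  have z: "\<Gamma> y v w = 0" if y: "y \<in> U" for y v w
  proof -
    have "dd (\<lambda>y. met y a b) c y = 0" for a b c
      using dd_cong[OF U(1) y, of "\<lambda>y. met y a b" "\<lambda>_. a \<bullet> b"] met by simp
    then show ?thesis by (simp add: \<Gamma>_def koszul_def sharp_def vec2_eq_iff)
  qed
  show "\<Gamma> x v w = 0" by (rule z[OF U(2)])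
  have "((\<lambda>y. \<Gamma> y v w) has_derivative (\<lambda>u. 0)) (at x)" for v w
    by (rule has_derivative_transform_within_open[OF has_derivative_const[of 0] U]) (simp add: z)
  then have "riemann met x u v w = 0" for u v w
    using lc_riemann[OF levi_civita_met UNIV_I, where D="\<lambda>_ _ _. 0"] by (simp add: z[OF U(2)])
  then show "scalar_curvature met x = 0"
    by (simp add: scalar_curvature_trh trh_def ricci_def)
qed

text \<open>Where the metric is Euclidean the Laplacian of the paraboloid is - 4 and the scalar
  curvature is 0. The bound on \<open>P\<close> keeps its unit disk in that region, and 2 - |x -
  P|^2 is at least 1 on it.\<close>

lemma flat_supersolution:
  fixes P :: "real^2"
  assumes flat: "\<And>x. 2 \<le> norm x \<Longrightarrow> E x = 1 \<and> F x = 0 \<and> G x = 1" and P: "3 < norm P"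
  shows "strict_supersolution P (\<lambda>x. 2 - ((x$1 - P$1)\<^sup>2 + (x$2 - P$2)\<^sup>2))"
proof -
  define u where "u x = 2 - ((x$1 - P$1)\<^sup>2 + (x$2 - P$2)\<^sup>2)" for x :: "real^2"
  have c: "((\<lambda>x::real^2. x $ i) has_derivative (\<lambda>v. v $ i)) (at x)" for i x
    by (rule bounded_linear.has_derivative[OF bounded_linear_vec_nth has_derivative_ident])
  have d1: "dd u v = (\<lambda>x. - 2 * ((x$1 - P$1) * v$1 + (x$2 - P$2) * v$2))" for v
  proof
    show "dd u v x = - 2 * ((x$1 - P$1) * v$1 + (x$2 - P$2) * v$2)" for x
      unfolding u_def by (rule dd_eqI) (auto intro!: derivative_eq_intros c simp: algebra_simps)
  qed
  have d2: "dd (dd u v) w x = - 2 * (w$1 * v$1 + w$2 * v$2)" for v w x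
    unfolding d1 by (rule dd_eqI) (auto intro!: derivative_eq_intros c simp: algebra_simps)
  have "smooth u"
    unfolding u_def by (intro smooth_on_diff smooth_on_add smooth_on_power smooth_on_const smooth_on_nth open_UNIV)
  moreover have "0 < u x \<and> trh x (hessian \<Gamma> u x) < scalar_curvature met x / 2 * u x" if x: "x \<in> cball P 1" for x
  proof -
    have n: "2 < norm x" using x P norm_triangle_ineq2[of P x] by (simp add: dist_norm)
    have oV: "open {x::real^2. 2 < norm x}" by (intro open_Collect_less continuous_intros)
    have fl: "\<Gamma> x v w = 0" "scalar_curvature met x = 0" for v w
      by (rule flat_region[OF oV]; use n flat in simp)+
    have "(norm (x - P))\<^sup>2 \<le> 1" using x by (simp add: dist_norm norm_minus_commute power_le_one)
    then have "0 < u x" unfolding norm_vec2 by (simp add: u_def)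
    moreover have "trh x (hessian \<Gamma> u x) = - 4"
      using flat[of x] n unfolding trh_def hessian_def d2 fl(1) by (simp add: D_def d1[of 0])
    ultimately show ?thesis using fl by simp
  qed
  ultimately show ?thesis unfolding strict_supersolution_def u_def[abs_def] by simp
qed

section \<open>The operator R / 2 - \<Delta> in divergence form\<close>

definition \<sigma> :: "real^2 \<Rightarrow> real" where "\<sigma> x = sqrt (D x)"

lemma \<sigma>: "0 < \<sigma> x" "\<sigma> x * \<sigma> x = D x" using Dpos[of x] by (simp_all add: \<sigma>_def)

lemma smooth_\<sigma>: "smooth \<sigma>"
  unfolding \<sigma>_def[abs_def] by (rule smooth_on_sqrt[OF smoothD]) (rule Dpos)

text \<open>Multiplying by the area density \<open>\<sigma>\<close> puts \<open>R / 2 - \<Delta>\<close> into divergence form with a unimodular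
  coefficient matrix.\<close>

abbreviation Eu :: "real^2 \<Rightarrow> real" where "Eu \<equiv> \<lambda>x. E x / \<sigma> x"
abbreviation Fu :: "real^2 \<Rightarrow> real" where "Fu \<equiv> \<lambda>x. F x / \<sigma> x"
abbreviation Gu :: "real^2 \<Rightarrow> real" where "Gu \<equiv> \<lambda>x. G x / \<sigma> x"
abbreviation Vu :: "real^2 \<Rightarrow> real" where "Vu \<equiv> \<lambda>x. scalar_curvature met x * \<sigma> x / 2"

text \<open>The ellipticity constant comes again from Cayley-Hamilton: a positive symmetric matrix
  of determinant one is at least the reciprocal of its trace. The trace is bounded on a compact ball
  and equals 2 in the flat region.\<close>

lemma unimodular_met:
  assumes flat: "\<And>x. 2 \<le> norm x \<Longrightarrow> E x = 1 \<and> F x = 0 \<and> G x = 1"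
  obtains c0 where "potential Eu Fu Gu c0 Vu"
proof -
  have s0: "\<sigma> x \<noteq> 0" for x using \<sigma>(1)[of x] by simp
  define T where "T x = E x / \<sigma> x + G x / \<sigma> x" for x
  have sT: "smooth T" unfolding T_def by (intro smooth_on_add smooth_on_divide smoothE smoothG smooth_\<sigma>) (rule s0)+
  have T0: "0 < T x" for x unfolding T_def using Epos[of x] Gpos[of x] \<sigma>(1)[of x] by (intro add_pos_pos divide_pos_pos)
  obtain M where M: "0 < M" "\<And>x. x \<in> cball 0 2 \<Longrightarrow> \<bar>T x\<bar> \<le> M"
    using compact_bounded_real[OF compact_cball[of 0 2] cont_smooth[OF sT]] by blast
  have TM: "T x \<le> M + 2" for x
  proof (cases "norm x \<le> 2")
    case False
    then have "E x = 1 \<and> F x = 0 \<and> G x = 1" by (intro flat) simp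
    then have "T x = 2" by (simp add: T_def \<sigma>_def D_def)
    then show ?thesis using M(1) by simp
  qed (use M(2)[of x] in \<open>simp add: abs_le_iff\<close>)
  have det: "E x / \<sigma> x * (G x / \<sigma> x) - F x / \<sigma> x * (F x / \<sigma> x) = 1" for x
  proof -
    have "E x / \<sigma> x * (G x / \<sigma> x) - F x / \<sigma> x * (F x / \<sigma> x) = (E x * G x - (F x)\<^sup>2) / (\<sigma> x * \<sigma> x)"
      by (simp add: power2_eq_square diff_divide_distrib)
    then show ?thesis unfolding \<sigma>(2) by (simp flip: D_def)
  qed
  have "1 / (M + 2) * (norm \<xi>)\<^sup>2 \<le> E x / \<sigma> x * (\<xi>$1 * \<xi>$1) + 2 * (F x / \<sigma> x) * (\<xi>$1 * \<xi>$2) + G x / \<sigma> x * (\<xi>$2 * \<xi>$2)" for x and \<xi> :: "real^2"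
  proof -
    define p q s where "p = E x / \<sigma> x" and "q = F x / \<sigma> x" and "s = G x / \<sigma> x"
    define f where "f = p * (\<xi>$1 * \<xi>$1) + 2 * q * (\<xi>$1 * \<xi>$2) + s * (\<xi>$2 * \<xi>$2)"
    have "(p + s) * f = (p * s - q * q) * (norm \<xi>)\<^sup>2 + ((p * \<xi>$1 + q * \<xi>$2)\<^sup>2 + (q * \<xi>$1 + s * \<xi>$2)\<^sup>2)"
      unfolding norm_vec2 f_def by (simp add: power2_eq_square algebra_simps)
    moreover have "p * s - q * q = 1" unfolding p_def q_def s_def by (rule det)
    ultimately have le: "(norm \<xi>)\<^sup>2 \<le> T x * f" by (simp add: T_def p_def s_def)
    then have "0 \<le> T x * f" using zero_le_power2[of "norm \<xi>"] by linarith
    then have "0 \<le> f" using T0[of x] by (simp add: zero_le_mult_iff)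
    then have "T x * f \<le> (M + 2) * f" using TM by (intro mult_right_mono)
    with le have "(norm \<xi>)\<^sup>2 \<le> (M + 2) * f" by linarith
    then show ?thesis using M(1) unfolding f_def p_def q_def s_def by (simp add: pos_divide_le_eq mult.commute)
  qed
  moreover have "smooth (\<lambda>x. f x / \<sigma> x)" if "smooth f" for f
    using that smooth_\<sigma> s0 by (intro smooth_on_divide)
  moreover have "smooth Vu"
    by (intro smooth_on_divide smooth_on_mult smooth_scalar_curvature smooth_\<sigma> smooth_on_const) auto
  ultimately have "potential Eu Fu Gu (1 / (M + 2)) Vu"
    using M(1) smoothE smoothF smoothG det by (intro potential.intro unimodular.intro potential_axioms.intro) auto
  then show thesis by (rule that)
qed

end

context plane_metric
begin

lemma dd_D: "dd D v x = dd E v x * G x + E x * dd G v x - 2 * F x * dd F v x"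
  unfolding D_def[abs_def] power2_eq_square
  by (simp add: dd_diff dd_mult smooth_on_mult smoothE smoothF smoothG)

text \<open>Trades the derivative of the square root for that of \<open>D\<close>, so that the
  comparison of coefficients in \<open>operator_eq\<close> becomes a rational identity in the metric
  coefficients.\<close>

lemma dd_over_\<sigma>:
  assumes f: "smooth f"
  shows "dd (\<lambda>x. f x / \<sigma> x) v x = (2 * D x * dd f v x - f x * dd D v x) / (2 * (\<sigma> x * \<sigma> x * \<sigma> x))"
proof -
  have s0: "\<sigma> x \<noteq> 0" for x using \<sigma>(1)[of x] by simp
  have "dd (\<lambda>x. \<sigma> x * \<sigma> x) v x = dd D v x" by (simp add: \<sigma>(2))
  then have ds: "dd D v x = 2 * \<sigma> x * dd \<sigma> v x" by (simp add: dd_mult smooth_\<sigma>)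
  have sm: "smooth (\<lambda>x. f x / \<sigma> x)" using f smooth_\<sigma> s0 by (intro smooth_on_divide)
  have "dd (\<lambda>x. (f x / \<sigma> x) * \<sigma> x) v x = dd f v x" by (simp add: s0)
  then have "dd f v x = f x / \<sigma> x * dd \<sigma> v x + dd (\<lambda>x. f x / \<sigma> x) v x * \<sigma> x"
    unfolding dd_mult[OF sm smooth_\<sigma>] by simp
  then have "dd (\<lambda>x. f x / \<sigma> x) v x * \<sigma> x = dd f v x - f x / \<sigma> x * dd \<sigma> v x" by simp
  then have "dd (\<lambda>x. f x / \<sigma> x) v x * (\<sigma> x * \<sigma> x) = dd f v x * \<sigma> x - f x * dd \<sigma> v x"
    using s0[of x] by (simp add: field_simps)
  then have "dd (\<lambda>x. f x / \<sigma> x) v x * (2 * (\<sigma> x * \<sigma> x * \<sigma> x)) = 2 * D x * dd f v x - f x * dd D v x"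
    unfolding ds \<sigma>(2)[symmetric] by algebra
  then show ?thesis using s0[of x] by (simp add: field_simps)
qed

text \<open>The coordinate formula for the Laplacian as div(\<sigma> grad u) / \<sigma>. Second
  order terms agree at once; for first order terms, \<open>A1\<close> and \<open>A2\<close> times
  \<sigma> are minus the Christoffel symbols contracted with the adjugate of the metric matrix,
  which is checked from the Koszul formula.\<close>

lemma operator_eq:
  assumes pot: "potential Eu Fu Gu c0 Vu"
    and u: "smooth u"
  shows "potential.op Eu Fu Gu Vu u x
    = \<sigma> x * (scalar_curvature met x / 2 * u x - trh x (hessian \<Gamma> u x))"
proof -
  interpret potential Eu Fu Gu c0 Vu
    by (rule pot)
  have s0: "\<sigma> x \<noteq> 0" using \<sigma>(1)[of x] by simp
  let ?e1 = "axis 1 1 :: real^2" and ?e2 = "axis 2 1 :: real^2"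
  define c where "c i = G x * \<Gamma> x ?e1 ?e1 $ i - F x * (\<Gamma> x ?e1 ?e2 $ i + \<Gamma> x ?e2 ?e1 $ i) + E x * \<Gamma> x ?e2 ?e2 $ i" for i
  have tr: "trh x (hessian \<Gamma> u x) = (G x * d1 (d1 u) x - F x * (d1 (d2 u) x + d2 (d1 u) x) + E x * d2 (d2 u) x
      - (c 1 * d1 u x + c 2 * d2 u x)) / D x"
    unfolding trh_def hessian_def dd_dir2[OF u, of "\<Gamma> x v w" for v w] c_def by (simp add: algebra_simps)
  have A: "A1 x * \<sigma> x = - c 1" "A2 x * \<sigma> x = - c 2"
  proof -
    have D': "D x * Y = Z" if "Y = Z / D x" for Y Z using that by simp
    have k: "D x * \<Gamma> x v w $ 1 = G x * koszul x v w ?e1 - F x * koszul x v w ?e2"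
      "D x * \<Gamma> x v w $ 2 = E x * koszul x v w ?e2 - F x * koszul x v w ?e1" for v w
      by (rule D', simp add: \<Gamma>_def sharp_def)+
    have c1: "D x * c i = G x * (D x * \<Gamma> x ?e1 ?e1 $ i) - F x * (D x * \<Gamma> x ?e1 ?e2 $ i + D x * \<Gamma> x ?e2 ?e1 $ i) + E x * (D x * \<Gamma> x ?e2 ?e2 $ i)" for i
      by (simp add: c_def algebra_simps)
    have cube: "a / (2 * (\<sigma> x * \<sigma> x * \<sigma> x)) * \<sigma> x * D x = a / 2" for a
      using s0 by (simp flip: \<sigma>(2))
    have "A1 x * \<sigma> x * D x = (2 * D x * d1 G x - G x * d1 D x) / 2 - (2 * D x * d2 F x - F x * d2 D x) / 2"
      unfolding A1_def dd_over_\<sigma>[OF smoothG] dd_over_\<sigma>[OF smoothF] left_diff_distrib cube ..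
    also have "\<dots> = - (D x * c 1)"
      unfolding c1 k koszul_def dd_met dd_D by (simp add: D_def power2_eq_square field_simps)
    also have "\<dots> = (- c 1) * D x" by (simp only: mult_minus_left mult.commute)
    finally show "A1 x * \<sigma> x = - c 1" by (simp only: mult_right_cancel[OF D0])
    have "A2 x * \<sigma> x * D x = (2 * D x * d2 E x - E x * d2 D x) / 2 - (2 * D x * d1 F x - F x * d1 D x) / 2"
      unfolding A2_def dd_over_\<sigma>[OF smoothE] dd_over_\<sigma>[OF smoothF] left_diff_distrib cube ..
    also have "\<dots> = - (D x * c 2)"
      unfolding c1 k koszul_def dd_met dd_D by (simp add: D_def power2_eq_square field_simps)
    also have "\<dots> = (- c 2) * D x" by (simp only: mult_minus_left mult.commute)
    finally show "A2 x * \<sigma> x = - c 2" by (simp only: mult_right_cancel[OF D0])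
  qed
  have "divop u x * \<sigma> x = - c 1 * d1 u x + - c 2 * d2 u x + (G x * d1 (d1 u) x - F x * (d1 (d2 u) x + d2 (d1 u) x) + E x * d2 (d2 u) x)"
    unfolding divop_expand[OF u] distrib_right A[symmetric] using s0 by (simp add: field_simps)
  also have "\<dots> = D x * trh x (hessian \<Gamma> u x)" unfolding tr by simp
  finally have "divop u x * \<sigma> x = (\<sigma> x * trh x (hessian \<Gamma> u x)) * \<sigma> x" by (simp flip: \<sigma>(2))
  then have "divop u x = \<sigma> x * trh x (hessian \<Gamma> u x)" using s0 by simp
  then show ?thesis unfolding op_def by (simp add: algebra_simps)
qed

lemma gradient_met:
  assumes u: "smooth u"
  shows "gradient met u x = sharp x (vector [dd u (axis 1 1) x, dd u (axis 2 1) x])"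
proof -
  have eq: "met x (sharp x (vector [dd u (axis 1 1) x, dd u (axis 2 1) x])) z = frechet_derivative u (at x) z" for z
    unfolding sharp_eq dd_def[symmetric] dd_dir2[OF u, of z] by (simp add: inner_vec2 mult.commute)
  show ?thesis
    unfolding gradient_def
  proof (rule the_equality)
    fix w assume w: "\<forall>z. met x w z = frechet_derivative u (at x) z"
    show "w = sharp x (vector [dd u (axis 1 1) x, dd u (axis 2 1) x])"
      by (rule inner_form_eqI[OF inner_form_met[of x]]) (simp add: w eq)
  qed (simp add: eq)
qed

text \<open>For test functions vanishing on the circle the boundary integral drops out and the
  numerator of the Rayleigh quotient is \<open>energy\<close>. The constant \<mu> is a number l
  strictly between 0 and the eigenvalue times a lower bound for the area density, which converts the
  weighted norm into the Euclidean one.\<close>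

lemma dirichlet_from_eigenvalue:
  assumes pot: "potential Eu Fu Gu c0 Vu"
    and r: "0 < r" and h: "\<And>x. norm x < 1 + r \<Longrightarrow> met x = h x" and pos: "0 < principal_eigenvalue h"
  obtains \<mu> where "0 < \<mu>"
    "potential.dirichlet_positive Eu Fu Gu Vu 1 \<mu>"
proof -
  interpret potential Eu Fu Gu c0 Vu
    by (rule pot)
  obtain l where "0 < ereal l" and l: "ereal l < principal_eigenvalue h" using ereal_dense2[OF pos] by auto
  then have l0: "0 < l" by simp
  obtain m where m: "0 < m" "\<And>x. x \<in> disk \<Longrightarrow> m \<le> \<sigma> x"
    using compact_positive_lower[OF compact_cball cont_smooth[OF smooth_\<sigma>], of 0 1] \<sigma>(1) by metis
  have hd: "h x = met x" if "x \<in> disk" for x using h[of x] that r by simp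
  have sc: "scalar_curvature h x = scalar_curvature met x" if x: "x \<in> disk" for x
  proof (rule scalar_curvature_cong_open)
    show "open {y::real^2. norm y < 1 + r}" by (intro open_Collect_less continuous_intros)
  qed (use x r h in auto)
  have area: "area_integral h f = (\<integral>x. indicator disk x * (f x * \<sigma> x) \<partial>lborel)" for f
  proof -
    have "det (\<chi> i j. h x (axis i 1) (axis j 1)) = D x" if "x \<in> disk" for x
      unfolding hd[OF that] det_2 by (simp add: met_def D_def power2_eq_square)
    then have "indicator disk x *\<^sub>R (f x * sqrt (det (\<chi> i j. h x (axis i 1) (axis j 1)))) = indicator disk x * (f x * \<sigma> x)" for x
      by (simp add: indicator_def \<sigma>_def)
    then show ?thesis unfolding area_integral_def set_lebesgue_integral_def by presburger
  qed
  let ?I = "\<lambda>w. \<integral>x. (w x)\<^sup>2 \<partial>lborel"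
  have "l * m * ?I w \<le> energy w"
    if w: "smooth w" and supp: "\<And>x. 1 \<le> norm x \<Longrightarrow> w x = 0" for w
  proof (cases "\<exists>x\<in>disk. w x \<noteq> 0")
    case False
    then have z: "w x = 0" for x using supp[of x] by (cases "norm x \<le> 1") auto
    then have "w = (\<lambda>x. 0)" by auto
    then show ?thesis by (simp add: energy_def)
  next
    case True
    then have "w \<in> test_functions" using w unfolding test_functions_def by blast
    then have "principal_eigenvalue h \<le> ereal (rayleigh_quotient h w)"
      unfolding principal_eigenvalue_def by (rule INF_lower)
    with l have rq: "l < rayleigh_quotient h w" by (metis less_ereal.simps(1) order_less_le_trans)
    have "boundary_integral h (\<lambda>x. boundary_curvature h x * (w x)\<^sup>2) = 0"
    proof -
      have "norm (vector [cos t, sin t] :: real^2) = 1" for t :: real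
        by (simp add: norm_eq_sqrt_inner inner_vec2 flip: power2_eq_square)
      then show ?thesis by (simp add: boundary_integral_def Let_def supp)
    qed
    moreover have "area_integral h (\<lambda>x. h x (gradient h w x) (gradient h w x) + scalar_curvature h x * (w x)\<^sup>2 / 2) = energy w"
      unfolding area energy_def
    proof (rule Bochner_Integration.integral_cong[OF refl])
      fix x :: "real^2"
      show "indicator disk x * ((h x (gradient h w x) (gradient h w x) + scalar_curvature h x * (w x)\<^sup>2 / 2) * \<sigma> x)
        = qform x (d1 w x) (d2 w x) + scalar_curvature met x * \<sigma> x / 2 * (w x)\<^sup>2"
      proof (cases "x \<in> disk")
        case True
        have "gradient h w x = gradient met w x" unfolding gradient_def hd[OF True] ..
        then have gr: "gradient h w x = sharp x (vector [d1 w x, d2 w x])"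
          using gradient_met[OF w] by simp
        have "h x (gradient h w x) (gradient h w x) * \<sigma> x = qform x (d1 w x) (d2 w x)"
          unfolding hd[OF True] gr sharp_eq unfolding sharp_def qform_def inner_vec2 \<sigma>(2)[symmetric]
          using \<sigma>(1)[of x] by (simp add: field_simps)
        then show ?thesis using True by (simp add: sc algebra_simps)
      next
        case False
        then have n: "1 < norm x" by simp
        then have "dd w v x = 0" for v using dd_outside[of 1 w x v] supp by simp
        then show ?thesis using False supp n by simp
      qed
    qed
    ultimately have rqe: "rayleigh_quotient h w = energy w / area_integral h (\<lambda>x. (w x)\<^sup>2)"
      by (simp add: rayleigh_quotient_def)
    have cont: "continuous_on UNIV (\<lambda>x. (w x)\<^sup>2)" "continuous_on UNIV (\<lambda>x. (w x)\<^sup>2 * \<sigma> x)"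
      by (intro continuous_intros cont_smooth w smooth_\<sigma>)+
    have ints: "integrable lborel (\<lambda>x. (w x)\<^sup>2)" "integrable lborel (\<lambda>x. (w x)\<^sup>2 * \<sigma> x)"
      by (rule integrable_compact_support[OF cont(1), of 1], simp add: supp)
        (rule integrable_compact_support[OF cont(2), of 1], simp add: supp)
    have ind: "indicator disk x * ((w x)\<^sup>2 * \<sigma> x) = (w x)\<^sup>2 * \<sigma> x" for x using supp[of x] by (auto simp: indicator_def)
    define N where "N = area_integral h (\<lambda>x. (w x)\<^sup>2)"
    have "(\<integral>x. m * (w x)\<^sup>2 \<partial>lborel) \<le> (\<integral>x. (w x)\<^sup>2 * \<sigma> x \<partial>lborel)"
    proof (rule integral_mono)
      show "m * (w x)\<^sup>2 \<le> (w x)\<^sup>2 * \<sigma> x" for x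
        using supp[of x] m(2)[of x] mult_right_mono[of m "\<sigma> x" "(w x)\<^sup>2"] by (cases "norm x \<le> 1") (auto simp: mult.commute)
    qed (use ints in auto)
    then have mN: "m * (?I w) \<le> N" unfolding N_def area ind by simp
    moreover have "0 \<le> (?I w)" by simp
    ultimately have "0 \<le> N" using m(1) by (smt (verit) mult_nonneg_nonneg)
    moreover have "N \<noteq> 0" using rq l0 rqe by (auto simp: N_def)
    ultimately have "0 < N" by simp
    then have "l * N \<le> energy w" using rq rqe by (simp add: N_def[symmetric] field_simps)
    moreover have "l * (m * (?I w)) \<le> l * N" by (rule mult_left_mono[OF mN]) (use l0 in simp)
    ultimately show ?thesis by (simp only: mult.assoc)
  qed
  then have "dirichlet_positive 1 (l * m)" unfolding dirichlet_positive_def by blast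
  then show thesis using that[of "l * m"] l0 m(1) by simp
qed

end

theorem corollary4p10:
  fixes h :: "(real^2) metric"
  assumes "h \<in> positive_metrics"
  shows "weakly_PSC_min_concordant h standard_metric"
proof -
  have h: "riemannian_metric_on disk h" and pos: "0 < principal_eigenvalue h"
    using assms by (auto simp: positive_metrics_def)
  obtain E F G r where pm: "plane_metric E F G" and r: "0 < r"
    and agree: "\<And>x. norm x < 1 + r \<Longrightarrow> plane_metric.met E F G x = h x"
    and flat: "\<And>x. 2 \<le> norm x \<Longrightarrow> E x = 1 \<and> F x = 0 \<and> G x = 1"
    by (rule metric_global_extension[OF h]) blast
  interpret plane_metric E F G by (rule pm)
  obtain c0 where pot: "potential Eu Fu Gu c0 Vu"
    by (rule unimodular_met[OF flat]) blast
  interpret potential Eu Fu Gu c0 Vu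
    by (rule pot)
  obtain \<mu> where \<mu>: "0 < \<mu>" "dirichlet_positive 1 \<mu>"
    by (rule dirichlet_from_eigenvalue[OF pot r agree pos])
  obtain u where u: "smooth u" "\<And>x. x \<in> disk \<Longrightarrow> 0 < u x" "\<And>x. x \<in> disk \<Longrightarrow> 0 < op u x"
    by (rule positive_supersolution[OF \<mu>(2,1)]) blast
  have u0: "strict_supersolution 0 u"
    unfolding strict_supersolution_def
  proof (intro conjI ballI u(1,2))
    fix x assume "x \<in> disk"
    then have "0 < \<sigma> x * (scalar_curvature met x / 2 * u x - trh x (hessian \<Gamma> u x))"
      using u(3) operator_eq[OF pot u(1)] by simp
    then show "trh x (hessian \<Gamma> u x) < scalar_curvature met x / 2 * u x"
      using \<sigma>(1)[of x] by (simp add: zero_less_mult_iff)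
  qed
  \<comment> \<open>Norm 4 puts the unit disk around \<open>P\<close> beyond radius 2, where the
    extended metric is Euclidean; so the final slice carries the standard metric.\<close>
  define P :: "real^2" where "P = vector [4, 0]"
  have P: "norm P = 4" by (simp add: P_def norm_eq_sqrt_inner inner_vec2)
  obtain g where g: "riemannian_metric_on (disk \<times> {0..1}) g"
    "\<And>p. p \<in> disk \<times> {0..1} \<Longrightarrow> 0 < scalar_curvature g p"
    "\<And>p. p \<in> sphere 0 1 \<times> {0..1} \<Longrightarrow> mean_curvature g wall_conormal p = 0"
    "\<And>x v w. g (x, 0) (v, 0) (w, 0) = met x v w" "\<And>x v w. g (x, 1) (v, 0) (w, 0) = met (P + x) v w"
    "free_boundary_minimal_slice g 0" "free_boundary_minimal_slice g 1"
    by (rule lens_concordance[OF u0 flat_supersolution[OF flat, of P]]) (simp_all add: P)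
  have "met x v w = h x v w" if "x \<in> disk" for x v w using agree[of x] that r by simp
  moreover have "met (P + x) v w = standard_metric x v w" if "x \<in> disk" for x v w
  proof -
    have "2 \<le> norm (P + x)" using that norm_triangle_ineq4[of "P + x" x] by (simp add: P)
    then show ?thesis using flat[of "P + x"] by (simp add: met_def standard_metric_def inner_vec2)
  qed
  ultimately show ?thesis
    unfolding weakly_PSC_min_concordant_def using g by (intro exI[of _ g]) auto
qed

end
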